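(* Let $X=[0,1]$ and let $(T,X,\mu)$ be a Gibbs-Markov map. Let $\phi(x)=d(x,x_0)^{-1/\alpha}$ where $\alpha\in(0,2]$, $x_0\in(0,1)$ and $d(x,y)=|x-y|$. Let $(b_n)_{n\ge1}$ be a sequence of positive reals with $\lim_{n\to\infty}n\,\mu(|\phi|>b_n)=1$. Let $\nu$, $(P_i)_{i\ge 1}$ and $(Q_{ij})_{i,j\ge 1}$ be the measure and the points describing the limit of the counting measures $\sum_{j=1}^n\delta_{\phi\circ T^j/b_n}$, as specified in the context. (a) If $0<\alpha<1$, then $$\frac1{b_n}\sum_{j=1}^n\phi\circ T^j\ \to_d\ S,$$ where $S=\sum_{i=1}^\infty\sum_{j=1}^\infty P_iQ_{ij}$ has a stable distribution with index $\alpha$. (b) If $1\le\alpha<2$, then $$\frac1{b_n}\left(\sum_{j=1}^n\phi\circ T^j-E\Big[\sum_{j=1}^n\phi\circ T^j\,\mathbf{1}_{\{|\phi\circ T^j|<b_n\}}\Big]\right)\ \to_d\ S,$$ where $S$ is the distributional limit, as $\epsilon\to0$, of $$\sum_{i=1}^\infty\sum_{j=1}^\infty P_iQ_{ij}\,\mathbf{1}_{(\epsilon,\infty)}(|P_iQ_{ij}|)-\int_{\epsilon<|x|\le1}x\,\nu(dx),$$ and $S$ has a stable distribution with index $\alpha$.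
   Context: $E[\cdot]$ denotes expectation with respect to $\mu$, and $\to_d$ denotes convergence in distribution, the initial point being distributed according to $\mu$. Limit point process: $\nu(dx)=\alpha x^{-\alpha-1}\mathbf{1}_{(0,\infty)}(x)\,dx$ (this is the general tail measure $[p\alpha x^{-\alpha-1}\mathbf{1}_{(0,\infty)}+(1-p)\alpha(-x)^{-\alpha-1}\mathbf{1}_{(-\infty,0)}]dx$ with $p=\lim_{t\to\infty}\mu(\phi>t)/\mu(|\phi|>t)=1$, because $\phi>0$). The setting uses the known fact (Freitas, Freitas and Magalhães) that, for this observable on Gibbs-Markov maps, the random counting measures $N_n=\sum_{j=1}^n\delta_{\phi\circ T^j/b_n}$ on $\mathbb{R}\setminus\{0\}$ converge in distribution, in the space of random counting measures, to a point process $N=\sum_{i=1}^\infty\sum_{j=1}^\infty\delta_{P_iQ_{ij}}$, where $\sum_{i\ge1}\delta_{P_i}$ is a Poisson process with intensity measure $\nu$, the point processes $Q_i=\sum_{j\ge1}\delta_{Q_{ij}}$, $i\ge1$, are i.i.d. with $Q_{ij}\in[-1,1]\setminus\{0\}$, and all these point processes are mutually independent. The $P_i$ and $Q_{ij}$ in the claim are the ones in this limit. Gibbs-Markov map: let $m$ be Lebesgue measure on $X=[0,1]$, let $\mu$ be a probability measure equivalent to $m$ with density bounded above and bounded away from zero, and let $\mathcal{P}=\{A_i\}$ be a countable partition of $[0,1]$ (mod $m$) into open intervals with $m(A_i)>0$. An ergodic $\mu$-preserving transformation $T:X\to X$, differentiable on each $A_i$, is a Gibbs-Markov map if: (1) the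 $\sigma$-algebra $\mathcal{B}$ of $X$ is the smallest $m$-complete $\sigma$-algebra containing $\bigvee_{n\ge0}T^{-n}\mathcal{P}$; (2) (Markov property and big images) for all $A_i\in\mathcal{P}$, $TA_i$ is (mod $m$) a union of elements of $\mathcal{P}$, and there is $C>0$ with $m(TA_i)>C$ for all $i$; (3) $T:A_i\to TA_i$ is invertible for each $i$; (4) there is $\Lambda>1$ such that $|T'(x)|>\Lambda$ for all $x$ where $T'$ is defined; (5) (bounded distortion) there are constants $0<C_1\le C_2$ such that for all $n$, all $A\in\bigvee_{j=0}^nT^{-j}\mathcal{P}$ and all $x,y\in A$, $C_1\le\left|\frac{DT^n(x)}{DT^n(y)}\right|\le C_2$. Moreover $T$ has exponential decay in $\mathrm{BV}(X)$ (functions of bounded variation on $[0,1]$ with norm equal to total variation plus $L^1$ norm): the transfer operator $P:L^1(\mu)\to L^1(\mu)$, defined by $\int f\circ T\cdot g\,d\mu=\int f\cdot P(g)\,d\mu$ for all $f\in L^\infty(\mu)$, $g\in L^1(\mu)$, satisfies, for some $C>0$ and $\lambda\in(0,1)$, $\|P^k g\|_{\mathrm{BV}}\le C\lambda^k\|g\|_{\mathrm{BV}}$ for all $k\ge0$ and all $g\in\mathrm{BV}(X)$ with $\int_X g\,d\mu=0$. *)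

theory Defs
  imports "HOL-Probability.Probability"
begin

section \<open>Gibbs-Markov maps of the unit interval\<close>

abbreviation unit_interval :: "real set" where
  "unit_interval \<equiv> {0..1}"

abbreviation leb01 :: "real measure" where
  "leb01 \<equiv> lebesgue_on unit_interval"

text \<open>The elements of the join of \<open>\<P>, T\<^sup>-\<^sup>1 \<P>, \<dots>, T\<^sup>-\<^sup>n \<P>\<close>. Empty intersections are included;
  they are harmless wherever a property of all points of a cylinder is stated.\<close>

definition cylinders :: "(real \<Rightarrow> real) \<Rightarrow> real set set \<Rightarrow> nat \<Rightarrow> real set set" where
  "cylinders T \<P> n =
     {\<Inter>j\<in>{..n}. (T ^^ j) -` a j \<inter> unit_interval | a. \<forall>j\<le>n. a j \<in> \<P>}"

text \<open>The smallest \<open>\<sigma>\<close>-algebra of Lebesgue measurable subsets of \<open>[0,1]\<close> which contains the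
  family \<open>G\<close> and is complete for Lebesgue measure.\<close>

definition complete_sigma_hull :: "real set set \<Rightarrow> real set set" where
  "complete_sigma_hull G =
     \<Inter>{\<A>. sigma_algebra unit_interval \<A> \<and> \<A> \<subseteq> sets leb01 \<and> G \<subseteq> \<A> \<and>
          (\<forall>Z \<in> \<A> \<inter> null_sets leb01. Pow Z \<subseteq> \<A>)}"

text \<open>Statements ``mod \<open>m\<close>'' are up to Lebesgue null sets. The derivative in
  \<open>expanding\<close> is one-sided at the end points of \<open>[0,1]\<close>.\<close>

locale gibbs_markov_map = prob_space \<mu>
  for \<mu> :: "real measure" +
  fixes T :: "real \<Rightarrow> real" and \<P> :: "real set set"
  assumes invariant_density:
      "\<exists>h c C. h \<in> borel_measurable leb01 \<and> 0 < c \<and> (\<forall>x\<in>unit_interval. c \<le> h x \<and> h x \<le> C) \<and>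
         \<mu> = density leb01 (\<lambda>x. ennreal (h x))"
    and measurable_map: "T \<in> measurable \<mu> \<mu>"
    and invariant: "distr \<mu> \<mu> T = \<mu>"
    and ergodic: "A \<in> sets \<mu> \<Longrightarrow> T -` A \<inter> space \<mu> = A \<Longrightarrow> measure \<mu> A = 0 \<or> measure \<mu> A = 1"
    and countable_partition: "countable \<P>"
    and partition_intervals:
      "A \<in> \<P> \<Longrightarrow> \<exists>a b. 0 \<le> a \<and> a < b \<and> b \<le> 1 \<and> A = {a<..<b}"
    and partition_disjoint: "disjoint \<P>"
    and partition_covers: "unit_interval - \<Union>\<P> \<in> null_sets leb01"
    and differentiable_branches: "A \<in> \<P> \<Longrightarrow> T differentiable_on A"
    and generating:
      "sets leb01 = complete_sigma_hull {(T ^^ n) -` A \<inter> unit_interval | n A. A \<in> \<P>}"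
    and markov: "A \<in> \<P> \<Longrightarrow> \<exists>\<Q>\<subseteq>\<P>. sym_diff (T ` A) (\<Union>\<Q>) \<in> null_sets leb01"
    and big_images: "\<exists>C>0. \<forall>A\<in>\<P>. measure leb01 (T ` A) > C"
    and injective_branches: "A \<in> \<P> \<Longrightarrow> inj_on T A"
    and expanding:
      "\<exists>\<Lambda>>1. \<forall>x\<in>unit_interval. \<forall>D.
         (T has_real_derivative D) (at x within unit_interval) \<longrightarrow> \<bar>D\<bar> > \<Lambda>"
    and bounded_distortion:
      "\<exists>C1 C2. 0 < C1 \<and> C1 \<le> C2 \<and>
         (\<forall>n. \<forall>A\<in>cylinders T \<P> n. \<forall>x\<in>A. \<forall>y\<in>A.
            C1 \<le> \<bar>deriv (T ^^ n) x / deriv (T ^^ n) y\<bar> \<and>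
            \<bar>deriv (T ^^ n) x / deriv (T ^^ n) y\<bar> \<le> C2)"


section \<open>Exponential decay in BV\<close>

definition variation_sums :: "(real \<Rightarrow> real) \<Rightarrow> real set" where
  "variation_sums g =
     {\<Sum>i<n. \<bar>g (t (Suc i)) - g (t i)\<bar> | n t.
        (\<forall>i\<le>n. t i \<in> unit_interval) \<and> (\<forall>i<n. t i \<le> t (Suc i))}"

definition bounded_var :: "(real \<Rightarrow> real) \<Rightarrow> bool" where
  "bounded_var g \<longleftrightarrow> bdd_above (variation_sums g)"

definition bv_norm :: "real measure \<Rightarrow> (real \<Rightarrow> real) \<Rightarrow> real" where
  "bv_norm \<mu> g = Sup (variation_sums g) + (\<integral>x. \<bar>g x\<bar> \<partial>\<mu>)"

text \<open>The transfer operator is determined by duality only up to \<open>\<mu>\<close>-null sets; the choice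
  below picks one representative.\<close>

definition transfer_op :: "real measure \<Rightarrow> (real \<Rightarrow> real) \<Rightarrow> (real \<Rightarrow> real) \<Rightarrow> (real \<Rightarrow> real)" where
  "transfer_op \<mu> T g =
     (SOME g'. integrable \<mu> g' \<and>
        (\<forall>f. f \<in> borel_measurable \<mu> \<and> (\<exists>B. AE x in \<mu>. \<bar>f x\<bar> \<le> B) \<longrightarrow>
           (\<integral>x. f (T x) * g x \<partial>\<mu>) = (\<integral>x. f x * g' x \<partial>\<mu>)))"

text \<open>As \<open>P\<^sup>k g\<close> is an equivalence class in \<open>L\<^sup>1(\<mu>)\<close>, the norm bound is required of
  some representative \<open>u\<close> of it.\<close>

definition exp_decay_BV :: "real measure \<Rightarrow> (real \<Rightarrow> real) \<Rightarrow> bool" where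
  "exp_decay_BV \<mu> T \<longleftrightarrow>
     (\<exists>C>0. \<exists>\<rho>. 0 < \<rho> \<and> \<rho> < 1 \<and>
        (\<forall>k g. bounded_var g \<and> (\<integral>x. g x \<partial>\<mu>) = 0 \<longrightarrow>
           (\<exists>u. (AE x in \<mu>. u x = (transfer_op \<mu> T ^^ k) g x) \<and> bounded_var u \<and>
                bv_norm \<mu> u \<le> C * \<rho> ^ k * bv_norm \<mu> g)))"


section \<open>Point processes on the punctured line\<close>

definition punctured_borel :: "real measure" where
  "punctured_borel = restrict_space borel (- {0})"

text \<open>\<open>dirac_sum I x\<close> is the sum over \<open>i \<in> I\<close> of the unit masses at \<open>x i\<close>, as a measure
  on \<open>\<real> \<setminus> {0}\<close>. Indices with \<open>x i = 0\<close> do not contribute, so that \<open>x i = 0\<close> encodes an absent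
  point: a sequence can enumerate finitely many points.\<close>

definition dirac_sum :: "'i set \<Rightarrow> ('i \<Rightarrow> real) \<Rightarrow> real measure" where
  "dirac_sum I x = distr (count_space {i\<in>I. x i \<noteq> 0}) punctured_borel x"

definition counting_measures :: "real measure set" where
  "counting_measures =
     {m. (\<exists>(I::nat set) x. m = dirac_sum I x) \<and>
         (\<forall>K. compact K \<and> 0 \<notin> K \<longrightarrow> emeasure m K < \<infinity>)}"

text \<open>The continuous functions on \<open>\<real> \<setminus> {0}\<close> with compact support, extended by \<open>0\<close> at \<open>0\<close>.\<close>

definition test_functions :: "(real \<Rightarrow> real) set" where
  "test_functions =
     {f. continuous_on UNIV f \<and> (\<exists>K. compact K \<and> 0 \<notin> K \<and> (\<forall>x. x \<notin> K \<longrightarrow> f x = 0))}"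

text \<open>The coarsest topology for which \<open>m \<mapsto> \<integral> f dm\<close> is continuous for every test function \<open>f\<close>.\<close>

definition vague_topology :: "real measure topology" where
  "vague_topology =
     pullback_topology counting_measures (\<lambda>m. \<lambda>f\<in>test_functions. \<integral>x. f x \<partial>m)
       (product_topology (\<lambda>_. euclideanreal) test_functions)"

text \<open>Convergence in distribution of random counting measures. The processes need only be locally
  finite almost surely; requiring \<open>F\<close> to vanish off \<open>counting_measures\<close> makes the values of \<open>F\<close>
  on the exceptional null set irrelevant.\<close>

definition conv_in_distr_pp ::
  "'a measure \<Rightarrow> (nat \<Rightarrow> 'a \<Rightarrow> real measure) \<Rightarrow> 'b measure \<Rightarrow> ('b \<Rightarrow> real measure) \<Rightarrow> bool" where
  "conv_in_distr_pp \<mu> Nn M N \<longleftrightarrow>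
     (\<forall>n. AE x in \<mu>. Nn n x \<in> counting_measures) \<and>
     (AE \<omega> in M. N \<omega> \<in> counting_measures) \<and>
     (\<forall>F. continuous_map vague_topology euclideanreal F \<and> bounded (F ` counting_measures) \<and>
          (\<forall>m. m \<notin> counting_measures \<longrightarrow> F m = 0) \<longrightarrow>
        (\<lambda>n. \<integral>x. F (Nn n x) \<partial>\<mu>) \<longlonglongrightarrow> (\<integral>\<omega>. F (N \<omega>) \<partial>M))"

text \<open>Measures on \<open>\<real> \<setminus> {0}\<close> with the \<open>\<sigma>\<close>-algebra generated by the evaluations \<open>m \<mapsto> m(A)\<close>.\<close>

definition measure_algebra :: "real measure measure" where
  "measure_algebra =
     (SUP A \<in> sets punctured_borel.
        vimage_algebra {m. sets m = sets punctured_borel} (\<lambda>m. emeasure m A) borel)"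

definition (in prob_space) poisson_process :: "('a \<Rightarrow> real measure) \<Rightarrow> real measure \<Rightarrow> bool" where
  "poisson_process N \<nu> \<longleftrightarrow>
     N \<in> measurable M measure_algebra \<and>
     (\<forall>A\<in>sets punctured_borel. emeasure \<nu> A < \<infinity> \<longrightarrow>
        (\<forall>k::nat. prob {\<omega>\<in>space M. emeasure (N \<omega>) A = of_nat k} =
           measure \<nu> A ^ k / fact k * exp (- measure \<nu> A))) \<and>
     (\<forall>(I::nat set) A. finite I \<and> A ` I \<subseteq> sets punctured_borel \<and> disjoint_family_on A I \<longrightarrow>
        indep_vars (\<lambda>_. borel) (\<lambda>i \<omega>. emeasure (N \<omega>) (A i)) I)"

definition tail_measure :: "real \<Rightarrow> real measure" where
  "tail_measure \<alpha> = density lborel (\<lambda>x. ennreal (\<alpha> * x powr (- \<alpha> - 1) * indicator {0<..} x))"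

text \<open>The points of a Poisson cluster process: Poisson points \<open>P i\<close> with intensity \<open>tail_measure \<alpha>\<close>
  and i.i.d. point processes \<open>\<Sum>\<^sub>j \<delta>(Q i j)\<close> on \<open>[-1,1] \<setminus> {0}\<close>, all independent (indices start at
  \<open>0\<close>). The value \<open>Q i j = 0\<close> encodes an absent point, so finite clusters are allowed.
  Independence is required of the sequence \<open>(P i)\<^sub>i\<close> and not only of the unlabelled measure
  \<open>\<Sum>\<^sub>i \<delta>(P i)\<close>: the process \<open>\<Sum>\<^sub>i \<Sum>\<^sub>j \<delta>(P i * Q i j)\<close> depends on which cluster is attached to
  which Poisson point, so the labelling must not depend on the clusters.\<close>

locale poisson_cluster_points = prob_space M
  for M :: "'w measure" +
  fixes \<alpha> :: real and P :: "nat \<Rightarrow> 'w \<Rightarrow> real" and Q :: "nat \<Rightarrow> nat \<Rightarrow> 'w \<Rightarrow> real"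
  assumes random_P: "P i \<in> borel_measurable M"
    and random_Q: "Q i j \<in> borel_measurable M"
    and Q_range: "\<omega> \<in> space M \<Longrightarrow> Q i j \<omega> \<in> {-1..1}"
    and poisson_P: "poisson_process (\<lambda>\<omega>. dirac_sum UNIV (\<lambda>i. P i \<omega>)) (tail_measure \<alpha>)"
    and identical_Q:
      "distr M measure_algebra (\<lambda>\<omega>. dirac_sum UNIV (\<lambda>j. Q i j \<omega>)) =
       distr M measure_algebra (\<lambda>\<omega>. dirac_sum UNIV (\<lambda>j. Q 0 j \<omega>))"
    and independent:
      "indep_sets
         (case_option
            (sets (vimage_algebra (space M) (\<lambda>\<omega> i. P i \<omega>) (\<Pi>\<^sub>M i\<in>UNIV. borel)))
            (\<lambda>i. sets (vimage_algebra (space M)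
               (\<lambda>\<omega>. dirac_sum UNIV (\<lambda>j. Q i j \<omega>)) measure_algebra)))
         UNIV"


section \<open>Stable laws\<close>

text \<open>Stability in the broad sense: a nondegenerate law \<open>L\<close> such that the sum of \<open>n\<close> independent
  variables with law \<open>L\<close> is distributed as \<open>n powr (1 / \<alpha>) * X + d\<close>, where \<open>X\<close> has law \<open>L\<close>.\<close>

definition stable_law :: "real \<Rightarrow> real measure \<Rightarrow> bool" where
  "stable_law \<alpha> L \<longleftrightarrow>
     real_distribution L \<and> \<not> (\<exists>c. AE x in L. x = c) \<and>
     (\<forall>n\<ge>1. \<exists>d. distr (\<Pi>\<^sub>M i\<in>{..<n}. L) borel (\<lambda>x. \<Sum>i<n. x i) =
               distr L borel (\<lambda>x. real n powr (1 / \<alpha>) * x + d))"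

end

theory Submission
  imports Defs
begin

text \<open>Put \<open>X n j = \<phi> \<circ> T\<^sup>j / b\<^sub>n\<close>. The truncation \<open>min \<phi> B\<close> is unimodal, so it has bounded variation and its
  correlations decay exponentially. Splitting it at the levels \<open>B \<delta>\<^sup>k\<close>, with \<open>k\<close> the time lag,
  bounds the variance of \<open>\<Sum>\<^sub>j min (X n j) \<epsilon>\<close> by a constant times \<open>\<epsilon>\<close> to the power \<open>2 - \<alpha>\<close>, uniformly in \<open>n\<close>:
  only the points of size at least \<open>\<epsilon>\<close> matter, and their sums converge with the
  point processes.

  The variance bounds also give uniform integrability, so means converge. For the limit \<open>N\<close>, the
  Poisson cluster structure says that \<open>E exp (i u N(g(m\<^sup>1\<^sup>/\<^sup>\<alpha> \<cdot>)))\<close> is the \<open>m\<close>-th power of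
  \<open>E exp (i u N(g))\<close>. This makes the mean measure of \<open>N\<close> homogeneous, hence equal to \<open>\<nu>\<close> by the choice
  of \<open>b\<^sub>n\<close>, which identifies the centring; and it makes the limit stable. The limit is not
  constant, since the small points have finite variance whereas the sum of the excesses \<open>(x - 1)\<^sup>+\<close>
  over the points of \<open>N\<close> is not square integrable.\<close>

section \<open>Decay of correlations\<close>

text \<open>Applied to \<open>min \<phi> B\<close> as a whole, decay in BV bounds the covariance at
  lag k by a multiple of \<rho>^k * B * E[min \<phi> B]. For \<alpha> < 1 this has the order B^(2 -
  \<alpha>), but for \<alpha> >= 1 the mean is of larger order than B^(1 - \<alpha>); hence the
  levels that follow the lag. Vague convergence on the punctured line sees neither points near 0 nor
  points near infinity. The former are controlled by variances, or by means if \<alpha> < 1, the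
  latter by a tail bound uniform in n. The density of \<mu> is only bounded above and below, so the
  tail of \<phi> is known up to constants. That the expected number of exceedances of t * b_n tends
  to t^(-\<alpha>) is therefore not computed, but deduced from the scaling of the limit and the
  normalisation at the single level t = 1. A Poisson process is specified only by its counts in
  disjoint sets. The cluster centres are therefore rounded to finitely many values first, for which
  the characteristic functional is a finite product.\<close>

definition unimodal :: "real \<Rightarrow> real \<Rightarrow> (real \<Rightarrow> real) \<Rightarrow> bool" where
  "unimodal x0 D u \<longleftrightarrow> (\<forall>x. 0 \<le> u x \<and> u x \<le> D) \<and>
     (\<forall>x y. x \<le> y \<and> y < x0 \<longrightarrow> u x \<le> u y) \<and> (\<forall>x y. x0 < x \<and> x \<le> y \<longrightarrow> u y \<le> u x)"

lemma variation_mono_le: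
  fixes f :: "real \<Rightarrow> real"
  assumes "mono f" "\<And>x. 0 \<le> f x" "\<And>x. f x \<le> D" "\<And>i. i < n \<Longrightarrow> t i \<le> t (Suc i)"
  shows "(\<Sum>i<n. \<bar>f (t (Suc i)) - f (t i)\<bar>) \<le> D"
proof -
  have "(\<Sum>i<n. \<bar>f (t (Suc i)) - f (t i)\<bar>) = (\<Sum>i<n. f (t (Suc i)) - f (t i))"
    using assms by (intro sum.cong) (auto simp: monoD)
  also have "\<dots> = f (t n) - f (t 0)" by (rule sum_lessThan_telescope)
  also have "\<dots> \<le> D" using assms(2)[of "t 0"] assms(3)[of "t n"] by linarith
  finally show ?thesis .
qed

text \<open>The value at the mode \<open>x0\<close> is arbitrary; it accounts for two of the four monotone summands.\<close>

lemma variation_unimodal_le: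
  assumes u: "unimodal x0 D u" and t: "\<And>i. i < n \<Longrightarrow> t i \<le> t (Suc i)"
  shows "(\<Sum>i<n. \<bar>u (t (Suc i)) - u (t i)\<bar>) \<le> 4 * D"
proof -
  define f1 where "f1 x = (if x < x0 then u x else D)" for x
  define f2 where "f2 x = (if x > x0 then D - u x else 0)" for x
  define f3 where "f3 x = (if x \<ge> x0 then D - u x0 else 0)" for x
  define f4 where "f4 x = (if x > x0 then D - u x0 else 0)" for x
  have range: "0 \<le> u x" "u x \<le> D" for x using u by (auto simp: unimodal_def)
  have D: "0 \<le> D" using range[of 0] by linarith
  have eq: "u x = f1 x - f2 x - f3 x + f4 x" for x
    by (cases "x < x0"; cases "x = x0") (auto simp: f1_def f2_def f3_def f4_def)
  have m: "mono f1" "mono f2" "mono f3" "mono f4"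
    using u unfolding unimodal_def mono_def f1_def f2_def f3_def f4_def by auto
  have b: "0 \<le> f1 x" "f1 x \<le> D" "0 \<le> f2 x" "f2 x \<le> D" "0 \<le> f3 x" "f3 x \<le> D" "0 \<le> f4 x" "f4 x \<le> D" for x
    using range D by (auto simp: f1_def f2_def f3_def f4_def)
  have "(\<Sum>i<n. \<bar>u (t (Suc i)) - u (t i)\<bar>) \<le>
    (\<Sum>i<n. \<bar>f1 (t (Suc i)) - f1 (t i)\<bar> + \<bar>f2 (t (Suc i)) - f2 (t i)\<bar>
       + \<bar>f3 (t (Suc i)) - f3 (t i)\<bar> + \<bar>f4 (t (Suc i)) - f4 (t i)\<bar>)"
    by (intro sum_mono) (simp add: eq)
  also have "\<dots> \<le> D + D + D + D"
    unfolding sum.distrib by (intro add_mono variation_mono_le m b t)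
  finally show ?thesis by simp
qed

section \<open>The transfer operator, its duality, and correlations of unimodal functions\<close>

context gibbs_markov_map
begin

text \<open>The pushforward under T of the measure with density g has a Radon-Nikodym derivative
  with respect to \<mu>. Since \<open>transfer_op\<close> is defined by choice, all its properties
  rest on such an existence result.\<close>

lemma transfer_op_exists_nonneg:
  fixes g :: "real \<Rightarrow> real"
  assumes g: "integrable \<mu> g" "\<And>x. 0 \<le> g x"
  shows "\<exists>g'. integrable \<mu> g' \<and>
        (\<forall>f. f \<in> borel_measurable \<mu> \<and> (\<exists>B. AE x in \<mu>. \<bar>f x\<bar> \<le> B) \<longrightarrow>
           (\<integral>x. f (T x) * g x \<partial>\<mu>) = (\<integral>x. f x * g' x \<partial>\<mu>))"
proof -
  note [measurable] = measurable_map
  have [measurable]: "g \<in> borel_measurable \<mu>" using g by auto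
  define D where "D = density \<mu> (\<lambda>x. ennreal (g x))"
  define N where "N = distr D \<mu> T"
  have setsD[measurable_cong, simp]: "sets D = sets \<mu>" by (simp add: D_def)
  have spD[simp]: "space D = space \<mu>" by (simp add: D_def)
  have setsN[measurable_cong, simp]: "sets N = sets \<mu>" by (simp add: N_def)
  have TD[measurable]: "T \<in> measurable D \<mu>" using measurable_map by (simp add: measurable_def)
  have finD: "emeasure D (space D) < \<infinity>"
    using g by (simp add: D_def emeasure_density integrable_iff_bounded cong: nn_integral_cong)
  interpret D: finite_measure D using finD by (intro finite_measureI) auto
  interpret N: finite_measure N unfolding N_def by (rule D.finite_measure_distr) simp
  \<comment> \<open>Invariance makes the preimage of a null set null, for \<mu> and hence for the
    measure with density g.\<close>
  have ac: "absolutely_continuous \<mu> N"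
  proof (unfold absolutely_continuous_def, safe)
    fix A assume A: "A \<in> null_sets \<mu>"
    then have Am[measurable]: "A \<in> sets \<mu>" by auto
    have "emeasure \<mu> (T -` A \<inter> space \<mu>) = emeasure (distr \<mu> \<mu> T) A"
      by (simp add: emeasure_distr)
    also have "\<dots> = 0" using A invariant by auto
    finally have "T -` A \<inter> space \<mu> \<in> null_sets \<mu>" by auto
    then have "AE x in \<mu>. x \<notin> T -` A \<inter> space \<mu>" by (rule AE_not_in)
    then have "T -` A \<inter> space \<mu> \<in> null_sets D" unfolding D_def
      by (subst null_sets_density_iff) auto
    then show "A \<in> null_sets N" unfolding N_def by (auto simp: null_sets_distr_iff)
  qed
  define r where "r = RN_deriv \<mu> N"
  have [measurable]: "r \<in> borel_measurable \<mu>" by (simp add: r_def)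
  have dens: "density \<mu> r = N" unfolding r_def
    by (rule density_RN_deriv[OF ac]) simp
  have rint: "(\<integral>\<^sup>+x. r x \<partial>\<mu>) < \<infinity>"
  proof -
    have "(\<integral>\<^sup>+x. r x \<partial>\<mu>) = emeasure (density \<mu> r) (space \<mu>)"
      by (simp add: emeasure_density cong: nn_integral_cong)
    also have "\<dots> = emeasure N (space N)" using dens by (metis sets_eq_imp_space_eq setsN)
    also have "\<dots> < \<infinity>" using N.emeasure_finite by (simp add: less_top[symmetric])
    finally show ?thesis .
  qed
  have rfin: "AE x in \<mu>. r x \<noteq> \<infinity>" using rint by (intro nn_integral_PInf_AE) auto
  define g' where "g' x = enn2real (r x)" for x
  have [measurable]: "g' \<in> borel_measurable \<mu>" by (simp add: g'_def[abs_def])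
  have r_g': "AE x in \<mu>. r x = ennreal (g' x)" using rfin
    by eventually_elim (simp add: g'_def top.not_eq_extremum)
  have ig': "integrable \<mu> g'"
  proof (rule integrableI_nonneg)
    show "(\<integral>\<^sup>+x. ennreal (g' x) \<partial>\<mu>) < \<infinity>"
      using rint nn_integral_cong_AE[OF r_g'] by simp
  qed (auto simp: g'_def)
  have dens': "density \<mu> (\<lambda>x. ennreal (g' x)) = N"
    using density_cong[OF _ _ r_g'] dens by simp
  have "(\<integral>x. f (T x) * g x \<partial>\<mu>) = (\<integral>x. f x * g' x \<partial>\<mu>)" if [measurable]: "f \<in> borel_measurable \<mu>" for f :: "real \<Rightarrow> real"
  proof -
    have "(\<integral>x. f (T x) * g x \<partial>\<mu>) = (\<integral>x. f (T x) \<partial>D)"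
      unfolding D_def using g by (subst integral_density) (auto simp: mult.commute)
    also have "\<dots> = (\<integral>x. f x \<partial>N)" unfolding N_def by (subst integral_distr) auto
    also have "\<dots> = (\<integral>x. f x * g' x \<partial>\<mu>)"
      unfolding dens'[symmetric] by (subst integral_density) (auto simp: g'_def mult.commute)
    finally show ?thesis .
  qed
  with ig' show ?thesis by blast
qed

lemma integrable_bdd_mult:
  assumes "integrable \<mu> g" "f \<in> borel_measurable \<mu>" "AE x in \<mu>. \<bar>f x\<bar> \<le> (B::real)"
  shows "integrable \<mu> (\<lambda>x. f x * g x :: real)"
proof (rule Bochner_Integration.integrable_bound)
  show "integrable \<mu> (\<lambda>x. B * g x)" using assms by simp
  show "AE x in \<mu>. norm (f x * g x) \<le> norm (B * g x)" using assms(3)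
    by eventually_elim (auto simp: abs_mult intro!: mult_right_mono)
qed (use assms in auto)

lemma AE_comp_T:
  assumes "AE x in \<mu>. Q x" shows "AE x in \<mu>. Q (T x)"
proof -
  have "AE x in distr \<mu> \<mu> T. Q x" unfolding invariant by (rule assms)
  then show ?thesis by (rule AE_distrD[OF measurable_map])
qed

text \<open>Positive and negative part are treated separately; boundedness of f makes both integrals
  finite, so that they can be subtracted.\<close>

lemma transfer_op_exists:
  fixes g :: "real \<Rightarrow> real"
  assumes g: "integrable \<mu> g"
  shows "\<exists>g'. integrable \<mu> g' \<and>
        (\<forall>f. f \<in> borel_measurable \<mu> \<and> (\<exists>B. AE x in \<mu>. \<bar>f x\<bar> \<le> B) \<longrightarrow>
           (\<integral>x. f (T x) * g x \<partial>\<mu>) = (\<integral>x. f x * g' x \<partial>\<mu>))"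
proof -
  note [measurable] = measurable_map
  define gp where "gp x = max 0 (g x)" for x
  define gm where "gm x = max 0 (- g x)" for x
  have ip1: "integrable \<mu> gp" unfolding gp_def
    by (rule Bochner_Integration.integrable_max) (use g in auto)
  have ip2: "integrable \<mu> gm" unfolding gm_def
    by (rule Bochner_Integration.integrable_max) (use g in auto)
  obtain p where p: "integrable \<mu> p" "\<And>f. f \<in> borel_measurable \<mu> \<Longrightarrow> (\<exists>B. AE x in \<mu>. \<bar>f x\<bar> \<le> B) \<Longrightarrow>
           (\<integral>x. f (T x) * gp x \<partial>\<mu>) = (\<integral>x. f x * p x \<partial>\<mu>)"
    using transfer_op_exists_nonneg[OF ip1] by (auto simp: gp_def)
  obtain q where q: "integrable \<mu> q" "\<And>f. f \<in> borel_measurable \<mu> \<Longrightarrow> (\<exists>B. AE x in \<mu>. \<bar>f x\<bar> \<le> B) \<Longrightarrow>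
           (\<integral>x. f (T x) * gm x \<partial>\<mu>) = (\<integral>x. f x * q x \<partial>\<mu>)"
    using transfer_op_exists_nonneg[OF ip2] by (auto simp: gm_def)
  have "(\<integral>x. f (T x) * g x \<partial>\<mu>) = (\<integral>x. f x * (p x - q x) \<partial>\<mu>)"
    if f[measurable]: "f \<in> borel_measurable \<mu>" and B: "AE x in \<mu>. \<bar>f x\<bar> \<le> B" for f :: "real \<Rightarrow> real" and B
  proof -
    have BT: "AE x in \<mu>. \<bar>f (T x)\<bar> \<le> B" using AE_comp_T[OF B] .
    have fT[measurable]: "(\<lambda>x. f (T x)) \<in> borel_measurable \<mu>" by measurable
    have "(\<integral>x. f (T x) * g x \<partial>\<mu>) = (\<integral>x. f (T x) * gp x - f (T x) * gm x \<partial>\<mu>)"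
      by (intro Bochner_Integration.integral_cong) (auto simp: gp_def gm_def max_def)
    also have "\<dots> = (\<integral>x. f (T x) * gp x \<partial>\<mu>) - (\<integral>x. f (T x) * gm x \<partial>\<mu>)"
      using integrable_bdd_mult[OF ip1 fT BT] integrable_bdd_mult[OF ip2 fT BT] by (rule Bochner_Integration.integral_diff)
    also have "\<dots> = (\<integral>x. f x * p x \<partial>\<mu>) - (\<integral>x. f x * q x \<partial>\<mu>)"
      using p(2)[OF f exI, OF B] q(2)[OF f exI, OF B] by simp
    also have "\<dots> = (\<integral>x. f x * p x - f x * q x \<partial>\<mu>)"
      using integrable_bdd_mult[OF p(1) f B] integrable_bdd_mult[OF q(1) f B] by (rule Bochner_Integration.integral_diff[symmetric])
    finally show ?thesis by (simp add: algebra_simps)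
  qed
  with p(1) q(1) show ?thesis by (intro exI[of _ "\<lambda>x. p x - q x"]) auto
qed

lemma transfer_op_dual:
  assumes "integrable \<mu> g"
  shows "integrable \<mu> (transfer_op \<mu> T g)"
    and "\<And>f B. f \<in> borel_measurable \<mu> \<Longrightarrow> (AE x in \<mu>. \<bar>f x\<bar> \<le> B) \<Longrightarrow>
           (\<integral>x. f (T x) * g x \<partial>\<mu>) = (\<integral>x. f x * transfer_op \<mu> T g x \<partial>\<mu>)"
  using someI_ex[OF transfer_op_exists[OF assms]] unfolding transfer_op_def by blast+

lemma measurable_iter [measurable]: "T ^^ k \<in> measurable \<mu> \<mu>"
proof (induction k)
  case (Suc k)
  then show ?case using measurable_comp[OF Suc measurable_map] by (simp add: comp_def)
qed (simp add: id_def)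

lemma transfer_op_iter_dual:
  assumes "integrable \<mu> g"
  shows "integrable \<mu> ((transfer_op \<mu> T ^^ k) g) \<and>
    (\<forall>f B. f \<in> borel_measurable \<mu> \<longrightarrow> (AE x in \<mu>. \<bar>f x\<bar> \<le> B) \<longrightarrow>
           (\<integral>x. f ((T ^^ k) x) * g x \<partial>\<mu>) = (\<integral>x. f x * (transfer_op \<mu> T ^^ k) g x \<partial>\<mu>))"
proof (induction k)
  case 0 show ?case using assms by simp
next
  case (Suc k)
  let ?h = "(transfer_op \<mu> T ^^ k) g"
  note [measurable] = measurable_map
  have h: "integrable \<mu> ?h" using Suc by simp
  have "(\<integral>x. f ((T ^^ Suc k) x) * g x \<partial>\<mu>) = (\<integral>x. f x * transfer_op \<mu> T ?h x \<partial>\<mu>)"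
    if f[measurable]: "f \<in> borel_measurable \<mu>" and B: "AE x in \<mu>. \<bar>f x\<bar> \<le> B" for f :: "real \<Rightarrow> real" and B
  proof -
    have "(\<integral>x. f ((T ^^ Suc k) x) * g x \<partial>\<mu>) = (\<integral>x. (f \<circ> T) ((T ^^ k) x) * g x \<partial>\<mu>)" by simp
    also have "\<dots> = (\<integral>x. (f \<circ> T) x * ?h x \<partial>\<mu>)"
    proof (rule Suc[THEN conjunct2, rule_format])
      show "f \<circ> T \<in> borel_measurable \<mu>" using measurable_comp[OF measurable_map f] .
      show "AE x in \<mu>. \<bar>(f \<circ> T) x\<bar> \<le> B" using AE_comp_T[OF B] by simp
    qed
    also have "\<dots> = (\<integral>x. f x * transfer_op \<mu> T ?h x \<partial>\<mu>)" using transfer_op_dual(2)[OF h f B] by simp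
    finally show ?thesis .
  qed
  then show ?case using transfer_op_dual(1)[OF h] by auto
qed

text \<open>Two-point subdivisions already bound the oscillation by the total variation.\<close>

lemma variation_sup_bound:
  assumes "bounded_var u" "x \<in> unit_interval" "y \<in> unit_interval"
  shows "u x - u y \<le> Sup (variation_sums u)"
proof -
  have *: "\<bar>u b - u a\<bar> \<in> variation_sums u" if "a \<in> unit_interval" "b \<in> unit_interval" "a \<le> b" for a b
    unfolding variation_sums_def
    using that by (intro CollectI exI[of _ 1] exI[of _ "\<lambda>i::nat. if i = 0 then a else b"]) auto
  have "\<bar>u x - u y\<bar> \<in> variation_sums u"
    using *[of x y] *[of y x] assms by (cases "x \<le> y") (auto simp: abs_minus_commute)
  then have "\<bar>u x - u y\<bar> \<le> Sup (variation_sums u)"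
    using assms(1) unfolding bounded_var_def by (rule cSup_upper)
  then show ?thesis by linarith
qed

lemma space_mu: "space \<mu> = unit_interval" and sets_mu: "sets \<mu> = sets leb01"
  using invariant_density by auto

lemma expectation_iter:
  fixes F :: "real \<Rightarrow> real"
  assumes [measurable]: "F \<in> borel_measurable \<mu>"
  shows "expectation (\<lambda>x. F ((T ^^ k) x)) = expectation F"
proof -
  have "distr \<mu> \<mu> (T ^^ k) = \<mu>"
  proof (induction k)
    case (Suc k)
    have "distr \<mu> \<mu> (T ^^ Suc k) = distr (distr \<mu> \<mu> (T ^^ k)) \<mu> T"
      by (subst distr_distr) (auto simp: comp_def measurable_map)
    then show ?case by (simp only: Suc invariant)
  qed (simp add: distr_id2)
  then have "expectation F = integral\<^sup>L (distr \<mu> \<mu> (T ^^ k)) F" by simp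
  also have "\<dots> = expectation (\<lambda>x. F ((T ^^ k) x))" by (rule integral_distr) auto
  finally show ?thesis by simp
qed

text \<open>The decay hypothesis is applied to u minus its mean. The iterate has mean zero, hence
  takes values of both signs, so its supremum is at most its variation. This sup bound leaves the L1
  norm of v as a factor, which for a v that is rarely nonzero is far smaller than its supremum; the
  bound B provides integrability.\<close>

lemma decay_of_correlations:
  assumes "exp_decay_BV \<mu> T"
  shows "\<exists>C>0. \<exists>\<rho>. 0 < \<rho> \<and> \<rho> < 1 \<and>
    (\<forall>x0 D u v B k. unimodal x0 D u \<longrightarrow> u \<in> borel_measurable \<mu> \<longrightarrow> v \<in> borel_measurable \<mu> \<longrightarrow>
       (\<forall>x. \<bar>v x\<bar> \<le> B) \<longrightarrow>
       \<bar>expectation (\<lambda>x. v ((T ^^ k) x) * u x) - expectation v * expectation u\<bar>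
         \<le> C * \<rho> ^ k * D * expectation (\<lambda>x. \<bar>v x\<bar>))"
proof -
  obtain C \<rho> where C: "C > 0" "0 < \<rho>" "\<rho> < 1" and dec:
    "\<And>k g. bounded_var g \<Longrightarrow> expectation g = 0 \<Longrightarrow>
           \<exists>u. (AE x in \<mu>. u x = (transfer_op \<mu> T ^^ k) g x) \<and> bounded_var u \<and>
                bv_norm \<mu> u \<le> C * \<rho> ^ k * bv_norm \<mu> g"
    using assms unfolding exp_decay_BV_def by metis
  have main: "\<bar>expectation (\<lambda>x. v ((T ^^ k) x) * u x) - expectation v * expectation u\<bar>
         \<le> (C * 5) * \<rho> ^ k * D * expectation (\<lambda>x. \<bar>v x\<bar>)"
    if uni: "unimodal x0 D u" and [measurable]: "u \<in> borel_measurable \<mu>" "v \<in> borel_measurable \<mu>"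
      and B: "\<forall>x. \<bar>v x\<bar> \<le> B" for x0 D u v B k
  proof -
    have range: "0 \<le> u x" "u x \<le> D" for x using uni by (auto simp: unimodal_def)
    have D0: "0 \<le> D" using range[of 0] by linarith
    have iu: "integrable \<mu> u" by (rule integrable_const_bound[of _ D]) (use range in auto)
    have iv: "integrable \<mu> v" by (rule integrable_const_bound[of _ B]) (use B in auto)
    define c where "c = expectation u"
    have c: "0 \<le> c" "c \<le> D" unfolding c_def
      using range iu integral_ge_const[OF iu, of 0] integral_le_const[OF iu, of D] by auto
    define g where "g x = u x - c" for x
    have ig: "integrable \<mu> g" unfolding g_def using iu by simp
    have Eg: "expectation g = 0" unfolding g_def using iu by (simp add: c_def prob_space)
    have vs: "z \<le> 4 * D" if "z \<in> variation_sums g" for z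
      using that variation_unimodal_le[OF uni] unfolding variation_sums_def g_def by auto
    have bvg: "bounded_var g" unfolding bounded_var_def bdd_above_def using vs by blast
    have ne: "variation_sums g \<noteq> {}"
      unfolding variation_sums_def by (auto intro!: exI[of _ "0::nat"] exI[of _ "\<lambda>_. 0"])
    have "(\<integral>x. \<bar>g x\<bar> \<partial>\<mu>) \<le> D"
    proof (rule integral_le_const)
      show "integrable \<mu> (\<lambda>x. \<bar>g x\<bar>)" using ig by simp
      show "AE x in \<mu>. \<bar>g x\<bar> \<le> D" using range c unfolding g_def
        by (intro AE_I2) (smt (verit))
    qed
    \<comment> \<open>Variation at most 4 * D, L1 norm at most D.\<close>
    then have bvn: "bv_norm \<mu> g \<le> 5 * D"
      unfolding bv_norm_def using cSup_least[OF ne vs] by simp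
    obtain w where w: "AE x in \<mu>. w x = (transfer_op \<mu> T ^^ k) g x" "bounded_var w"
      "bv_norm \<mu> w \<le> C * \<rho> ^ k * bv_norm \<mu> g" using dec[OF bvg Eg] by blast
    define p where "p = (transfer_op \<mu> T ^^ k) g"
    have ip: "integrable \<mu> p" and dual: "\<And>f B. f \<in> borel_measurable \<mu> \<Longrightarrow> (AE x in \<mu>. \<bar>f x\<bar> \<le> B) \<Longrightarrow>
       expectation (\<lambda>x. f ((T ^^ k) x) * g x) = expectation (\<lambda>x. f x * p x)"
      using transfer_op_iter_dual[OF ig, of k] unfolding p_def by blast+
    have [measurable]: "p \<in> borel_measurable \<mu>" using ip by auto
    define V where "V = Sup (variation_sums w)"
    have V: "V \<le> C * \<rho> ^ k * (5 * D)"
    proof -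
      have "0 \<le> (\<integral>x. \<bar>w x\<bar> \<partial>\<mu>)" by simp
      then have "V \<le> bv_norm \<mu> w" unfolding V_def bv_norm_def by linarith
      also have "\<dots> \<le> C * \<rho> ^ k * bv_norm \<mu> g" by (rule w)
      also have "\<dots> \<le> C * \<rho> ^ k * (5 * D)" using C bvn by (intro mult_left_mono) auto
      finally show ?thesis .
    qed
    \<comment> \<open>Duality against the constant 1: iterates keep mean zero.\<close>
    have Ep: "expectation p = 0" using dual[of "\<lambda>_. 1" 1] Eg by simp
    have wp: "AE x in \<mu>. w x = p x" using w(1) unfolding p_def .
    have "AE x in \<mu>. \<bar>p x\<bar> \<le> V"
    proof -
      have 1: "\<exists>y\<in>unit_interval. w y \<le> 0"
      proof (rule ccontr)
        assume "\<not> ?thesis"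
        then have "AE x in \<mu>. w x > 0" by (intro AE_I2) (auto simp: space_mu not_le)
        then have "AE x in \<mu>. 0 < p x" using wp by eventually_elim simp
        then have "0 < expectation p"
          using ip by (intro expectation_greater) auto
        then show False using Ep by simp
      qed
      have 2: "\<exists>y\<in>unit_interval. 0 \<le> w y"
      proof (rule ccontr)
        assume "\<not> ?thesis"
        then have "AE x in \<mu>. w x < 0" by (intro AE_I2) (auto simp: space_mu not_le)
        then have "AE x in \<mu>. p x < 0" using wp by eventually_elim simp
        then have "expectation p < 0"
          using ip by (intro expectation_less) auto
        then show False using Ep by simp
      qed
      \<comment> \<open>Comparing w x with a value of w of the opposite sign bounds |w x| by the
        oscillation of w.\<close>
      obtain y1 y2 where y: "y1 \<in> unit_interval" "w y1 \<le> 0" "y2 \<in> unit_interval" "0 \<le> w y2" using 1 2 by blast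
      have "\<bar>w x\<bar> \<le> V" if "x \<in> unit_interval" for x
        using variation_sup_bound[OF w(2) that y(1)] variation_sup_bound[OF w(2) y(3) that] y
        unfolding V_def by linarith
      then have "AE x in \<mu>. \<bar>w x\<bar> \<le> V" by (intro AE_I2) (auto simp: space_mu)
      then show ?thesis using wp by eventually_elim simp
    qed
    then have pb: "AE x in \<mu>. \<bar>v x * p x\<bar> \<le> \<bar>v x\<bar> * (C * \<rho> ^ k * (5 * D))"
      by eventually_elim (use V in \<open>auto simp: abs_mult intro!: mult_left_mono\<close>)
    have ivp: "integrable \<mu> (\<lambda>x. v x * p x)" by (rule integrable_bdd_mult[OF ip _ AE_I2]) (use B in auto)
    have Bk: "AE x in \<mu>. \<bar>v ((T ^^ k) x)\<bar> \<le> B" using B by auto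
    have "expectation v = expectation (\<lambda>x. v ((T ^^ k) x))" by (simp add: expectation_iter)
    moreover have "expectation (\<lambda>x. v ((T ^^ k) x) * g x) =
        expectation (\<lambda>x. v ((T ^^ k) x) * u x) - expectation (\<lambda>x. v ((T ^^ k) x)) * c"
    proof -
      have "integrable \<mu> (\<lambda>x. v ((T ^^ k) x) * u x)" "integrable \<mu> (\<lambda>x. v ((T ^^ k) x) * c)"
        by (rule integrable_bdd_mult[OF _ _ Bk]; use iu in simp)+
      then have "expectation (\<lambda>x. v ((T ^^ k) x) * u x) - expectation (\<lambda>x. v ((T ^^ k) x) * c)
         = expectation (\<lambda>x. v ((T ^^ k) x) * u x - v ((T ^^ k) x) * c)"
        by (rule Bochner_Integration.integral_diff[symmetric])
      then show ?thesis by (simp add: g_def right_diff_distrib)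
    qed
    ultimately have "expectation (\<lambda>x. v ((T ^^ k) x) * u x) - expectation v * expectation u
        = expectation (\<lambda>x. v x * p x)" using dual[of v B] B c_def by simp
    moreover have "\<bar>expectation (\<lambda>x. v x * p x)\<bar> \<le> expectation (\<lambda>x. \<bar>v x\<bar> * (C * \<rho> ^ k * (5 * D)))"
    proof (rule order_trans)
      show "\<bar>expectation (\<lambda>x. v x * p x)\<bar> \<le> expectation (\<lambda>x. \<bar>v x * p x\<bar>)"
        using integral_norm_bound[of \<mu> "\<lambda>x. v x * p x"] by simp
      show "expectation (\<lambda>x. \<bar>v x * p x\<bar>) \<le> expectation (\<lambda>x. \<bar>v x\<bar> * (C * \<rho> ^ k * (5 * D)))"
        using pb ivp iv by (intro integral_mono_AE) auto
    qed
    ultimately show ?thesis by (simp add: mult_ac)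
  qed
  show ?thesis
    by (intro exI[of _ "C * 5"] exI[of _ \<rho>] conjI allI impI main) (use C in auto)
qed

end

section \<open>Truncated moments along orbits\<close>

text \<open>At the least l with \<open>B / 2 ^ Suc l\<close> below \<open>min y B\<close>, that
  minimum is at most \<open>B / 2 ^ l\<close>, so a single term of the series suffices. Level sets
  are used because only tail probabilities will be known.\<close>

lemma dyadic_majorant:
  fixes y B :: real
  assumes "0 \<le> y" "0 < B" "p \<ge> 1"
  shows "ennreal (min y B ^ p) \<le> (\<Sum>l. ennreal ((B / 2 ^ l) ^ p * indicator {z. B / 2 ^ Suc l < z} y))"
proof (cases "y = 0")
  case True
  then have "min y B ^ p = 0" using assms by (simp add: min_def)
  then show ?thesis by (simp only: ennreal_0 zero_le)
next
  case False
  define m where "m = min y B"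
  have m: "0 < m" "m \<le> B" "m \<le> y" using False assms by (auto simp: m_def)
  have "\<exists>l. B / 2 ^ Suc l < m"
  proof -
    obtain l where "(1/2) ^ l < m / B" using real_arch_pow_inv[of "m / B" "1/2"] m assms by auto
    then have "(1/2) ^ l * B < m" using assms by (simp only: pos_less_divide_eq)
    then have "B / 2 ^ l < m" by (simp add: power_one_over)
    moreover have "B / 2 ^ Suc l \<le> B / 2 ^ l" using assms by (simp add: field_simps)
    ultimately show ?thesis by (intro exI[of _ l]) linarith
  qed
  define l where "l = (LEAST l. B / 2 ^ Suc l < m)"
  have l: "B / 2 ^ Suc l < m" unfolding l_def by (rule LeastI_ex) fact
  have "m \<le> B / 2 ^ l"
  proof (cases l)
    case (Suc k)
    have "\<not> B / 2 ^ Suc k < m" using not_less_Least[of k "\<lambda>l. B / 2 ^ Suc l < m"] Suc l_def by auto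
    then show ?thesis using Suc by simp
  qed (use m in simp)
  then have "m ^ p \<le> (B / 2 ^ l) ^ p" using m by (intro power_mono) auto
  also have "\<dots> = (B / 2 ^ l) ^ p * indicator {z. B / 2 ^ Suc l < z} y"
  proof -
    have "B / 2 ^ Suc l < y" using l m(3) by (rule less_le_trans)
    then show ?thesis by (simp only: indicator_def mem_Collect_eq if_True mult_1_right of_bool_eq simp_thms)
  qed
  finally have "ennreal (m ^ p) \<le> ennreal ((B / 2 ^ l) ^ p * indicator {z. B / 2 ^ Suc l < z} y)"
    by (rule ennreal_leI)
  also have "\<dots> = sum (\<lambda>l. ennreal ((B / 2 ^ l) ^ p * indicator {z. B / 2 ^ Suc l < z} y)) {l}" by simp
  also have "\<dots> \<le> (\<Sum>l. ennreal ((B / 2 ^ l) ^ p * indicator {z. B / 2 ^ Suc l < z} y))"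
    by (rule sum_le_suminf) auto
  finally show ?thesis unfolding m_def .
qed

text \<open>Level l of the dyadic majorant contributes at most K 2^\<alpha> B^(p - \<alpha>) 2^(l
  (\<alpha> - p)). This is a geometric series because \<alpha> < p, and its sum is the stated
  constant.\<close>

lemma (in prob_space) truncated_moment:
  assumes [measurable]: "Y \<in> borel_measurable M" and Y: "\<And>x. 0 \<le> Y x"
    and tail: "\<And>t. 0 < t \<Longrightarrow> prob {x\<in>space M. t < Y x} \<le> K * t powr (- \<alpha>)"
    and p: "p \<ge> 1" "\<alpha> < real p" and K: "0 \<le> K" and B: "0 < B"
  shows "expectation (\<lambda>x. min (Y x) B ^ p) \<le> K * 2 powr \<alpha> / (1 - 2 powr (\<alpha> - p)) * B powr (p - \<alpha>)"
proof -
  define r where "r = 2 powr (\<alpha> - p)"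
  have r: "0 < r" "r < 1" using p by (auto simp: r_def powr_less_one)
  define c where "c = K * 2 powr \<alpha> * B powr (p - \<alpha>)"
  have c: "0 \<le> c" using K by (auto simp: c_def)
  have "(\<integral>\<^sup>+x. ennreal (min (Y x) B ^ p) \<partial>M) \<le>
      (\<integral>\<^sup>+x. (\<Sum>l. ennreal ((B / 2 ^ l) ^ p * indicator {z. B / 2 ^ Suc l < z} (Y x))) \<partial>M)"
    by (intro nn_integral_mono dyadic_majorant Y B p)
  also have "\<dots> = (\<Sum>l. \<integral>\<^sup>+x. ennreal ((B / 2 ^ l) ^ p * indicator {z. B / 2 ^ Suc l < z} (Y x)) \<partial>M)"
    by (rule nn_integral_suminf) simp
  also have "\<dots> \<le> (\<Sum>l. ennreal (c * r ^ l))"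
  proof (intro suminf_le summableI)
    fix l
    have "(\<integral>\<^sup>+x. ennreal ((B / 2 ^ l) ^ p * indicator {z. B / 2 ^ Suc l < z} (Y x)) \<partial>M)
       = (\<integral>\<^sup>+x. ennreal ((B / 2 ^ l) ^ p) * indicator {x\<in>space M. B / 2 ^ Suc l < Y x} x \<partial>M)"
      using B by (intro nn_integral_cong) (auto simp: indicator_def)
    also have "\<dots> = ennreal ((B / 2 ^ l) ^ p) * ennreal (prob {x\<in>space M. B / 2 ^ Suc l < Y x})"
      by (subst nn_integral_cmult_indicator) (auto simp: emeasure_eq_measure)
    also have "\<dots> \<le> ennreal ((B / 2 ^ l) ^ p) * ennreal (K * (B / 2 ^ Suc l) powr (- \<alpha>))"
      using tail[of "B / 2 ^ Suc l"] B by (intro mult_left_mono ennreal_leI) auto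
    also have "\<dots> = ennreal ((B / 2 ^ l) ^ p * (K * (B / 2 ^ Suc l) powr (- \<alpha>)))"
      using B K by (subst ennreal_mult) auto
    also have "(B / 2 ^ l) ^ p * (K * (B / 2 ^ Suc l) powr (- \<alpha>)) = c * r ^ l"
    proof -
      have 2: "(2::real) ^ j = 2 powr j" for j by (simp add: powr_realpow)
      have "(B / 2 ^ l) ^ p = B powr p * 2 powr (- real (l * p))"
      proof -
        have "(B / 2 ^ l) ^ p = B ^ p / 2 ^ (l * p)" by (simp only: power_divide power_mult)
        also have "B ^ p = B powr p" using B by (simp add: powr_realpow)
        also have "(2::real) ^ (l * p) = 2 powr (l * p)" using 2[of "l * p"] by simp
        finally show ?thesis by (simp only: powr_minus divide_inverse)
      qed
      moreover have "(B / 2 ^ Suc l) powr (- \<alpha>) = B powr (- \<alpha>) * 2 powr ((real l + 1) * \<alpha>)"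
      proof -
        have "(B / 2 ^ Suc l) powr (- \<alpha>) = B powr (- \<alpha>) / (2 powr (Suc l)) powr (- \<alpha>)"
          using B unfolding 2 by (intro powr_divide)
        also have "(2 powr (Suc l)) powr (- \<alpha>) = 2 powr (- ((real l + 1) * \<alpha>))"
          by (simp only: powr_powr) (simp add: algebra_simps)
        finally show ?thesis by (simp only: powr_minus divide_inverse inverse_inverse_eq)
      qed
      moreover have "r ^ l = 2 powr (l * (\<alpha> - p))"
        unfolding r_def by (subst powr_realpow[symmetric]) (auto simp: powr_powr mult.commute)
      ultimately have "(B / 2 ^ l) ^ p * (K * (B / 2 ^ Suc l) powr (- \<alpha>)) =
         K * (B powr p * B powr (- \<alpha>)) * (2 powr (- real (l * p)) * 2 powr ((real l + 1) * \<alpha>))" by simp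
      also have "\<dots> = K * B powr (p - \<alpha>) * 2 powr (- real (l * p) + (real l + 1) * \<alpha>)"
        by (simp only: powr_add[symmetric]) simp
      also have "- real (l * p) + (real l + 1) * \<alpha> = \<alpha> + l * (\<alpha> - p)" by (simp add: algebra_simps)
      finally show ?thesis unfolding c_def \<open>r ^ l = _\<close> by (simp add: powr_add mult_ac)
    qed
    finally show "(\<integral>\<^sup>+x. ennreal ((B / 2 ^ l) ^ p * indicator {z. B / 2 ^ Suc l < z} (Y x)) \<partial>M) \<le> ennreal (c * r ^ l)" .
  qed
  also have "\<dots> = ennreal (c * (1 / (1 - r)))"
    using r c by (intro suminf_ennreal_eq sums_mult geometric_sums) auto
  finally have le: "(\<integral>\<^sup>+x. ennreal (min (Y x) B ^ p) \<partial>M) \<le> ennreal (c * (1 / (1 - r)))" .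
  have "expectation (\<lambda>x. min (Y x) B ^ p) = enn2real (\<integral>\<^sup>+x. ennreal (min (Y x) B ^ p) \<partial>M)"
    using Y B by (intro integral_eq_nn_integral) auto
  also have "\<dots> \<le> c * (1 / (1 - r))" using le r c by (intro enn2real_leI) auto
  finally show ?thesis by (simp add: c_def r_def)
qed

lemma geometric_two_sided_sum:
  fixes r :: real
  assumes "0 \<le> r" "r < 1" "j \<in> {1..n}"
  shows "(\<Sum>l=1..n. r ^ nat \<bar>int j - int l\<bar>) \<le> 2 / (1 - r)"
proof -
  have g: "sum (\<lambda>i. r ^ i) S \<le> 1 / (1 - r)" if "finite S" for S :: "nat set"
    using sum_le_suminf[of "\<lambda>i. r ^ i" S] summable_geometric[of r] suminf_geometric[of r] assms that by auto
  have "(\<Sum>l=1..n. r ^ nat \<bar>int j - int l\<bar>) = (\<Sum>l\<in>{1..j}. r ^ nat \<bar>int j - int l\<bar>) + (\<Sum>l\<in>{j<..n}. r ^ nat \<bar>int j - int l\<bar>)"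
    using assms by (subst sum.union_disjoint[symmetric]) (auto intro!: sum.cong)
  also have "(\<Sum>l\<in>{1..j}. r ^ nat \<bar>int j - int l\<bar>) = (\<Sum>i\<in>(\<lambda>l. j - l) ` {1..j}. r ^ i)"
    by (subst sum.reindex) (auto simp: inj_on_def nat_diff_distrib' intro!: sum.cong arg_cong[of _ _ "\<lambda>x. r ^ x"])
  also have "(\<Sum>l\<in>{j<..n}. r ^ nat \<bar>int j - int l\<bar>) = (\<Sum>i\<in>(\<lambda>l. l - j) ` {j<..n}. r ^ i)"
    by (subst sum.reindex) (auto simp: inj_on_def nat_diff_distrib' intro!: sum.cong arg_cong[of _ _ "\<lambda>x. r ^ x"])
  also have "(\<Sum>i\<in>(\<lambda>l. j - l) ` {1..j}. r ^ i) + (\<Sum>i\<in>(\<lambda>l. l - j) ` {j<..n}. r ^ i) \<le> 1 / (1 - r) + 1 / (1 - r)"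
    by (intro add_mono g) auto
  finally show ?thesis by simp
qed

text \<open>After expanding the square, each j contributes a two-sided geometric series in the lag,
  so the bound is linear in n.\<close>

lemma (in prob_space) second_moment_sum_le:
  fixes Z :: "nat \<Rightarrow> 'a \<Rightarrow> real"
  assumes int: "\<And>j l. j \<in> {1..n} \<Longrightarrow> l \<in> {1..n} \<Longrightarrow> integrable M (\<lambda>x. Z j x * Z l x)"
    and cov: "\<And>j l. j \<in> {1..n} \<Longrightarrow> l \<in> {1..n} \<Longrightarrow> j \<le> l \<Longrightarrow> \<bar>expectation (\<lambda>x. Z j x * Z l x)\<bar> \<le> D * r ^ (l - j)"
    and r: "0 \<le> r" "r < 1" and D: "0 \<le> D"
  shows "expectation (\<lambda>x. (\<Sum>j=1..n. Z j x)\<^sup>2) \<le> real n * (D * (2 / (1 - r)))"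
proof -
  have "expectation (\<lambda>x. (\<Sum>j=1..n. Z j x)\<^sup>2) = expectation (\<lambda>x. \<Sum>j=1..n. \<Sum>l=1..n. Z j x * Z l x)"
    by (simp add: power2_eq_square sum_product)
  also have "\<dots> = (\<Sum>j=1..n. \<Sum>l=1..n. expectation (\<lambda>x. Z j x * Z l x))"
  proof -
    have "expectation (\<lambda>x. \<Sum>j=1..n. \<Sum>l=1..n. Z j x * Z l x) = (\<Sum>j=1..n. expectation (\<lambda>x. \<Sum>l=1..n. Z j x * Z l x))"
      using int by (intro Bochner_Integration.integral_sum Bochner_Integration.integrable_sum) auto
    also have "\<dots> = (\<Sum>j=1..n. \<Sum>l=1..n. expectation (\<lambda>x. Z j x * Z l x))"
      using int by (intro sum.cong refl Bochner_Integration.integral_sum) auto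
    finally show ?thesis .
  qed
  also have "\<dots> \<le> (\<Sum>j=1..n. \<Sum>l=1..n. D * r ^ nat \<bar>int j - int l\<bar>)"
  proof (intro sum_mono)
    fix j l assume jl: "j \<in> {1..n}" "l \<in> {1..n}"
    show "expectation (\<lambda>x. Z j x * Z l x) \<le> D * r ^ nat \<bar>int j - int l\<bar>"
    proof (cases "j \<le> l")
      case True
      then have "nat \<bar>int j - int l\<bar> = l - j" by linarith
      then show ?thesis using cov[OF jl True] by (metis abs_le_D1)
    next
      case False
      then have "nat \<bar>int j - int l\<bar> = j - l" by linarith
      moreover have "\<bar>expectation (\<lambda>x. Z l x * Z j x)\<bar> \<le> D * r ^ (j - l)" using cov[OF jl(2,1)] False by simp
      moreover have "(\<lambda>x. Z l x * Z j x) = (\<lambda>x. Z j x * Z l x)" by (simp add: mult.commute)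
      ultimately show ?thesis by (metis abs_le_D1)
    qed
  qed
  also have "\<dots> \<le> (\<Sum>j=1..n. D * (2 / (1 - r)))"
    unfolding sum_distrib_left[symmetric] using D r
    by (intro sum_mono mult_left_mono geometric_two_sided_sum) auto
  finally show ?thesis by simp
qed

text \<open>Clipping is nondecreasing in the height, and \<phi> decreases with the distance to the
  mode. At the mode itself the convention \<open>0 powr a = 0\<close> gives \<phi> the value 0
  instead of a maximum, which is why \<open>unimodal\<close> leaves that point free.\<close>

lemma unimodal_clip:
  assumes \<phi>: "\<And>x. \<phi> x = dist x x\<^sub>0 powr (- 1 / \<alpha>)" and \<alpha>: "0 < \<alpha>" and AB: "0 \<le> A" "A \<le> B"
  shows "unimodal x\<^sub>0 (B - A) (\<lambda>x. min (\<phi> x) B - min (\<phi> x) A)"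
proof -
  have mono: "min y B - min y A \<le> min z B - min z A" if "y \<le> z" for y z :: real
    using that AB by (auto simp: min_def)
  have "\<phi> x \<le> \<phi> y" if "dist y x\<^sub>0 \<le> dist x x\<^sub>0" "y \<noteq> x\<^sub>0" for x y
    unfolding \<phi> using that \<alpha> by (intro powr_mono2') auto
  moreover have "0 \<le> \<phi> x" for x by (simp add: \<phi>)
  ultimately show ?thesis unfolding unimodal_def using AB
    by (auto intro!: mono simp: dist_real_def)
qed

section \<open>Tails and covariances of the observable\<close>

context gibbs_markov_map
begin

lemma density_bounds:
  "\<exists>c C. 0 < c \<and> 0 < C \<and> (\<forall>A\<in>sets leb01. c * measure leb01 A \<le> prob A \<and> prob A \<le> C * measure leb01 A)"
proof -
  obtain h c C where h[measurable]: "h \<in> borel_measurable leb01" and c: "0 < c"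
    "\<And>x. x \<in> unit_interval \<Longrightarrow> c \<le> h x \<and> h x \<le> C" and mu: "\<mu> = density leb01 (\<lambda>x. ennreal (h x))"
    using invariant_density by blast
  have C: "0 < C" using c(1) c(2)[of 0] by auto
  interpret L: finite_measure leb01
    by (intro finite_measureI) (simp add: emeasure_restrict_space)
  have "c * measure leb01 A \<le> prob A \<and> prob A \<le> C * measure leb01 A" if A[measurable]: "A \<in> sets leb01" for A
  proof -
    have eq: "emeasure \<mu> A = (\<integral>\<^sup>+x. ennreal (h x) * indicator A x \<partial>leb01)"
      using A by (simp only: mu) (subst emeasure_density, auto)
    have "ennreal c * emeasure leb01 A = (\<integral>\<^sup>+x. ennreal c * indicator A x \<partial>leb01)"
      by (simp add: nn_integral_cmult_indicator)
    also have "\<dots> \<le> emeasure \<mu> A" unfolding eq using c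
      by (intro nn_integral_mono mult_right_mono ennreal_leI) auto
    finally have 1: "ennreal (c * measure leb01 A) \<le> ennreal (prob A)"
      using c by (simp add: emeasure_eq_measure L.emeasure_eq_measure ennreal_mult)
    have "emeasure \<mu> A \<le> (\<integral>\<^sup>+x. ennreal C * indicator A x \<partial>leb01)" unfolding eq using c
      by (intro nn_integral_mono mult_right_mono ennreal_leI) auto
    also have "\<dots> = ennreal C * emeasure leb01 A" by (simp add: nn_integral_cmult_indicator)
    finally have 2: "ennreal (prob A) \<le> ennreal (C * measure leb01 A)"
      using C by (simp add: emeasure_eq_measure L.emeasure_eq_measure ennreal_mult)
    show ?thesis using 1 2 C by (simp add: ennreal_le_iff)
  qed
  with c C show ?thesis by blast
qed

lemma leb01_interval: "0 \<le> a \<Longrightarrow> a \<le> b \<Longrightarrow> b \<le> 1 \<Longrightarrow> measure leb01 {a..b} = b - a"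
  "0 \<le> a \<Longrightarrow> a \<le> b \<Longrightarrow> b \<le> 1 \<Longrightarrow> measure leb01 {a<..<b} = b - a"
  by (subst measure_restrict_space; auto simp: subset_eq)+

lemma borel_imp_mu: "f \<in> borel_measurable borel \<Longrightarrow> f \<in> borel_measurable \<mu>" for f :: "real \<Rightarrow> real"
  using measurable_lebesgue_cong sets_mu
  by (metis measurable_completion measurable_cong_sets measurable_lborel2 measurable_restrict_space1)

text \<open>By invariance the covariance at times j and l depends on the lag l - j only.\<close>

lemma variance_iter_le:
  assumes [measurable]: "q \<in> borel_measurable \<mu>" and q: "\<And>x. 0 \<le> q x" "\<And>x. q x \<le> B"
    and cov: "\<And>k. \<bar>expectation (\<lambda>x. q ((T ^^ k) x) * q x) - expectation q * expectation q\<bar> \<le> D * r ^ k"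
    and r: "0 \<le> r" "r < 1"
  shows "expectation (\<lambda>x. (\<Sum>j=1..n. q ((T ^^ j) x) - expectation q)\<^sup>2) \<le> real n * (D * (2 / (1 - r)))"
proof (rule second_moment_sum_le[OF _ _ r])
  let ?m = "expectation q"
  have ib: "integrable \<mu> f" if [measurable]: "f \<in> borel_measurable \<mu>" and "\<And>x. \<bar>f x\<bar> \<le> Bf" for f :: "real \<Rightarrow> real" and Bf
    by (rule integrable_const_bound[of _ Bf]) (use that in auto)
  have iq: "integrable \<mu> q" by (rule ib[of _ B]) (use q in auto)
  have m: "0 \<le> ?m" "?m \<le> B" using q iq integral_ge_const[OF iq, of 0] integral_le_const[OF iq, of B] by auto
  have ab: "\<bar>q y - ?m\<bar> \<le> B" for y using q[of y] m by (auto simp: abs_le_iff)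
  show "integrable \<mu> (\<lambda>x. (q ((T ^^ j) x) - ?m) * (q ((T ^^ l) x) - ?m))" for j l
    by (rule ib[of _ "B * B"]) (auto simp: abs_mult intro!: mult_mono ab order_trans[OF abs_ge_zero ab])
  \<comment> \<open>The bound at lag 0 shows that D is nonnegative.\<close>
  have "0 \<le> \<bar>expectation (\<lambda>x. q ((T ^^ 0) x) * q x) - expectation q * expectation q\<bar>" by simp
  also have "\<dots> \<le> D" using cov[of 0] by simp
  finally show "0 \<le> D" .
  show "\<bar>expectation (\<lambda>x. (q ((T ^^ j) x) - ?m) * (q ((T ^^ l) x) - ?m))\<bar> \<le> D * r ^ (l - j)" if "j \<le> l" for j l
  proof -
    define k where "k = l - j"
    have l: "l = k + j" using that by (simp add: k_def)
    define F where "F x = (q ((T ^^ k) x) - ?m) * (q x - ?m)" for x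
    have [measurable]: "F \<in> borel_measurable \<mu>" unfolding F_def by measurable
    have "expectation (\<lambda>x. (q ((T ^^ j) x) - ?m) * (q ((T ^^ l) x) - ?m)) = expectation (\<lambda>x. F ((T ^^ j) x))"
      unfolding F_def l funpow_add by (simp add: mult.commute)
    also have "\<dots> = expectation F" by (rule expectation_iter) simp
    also have "\<dots> = expectation (\<lambda>x. q ((T ^^ k) x) * q x - ?m * q x - ?m * q ((T ^^ k) x) + ?m * ?m)"
      unfolding F_def by (intro Bochner_Integration.integral_cong) (auto simp: algebra_simps)
    also have "\<dots> = expectation (\<lambda>x. q ((T ^^ k) x) * q x) - ?m * ?m - ?m * expectation (\<lambda>x. q ((T ^^ k) x)) + ?m * ?m"
    proof -
      have a: "integrable \<mu> (\<lambda>x. q ((T ^^ k) x) * q x)"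
        by (rule ib[of _ "B * B"]) (use q in \<open>auto simp: abs_mult intro!: mult_mono intro: order_trans\<close>)
      have b: "integrable \<mu> (\<lambda>x. q ((T ^^ k) x))" by (rule ib[of _ B]) (use q in auto)
      show ?thesis using a b iq by (simp add: prob_space)
    qed
    also have "expectation (\<lambda>x. q ((T ^^ k) x)) = ?m" by (rule expectation_iter) simp
    finally show ?thesis using cov[of k] by (simp add: k_def)
  qed
qed

text \<open>The set where \<phi> exceeds t is the punctured ball of radius t^(-\<alpha>) about
  \<open>x\<^sub>0\<close>, cut to the unit interval, and \<mu> is comparable with Lebesgue measure.
  The minimum with r in the lower bound accounts for balls that leave the interval.\<close>

lemma tail_bounds:
  assumes \<phi>: "\<And>x. \<phi> x = dist x x\<^sub>0 powr (- 1 / \<alpha>)" and \<alpha>: "0 < \<alpha>" and x0: "0 < x\<^sub>0" "x\<^sub>0 < 1"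
  shows "\<exists>K c r. 0 < K \<and> 0 < c \<and> 0 < r \<and>
    (\<forall>t>0. prob {x\<in>space \<mu>. t < \<phi> x} \<le> K * t powr (- \<alpha>) \<and> c * min (t powr (- \<alpha>)) r \<le> prob {x\<in>space \<mu>. t < \<phi> x})"
proof -
  obtain c C where cC: "0 < c" "0 < C" and d: "\<And>A. A \<in> sets leb01 \<Longrightarrow> c * measure leb01 A \<le> prob A"
    "\<And>A. A \<in> sets leb01 \<Longrightarrow> prob A \<le> C * measure leb01 A"
    using density_bounds by blast
  define r where "r = min x\<^sub>0 (1 - x\<^sub>0)"
  have r: "0 < r" using x0 by (simp add: r_def)
  \<comment> \<open>The centre is excluded because \<phi> vanishes there by the convention on
    \<open>0 powr\<close>.\<close>
  have iff: "t < \<phi> x \<longleftrightarrow> x \<noteq> x\<^sub>0 \<and> dist x x\<^sub>0 < t powr (- \<alpha>)" if t: "0 < t" for t x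
  proof (cases "x = x\<^sub>0")
    case False
    then have d0: "0 < dist x x\<^sub>0" by simp
    have "t < \<phi> x \<longleftrightarrow> (t powr (- \<alpha>)) powr (- 1 / \<alpha>) < dist x x\<^sub>0 powr (- 1 / \<alpha>)"
      using t \<alpha> by (simp add: \<phi> powr_powr)
    also have "\<dots> \<longleftrightarrow> dist x x\<^sub>0 < t powr (- \<alpha>)"
    proof (cases "dist x x\<^sub>0 < t powr (- \<alpha>)")
      case True
      then show ?thesis using powr_less_mono2_neg[of "- 1 / \<alpha>" "dist x x\<^sub>0" "t powr (- \<alpha>)"] \<alpha> d0 by simp
    next
      case False
      then show ?thesis using powr_mono2'[of "- 1 / \<alpha>" "t powr (- \<alpha>)" "dist x x\<^sub>0"] t \<alpha> by (simp add: not_less)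
    qed
    finally show ?thesis using False by simp
  qed (use t in \<open>simp add: \<phi>\<close>)
  have m1: "measure leb01 ({a..b} \<inter> unit_interval) \<le> b - a" if "a \<le> b" for a b :: real
  proof -
    have "measure leb01 ({a..b} \<inter> unit_interval) = measure lebesgue ({a..b} \<inter> unit_interval)"
      by (subst measure_restrict_space) auto
    also have "\<dots> \<le> measure lebesgue {a..b}" by (intro measure_mono_fmeasurable) auto
    also have "\<dots> = b - a" using that by simp
    finally show ?thesis .
  qed
  have "prob {x\<in>space \<mu>. t < \<phi> x} \<le> (2 * C) * t powr (- \<alpha>)" if t: "0 < t" for t
  proof -
    let ?s = "t powr (- \<alpha>)"
    let ?I = "{x\<^sub>0 - ?s..x\<^sub>0 + ?s} \<inter> unit_interval"
    have I: "?I \<in> sets leb01" by (auto simp: sets_restrict_space)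
    have "prob {x\<in>space \<mu>. t < \<phi> x} \<le> prob ?I"
      using I sets_mu by (intro finite_measure_mono) (auto simp: iff[OF t] space_mu dist_real_def)
    also have "\<dots> \<le> C * measure leb01 ?I" by (rule d(2)[OF I])
    also have "\<dots> \<le> C * (2 * ?s)" using m1[of "x\<^sub>0 - ?s" "x\<^sub>0 + ?s"] cC by (intro mult_left_mono) auto
    finally show ?thesis by simp
  qed
  moreover have "c * min (t powr (- \<alpha>)) r \<le> prob {x\<in>space \<mu>. t < \<phi> x}" if t: "0 < t" for t
  proof -
    let ?s = "min (t powr (- \<alpha>)) r"
    let ?I = "{x\<^sub>0<..<x\<^sub>0 + ?s}"
    have s: "0 < ?s" "?s \<le> r" using t r by auto
    have sub: "?I \<subseteq> unit_interval" using s x0 by (auto simp: r_def)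
    have I: "?I \<in> sets leb01" using sub by (auto simp: sets_restrict_space_iff)
    have "c * ?s = c * measure leb01 ?I" using s x0 by (subst leb01_interval) (auto simp: r_def)
    also have "\<dots> \<le> prob ?I" by (rule d(1)[OF I])
    also have "\<dots> \<le> prob {x\<in>space \<mu>. t < \<phi> x}"
    proof (rule finite_measure_mono)
      show "?I \<subseteq> {x\<in>space \<mu>. t < \<phi> x}" using sub by (auto simp: iff[OF t] space_mu dist_real_def)
      have [measurable]: "\<phi> \<in> borel_measurable \<mu>" by (rule borel_imp_mu) (simp add: \<phi>[abs_def])
      show "{x\<in>space \<mu>. t < \<phi> x} \<in> sets \<mu>" by measurable
    qed
    finally show ?thesis .
  qed
  ultimately show ?thesis using cC r by (intro exI[of _ "2 * C"] exI[of _ c] exI[of _ r]) auto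
qed

lemma abs_diff_prod_le:
  "\<bar>a - b\<bar> \<le> c" if "0 \<le> a" "0 \<le> b" "a \<le> c" "b \<le> (c::real)"
  using that by linarith

text \<open>The clipped observable q is split as u + v at the level \<tau> = B \<delta>^k. Terms
  containing u are small by their second moment alone, which is of order \<tau>^(2 - \<alpha>). For
  v, decay of correlations applies, with E v at most E q^2 / \<tau>; this costs a factor
  \<delta>^(-k) against \<rho>^k, so that \<delta>^k remains. The order B^(2 - \<alpha>) is kept
  throughout.\<close>

lemma covariance_clip:
  assumes decay: "exp_decay_BV \<mu> T"
    and \<phi>: "\<And>x. \<phi> x = dist x x\<^sub>0 powr (- 1 / \<alpha>)" and \<alpha>: "0 < \<alpha>" "\<alpha> < 2"
    and tail: "\<And>t. 0 < t \<Longrightarrow> prob {x\<in>space \<mu>. t < \<phi> x} \<le> K * t powr (- \<alpha>)" and K: "0 \<le> K"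
  shows "\<exists>D\<ge>0. \<exists>r. 0 \<le> r \<and> r < 1 \<and> (\<forall>B>0. \<forall>k.
     \<bar>expectation (\<lambda>x. min (\<phi> ((T ^^ k) x)) B * min (\<phi> x) B) - expectation (\<lambda>x. min (\<phi> x) B) * expectation (\<lambda>x. min (\<phi> x) B)\<bar>
       \<le> D * B powr (2 - \<alpha>) * r ^ k)"
proof -
  obtain C \<rho> where C: "C > 0" "0 < \<rho>" "\<rho> < 1" and dec0:
    "\<forall>x0 D u v B k. unimodal x0 D u \<longrightarrow> u \<in> borel_measurable \<mu> \<longrightarrow> v \<in> borel_measurable \<mu> \<longrightarrow>
       (\<forall>x. \<bar>v x\<bar> \<le> B) \<longrightarrow>
       \<bar>expectation (\<lambda>x. v ((T ^^ k) x) * u x) - expectation v * expectation u\<bar>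
         \<le> C * \<rho> ^ k * D * expectation (\<lambda>x. \<bar>v x\<bar>)"
    using decay_of_correlations[OF decay] by blast
  note dec = dec0[rule_format]
  have phi_nn: "0 \<le> \<phi> x" for x by (simp add: \<phi>)
  have [measurable]: "\<phi> \<in> borel_measurable \<mu>" by (rule borel_imp_mu) (simp add: \<phi>[abs_def])
  define K' where "K' = K * 2 powr \<alpha> / (1 - 2 powr (\<alpha> - 2))"
  have K': "0 \<le> K'" using K \<alpha> by (auto simp: K'_def powr_less_one less_imp_le)
  \<comment> \<open>With \<delta>^2 = \<rho>, the loss 1 / \<delta>^k uses up half of the
    exponential decay.\<close>
  define \<delta> where "\<delta> = sqrt \<rho>"
  have \<delta>: "0 < \<delta>" "\<delta> < 1" "\<rho> = \<delta>\<^sup>2" using C by (auto simp: \<delta>_def)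
  \<comment> \<open>Chosen so that \<eta>^(2k) = (\<delta>^k)^(2 - \<alpha>), the factor by which
    the bound on the second moment drops between the levels B and \<tau>.\<close>
  define \<eta> where "\<eta> = \<delta> powr (1 - \<alpha> / 2)"
  have \<eta>: "0 < \<eta>" "\<eta> < 1" using \<delta> \<alpha> powr_less_mono2[of "1 - \<alpha>/2" \<delta> 1] by (auto simp: \<eta>_def)
  have mom: "expectation (\<lambda>x. (min (\<phi> x) B)\<^sup>2) \<le> K' * B powr (2 - \<alpha>)" if "0 < B" for B
    using truncated_moment[of \<phi> K \<alpha> 2 B] phi_nn tail \<alpha> K that unfolding K'_def by simp
  have ib: "integrable \<mu> f" if [measurable]: "f \<in> borel_measurable \<mu>" and "\<And>x. \<bar>f x\<bar> \<le> Bf" for f :: "real \<Rightarrow> real" and Bf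
    by (rule integrable_const_bound[of _ Bf]) (use that in auto)
  have main: "\<bar>expectation (\<lambda>x. min (\<phi> ((T ^^ k) x)) B * min (\<phi> x) B) - expectation (\<lambda>x. min (\<phi> x) B) * expectation (\<lambda>x. min (\<phi> x) B)\<bar>
       \<le> (K' * (2 + C)) * B powr (2 - \<alpha>) * (max \<eta> \<delta>) ^ k" if B: "0 < B" for B k
  proof -
    define \<tau> where "\<tau> = B * \<delta> ^ k"
    have \<tau>: "0 < \<tau>" "\<tau> \<le> B" using B \<delta> by (auto simp: \<tau>_def power_le_one mult_le_cancel_left1)
    define q where "q x = min (\<phi> x) B" for x
    define u where "u x = min (\<phi> x) \<tau>" for x
    define v where "v x = q x - u x" for x
    have [measurable]: "q \<in> borel_measurable \<mu>" "u \<in> borel_measurable \<mu>" "v \<in> borel_measurable \<mu>"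
      unfolding q_def u_def v_def by measurable
    have b: "0 \<le> u x" "u x \<le> q x" "q x \<le> B" "0 \<le> v x" "v x \<le> q x" "0 \<le> q x" "u x \<le> B" "v x \<le> B" for x
      using phi_nn[of x] \<tau> B by (auto simp: u_def q_def v_def min_def)
    \<comment> \<open>v vanishes where \<phi> is at most \<tau>, and elsewhere q is at least
      \<tau>.\<close>
    have vq: "v x \<le> (q x)\<^sup>2 / \<tau>" for x
    proof (cases "\<phi> x \<le> \<tau>")
      case True
      then show ?thesis using \<tau> by (simp add: v_def q_def u_def)
    next
      case False
      then have "\<tau> \<le> q x" using \<tau> by (simp add: q_def)
      then have "q x * \<tau> \<le> q x * q x" using b(6)[of x] by (rule mult_left_mono)
      then have "q x \<le> (q x)\<^sup>2 / \<tau>" using \<tau> by (simp add: pos_le_divide_eq power2_eq_square)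
      then show ?thesis using b(5)[of x] by linarith
    qed
    define M where "M = K' * B powr (2 - \<alpha>)"
    have Mnn: "0 \<le> M" using K' by (simp add: M_def)
    have Eq2: "expectation (\<lambda>x. (q x)\<^sup>2) \<le> M" unfolding q_def M_def by (rule mom[OF B])
    have Eu2: "expectation (\<lambda>x. (u x)\<^sup>2) \<le> M * (\<eta> ^ k)\<^sup>2"
    proof -
      have "expectation (\<lambda>x. (u x)\<^sup>2) \<le> K' * \<tau> powr (2 - \<alpha>)" unfolding u_def by (rule mom[OF \<tau>(1)])
      also have "\<tau> powr (2 - \<alpha>) = B powr (2 - \<alpha>) * (\<delta> ^ k) powr (2 - \<alpha>)"
        unfolding \<tau>_def using B \<delta> by (simp add: powr_mult)
      also have "(\<delta> ^ k) powr (2 - \<alpha>) = (\<eta> ^ k)\<^sup>2"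
      proof -
        have "\<eta> ^ k = \<eta> powr real k" using \<eta> by (simp add: powr_realpow)
        also have "\<dots> = \<delta> powr ((1 - \<alpha> / 2) * k)" by (simp only: \<eta>_def powr_powr)
        finally have "(\<eta> ^ k)\<^sup>2 = \<delta> powr ((1 - \<alpha> / 2) * k + (1 - \<alpha> / 2) * k)"
          by (simp only: power2_eq_square powr_add)
        moreover have "\<delta> ^ k = \<delta> powr real k" using \<delta> by (simp add: powr_realpow)
        then have "(\<delta> ^ k) powr (2 - \<alpha>) = \<delta> powr (k * (2 - \<alpha>))" by (simp only: powr_powr)
        moreover have "(1 - \<alpha> / 2) * k + (1 - \<alpha> / 2) * k = k * (2 - \<alpha>)" by algebra
        ultimately show ?thesis by (simp only:)
      qed
      finally show ?thesis by (simp add: M_def)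
    qed
    define s where "s = 1 / \<eta> ^ k"
    have s: "0 < s" using \<eta> by (simp add: s_def)
    text \<open>Young's inequality, weighted so that both terms have the same size.\<close>
    have young: "a * b \<le> (s * a\<^sup>2 + \<eta> ^ k * b\<^sup>2) / 2" for a b :: real
    proof -
      have "0 \<le> \<eta> ^ k * (s * a - b)\<^sup>2" using \<eta> by simp
      also have "\<dots> = s * a\<^sup>2 - 2 * (a * b) + \<eta> ^ k * b\<^sup>2"
        using \<eta> by (simp add: s_def power2_eq_square field_simps)
      finally show ?thesis by simp
    qed
    have iu2: "integrable \<mu> (\<lambda>x. (u x)\<^sup>2)" and iq2: "integrable \<mu> (\<lambda>x. (q x)\<^sup>2)"
      and iuu: "integrable \<mu> u" "integrable \<mu> q" "integrable \<mu> v"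
      by (rule ib[of _ "B\<^sup>2"] ib[of _ B]; use b in \<open>auto intro!: power_mono\<close>)+
    have jensen: "(expectation f)\<^sup>2 \<le> expectation (\<lambda>x. (f x)\<^sup>2)" if "integrable \<mu> f" "integrable \<mu> (\<lambda>x. (f x)\<^sup>2)" for f :: "real \<Rightarrow> real"
      using variance_eq[OF that] variance_positive[of f] by simp
    have half: "(s * A + \<eta> ^ k * E) / 2 \<le> M * \<eta> ^ k" if "A \<le> M * (\<eta> ^ k)\<^sup>2" "E \<le> M" for A E
    proof -
      have "s * A \<le> s * (M * (\<eta> ^ k)\<^sup>2)" using that s by (intro mult_left_mono) auto
      also have "\<dots> = M * \<eta> ^ k" using \<eta> by (simp add: s_def power2_eq_square)
      moreover have "\<eta> ^ k * E \<le> \<eta> ^ k * M" using that \<eta> by (intro mult_left_mono) auto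
      ultimately show ?thesis by (simp add: mult.commute)
    qed
    \<comment> \<open>A Cauchy-Schwarz bound: second moments M \<eta>^(2k) and M give M \<eta>^k,
      without any mixing.\<close>
    have cross: "expectation (\<lambda>x. f x * g x) \<le> M * \<eta> ^ k"
      if [measurable]: "f \<in> borel_measurable \<mu>" "g \<in> borel_measurable \<mu>"
        and bd: "\<And>x. 0 \<le> f x" "\<And>x. f x \<le> B" "\<And>x. 0 \<le> g x" "\<And>x. g x \<le> B"
        and E: "expectation (\<lambda>x. (f x)\<^sup>2) \<le> M * (\<eta> ^ k)\<^sup>2" "expectation (\<lambda>x. (g x)\<^sup>2) \<le> M" for f g :: "real \<Rightarrow> real"
    proof -
      have i: "integrable \<mu> (\<lambda>x. (f x)\<^sup>2)" "integrable \<mu> (\<lambda>x. (g x)\<^sup>2)"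
        by (rule ib[of _ "B\<^sup>2"]; use bd in \<open>auto intro!: power_mono\<close>)+
      have "integrable \<mu> (\<lambda>x. f x * g x)"
        by (rule ib[of _ "B * B"]) (use bd in \<open>auto simp: abs_mult intro!: mult_mono intro: order_trans\<close>)
      then have "expectation (\<lambda>x. f x * g x) \<le> expectation (\<lambda>x. (s * (f x)\<^sup>2 + \<eta> ^ k * (g x)\<^sup>2) / 2)"
        using i young by (intro integral_mono) auto
      also have "\<dots> = (s * expectation (\<lambda>x. (f x)\<^sup>2) + \<eta> ^ k * expectation (\<lambda>x. (g x)\<^sup>2)) / 2"
        using i by simp
      also have "\<dots> \<le> M * \<eta> ^ k" by (rule half[OF E])
      finally show ?thesis .
    qed
    have Ev2: "expectation (\<lambda>x. (v x)\<^sup>2) \<le> M"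
      using b by (intro order_trans[OF integral_mono Eq2] ib[of _ "B\<^sup>2"]) (auto intro!: power_mono)
    have prod: "expectation u * expectation g \<le> M * \<eta> ^ k"
      if "integrable \<mu> g" "integrable \<mu> (\<lambda>x. (g x)\<^sup>2)" "expectation (\<lambda>x. (g x)\<^sup>2) \<le> M" for g
      using young[of "expectation u" "expectation g"] jensen[OF iuu(1) iu2] jensen[OF that(1,2)] that(3) Eu2
        half[of "(expectation u)\<^sup>2" "(expectation g)\<^sup>2"] by linarith
    have iv2: "integrable \<mu> (\<lambda>x. (v x)\<^sup>2)" by (rule ib[of _ "B\<^sup>2"]) (use b in \<open>auto intro!: power_mono\<close>)
    have nn: "0 \<le> expectation u" "0 \<le> expectation v" "0 \<le> expectation q" using b by auto
    \<comment> \<open>Here and for the next term no decay is used: both parts of the covariance are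
      nonnegative and at most M \<eta>^k.\<close>
    have t1: "\<bar>expectation (\<lambda>x. q ((T ^^ k) x) * u x) - expectation q * expectation u\<bar> \<le> M * \<eta> ^ k"
    proof (rule abs_diff_prod_le)
      show "expectation (\<lambda>x. q ((T ^^ k) x) * u x) \<le> M * \<eta> ^ k"
        using cross[of u "\<lambda>x. q ((T ^^ k) x)"] b Eu2 Eq2 expectation_iter[of "\<lambda>x. (q x)\<^sup>2" k] by (simp add: mult.commute)
      show "expectation q * expectation u \<le> M * \<eta> ^ k" using prod[OF iuu(2) iq2 Eq2] by (simp add: mult.commute)
    qed (use b nn in auto)
    have t2: "\<bar>expectation (\<lambda>x. u ((T ^^ k) x) * v x) - expectation u * expectation v\<bar> \<le> M * \<eta> ^ k"
    proof (rule abs_diff_prod_le)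
      show "expectation (\<lambda>x. u ((T ^^ k) x) * v x) \<le> M * \<eta> ^ k"
        using cross[of "\<lambda>x. u ((T ^^ k) x)" v] b Eu2 Ev2 expectation_iter[of "\<lambda>x. (u x)\<^sup>2" k] by simp
      show "expectation u * expectation v \<le> M * \<eta> ^ k" by (rule prod[OF iuu(3) iv2 Ev2])
    qed (use b nn in auto)
    have t3: "\<bar>expectation (\<lambda>x. v ((T ^^ k) x) * v x) - expectation v * expectation v\<bar> \<le> C * M * \<delta> ^ k"
    proof -
      have "unimodal x\<^sub>0 (B - \<tau>) v" unfolding v_def q_def u_def using \<tau> by (intro unimodal_clip[OF \<phi> \<alpha>(1)]) auto
      then have "\<bar>expectation (\<lambda>x. v ((T ^^ k) x) * v x) - expectation v * expectation v\<bar> \<le> C * \<rho> ^ k * (B - \<tau>) * expectation (\<lambda>x. \<bar>v x\<bar>)"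
        by (rule dec[where B=B]) (use b in auto)
      also have "expectation (\<lambda>x. \<bar>v x\<bar>) = expectation v" using b by simp
      also have "C * \<rho> ^ k * (B - \<tau>) * expectation v \<le> C * \<rho> ^ k * B * (M / \<tau>)"
      proof (intro mult_mono)
        have "expectation v \<le> expectation (\<lambda>x. (q x)\<^sup>2 / \<tau>)" using iuu iq2 vq by (intro integral_mono) auto
        also have "\<dots> \<le> M / \<tau>" using Eq2 \<tau> by (simp add: divide_right_mono)
        finally show "expectation v \<le> M / \<tau>" .
      qed (use C B \<tau> nn in auto)
      also have "\<dots> = C * M * \<delta> ^ k"
        using B \<delta>(1) unfolding \<tau>_def \<delta>(3) by (simp add: power2_eq_square power_mult_distrib)
      finally show ?thesis .
    qed
    \<comment> \<open>Writing q' for q at time k, and likewise for u and v: q' q = q' u + u' v + v'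
      v. Only the last product has no factor u.\<close>
    have eq: "expectation (\<lambda>x. q ((T ^^ k) x) * q x) - expectation q * expectation q =
      (expectation (\<lambda>x. q ((T ^^ k) x) * u x) - expectation q * expectation u) +
      (expectation (\<lambda>x. u ((T ^^ k) x) * v x) - expectation u * expectation v) +
      (expectation (\<lambda>x. v ((T ^^ k) x) * v x) - expectation v * expectation v)"
    proof -
      have i: "integrable \<mu> (\<lambda>x. q ((T ^^ k) x) * u x)" "integrable \<mu> (\<lambda>x. u ((T ^^ k) x) * v x)" "integrable \<mu> (\<lambda>x. v ((T ^^ k) x) * v x)"
        by (rule ib[of _ "B * B"]; use b B in \<open>auto simp: abs_mult intro!: mult_mono intro: order_trans\<close>)+
      have "expectation (\<lambda>x. q ((T ^^ k) x) * q x) = expectation (\<lambda>x. q ((T ^^ k) x) * u x + u ((T ^^ k) x) * v x + v ((T ^^ k) x) * v x)"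
        by (intro Bochner_Integration.integral_cong) (auto simp: v_def algebra_simps)
      also have "\<dots> = expectation (\<lambda>x. q ((T ^^ k) x) * u x) + expectation (\<lambda>x. u ((T ^^ k) x) * v x) + expectation (\<lambda>x. v ((T ^^ k) x) * v x)"
        using i by simp
      moreover have "expectation v = expectation q - expectation u" unfolding v_def using iuu by simp
      then have "expectation q = expectation u + expectation v" by simp
      ultimately show ?thesis by (simp only:) (simp add: algebra_simps)
    qed
    have "\<bar>expectation (\<lambda>x. q ((T ^^ k) x) * q x) - expectation q * expectation q\<bar> \<le> M * \<eta> ^ k + M * \<eta> ^ k + C * M * \<delta> ^ k"
      unfolding eq using t1 t2 t3 by linarith
    also have "\<dots> \<le> M * (max \<eta> \<delta>) ^ k + M * (max \<eta> \<delta>) ^ k + C * M * (max \<eta> \<delta>) ^ k"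
      using \<eta> \<delta> Mnn C by (intro add_mono mult_left_mono power_mono) auto
    also have "\<dots> = (K' * (2 + C)) * B powr (2 - \<alpha>) * (max \<eta> \<delta>) ^ k" by (simp add: M_def algebra_simps)
    finally show ?thesis by (simp add: q_def[abs_def])
  qed
  show ?thesis
    by (rule exI[of _ "K' * (2 + C)"], intro conjI exI[of _ "max \<eta> \<delta>"] allI impI main) (use \<eta> \<delta> K' C in auto)
qed

end

text \<open>Eventually n p(b_n) < 2, whereas p(b_n) >= c r would make this product unbounded. So the
  minimum in the lower bound is b_n^(-\<alpha>), and it is at most 2 / (c n).\<close>

lemma (in gibbs_markov_map) normalisation_bound:
  fixes b :: "nat \<Rightarrow> real"
  assumes c: "0 < c" "0 < r"
    and lower: "\<And>t. 0 < t \<Longrightarrow> c * min (t powr (- \<alpha>)) r \<le> p t"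
    and b: "\<And>n. n \<ge> 1 \<Longrightarrow> b n > 0" and lim: "(\<lambda>n. real n * p (b n)) \<longlonglongrightarrow> 1"
  shows "\<exists>K>0. \<forall>n. real n * b n powr (- \<alpha>) \<le> K"
proof -
  have "\<forall>\<^sub>F n in sequentially. real n * p (b n) < 2" using order_tendstoD(2)[OF lim, of 2] by simp
  moreover have "\<forall>\<^sub>F n in sequentially. real n > 2 / (c * r)"
    using filterlim_real_sequentially by (simp add: filterlim_at_top_dense)
  moreover have "\<forall>\<^sub>F n in sequentially. n \<ge> 1" by (rule eventually_ge_at_top)
  ultimately have "\<forall>\<^sub>F n in sequentially. real n * b n powr (- \<alpha>) \<le> 2 / c"
  proof eventually_elim
    case (elim n)
    have "real n * (c * min (b n powr (- \<alpha>)) r) \<le> real n * p (b n)"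
      using lower[of "b n"] b[of n] elim by (intro mult_left_mono) auto
    then have *: "real n * (c * min (b n powr (- \<alpha>)) r) < 2" using elim by linarith
    have "b n powr (- \<alpha>) < r"
    proof (rule ccontr)
      assume "\<not> ?thesis"
      then have "min (b n powr (- \<alpha>)) r = r" by simp
      then have "real n * (c * r) < 2" using * by simp
      then show False using elim(2) c by (simp add: pos_divide_less_eq)
    qed
    then have "c * (real n * b n powr (- \<alpha>)) < 2" using * by (simp add: mult_ac)
    then show ?case using c by (simp add: pos_le_divide_eq mult.commute less_imp_le)
  qed
  then obtain N where N: "\<And>n. n \<ge> N \<Longrightarrow> real n * b n powr (- \<alpha>) \<le> 2 / c" by (auto simp: eventually_sequentially)
  \<comment> \<open>The finitely many early n are absorbed by adding all their values.\<close>
  define K where "K = 2 / c + (\<Sum>n\<le>N. real n * b n powr (- \<alpha>))"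
  have "real n * b n powr (- \<alpha>) \<le> K" for n
  proof (cases "n \<ge> N")
    case True
    then show ?thesis unfolding K_def using N[of n] by (intro order_trans[OF N]) (auto intro!: sum_nonneg)
  next
    case False
    then have "real n * b n powr (- \<alpha>) \<le> (\<Sum>n\<le>N. real n * b n powr (- \<alpha>))"
      by (intro member_le_sum[of n "{..N}" "\<lambda>n. real n * b n powr (- \<alpha>)"]) auto
    moreover have "0 \<le> 2 / c" using c by simp
    ultimately show ?thesis unfolding K_def by linarith
  qed
  moreover have "0 < K" unfolding K_def using c by (intro add_pos_nonneg sum_nonneg) auto
  ultimately show ?thesis by blast
qed

text \<open>Abstracts from \<open>X n j = \<phi> \<circ> T\<^sup>j / b\<^sub>n\<close>; only \<open>1 \<le> j \<le> n\<close> matters.\<close>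

locale tail_array = prob_space \<mu> for \<mu> :: "'a measure" +
  fixes X :: "nat \<Rightarrow> nat \<Rightarrow> 'a \<Rightarrow> real" and \<alpha> K :: real
  assumes X_meas [measurable]: "X n j \<in> borel_measurable \<mu>"
    and X_nonneg: "0 \<le> X n j x"
    and \<alpha>_range: "0 < \<alpha>" "\<alpha> < 2"
    and K_pos: "0 < K"
    and tail_le: "0 < t \<Longrightarrow> (\<Sum>j=1..n. prob {x\<in>space \<mu>. t < X n j x}) \<le> K * t powr (- \<alpha>)"
    and tail_lim: "(\<lambda>n. \<Sum>j=1..n. prob {x\<in>space \<mu>. 1 < X n j x}) \<longlonglongrightarrow> 1"
    and var_small: "0 < \<epsilon> \<Longrightarrow>
       expectation (\<lambda>x. (\<Sum>j=1..n. min (X n j x) \<epsilon> - expectation (\<lambda>x. min (X n j x) \<epsilon>))\<^sup>2) \<le> K * \<epsilon> powr (2 - \<alpha>)"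
    and var_ramp: "0 < s \<Longrightarrow> s < t \<Longrightarrow>
       expectation (\<lambda>x. (\<Sum>j=1..n. (min (X n j x) t - min (X n j x) s) / (t - s)
          - expectation (\<lambda>x. (min (X n j x) t - min (X n j x) s) / (t - s)))\<^sup>2) \<le> K * s powr (- \<alpha>)"
    and mean_small: "\<alpha> < 1 \<Longrightarrow> 0 < \<epsilon> \<Longrightarrow>
       (\<Sum>j=1..n. expectation (\<lambda>x. min (X n j x) \<epsilon>)) \<le> K * \<epsilon> powr (1 - \<alpha>)"

text \<open>Clipping \<phi> / b_n at \<epsilon> is clipping \<phi> at b_n \<epsilon> and dividing by
  b_n, so the estimates at that level rescale, n b_n^(-\<alpha>) being bounded. The absolute value
  of b_n secures nonnegativity at n = 0, where no sign of b is known.\<close>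

lemma (in gibbs_markov_map) tail_array_orbit:
  assumes decay: "exp_decay_BV \<mu> T"
    and \<phi>: "\<And>x. \<phi> x = dist x x\<^sub>0 powr (- 1 / \<alpha>)" and \<alpha>: "0 < \<alpha>" "\<alpha> < 2" and x0: "0 < x\<^sub>0" "x\<^sub>0 < 1"
    and b: "\<And>n. n \<ge> 1 \<Longrightarrow> b n > 0"
    and lim: "(\<lambda>n. real n * prob {x \<in> space \<mu>. \<bar>\<phi> x\<bar> > b n}) \<longlonglongrightarrow> 1"
  shows "\<exists>K. tail_array \<mu> (\<lambda>n j x. \<phi> ((T ^^ j) x) / \<bar>b n\<bar>) \<alpha> K"
proof -
  have phi_nn: "0 \<le> \<phi> x" for x by (simp add: \<phi>)
  have [measurable]: "\<phi> \<in> borel_measurable \<mu>" by (rule borel_imp_mu) (simp add: \<phi>[abs_def])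
  obtain K1 c r where K1: "0 < K1" "0 < c" "0 < r" and
    tail: "\<And>t. 0 < t \<Longrightarrow> prob {x\<in>space \<mu>. t < \<phi> x} \<le> K1 * t powr (- \<alpha>)" and
    lower: "\<And>t. 0 < t \<Longrightarrow> c * min (t powr (- \<alpha>)) r \<le> prob {x\<in>space \<mu>. t < \<phi> x}"
    using tail_bounds[OF \<phi> \<alpha>(1) x0] by blast
  have lim': "(\<lambda>n. real n * prob {x \<in> space \<mu>. b n < \<phi> x}) \<longlonglongrightarrow> 1" using lim by (simp add: phi_nn)
  obtain K2 where K2: "0 < K2" "\<And>n. real n * b n powr (- \<alpha>) \<le> K2"
    using normalisation_bound[OF K1(2,3) lower b lim'] by blast
  obtain D r1 where D: "0 \<le> D" "0 \<le> r1" "r1 < 1" and cov0: "\<forall>B>0. \<forall>k.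
     \<bar>expectation (\<lambda>x. min (\<phi> ((T ^^ k) x)) B * min (\<phi> x) B) - expectation (\<lambda>x. min (\<phi> x) B) * expectation (\<lambda>x. min (\<phi> x) B)\<bar>
       \<le> D * B powr (2 - \<alpha>) * r1 ^ k"
    using covariance_clip[OF decay \<phi> \<alpha> tail less_imp_le[OF K1(1)]] by blast
  note cov = cov0[rule_format]
  obtain C \<rho> where C: "C > 0" "0 < \<rho>" "\<rho> < 1" and dec0:
    "\<forall>x0 D u v B k. unimodal x0 D u \<longrightarrow> u \<in> borel_measurable \<mu> \<longrightarrow> v \<in> borel_measurable \<mu> \<longrightarrow>
       (\<forall>x. \<bar>v x\<bar> \<le> B) \<longrightarrow>
       \<bar>expectation (\<lambda>x. v ((T ^^ k) x) * u x) - expectation v * expectation u\<bar>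
         \<le> C * \<rho> ^ k * D * expectation (\<lambda>x. \<bar>v x\<bar>)"
    using decay_of_correlations[OF decay] by blast
  note dec = dec0[rule_format]
  define M1 where "M1 = D * (2 / (1 - r1)) * K2"
  define M2 where "M2 = C * K1 * (2 / (1 - \<rho>)) * K2"
  \<comment> \<open>The absolute value keeps the constant nonnegative for \<alpha> >= 1, where the
    denominator is not positive.\<close>
  define M3 where "M3 = \<bar>K1 * 2 powr \<alpha> / (1 - 2 powr (\<alpha> - 1))\<bar> * K2"
  define K where "K = K1 * K2 + M1 + M2 + M3"
  have M: "0 \<le> M1" "0 \<le> M2" "0 \<le> M3" "0 < K1 * K2" using D K1 K2 C by (auto simp: M1_def M2_def M3_def)
  have KM: "K1 * K2 \<le> K" "M1 \<le> K" "M2 \<le> K" "M3 \<le> K" using M unfolding K_def by linarith+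
  have scale: "real n * (M * (b n * t) powr (- \<alpha>)) \<le> M * K2 * t powr (- \<alpha>)" if "n \<ge> 1" "0 < t" "0 \<le> M" for n t M
  proof -
    have "real n * (M * (b n * t) powr (- \<alpha>)) = M * (real n * b n powr (- \<alpha>)) * t powr (- \<alpha>)"
      using b[OF that(1)] that by (simp add: powr_mult)
    also have "\<dots> \<le> M * K2 * t powr (- \<alpha>)" using K2 that by (intro mult_right_mono mult_left_mono) auto
    finally show ?thesis .
  qed
  show ?thesis
  proof (rule exI[of _ K], unfold_locales)
    let ?X = "\<lambda>n j x. \<phi> ((T ^^ j) x) / \<bar>b n\<bar>"
    show "?X n j \<in> borel_measurable \<mu>" for n j by measurable
    show "0 \<le> ?X n j x" for n j x using phi_nn by simp
    show "0 < \<alpha>" "\<alpha> < 2" by fact+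
    show "0 < K" using KM M by linarith
    have probX: "prob {x\<in>space \<mu>. t < ?X n j x} = prob {x\<in>space \<mu>. b n * t < \<phi> x}" if "n \<ge> 1" for t n j
    proof -
      have "prob {x\<in>space \<mu>. t < ?X n j x} = expectation (\<lambda>x. indicator {x\<in>space \<mu>. b n * t < \<phi> x} ((T ^^ j) x))"
      proof -
        have "prob {x\<in>space \<mu>. t < ?X n j x} = expectation (indicator {x\<in>space \<mu>. t < ?X n j x})" by simp
        also have "\<dots> = expectation (\<lambda>x. indicator {x\<in>space \<mu>. b n * t < \<phi> x} ((T ^^ j) x))"
          using b[OF that] measurable_space[OF measurable_iter[of j]]
          by (intro Bochner_Integration.integral_cong) (auto simp: indicator_def pos_less_divide_eq mult.commute)
        finally show ?thesis .
      qed
      also have "\<dots> = prob {x\<in>space \<mu>. b n * t < \<phi> x}" by (subst expectation_iter) auto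
      finally show ?thesis .
    qed
    have sumX: "(\<Sum>j=1..n. prob {x\<in>space \<mu>. t < ?X n j x}) = real n * prob {x\<in>space \<mu>. b n * t < \<phi> x}" for t n
      by (cases "n \<ge> 1") (simp_all add: probX)
    show "(\<Sum>j=1..n. prob {x\<in>space \<mu>. t < ?X n j x}) \<le> K * t powr (- \<alpha>)" if t: "0 < t" for t n
    proof (cases "n \<ge> 1")
      case True
      have "real n * prob {x\<in>space \<mu>. b n * t < \<phi> x} \<le> real n * (K1 * (b n * t) powr (- \<alpha>))"
        using tail[of "b n * t"] b[OF True] t by (intro mult_left_mono) auto
      also have "\<dots> \<le> K1 * K2 * t powr (- \<alpha>)" by (rule scale) (use True t K1 in auto)
      also have "\<dots> \<le> K * t powr (- \<alpha>)" using KM by (intro mult_right_mono) auto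
      finally show ?thesis unfolding sumX .
    next
      case False
      then show ?thesis using \<open>0 < K\<close> by simp
    qed
    show "(\<lambda>n. \<Sum>j=1..n. prob {x\<in>space \<mu>. 1 < ?X n j x}) \<longlonglongrightarrow> 1"
      unfolding sumX using lim' by simp
    have minX: "min (?X n j x) t = min (\<phi> ((T ^^ j) x)) (b n * t) / b n" if "n \<ge> 1" for n j x t
      using b[OF that] by (simp add: min_def pos_divide_le_eq mult.commute)
    have powr2: "(b n * t) powr (2 - \<alpha>) / (b n)\<^sup>2 = b n powr (- \<alpha>) * t powr (2 - \<alpha>)" if "n \<ge> 1" "0 < t" for n t
      using b[OF that(1)] that by (simp add: powr_mult powr_diff powr_minus powr_numeral field_simps)
    show "expectation (\<lambda>x. (\<Sum>j=1..n. min (?X n j x) \<epsilon> - expectation (\<lambda>x. min (?X n j x) \<epsilon>))\<^sup>2) \<le> K * \<epsilon> powr (2 - \<alpha>)"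
      if \<epsilon>: "0 < \<epsilon>" for \<epsilon> n
    proof (cases "n \<ge> 1")
      case True
      define B where "B = b n * \<epsilon>"
      have bn: "0 < b n" using b True by auto
      then have B: "0 < B" using \<epsilon> by (simp add: B_def)
      define q where "q x = min (\<phi> x) B" for x
      have [measurable]: "q \<in> borel_measurable \<mu>" unfolding q_def by measurable
      have qT: "expectation (\<lambda>x. q ((T ^^ j) x)) = expectation q" for j by (rule expectation_iter) simp
      have "expectation (\<lambda>x. (\<Sum>j=1..n. min (?X n j x) \<epsilon> - expectation (\<lambda>x. min (?X n j x) \<epsilon>))\<^sup>2)
         = expectation (\<lambda>x. (\<Sum>j=1..n. q ((T ^^ j) x) - expectation q)\<^sup>2 / (b n)\<^sup>2)"
        unfolding minX[OF True] B_def[symmetric] q_def[symmetric]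
        by (simp add: qT diff_divide_distrib[symmetric] sum_divide_distrib[symmetric] power_divide)
      also have "\<dots> = expectation (\<lambda>x. (\<Sum>j=1..n. q ((T ^^ j) x) - expectation q)\<^sup>2) / (b n)\<^sup>2" by simp
      also have "\<dots> \<le> (real n * (D * B powr (2 - \<alpha>) * (2 / (1 - r1)))) / (b n)\<^sup>2"
        by (intro divide_right_mono variance_iter_le[where B=B])
          (use cov[OF B] D B phi_nn in \<open>auto simp: q_def[abs_def]\<close>)
      also have "\<dots> = (D * (2 / (1 - r1))) * real n * (B powr (2 - \<alpha>) / (b n)\<^sup>2)" by (simp add: field_simps)
      also have "\<dots> = (D * (2 / (1 - r1))) * (real n * b n powr (- \<alpha>)) * \<epsilon> powr (2 - \<alpha>)"
        unfolding B_def powr2[OF True \<epsilon>] by simp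
      also have "\<dots> \<le> (D * (2 / (1 - r1))) * K2 * \<epsilon> powr (2 - \<alpha>)"
        using K2 D by (intro mult_right_mono mult_left_mono) auto
      also have "\<dots> \<le> K * \<epsilon> powr (2 - \<alpha>)" using KM unfolding M1_def by (intro mult_right_mono) auto
      finally show ?thesis .
    next
      case False
      then show ?thesis using \<open>0 < K\<close> by simp
    qed
    show "expectation (\<lambda>x. (\<Sum>j=1..n. (min (?X n j x) t - min (?X n j x) s) / (t - s)
          - expectation (\<lambda>x. (min (?X n j x) t - min (?X n j x) s) / (t - s)))\<^sup>2) \<le> K * s powr (- \<alpha>)"
      if s: "0 < s" "s < t" for s t n
    proof (cases "n \<ge> 1")
      case True
      have bn: "0 < b n" using b True by auto
      define A where "A = b n * s"
      define B where "B = b n * t"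
      have AB: "0 < A" "A < B" using s bn by (auto simp: A_def B_def)
      have BA: "B - A = b n * (t - s)" by (simp add: A_def B_def algebra_simps)
      define q where "q x = (min (\<phi> x) B - min (\<phi> x) A) / (B - A)" for x
      have [measurable]: "q \<in> borel_measurable \<mu>" unfolding q_def by measurable
      have q01: "0 \<le> q x" "q x \<le> 1" for x using AB by (auto simp: q_def min_def divide_simps)
      have uq: "unimodal x\<^sub>0 1 q"
      proof -
        have "unimodal x\<^sub>0 (B - A) (\<lambda>x. min (\<phi> x) B - min (\<phi> x) A)"
          using AB by (intro unimodal_clip[OF \<phi> \<alpha>(1)]) auto
        then show ?thesis using AB unfolding unimodal_def q_def by (auto simp: divide_right_mono)
      qed
      have Eq: "expectation q \<le> K1 * A powr (- \<alpha>)"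
      proof -
        have "expectation q \<le> expectation (indicator {x\<in>space \<mu>. A < \<phi> x})"
        proof (rule integral_mono)
          show "integrable \<mu> q" by (rule integrable_const_bound[of _ 1]) (use q01 in auto)
          show "q x \<le> indicator {x\<in>space \<mu>. A < \<phi> x} x" if "x \<in> space \<mu>" for x
          proof (cases "A < \<phi> x")
            case False
            then have "q x = 0" using AB by (simp add: q_def)
            then show ?thesis by simp
          qed (use q01[of x] that in simp)
        qed (rule integrable_const_bound[of _ 1], auto)
        also have "\<dots> = prob {x\<in>space \<mu>. A < \<phi> x}" by simp
        also have "\<dots> \<le> K1 * A powr (- \<alpha>)" by (rule tail[OF AB(1)])
        finally show ?thesis .
      qed
      have qT: "expectation (\<lambda>x. q ((T ^^ j) x)) = expectation q" for j by (rule expectation_iter) simp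
      have Xq: "(min (?X n j x) t - min (?X n j x) s) / (t - s) = q ((T ^^ j) x)" for j x
        unfolding minX[OF True] q_def BA using bn by (simp add: A_def B_def diff_divide_distrib)
      have "expectation (\<lambda>x. (\<Sum>j=1..n. q ((T ^^ j) x) - expectation (\<lambda>x. q ((T ^^ j) x)))\<^sup>2)
         = expectation (\<lambda>x. (\<Sum>j=1..n. q ((T ^^ j) x) - expectation q)\<^sup>2)" unfolding qT ..
      \<comment> \<open>The ramp lies between 0 and 1, so the decay estimate with D = 1 already
        yields a multiple of n E q; the splitting by levels is specific to heights that
        grow.\<close>
      also have "\<dots> \<le> real n * ((C * (K1 * A powr (- \<alpha>))) * (2 / (1 - \<rho>)))"
      proof (rule variance_iter_le[where B=1])
        show "\<bar>expectation (\<lambda>x. q ((T ^^ k) x) * q x) - expectation q * expectation q\<bar> \<le> (C * (K1 * A powr (- \<alpha>))) * \<rho> ^ k" for k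
        proof -
          have "\<bar>expectation (\<lambda>x. q ((T ^^ k) x) * q x) - expectation q * expectation q\<bar> \<le> C * \<rho> ^ k * 1 * expectation (\<lambda>x. \<bar>q x\<bar>)"
            by (rule dec[OF uq, where B=1]) (use q01 in auto)
          also have "\<dots> \<le> C * \<rho> ^ k * 1 * (K1 * A powr (- \<alpha>))" using Eq q01 C by (intro mult_left_mono) auto
          finally show ?thesis by (simp add: mult_ac)
        qed
      qed (use q01 C in auto)
      also have "\<dots> = real n * ((C * K1 * (2 / (1 - \<rho>))) * (b n * s) powr (- \<alpha>))" by (simp add: A_def mult_ac)
      also have "\<dots> \<le> (C * K1 * (2 / (1 - \<rho>))) * K2 * s powr (- \<alpha>)"
        by (rule scale) (use True s C K1 in auto)
      also have "\<dots> \<le> K * s powr (- \<alpha>)" using KM unfolding M2_def by (intro mult_right_mono) auto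
      finally show ?thesis unfolding Xq .
    next
      case False
      then show ?thesis using \<open>0 < K\<close> by simp
    qed
    show "(\<Sum>j=1..n. expectation (\<lambda>x. min (?X n j x) \<epsilon>)) \<le> K * \<epsilon> powr (1 - \<alpha>)"
      if a1: "\<alpha> < 1" and \<epsilon>: "0 < \<epsilon>" for \<epsilon> n
    proof (cases "n \<ge> 1")
      case True
      have bn: "0 < b n" using b True by auto
      define B where "B = b n * \<epsilon>"
      have B: "0 < B" using \<epsilon> bn by (simp add: B_def)
      define q where "q x = min (\<phi> x) B" for x
      have [measurable]: "q \<in> borel_measurable \<mu>" unfolding q_def by measurable
      have qT: "expectation (\<lambda>x. q ((T ^^ j) x)) = expectation q" for j by (rule expectation_iter) simp
      define k where "k = K1 * 2 powr \<alpha> / (1 - 2 powr (\<alpha> - 1))"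
      have k: "k \<le> \<bar>k\<bar>" by simp
      have Eq: "expectation q \<le> \<bar>k\<bar> * B powr (1 - \<alpha>)"
      proof -
        have "expectation (\<lambda>x. min (\<phi> x) B ^ 1) \<le> K1 * 2 powr \<alpha> / (1 - 2 powr (\<alpha> - real 1)) * B powr (real 1 - \<alpha>)"
          by (rule truncated_moment[OF _ phi_nn tail]) (use a1 K1 B in auto)
        then have "expectation q \<le> k * B powr (1 - \<alpha>)" by (simp add: q_def[abs_def] k_def)
        also have "\<dots> \<le> \<bar>k\<bar> * B powr (1 - \<alpha>)" by (intro mult_right_mono) auto
        finally show ?thesis .
      qed
      have "(\<Sum>j=1..n. expectation (\<lambda>x. min (?X n j x) \<epsilon>)) = real n * (expectation q / b n)"
        unfolding minX[OF True] B_def[symmetric] q_def[symmetric] by (simp add: qT)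
      also have "\<dots> \<le> real n * (\<bar>k\<bar> * B powr (1 - \<alpha>) / b n)"
        using Eq bn by (intro mult_left_mono divide_right_mono) auto
      also have "B powr (1 - \<alpha>) = b n * b n powr (- \<alpha>) * \<epsilon> powr (1 - \<alpha>)"
        using bn \<epsilon> by (simp add: B_def powr_mult powr_diff powr_minus field_simps)
      also have "real n * (\<bar>k\<bar> * (b n * b n powr (- \<alpha>) * \<epsilon> powr (1 - \<alpha>)) / b n) = \<bar>k\<bar> * (real n * b n powr (- \<alpha>)) * \<epsilon> powr (1 - \<alpha>)"
        using bn by simp
      also have "\<dots> \<le> \<bar>k\<bar> * K2 * \<epsilon> powr (1 - \<alpha>)" using K2 by (intro mult_right_mono mult_left_mono) auto
      also have "\<dots> \<le> K * \<epsilon> powr (1 - \<alpha>)" using KM unfolding M3_def k_def by (intro mult_right_mono) auto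
      finally show ?thesis .
    next
      case False
      then show ?thesis using \<open>0 < K\<close> by simp
    qed
  qed
qed

section \<open>Point sums and convergence of point processes\<close>

lemma measurable_points [measurable]:
  "x \<in> measurable (count_space {i\<in>I. x i \<noteq> 0}) punctured_borel"
  unfolding punctured_borel_def by (auto intro!: measurable_restrict_space2)

lemma sets_dirac_sum [simp, measurable_cong]: "sets (dirac_sum I x) = sets punctured_borel"
  by (simp add: dirac_sum_def)

text \<open>With h 0 = 0 the absent points are invisible, so the integral is a sum over all
  indices.\<close>

lemma nn_integral_dirac_sum:
  assumes "h \<in> borel_measurable punctured_borel" "h 0 = 0"
  shows "(\<integral>\<^sup>+y. h y \<partial>dirac_sum I x) = (\<integral>\<^sup>+i. h (x i) \<partial>count_space I)"
proof -
  have "(\<integral>\<^sup>+y. h y \<partial>dirac_sum I x) = (\<integral>\<^sup>+i. h (x i) \<partial>count_space {i\<in>I. x i \<noteq> 0})"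
    unfolding dirac_sum_def by (rule nn_integral_distr[OF measurable_points]) (simp add: assms)
  also have "\<dots> = (\<integral>\<^sup>+i. h (x i) \<partial>count_space I)"
    by (rule nn_integral_count_space_eq) (use assms in auto)
  finally show ?thesis .
qed

lemma borel_imp_punctured: "h \<in> borel_measurable borel \<Longrightarrow> h \<in> borel_measurable punctured_borel"
  unfolding punctured_borel_def by (rule measurable_restrict_space1)

lemma emeasure_dirac_sum:
  assumes "A \<in> sets punctured_borel"
  shows "emeasure (dirac_sum I x) A = (\<integral>\<^sup>+i. indicator A (x i) \<partial>count_space I)"
proof -
  have "0 \<notin> A" using sets.sets_into_space[OF assms] by (auto simp: punctured_borel_def space_restrict_space)
  then show ?thesis using nn_integral_dirac_sum[of "indicator A" I x] assms by simp
qed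

lemma punctured_sets_iff: "A \<in> sets punctured_borel \<longleftrightarrow> A \<in> sets borel \<and> 0 \<notin> A"
  unfolding punctured_borel_def by (subst sets_restrict_space_iff) auto

lemma compact_bounds:
  fixes K :: "real set"
  assumes "compact K" "0 \<notin> K"
  shows "\<exists>k::nat. K \<subseteq> {x. 1 / Suc k \<le> \<bar>x\<bar> \<and> \<bar>x\<bar> \<le> Suc k}"
proof -
  have "open (- K)" "0 \<in> - K" using assms compact_imp_closed by auto
  then obtain e where e: "e > 0" "ball 0 e \<subseteq> - K" by (meson openE)
  obtain B where B: "\<And>x. x \<in> K \<Longrightarrow> \<bar>x\<bar> \<le> B" using compact_imp_bounded[OF assms(1)] by (auto simp: bounded_iff)
  obtain k1 where k1: "1 / Suc k1 < e" using e nat_approx_posE by blast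
  obtain k2 where k2: "B \<le> real k2" using real_arch_simple by blast
  define k where "k = max k1 k2"
  have "1 / Suc k \<le> 1 / Suc k1" by (simp add: k_def frac_le)
  moreover have "B \<le> Suc k" using k2 by (simp add: k_def)
  moreover have "e \<le> \<bar>x\<bar>" if "x \<in> K" for x using e that by (auto simp: subset_eq dist_real_def not_less)
  ultimately have "K \<subseteq> {x. 1 / Suc k \<le> \<bar>x\<bar> \<and> \<bar>x\<bar> \<le> Suc k}" using k1 B by fastforce
  then show ?thesis ..
qed

text \<open>A countable exhaustion of the punctured line by compact sets. Local finiteness becomes
  countably many conditions, so it can be handled measurably and almost surely.\<close>

definition shell :: "nat \<Rightarrow> real set" where "shell k = {x. 1 / Suc k \<le> \<bar>x\<bar> \<and> \<bar>x\<bar> \<le> Suc k}"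

lemma compact_shell: "compact (shell k)" "0 \<notin> shell k"
proof -
  have "closed (shell k)" unfolding shell_def by (intro closed_Collect_conj closed_Collect_le continuous_intros)
  moreover have "bounded (shell k)" unfolding shell_def bounded_iff by (intro exI[of _ "real (Suc k)"]) auto
  ultimately show "compact (shell k)" by (simp add: compact_eq_bounded_closed)
qed (simp add: shell_def)

lemma shell_sets: "shell k \<in> sets punctured_borel"
  using compact_shell compact_imp_closed[of "shell k"] by (simp add: punctured_sets_iff)

lemma dirac_sum_reindex:
  assumes "bij_betw g J I"
  shows "dirac_sum J (\<lambda>j. x (g j)) = dirac_sum I x"
proof (rule measure_eqI)
  fix A assume "A \<in> sets (dirac_sum J (\<lambda>j. x (g j)))"
  then have A: "A \<in> sets punctured_borel" by simp
  show "emeasure (dirac_sum J (\<lambda>j. x (g j))) A = emeasure (dirac_sum I x) A"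
    unfolding emeasure_dirac_sum[OF A] by (rule nn_integral_bij_count_space[OF assms])
qed simp

text \<open>Counting measures are defined through sums over sets of naturals; \<open>to_nat\<close>
  brings a sum over pairs into that form.\<close>

lemma dirac_sum_counting_iff:
  fixes x :: "'i::countable \<Rightarrow> real"
  shows "dirac_sum I x \<in> counting_measures \<longleftrightarrow> (\<forall>k. finite {i\<in>I. x i \<in> shell k})"
proof -
  have "bij_betw (from_nat :: nat \<Rightarrow> 'i) (to_nat ` I) I"
    by (auto simp: bij_betw_def inj_on_def image_image)
  then have "dirac_sum (to_nat ` I) (\<lambda>j. x (from_nat j)) = dirac_sum I x" by (rule dirac_sum_reindex)
  then have 1: "\<exists>(J::nat set) y. dirac_sum I x = dirac_sum J y" by metis
  have eq: "emeasure (dirac_sum I x) K = emeasure (count_space I) {i\<in>I. x i \<in> K}" if "K \<in> sets punctured_borel" for K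
  proof -
    have "emeasure (dirac_sum I x) K = (\<integral>\<^sup>+i. indicator {i\<in>I. x i \<in> K} i \<partial>count_space I)"
      unfolding emeasure_dirac_sum[OF that] by (intro nn_integral_cong) (auto simp: indicator_def)
    then show ?thesis by simp
  qed
  have fin: "emeasure (dirac_sum I x) K < \<infinity> \<longleftrightarrow> finite {i\<in>I. x i \<in> K}" if "K \<in> sets punctured_borel" for K
    unfolding eq[OF that] by (subst emeasure_count_space) (auto simp: of_nat_less_top)
  show ?thesis
  proof
    assume "dirac_sum I x \<in> counting_measures"
    then have "emeasure (dirac_sum I x) (shell k) < \<infinity>" for k using compact_shell by (auto simp: counting_measures_def)
    then show "\<forall>k. finite {i\<in>I. x i \<in> shell k}" using fin[OF shell_sets] by auto
  next
    assume *: "\<forall>k. finite {i\<in>I. x i \<in> shell k}"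
    have "emeasure (dirac_sum I x) K < \<infinity>" if K: "compact K" "0 \<notin> K" for K
    proof -
      obtain k where k: "K \<subseteq> shell k" using compact_bounds[OF K] unfolding shell_def by blast
      have "emeasure (dirac_sum I x) K \<le> emeasure (dirac_sum I x) (shell k)"
        by (rule emeasure_mono[OF k]) (simp add: shell_sets)
      also have "\<dots> < \<infinity>" using fin[OF shell_sets] * by auto
      finally show ?thesis .
    qed
    then show "dirac_sum I x \<in> counting_measures" using 1 by (auto simp: counting_measures_def)
  qed
qed

text \<open>Integration of a test function is a coordinate of the pulled-back product topology. The
  value 0 off \<open>counting_measures\<close> is the normalisation that
  \<open>conv_in_distr_pp\<close> asks of its functionals.\<close>

lemma continuous_map_vague:
  assumes "f \<in> test_functions" "continuous_on UNIV (h :: real \<Rightarrow> real)"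
  shows "continuous_map vague_topology euclideanreal (\<lambda>m. if m \<in> counting_measures then h (\<integral>x. f x \<partial>m) else 0)"
proof -
  let ?J = "\<lambda>m. \<lambda>f\<in>test_functions. \<integral>x. f x \<partial>m"
  have "continuous_map (product_topology (\<lambda>_. euclideanreal) test_functions) euclideanreal (\<lambda>z. z f)"
    using assms by (intro continuous_map_product_projection)
  moreover have "continuous_map euclideanreal euclideanreal h" using assms by simp
  ultimately have "continuous_map (product_topology (\<lambda>_. euclideanreal) test_functions) euclideanreal (h \<circ> (\<lambda>z. z f))"
    by (rule continuous_map_compose)
  then have "continuous_map vague_topology euclideanreal ((h \<circ> (\<lambda>z. z f)) \<circ> ?J)"
    unfolding vague_topology_def by (rule continuous_map_pullback)
  then show ?thesis
  proof (rule continuous_map_eq)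
    fix m assume "m \<in> topspace vague_topology"
    then have "m \<in> counting_measures" by (simp add: vague_topology_def topspace_pullback_topology)
    then show "((h \<circ> (\<lambda>z. z f)) \<circ> ?J) m = (if m \<in> counting_measures then h (\<integral>x. f x \<partial>m) else 0)"
      using assms by simp
  qed
qed

lemma conv_in_distr_pp_test:
  assumes "conv_in_distr_pp \<mu> Nn M N" "f \<in> test_functions" "continuous_on UNIV (h :: real \<Rightarrow> real)" "\<And>x. \<bar>h x\<bar> \<le> B"
  shows "(\<lambda>n. \<integral>x. (if Nn n x \<in> counting_measures then h (\<integral>y. f y \<partial>Nn n x) else 0) \<partial>\<mu>) \<longlonglongrightarrow>
    (\<integral>\<omega>. (if N \<omega> \<in> counting_measures then h (\<integral>y. f y \<partial>N \<omega>) else 0) \<partial>M)"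
proof -
  let ?F = "\<lambda>m. if m \<in> counting_measures then h (\<integral>x. f x \<partial>m) else 0"
  have "bounded (?F ` counting_measures)" unfolding bounded_iff using assms(4) by auto
  then show ?thesis using assms(1) continuous_map_vague[OF assms(2,3)] unfolding conv_in_distr_pp_def by auto
qed

text \<open>The integral of g against the point process, kept in \<open>ennreal\<close> so that no
  summability has to be known. Negative values of g count as 0.\<close>

definition point_sum :: "('i \<Rightarrow> 'w \<Rightarrow> real) \<Rightarrow> (real \<Rightarrow> real) \<Rightarrow> 'w \<Rightarrow> ennreal" where
  "point_sum z g \<omega> = (\<integral>\<^sup>+p. ennreal (g (z p \<omega>)) \<partial>count_space UNIV)"

lemma point_sum_measurable [measurable]:
  fixes z :: "'i::countable \<Rightarrow> 'w \<Rightarrow> real"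
  assumes [measurable]: "\<And>p. z p \<in> borel_measurable M" "g \<in> borel_measurable borel"
  shows "point_sum z g \<in> borel_measurable M"
proof -
  have "(\<lambda>\<omega>. \<integral>\<^sup>+p. (\<lambda>(\<omega>, p). ennreal (g (z p \<omega>))) (\<omega>, p) \<partial>count_space UNIV) \<in> borel_measurable M"
  proof (rule sigma_finite_measure.borel_measurable_nn_integral_fst)
    show "sigma_finite_measure (count_space (UNIV :: 'i set))" by (simp add: sigma_finite_measure_count_space_countable)
    show "(\<lambda>(\<omega>, p). ennreal (g (z p \<omega>))) \<in> borel_measurable (M \<Otimes>\<^sub>M count_space UNIV)"
    proof -
      have "(\<lambda>(p, \<omega>). ennreal (g (z p \<omega>))) \<in> borel_measurable (count_space UNIV \<Otimes>\<^sub>M M)"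
        by (rule measurable_pair_measure_countable1) auto
      from measurable_pair_swap[OF this] show ?thesis by (simp add: split_beta')
    qed
  qed
  then show ?thesis by (simp add: point_sum_def[abs_def])
qed

lemma point_sum_finite:
  assumes "finite {p. g (z p \<omega>) \<noteq> 0}" "\<And>x. 0 \<le> g x"
  shows "point_sum z g \<omega> = ennreal (\<Sum>p\<in>{p. g (z p \<omega>) \<noteq> 0}. g (z p \<omega>))"
proof -
  have "point_sum z g \<omega> = (\<integral>\<^sup>+p. ennreal (g (z p \<omega>)) \<partial>count_space {p. g (z p \<omega>) \<noteq> 0})"
    unfolding point_sum_def by (rule nn_integral_count_space_eq) auto
  also have "\<dots> = (\<Sum>p\<in>{p. g (z p \<omega>) \<noteq> 0}. ennreal (g (z p \<omega>)))"
    by (rule nn_integral_count_space_finite[OF assms(1)])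
  also have "\<dots> = ennreal (\<Sum>p\<in>{p. g (z p \<omega>) \<noteq> 0}. g (z p \<omega>))" using assms(2) by (intro sum_ennreal) auto
  finally show ?thesis .
qed

lemma integral_dirac_sum:
  assumes [measurable]: "f \<in> borel_measurable borel" and "f 0 = 0" "\<And>x. 0 \<le> f x"
  shows "(\<integral>y. f y \<partial>dirac_sum I x) = enn2real (\<integral>\<^sup>+i. ennreal (f (x i)) \<partial>count_space I)"
proof -
  have m: "(\<lambda>x. ennreal (f x)) \<in> borel_measurable punctured_borel" by (intro borel_imp_punctured) simp
  have "f \<in> borel_measurable (dirac_sum I x)"
    using borel_imp_punctured[OF assms(1)] measurable_cong_sets[OF sets_dirac_sum refl] by blast
  then have "(\<integral>y. f y \<partial>dirac_sum I x) = enn2real (\<integral>\<^sup>+y. ennreal (f y) \<partial>dirac_sum I x)"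
    using assms by (intro integral_eq_nn_integral) auto
  then show ?thesis by (subst (asm) nn_integral_dirac_sum[OF m]) (auto simp: assms(2))
qed

text \<open>Removes the guards by \<open>counting_measures\<close>: the prelimit sums are finite,
  hence always locally finite, and the limit is locally finite almost surely.\<close>

lemma point_convergence:
  fixes z :: "'i::countable \<Rightarrow> 'w \<Rightarrow> real" and X :: "nat \<Rightarrow> nat \<Rightarrow> 'a \<Rightarrow> real"
  assumes conv: "conv_in_distr_pp \<mu> (\<lambda>n x. dirac_sum {1..n} (\<lambda>j. X n j x)) M (\<lambda>\<omega>. dirac_sum UNIV (\<lambda>p. z p \<omega>))"
    and z: "\<And>p. z p \<in> borel_measurable M"
    and f: "continuous_on UNIV f" "\<And>x. 0 \<le> f x" "0 < \<delta>" "\<And>x. \<bar>x\<bar> \<le> \<delta> \<Longrightarrow> f x = 0" "\<And>x. R \<le> \<bar>x\<bar> \<Longrightarrow> f x = 0"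
    and h: "continuous_on UNIV (h :: real \<Rightarrow> real)" "\<And>x. \<bar>h x\<bar> \<le> B"
  shows "(\<lambda>n. \<integral>x. h (\<Sum>j=1..n. f (X n j x)) \<partial>\<mu>) \<longlonglongrightarrow> (\<integral>\<omega>. h (enn2real (point_sum z f \<omega>)) \<partial>M)"
proof -
  have [measurable]: "f \<in> borel_measurable borel" "h \<in> borel_measurable borel"
    using f h by (auto intro: borel_measurable_continuous_onI)
  note [measurable] = z
  have f0: "f 0 = 0" using f by auto
  have test: "f \<in> test_functions"
  proof -
    have "compact {x. \<delta> \<le> \<bar>x\<bar> \<and> \<bar>x\<bar> \<le> R}" unfolding compact_eq_bounded_closed
      by (auto simp: bounded_iff intro!: exI[of _ R] closed_Collect_conj closed_Collect_le continuous_intros)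
    moreover have "f x = 0" if "x \<notin> {x. \<delta> \<le> \<bar>x\<bar> \<and> \<bar>x\<bar> \<le> R}" for x using that f(4,5)[of x] by auto
    ultimately show ?thesis using f(1,3) unfolding test_functions_def
      by (intro CollectI conjI exI[of _ "{x. \<delta> \<le> \<bar>x\<bar> \<and> \<bar>x\<bar> \<le> R}"]) auto
  qed
  have lhs: "(if dirac_sum {1..n} (\<lambda>j. X n j x) \<in> counting_measures then h (\<integral>y. f y \<partial>dirac_sum {1..n} (\<lambda>j. X n j x)) else 0)
     = h (\<Sum>j=1..n. f (X n j x))" for n x
  proof -
    have "dirac_sum {1..n} (\<lambda>j. X n j x) \<in> counting_measures" by (simp add: dirac_sum_counting_iff)
    moreover have "(\<integral>y. f y \<partial>dirac_sum {1..n} (\<lambda>j. X n j x)) = (\<Sum>j=1..n. f (X n j x))"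
      using f by (subst integral_dirac_sum) (auto simp: f0 nn_integral_count_space_finite sum_ennreal sum_nonneg)
    ultimately show ?thesis by simp
  qed
  have AEc: "AE \<omega> in M. dirac_sum UNIV (\<lambda>p. z p \<omega>) \<in> counting_measures"
    using conv by (simp add: conv_in_distr_pp_def)
  \<comment> \<open>Membership is measurable because it says that the count of every shell is
    finite.\<close>
  have cm[measurable]: "Measurable.pred M (\<lambda>\<omega>. dirac_sum UNIV (\<lambda>p. z p \<omega>) \<in> counting_measures)"
  proof -
    have "finite {p. z p \<omega> \<in> shell k} \<longleftrightarrow> point_sum z (indicator (shell k)) \<omega> < \<infinity>" for \<omega> k
    proof -
      have "point_sum z (indicator (shell k)) \<omega> = (\<integral>\<^sup>+p. indicator {p. z p \<omega> \<in> shell k} p \<partial>count_space UNIV)"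
        unfolding point_sum_def by (intro nn_integral_cong) (auto simp: indicator_def)
      also have "\<dots> = emeasure (count_space UNIV) {p. z p \<omega> \<in> shell k}" by simp
      finally show ?thesis by (simp add: emeasure_count_space of_nat_less_top)
    qed
    moreover have [measurable]: "shell k \<in> sets borel" for k using shell_sets by (simp add: punctured_sets_iff)
    ultimately show ?thesis by (simp add: dirac_sum_counting_iff)
  qed
  have "(\<integral>\<omega>. (if dirac_sum UNIV (\<lambda>p. z p \<omega>) \<in> counting_measures then h (\<integral>y. f y \<partial>dirac_sum UNIV (\<lambda>p. z p \<omega>)) else 0) \<partial>M)
     = (\<integral>\<omega>. h (enn2real (point_sum z f \<omega>)) \<partial>M)"
  proof -
    have eq: "(\<integral>y. f y \<partial>dirac_sum UNIV (\<lambda>p. z p \<omega>)) = enn2real (point_sum z f \<omega>)" for \<omega>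
      using f by (subst integral_dirac_sum) (auto simp: f0 point_sum_def)
    show ?thesis unfolding eq
      by (rule integral_cong_AE) (use AEc in \<open>auto intro: AE_mp\<close>)
  qed
  then show ?thesis using conv_in_distr_pp_test[OF conv test h] unfolding lhs by simp
qed

section \<open>The Poisson cluster process\<close>

lemma space_measure_algebra: "space measure_algebra = {m. sets m = sets punctured_borel}"
  unfolding measure_algebra_def by (subst space_Sup_eq_UN) (auto simp: punctured_borel_def intro!: exI[of _ "{}"])

lemma measurable_emeasure_measure_algebra [measurable]:
  assumes "A \<in> sets punctured_borel"
  shows "(\<lambda>m. emeasure m A) \<in> borel_measurable measure_algebra"
  unfolding measure_algebra_def
  by (rule measurable_Sup1[OF imageI[OF assms]]) (auto intro: measurable_vimage_algebra1)

text \<open>The \<sigma>-algebra is generated by evaluations at sets; the standard induction on h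
  passes to integrals. This allows functionals of a cluster to be read as functions of its random
  measure.\<close>

lemma measurable_nn_integral_measure_algebra:
  assumes "h \<in> borel_measurable punctured_borel"
  shows "(\<lambda>m. \<integral>\<^sup>+y. h y \<partial>m) \<in> borel_measurable measure_algebra"
  using assms
proof (induction h rule: borel_measurable_induct)
  case (cong f g)
  have "(\<lambda>m. integral\<^sup>N m f) \<in> borel_measurable measure_algebra
     \<longleftrightarrow> (\<lambda>m. integral\<^sup>N m g) \<in> borel_measurable measure_algebra"
    using cong by (intro measurable_cong nn_integral_cong) (auto simp: space_measure_algebra dest: sets_eq_imp_space_eq)
  then show ?case using cong by simp
next
  case (set A)
  have "(\<lambda>m. integral\<^sup>N m (indicator A)) \<in> borel_measurable measure_algebra
     \<longleftrightarrow> (\<lambda>m. emeasure m A) \<in> borel_measurable measure_algebra"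
    using set by (intro measurable_cong nn_integral_indicator) (auto simp: space_measure_algebra)
  then show ?case using set by simp
next
  case (mult u c)
  have "(\<lambda>m. integral\<^sup>N m (\<lambda>x. c * u x)) \<in> borel_measurable measure_algebra
     \<longleftrightarrow> (\<lambda>m. c * integral\<^sup>N m u) \<in> borel_measurable measure_algebra"
    using mult by (intro measurable_cong nn_integral_cmult)
      (auto simp: space_measure_algebra cong: measurable_cong_sets)
  then show ?case using mult by simp
next
  case (add u w)
  have "(\<lambda>m. integral\<^sup>N m (\<lambda>x. w x + u x)) \<in> borel_measurable measure_algebra
     \<longleftrightarrow> (\<lambda>m. integral\<^sup>N m w + integral\<^sup>N m u) \<in> borel_measurable measure_algebra"
    using add by (intro measurable_cong nn_integral_add)
      (auto simp: space_measure_algebra cong: measurable_cong_sets)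
  then show ?case using add by simp
next
  case (seq U)
  have eq: "integral\<^sup>N m (SUP i. U i) = (SUP i. integral\<^sup>N m (U i))" if "m \<in> space measure_algebra" for m
  proof -
    have "integral\<^sup>N m (SUP i. U i) = integral\<^sup>N m (\<lambda>x. SUP i. U i x)" by (intro nn_integral_cong) (simp add: image_comp comp_def)
    also have "\<dots> = (SUP i. integral\<^sup>N m (U i))"
      using seq that by (intro nn_integral_monotone_convergence_SUP)
        (auto simp: space_measure_algebra cong: measurable_cong_sets)
    finally show ?thesis .
  qed
  have "(\<lambda>m. integral\<^sup>N m (SUP i. U i)) \<in> borel_measurable measure_algebra
     \<longleftrightarrow> (\<lambda>m. SUP i. integral\<^sup>N m (U i)) \<in> borel_measurable measure_algebra"
    by (intro measurable_cong eq)
  with seq have "(\<lambda>m. integral\<^sup>N m (SUP i. U i)) \<in> borel_measurable measure_algebra" by simp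
  then show ?case by (rule back_subst[where P="\<lambda>x. x"]) (simp only: seq)
qed

lemma measurable_dirac_sum:
  fixes x :: "'i::countable \<Rightarrow> 'w \<Rightarrow> real"
  assumes [measurable]: "\<And>i. x i \<in> borel_measurable M"
  shows "(\<lambda>\<omega>. dirac_sum UNIV (\<lambda>i. x i \<omega>)) \<in> measurable M measure_algebra"
  unfolding measure_algebra_def
proof (rule measurable_Sup2)
  fix N assume "N \<in> (\<lambda>A. vimage_algebra {m. sets m = sets punctured_borel} (\<lambda>m. emeasure m A) borel) ` sets punctured_borel"
  then obtain A where A: "A \<in> sets punctured_borel"
    and N: "N = vimage_algebra {m. sets m = sets punctured_borel} (\<lambda>m. emeasure m A) borel" by auto
  then have [measurable]: "A \<in> sets borel" by (simp add: punctured_sets_iff)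
  have "(\<lambda>\<omega>. emeasure (dirac_sum UNIV (\<lambda>i. x i \<omega>)) A) = point_sum x (indicator A)"
    using A by (auto simp: emeasure_dirac_sum point_sum_def ennreal_indicator)
  then have "(\<lambda>\<omega>. emeasure (dirac_sum UNIV (\<lambda>i. x i \<omega>)) A) \<in> borel_measurable M" by simp
  then show "(\<lambda>\<omega>. dirac_sum UNIV (\<lambda>i. x i \<omega>)) \<in> measurable M N"
    unfolding N by (intro measurable_vimage_algebra2) auto
qed (auto simp: punctured_borel_def)

text \<open>The infinite value that \<open>E\<close> may take, where \<open>enn2real\<close> is \<open>0\<close>, has probability \<open>0\<close>.\<close>

lemma (in prob_space) poisson_count:
  fixes E :: "'a \<Rightarrow> ennreal" and w :: complex
  assumes [measurable]: "E \<in> borel_measurable M" and r: "0 \<le> r"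
    and poi: "\<And>k::nat. prob {\<omega>\<in>space M. E \<omega> = of_nat k} = r ^ k / fact k * exp (- r)"
  shows "AE \<omega> in M. \<exists>k. E \<omega> = of_nat k"
    and "expectation (\<lambda>\<omega>. w ^ nat \<lfloor>enn2real (E \<omega>)\<rfloor>) = exp (of_real r * (w - 1))"
proof -
  define S where "S k = {\<omega>\<in>space M. E \<omega> = of_nat k}" for k :: nat
  have [measurable]: "S k \<in> sets M" for k unfolding S_def by measurable
  have disj: "disjoint_family S" unfolding disjoint_family_on_def S_def by auto
  \<comment> \<open>The Poisson weights add up to 1, so no probability is left for non-integer or
    infinite values of E.\<close>
  have sums1: "(\<lambda>k. prob (S k)) sums 1"
  proof -
    have "(\<lambda>k. r ^ k / fact k * exp (- r)) sums (exp r * exp (- r))"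
      using exp_converges[of r] by (intro sums_mult2) (simp add: divide_inverse mult.commute scaleR_conv_of_real)
    then show ?thesis using poi by (simp add: S_def exp_minus)
  qed
  have "prob (\<Union>k. S k) = 1"
  proof -
    have "range S \<subseteq> events" by auto
    from sums_unique2[OF finite_measure_UNION[OF this disj] sums1] show ?thesis .
  qed
  then have AES: "AE \<omega> in M. \<omega> \<in> (\<Union>k. S k)" by (intro prob_eq_1[THEN iffD1]) auto
  then show AEk: "AE \<omega> in M. \<exists>k. E \<omega> = of_nat k" by eventually_elim (auto simp: S_def)
  define Y where "Y \<omega> = nat \<lfloor>enn2real (E \<omega>)\<rfloor>" for \<omega>
  have [measurable]: "Y \<in> measurable M (count_space UNIV)" unfolding Y_def by measurable
  have Y: "Y \<omega> = k" if "E \<omega> = of_nat k" for \<omega> k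
    using that by (simp add: Y_def)
  have PY: "prob {\<omega>\<in>space M. Y \<omega> = k} = r ^ k / fact k * exp (- r)" for k
  proof -
    have "prob {\<omega>\<in>space M. Y \<omega> = k} = prob (S k)"
      using AEk unfolding S_def by (intro finite_measure_eq_AE) (auto dest: Y)
    then show ?thesis using poi[of k] by (simp add: S_def)
  qed
  define p where "p k = r ^ k / fact k * exp (- r)" for k :: nat
  have p0: "0 \<le> p k" for k using r by (simp add: p_def)
  have dY: "distr M (count_space UNIV) Y = density (count_space UNIV) (\<lambda>k. ennreal (p k))"
  proof (rule measure_eqI_countable[of _ UNIV])
    fix k
    have "emeasure (distr M (count_space UNIV) Y) {k} = ennreal (prob {\<omega>\<in>space M. Y \<omega> = k})"
      by (subst emeasure_distr) (auto simp: emeasure_eq_measure vimage_def Int_def conj_commute)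
    also have "\<dots> = ennreal (p k)" by (simp only: PY p_def)
    also have "\<dots> = (\<integral>\<^sup>+j. ennreal (p k) * indicator {k} j \<partial>count_space UNIV)"
      by (subst nn_integral_cmult_indicator) auto
    also have "\<dots> = (\<integral>\<^sup>+j. ennreal (p j) * indicator {k} j \<partial>count_space UNIV)"
      by (intro nn_integral_cong) (auto simp: indicator_def)
    also have "\<dots> = emeasure (density (count_space UNIV) (\<lambda>k. ennreal (p k))) {k}"
      by (subst emeasure_density) auto
    finally show "emeasure (distr M (count_space UNIV) Y) {k} = emeasure (density (count_space UNIV) (\<lambda>k. ennreal (p k))) {k}" .
  qed auto
  let ?t = "\<lambda>k. p k *\<^sub>R w ^ k"
  have tk: "?t k = of_real (exp (- r)) * ((of_real r * w) ^ k /\<^sub>R fact k)" for k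
    by (simp add: p_def power_mult_distrib scaleR_conv_of_real field_simps)
  have sm: "?t sums (of_real (exp (- r)) * exp (of_real r * w))"
    unfolding tk by (intro sums_mult exp_converges)
  have sn: "summable (\<lambda>k. norm (?t k))"
    unfolding tk norm_mult by (intro summable_mult summable_norm_exp)
  have "expectation (\<lambda>\<omega>. w ^ Y \<omega>) = (\<integral>k. w ^ k \<partial>distr M (count_space UNIV) Y)"
    by (rule integral_distr[symmetric]) auto
  also have "\<dots> = (\<integral>k. ?t k \<partial>count_space UNIV)"
    unfolding dY by (subst integral_density) (auto simp: p0)
  also have "\<dots> = (\<Sum>k. ?t k)"
    using sn by (intro integral_count_space_nat) (simp add: integrable_count_space_nat_iff)
  also have "\<dots> = of_real (exp (- r)) * exp (of_real r * w)" using sm by (simp add: sums_iff)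
  also have "\<dots> = exp (of_real r * (w - 1))"
    by (simp add: exp_of_real[symmetric] exp_add[symmetric] algebra_simps)
  finally show "expectation (\<lambda>\<omega>. w ^ nat \<lfloor>enn2real (E \<omega>)\<rfloor>) = exp (of_real r * (w - 1))" by (simp add: Y_def)
qed

text \<open>A measurable function of X generates no more than X does. This turns the independence of
  \<sigma>-algebras assumed in \<open>poisson_cluster_points\<close> into independence of random
  variables.\<close>

lemma sigma_sets_vimage_subset:
  assumes X: "X \<in> space M \<rightarrow> space N" and c: "c \<in> measurable N L" and f: "\<And>\<omega>. \<omega> \<in> space M \<Longrightarrow> f \<omega> = c (X \<omega>)"
  shows "sigma_sets (space M) {f -` A \<inter> space M | A. A \<in> sets L} \<subseteq> sets (vimage_algebra (space M) X N)"
proof -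
  have "f -` A \<inter> space M \<in> sets (vimage_algebra (space M) X N)" if A: "A \<in> sets L" for A
  proof -
    have "f -` A \<inter> space M = X -` (c -` A \<inter> space N) \<inter> space M" using X f by auto
    then show ?thesis using measurable_sets[OF c A] unfolding sets_vimage_algebra2[OF X] by blast
  qed
  then have "{f -` A \<inter> space M | A. A \<in> sets L} \<subseteq> sets (vimage_algebra (space M) X N)" by auto
  from sets.sigma_sets_subset[OF this] show ?thesis by simp
qed

text \<open>The substitution of c x for x produces the Jacobian c and the density factor
  c^(-\<alpha> - 1), together c^(-\<alpha>).\<close>

lemma measure_tail_measure_scale:
  assumes c: "0 < c" and [measurable]: "A \<in> sets borel"
  shows "emeasure (tail_measure \<alpha>) {x. c * x \<in> A} = ennreal (c powr \<alpha>) * emeasure (tail_measure \<alpha>) A"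
proof -
  let ?f = "\<lambda>x::real. ennreal (\<alpha> * x powr (- \<alpha> - 1) * indicator {0<..} x)"
  have eq: "?f (c * x) = ennreal (c powr (- \<alpha> - 1)) * ?f x" for x
    using c by (subst ennreal_mult'[symmetric]) (auto simp: indicator_def zero_less_mult_iff powr_mult mult_ac)
  have [measurable]: "{x. c * x \<in> A} \<in> sets borel" by measurable
  have cc: "ennreal (c powr \<alpha>) * ennreal c * ennreal (c powr (- \<alpha> - 1)) = 1"
  proof -
    have "c powr \<alpha> * c * c powr (- \<alpha> - 1) = c powr (\<alpha> + 1 + (- \<alpha> - 1))" using c by (simp only: powr_add powr_one)
    then have "c powr \<alpha> * c * c powr (- \<alpha> - 1) = 1" using c by simp
    then show ?thesis using c by (simp flip: ennreal_mult)
  qed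
  have "emeasure (tail_measure \<alpha>) A = (\<integral>\<^sup>+x. ?f x * indicator A x \<partial>lborel)"
    unfolding tail_measure_def by (rule emeasure_density) auto
  also have "\<dots> = ennreal \<bar>c\<bar> * (\<integral>\<^sup>+x. ?f (0 + c * x) * indicator A (0 + c * x) \<partial>lborel)"
    using c by (intro nn_integral_real_affine) auto
  also have "(\<integral>\<^sup>+x. ?f (0 + c * x) * indicator A (0 + c * x) \<partial>lborel)
      = (\<integral>\<^sup>+x. ennreal (c powr (- \<alpha> - 1)) * (?f x * indicator {x. c * x \<in> A} x) \<partial>lborel)"
    unfolding add_0_left eq by (intro nn_integral_cong) (auto simp: indicator_def mult_ac)
  also have "\<dots> = ennreal (c powr (- \<alpha> - 1)) * (\<integral>\<^sup>+x. ?f x * indicator {x. c * x \<in> A} x \<partial>lborel)"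
    by (rule nn_integral_cmult) auto
  also have "(\<integral>\<^sup>+x. ?f x * indicator {x. c * x \<in> A} x \<partial>lborel) = emeasure (tail_measure \<alpha>) {x. c * x \<in> A}"
    unfolding tail_measure_def by (rule emeasure_density[symmetric]) auto
  finally have "ennreal (c powr \<alpha>) * emeasure (tail_measure \<alpha>) A =
     (ennreal (c powr \<alpha>) * ennreal c * ennreal (c powr (- \<alpha> - 1))) * emeasure (tail_measure \<alpha>) {x. c * x \<in> A}"
    using c by (simp add: mult_ac)
  then show ?thesis unfolding cc by simp
qed

lemma emeasure_tail_measure_Ioi:
  assumes "0 < \<alpha>" "0 < a"
  shows "emeasure (tail_measure \<alpha>) {a<..} = ennreal (a powr (- \<alpha>))"
proof -
  let ?f = "\<lambda>x::real. ennreal (\<alpha> * x powr (- \<alpha> - 1) * indicator {0<..} x)"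
  have "emeasure (tail_measure \<alpha>) {a<..} = (\<integral>\<^sup>+x. ?f x * indicator {a<..} x \<partial>lborel)"
    unfolding tail_measure_def by (rule emeasure_density) auto
  also have "\<dots> = (\<integral>\<^sup>+x. ennreal (\<alpha> * x powr (- \<alpha> - 1)) * indicator {a..} x \<partial>lborel)"
    using AE_lborel_singleton[of a] assms
    by (intro nn_integral_cong_AE) (auto elim!: eventually_mono simp: indicator_def)
  also have "\<dots> = ennreal (0 - (- (a powr (- \<alpha>))))"
  proof (rule nn_integral_FTC_atLeast)
    show "DERIV (\<lambda>x. - (x powr (- \<alpha>))) x :> \<alpha> * x powr (- \<alpha> - 1)" if "a \<le> x" for x
      using that assms by (auto intro!: derivative_eq_intros)
    show "((\<lambda>x. - (x powr (- \<alpha>))) \<longlongrightarrow> 0) at_top"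
      using tendsto_neg_powr[of "- \<alpha>" "\<lambda>x::real. x" at_top] assms
      tendsto_minus[of "\<lambda>x. x powr (- \<alpha>)" 0 at_top] by (simp add: filterlim_ident)
  qed (use assms in auto)
  finally show ?thesis by simp
qed

section \<open>The characteristic functional for finitely many labels\<close>

context poisson_cluster_points
begin

lemma measurable_P [measurable]: "P i \<in> borel_measurable M" by (rule random_P)
lemma measurable_Q [measurable]: "Q i j \<in> borel_measurable M" by (rule random_Q)

text \<open>The contribution of cluster \<open>i\<close>, placed at \<open>v\<close>, to \<open>exp (\<i> u N(g))\<close>. The sum over the
  cluster may be infinite, in which case \<open>enn2real\<close> makes it \<open>0\<close>.\<close>

definition cluster_iexp :: "(real \<Rightarrow> real) \<Rightarrow> real \<Rightarrow> nat \<Rightarrow> real \<Rightarrow> 'w \<Rightarrow> complex" where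
  "cluster_iexp g u i v \<omega> = iexp (u * enn2real (point_sum (Q i) (\<lambda>y. g (v * y)) \<omega>))"

definition cluster_char :: "(real \<Rightarrow> real) \<Rightarrow> real \<Rightarrow> real \<Rightarrow> complex" where
  "cluster_char g u v = expectation (cluster_iexp g u 0 v)"

lemma norm_cluster_iexp [simp]: "cmod (cluster_iexp g u i v \<omega>) = 1"
  by (simp add: cluster_iexp_def)

lemma cluster_iexp_measurable [measurable]:
  assumes [measurable]: "g \<in> borel_measurable borel"
  shows "cluster_iexp g u i v \<in> borel_measurable M"
  unfolding cluster_iexp_def[abs_def] by measurable

lemma norm_cluster_char:
  assumes "g \<in> borel_measurable borel"
  shows "cmod (cluster_char g u v) \<le> 1"
proof -
  have "cmod (cluster_char g u v) \<le> expectation (\<lambda>\<omega>. cmod (cluster_iexp g u 0 v \<omega>))"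
    unfolding cluster_char_def by (rule integral_norm_bound)
  then show ?thesis by (simp add: prob_space)
qed

lemma cluster_iexp_0 [simp]: "g 0 = 0 \<Longrightarrow> cluster_iexp g u i 0 \<omega> = 1"
  by (simp add: cluster_iexp_def point_sum_def)

lemma cluster_char_0 [simp]:
  assumes "g 0 = 0" shows "cluster_char g u 0 = 1"
proof -
  have "cluster_iexp g u 0 0 = (\<lambda>_. 1)" using assms by (intro ext) simp
  then show ?thesis by (simp add: cluster_char_def prob_space)
qed

text \<open>Clusters are independent and identically distributed only as unlabelled measures, so the
  contribution of a cluster has to be exhibited as a function of its measure, the same for all
  i.\<close>

lemma cluster_iexp_eq:
  assumes [measurable]: "g \<in> borel_measurable borel" and "g 0 = 0"
  shows "\<exists>c \<in> borel_measurable measure_algebra. \<forall>i \<omega>. cluster_iexp g u i v \<omega> = c (dirac_sum UNIV (\<lambda>j. Q i j \<omega>))"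
proof (intro bexI allI)
  let ?c = "\<lambda>m. iexp (u * enn2real (\<integral>\<^sup>+y. ennreal (g (v * y)) \<partial>m))"
  have h: "(\<lambda>y. ennreal (g (v * y))) \<in> borel_measurable punctured_borel" by (intro borel_imp_punctured) simp
  have [measurable]: "(\<lambda>m. \<integral>\<^sup>+y. ennreal (g (v * y)) \<partial>m) \<in> borel_measurable measure_algebra"
    by (rule measurable_nn_integral_measure_algebra[OF h])
  show "?c \<in> borel_measurable measure_algebra" by measurable
  show "cluster_iexp g u i v \<omega> = ?c (dirac_sum UNIV (\<lambda>j. Q i j \<omega>))" for i \<omega>
    using nn_integral_dirac_sum[OF h, of UNIV "\<lambda>j. Q i j \<omega>"] assms by (simp add: cluster_iexp_def point_sum_def)
qed

lemma expectation_cluster_iexp: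
  assumes "g \<in> borel_measurable borel" "g 0 = 0"
  shows "expectation (cluster_iexp g u i v) = cluster_char g u v"
proof -
  obtain c where [measurable]: "c \<in> borel_measurable measure_algebra"
    and c: "\<And>i \<omega>. cluster_iexp g u i v \<omega> = c (dirac_sum UNIV (\<lambda>j. Q i j \<omega>))"
    using cluster_iexp_eq[OF assms] by blast
  have d: "expectation (cluster_iexp g u i v) = (\<integral>m. c m \<partial>distr M measure_algebra (\<lambda>\<omega>. dirac_sum UNIV (\<lambda>j. Q i j \<omega>)))" for i
    unfolding c[abs_def] by (rule integral_distr[symmetric]) (auto intro: measurable_dirac_sum)
  show ?thesis unfolding cluster_char_def d identical_Q[of i] ..
qed

text \<open>This replaces conditioning on the centres: on the event that the labels form a fixed
  pattern s, the clusters sit at the deterministic positions \<open>v (s i)\<close>, and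
  independence factorises the expectation.\<close>

lemma expectation_labelled_clusters:
  fixes lab :: "real \<Rightarrow> nat"
  assumes g: "g \<in> borel_measurable borel" "g 0 = 0" and lab[measurable]: "lab \<in> measurable borel (count_space UNIV)"
  shows "expectation (\<lambda>\<omega>. of_bool (\<forall>i<n. lab (P i \<omega>) = s i) * (\<Prod>i<n. cluster_iexp g u i (v (s i)) \<omega>))
    = expectation (\<lambda>\<omega>. of_bool (\<forall>i<n. lab (P i \<omega>) = s i)) * (\<Prod>i<n. cluster_char g u (v (s i)))"
proof -
  note [measurable] = g(1)
  \<comment> \<open>Indexed like the independence assumption: \<open>None\<close> is the event about
    the centres, \<open>Some i\<close> the i-th cluster.\<close>
  define F where "F k \<omega> = (case k of None \<Rightarrow> (of_bool (\<forall>i<n. lab (P i \<omega>) = s i) :: complex)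
     | Some i \<Rightarrow> cluster_iexp g u i (v (s i)) \<omega>)" for k \<omega>
  define c where "c l x = (if lab x = l then 1 else 0 :: complex)" for l x
  have c: "c l \<in> borel_measurable borel" for l
    unfolding c_def[abs_def] by (rule measurable_compose[OF lab]) simp
  \<comment> \<open>The product form displays the event as a measurable function of the sequence of
    centres.\<close>
  have prod_c: "(of_bool (\<forall>i<n. lab (p i) = s i) :: complex) = (\<Prod>i<n. c (s i) (p i))" for p
    by (induction n) (auto simp: c_def less_Suc_eq)
  have FM: "F k \<in> borel_measurable M" for k
  proof (cases k)
    case None
    have "(\<lambda>\<omega>. \<Prod>i<n. c (s i) (P i \<omega>)) \<in> borel_measurable M"
      by (intro borel_measurable_prod measurable_compose[OF random_P c])
    then show ?thesis unfolding F_def[abs_def] None option.case prod_c .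
  next
    case (Some i)
    then show ?thesis using cluster_iexp_measurable[OF g(1)] by (simp only: F_def[abs_def] option.case)
  qed
  have ind: "indep_vars (\<lambda>_. borel) F UNIV"
    unfolding indep_vars_def
  proof (intro conjI ballI)
    show "indep_sets (\<lambda>i. sigma_sets (space M) {F i -` A \<inter> space M |A. A \<in> sets borel}) UNIV"
    proof (rule indep_sets_mono_sets[OF independent])
      fix k :: "nat option"
      show "sigma_sets (space M) {F k -` A \<inter> space M |A. A \<in> sets borel} \<subseteq>
        case_option (sets (vimage_algebra (space M) (\<lambda>\<omega> i. P i \<omega>) (\<Pi>\<^sub>M i\<in>UNIV. borel)))
            (\<lambda>i. sets (vimage_algebra (space M) (\<lambda>\<omega>. dirac_sum UNIV (\<lambda>j. Q i j \<omega>)) measure_algebra)) k"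
      proof (cases k)
        case None
        have "(\<lambda>p. \<Prod>i<n. c (s i) (p i)) \<in> borel_measurable (\<Pi>\<^sub>M i\<in>(UNIV::nat set). borel)"
          by (intro borel_measurable_prod measurable_compose[OF measurable_component_singleton[where M="\<lambda>_. borel"] c]) simp
        then show ?thesis unfolding None option.case
        proof (rule sigma_sets_vimage_subset[rotated])
          show "(\<lambda>\<omega> i. P i \<omega>) \<in> space M \<rightarrow> space (\<Pi>\<^sub>M i\<in>UNIV. borel)" by (simp add: space_PiM)
          show "F None \<omega> = (\<Prod>i<n. c (s i) (P i \<omega>))" for \<omega> by (simp only: F_def option.case prod_c)
        qed
      next
        case (Some i)
        obtain d where d: "d \<in> borel_measurable measure_algebra"
          "\<And>i' \<omega>. cluster_iexp g u i' (v (s i)) \<omega> = d (dirac_sum UNIV (\<lambda>j. Q i' j \<omega>))"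
          using cluster_iexp_eq[OF g, of u "v (s i)"] by blast
        show ?thesis unfolding Some option.case
          by (rule sigma_sets_vimage_subset[OF _ d(1)]) (auto simp: F_def d(2) space_measure_algebra)
      qed
    qed
  qed (rule FM)
  let ?I = "insert None (Some ` {..<n})"
  have ind': "indep_vars (\<lambda>_. borel) F ?I" by (rule indep_vars_subset[OF ind]) auto
  have int: "integrable M (F k)" for k
    by (rule integrable_const_bound[of _ 1, OF _ FM]) (auto simp: F_def split: option.split)
  have split: "(\<Prod>k\<in>?I. G k) = G None * (\<Prod>i<n. G (Some i))" for G :: "nat option \<Rightarrow> complex"
    by (subst prod.insert) (auto simp: prod.reindex)
  have "expectation (\<lambda>\<omega>. \<Prod>k\<in>?I. F k \<omega>) = (\<Prod>k\<in>?I. expectation (F k))"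
    by (rule indep_vars_lebesgue_integral[OF _ ind' int]) auto
  then show ?thesis unfolding split
    by (simp add: F_def[abs_def] expectation_cluster_iexp[OF g])
qed

text \<open>Labels bounded by L leave finitely many patterns for the first n centres; summing over
  the patterns recovers the full expectation.\<close>

lemma expectation_prod_clusters:
  fixes lab :: "real \<Rightarrow> nat"
  assumes g: "g \<in> borel_measurable borel" "g 0 = 0" and lab[measurable]: "lab \<in> measurable borel (count_space UNIV)"
    and L: "\<And>x. lab x \<le> L"
  shows "expectation (\<lambda>\<omega>. \<Prod>i<n. cluster_iexp g u i (v (lab (P i \<omega>))) \<omega>)
    = expectation (\<lambda>\<omega>. \<Prod>i<n. cluster_char g u (v (lab (P i \<omega>))))"
proof -
  note [measurable] = g(1)
  define S where "S = {..<n} \<rightarrow>\<^sub>E {..L}"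
  have fS: "finite S" by (auto simp: S_def intro: finite_PiE)
  have expand: "(\<Prod>i<n. f i (lab (P i \<omega>))) = (\<Sum>s\<in>S. of_bool (\<forall>i<n. lab (P i \<omega>) = s i) * (\<Prod>i<n. f i (s i)))"
    for f :: "nat \<Rightarrow> nat \<Rightarrow> complex" and \<omega>
  proof -
    \<comment> \<open>The pattern realised at \<omega>, the only one whose event occurs.\<close>
    define s0 where "s0 = (\<lambda>i\<in>{..<n}. lab (P i \<omega>))"
    have s0: "s0 \<in> S" using L by (auto simp: s0_def S_def)
    have "of_bool (\<forall>i<n. lab (P i \<omega>) = s i) = (of_bool (s = s0) :: complex)" if "s \<in> S" for s
    proof -
      have "(\<forall>i<n. lab (P i \<omega>) = s i) \<longleftrightarrow> s = s0"
      proof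
        assume *: "\<forall>i<n. lab (P i \<omega>) = s i"
        show "s = s0" by (rule PiE_ext[OF that[unfolded S_def] s0[unfolded S_def]]) (use * in \<open>simp add: s0_def\<close>)
      qed (simp add: s0_def)
      then show ?thesis by simp
    qed
    then have "(\<Sum>s\<in>S. of_bool (\<forall>i<n. lab (P i \<omega>) = s i) * (\<Prod>i<n. f i (s i))) = (\<Sum>s\<in>S. if s = s0 then (\<Prod>i<n. f i (s i)) else 0)"
      by (intro sum.cong) auto
    also have "\<dots> = (\<Prod>i<n. f i (s0 i))" using sum.delta[OF fS, of s0 "\<lambda>s. \<Prod>i<n. f i (s i)"] s0 by simp
    also have "\<dots> = (\<Prod>i<n. f i (lab (P i \<omega>)))" by (intro prod.cong) (auto simp: s0_def)
    finally show ?thesis by simp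
  qed
  have i1: "integrable M (\<lambda>\<omega>. of_bool (\<forall>i<n. lab (P i \<omega>) = s i) * (\<Prod>i<n. cluster_iexp g u i (v (s i)) \<omega>))" for s
    by (rule integrable_const_bound[of _ 1]) (auto simp: norm_mult prod_norm[symmetric])
  have i2: "integrable M (\<lambda>\<omega>. of_bool (\<forall>i<n. lab (P i \<omega>) = s i) :: complex)" for s
    by (rule integrable_const_bound[of _ 1]) auto
  have "expectation (\<lambda>\<omega>. \<Prod>i<n. cluster_iexp g u i (v (lab (P i \<omega>))) \<omega>)
     = expectation (\<lambda>\<omega>. \<Sum>s\<in>S. of_bool (\<forall>i<n. lab (P i \<omega>) = s i) * (\<Prod>i<n. cluster_iexp g u i (v (s i)) \<omega>))"
    by (intro Bochner_Integration.integral_cong refl expand[of "\<lambda>i l. cluster_iexp g u i (v l) \<omega>" \<omega> for \<omega>])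
  also have "\<dots> = (\<Sum>s\<in>S. expectation (\<lambda>\<omega>. of_bool (\<forall>i<n. lab (P i \<omega>) = s i)) * (\<Prod>i<n. cluster_char g u (v (s i))))"
    using i1 by (simp only: Bochner_Integration.integral_sum expectation_labelled_clusters[OF g lab])
  also have "\<dots> = expectation (\<lambda>\<omega>. \<Sum>s\<in>S. of_bool (\<forall>i<n. lab (P i \<omega>) = s i) * (\<Prod>i<n. cluster_char g u (v (s i))))"
    using i2 by (subst Bochner_Integration.integral_sum) auto
  also have "\<dots> = expectation (\<lambda>\<omega>. \<Prod>i<n. cluster_char g u (v (lab (P i \<omega>))))"
    by (intro Bochner_Integration.integral_cong refl expand[of "\<lambda>i l. cluster_char g u (v l)" \<omega> for \<omega>, symmetric])
  finally show ?thesis .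
qed

text \<open>Label 0 collects the discarded centres, possibly infinitely many, and w 0 = 1 makes them
  neutral. The other cells have finite intensity; their counts are independent Poisson variables,
  and the limit is the product of their generating functions.\<close>

lemma poisson_labels:
  fixes lab :: "real \<Rightarrow> nat" and w :: "nat \<Rightarrow> complex"
  assumes lab[measurable]: "lab \<in> measurable borel (count_space UNIV)"
    and L: "\<And>x. lab x \<le> L" and lab0: "lab 0 = 0"
    and fin: "\<And>l. l \<ge> 1 \<Longrightarrow> emeasure (tail_measure \<alpha>) {x. lab x = l} < \<infinity>"
    and w: "\<And>l. cmod (w l) \<le> 1" "w 0 = 1"
  shows "AE \<omega> in M. finite {i. lab (P i \<omega>) \<noteq> 0}"
    and "(\<lambda>n. expectation (\<lambda>\<omega>. \<Prod>i<n. w (lab (P i \<omega>)))) \<longlonglongrightarrow>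
      (\<Prod>l=1..L. exp (of_real (measure (tail_measure \<alpha>) {x. lab x = l}) * (w l - 1)))"
proof -
  have wlab: "(\<lambda>x. w (lab x)) \<in> borel_measurable borel" by (rule measurable_compose[OF lab]) simp
  have wP: "(\<lambda>\<omega>. w (lab (P i \<omega>))) \<in> borel_measurable M" for i
    by (rule measurable_compose[OF random_P wlab])
  define A where "A l = {x. lab x = l}" for l
  have [measurable]: "A l \<in> sets borel" for l unfolding A_def by measurable
  have Ap: "A l \<in> sets punctured_borel" if "l \<ge> 1" for l using that lab0 by (auto simp: punctured_sets_iff A_def)
  define E where "E l \<omega> = emeasure (dirac_sum UNIV (\<lambda>i. P i \<omega>)) (A l)" for l \<omega>
  have E_eq: "E l \<omega> = emeasure (count_space UNIV) {i. lab (P i \<omega>) = l}" if "l \<ge> 1" for l \<omega>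
  proof -
    have "E l \<omega> = (\<integral>\<^sup>+i. indicator {i. lab (P i \<omega>) = l} i \<partial>count_space UNIV)"
      unfolding E_def emeasure_dirac_sum[OF Ap[OF that]] by (intro nn_integral_cong) (auto simp: indicator_def A_def)
    then show ?thesis by simp
  qed
  have ind: "indep_vars (\<lambda>_. borel) E {1..L}"
  proof -
    have "disjoint_family_on A {1..L}" by (auto simp: disjoint_family_on_def A_def)
    moreover have "A ` {1..L} \<subseteq> sets punctured_borel" using Ap by auto
    ultimately show ?thesis using poisson_P unfolding poisson_process_def E_def by blast
  qed
  have Em: "E l \<in> borel_measurable M" if "l \<in> {1..L}" for l using ind that by (auto simp: indep_vars_def)
  have poi: "prob {\<omega>\<in>space M. E l \<omega> = of_nat k} = measure (tail_measure \<alpha>) (A l) ^ k / fact k * exp (- measure (tail_measure \<alpha>) (A l))"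
    if "l \<in> {1..L}" for l k
    using poisson_P Ap[of l] fin[of l] that unfolding poisson_process_def E_def A_def by auto
  have AEl: "AE \<omega> in M. \<exists>k. E l \<omega> = of_nat k" if "l \<in> {1..L}" for l
    by (rule poisson_count(1)[OF Em[OF that] _ poi[OF that]]) simp
  have AEfin: "AE \<omega> in M. \<forall>l\<in>{1..L}. finite {i. lab (P i \<omega>) = l}"
  proof (rule AE_finite_allI)
    fix l assume l: "l \<in> {1..L}"
    have "finite {i. lab (P i \<omega>) = l}" if "\<exists>k. E l \<omega> = of_nat k" for \<omega>
    proof (rule ccontr)
      assume "infinite {i. lab (P i \<omega>) = l}"
      then have "E l \<omega> = \<infinity>" using E_eq[of l \<omega>] l by simp
      then show False using that by auto
    qed
    then show "AE \<omega> in M. finite {i. lab (P i \<omega>) = l}" using AEl[OF l] by (auto elim: eventually_mono)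
  qed simp
  show 1: "AE \<omega> in M. finite {i. lab (P i \<omega>) \<noteq> 0}"
    using AEfin
  proof eventually_elim
    case (elim \<omega>)
    have "{i. lab (P i \<omega>) \<noteq> 0} \<subseteq> (\<Union>l\<in>{1..L}. {i. lab (P i \<omega>) = l})" using L by (auto simp: Suc_le_eq)
    then show ?case using elim by (auto intro: finite_subset)
  qed
  define c where "c l \<omega> = nat \<lfloor>enn2real (E l \<omega>)\<rfloor>" for l \<omega>
  have c: "c l \<omega> = card {i. lab (P i \<omega>) = l}" if "finite {i. lab (P i \<omega>) = l}" "l \<ge> 1" for l \<omega>
    using that by (simp add: c_def E_eq)
  \<comment> \<open>Almost surely only finitely many factors differ from 1, so the product is
    eventually constant in n.\<close>
  have AElim: "AE \<omega> in M. (\<lambda>n. \<Prod>i<n. w (lab (P i \<omega>))) \<longlonglongrightarrow> (\<Prod>l=1..L. w l ^ c l \<omega>)"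
    using 1
  proof eventually_elim
    case (elim \<omega>)
    let ?S = "{i. lab (P i \<omega>) \<noteq> 0}"
    obtain n0 where n0: "?S \<subseteq> {..<n0}" using finite_nat_iff_bounded elim by blast
    have "(\<Prod>i<n. w (lab (P i \<omega>))) = (\<Prod>l=1..L. w l ^ c l \<omega>)" if "n \<ge> n0" for n
    proof -
      have "(\<Prod>i<n. w (lab (P i \<omega>))) = (\<Prod>i\<in>?S. w (lab (P i \<omega>)))"
        using n0 that w by (intro prod.mono_neutral_right) auto
      also have "\<dots> = (\<Prod>l\<in>{1..L}. \<Prod>i\<in>{i\<in>?S. lab (P i \<omega>) = l}. w (lab (P i \<omega>)))"
        using elim L by (intro prod.group[symmetric]) (auto simp: Suc_le_eq)
      also have "\<dots> = (\<Prod>l\<in>{1..L}. w l ^ c l \<omega>)"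
      proof (rule prod.cong[OF refl])
        fix l assume l: "l \<in> {1..L}"
        have eq: "{i\<in>?S. lab (P i \<omega>) = l} = {i. lab (P i \<omega>) = l}" using l by auto
        have f: "finite {i. lab (P i \<omega>) = l}" by (rule finite_subset[OF _ elim]) (use l in auto)
        have "(\<Prod>i\<in>{i. lab (P i \<omega>) = l}. w (lab (P i \<omega>))) = (\<Prod>i\<in>{i. lab (P i \<omega>) = l}. w l)"
          by (intro prod.cong) auto
        also have "\<dots> = w l ^ card {i. lab (P i \<omega>) = l}" by simp
        finally show "(\<Prod>i\<in>{i\<in>?S. lab (P i \<omega>) = l}. w (lab (P i \<omega>))) = w l ^ c l \<omega>"
          using c[OF f] l unfolding eq by simp
      qed
      finally show ?thesis .
    qed
    then show ?case by (intro tendsto_eventually) (auto simp: eventually_sequentially)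
  qed
  have cm: "(\<lambda>\<omega>. w l ^ c l \<omega>) \<in> borel_measurable M" if "l \<in> {1..L}" for l
  proof -
    have "(\<lambda>e. w l ^ nat \<lfloor>enn2real e\<rfloor>) \<in> borel_measurable borel" by measurable
    from measurable_compose[OF Em[OF that] this] show ?thesis by (simp add: c_def)
  qed
  have "(\<lambda>n. expectation (\<lambda>\<omega>. \<Prod>i<n. w (lab (P i \<omega>)))) \<longlonglongrightarrow> expectation (\<lambda>\<omega>. \<Prod>l=1..L. w l ^ c l \<omega>)"
  proof (rule integral_dominated_convergence[where w="\<lambda>_. 1"])
    show "AE \<omega> in M. cmod (\<Prod>i<n. w (lab (P i \<omega>))) \<le> 1" for n
      using w by (auto simp: prod_norm[symmetric] intro!: prod_le_1)
  qed (use AElim cm wP in \<open>auto intro!: borel_measurable_prod\<close>)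
  also have "expectation (\<lambda>\<omega>. \<Prod>l=1..L. w l ^ c l \<omega>) = (\<Prod>l=1..L. expectation (\<lambda>\<omega>. w l ^ c l \<omega>))"
  proof (rule indep_vars_lebesgue_integral)
    show "indep_vars (\<lambda>_. borel) (\<lambda>l \<omega>. w l ^ c l \<omega>) {1..L}"
      unfolding c_def by (rule indep_vars_compose2[OF ind, where Y="\<lambda>l e. w l ^ nat \<lfloor>enn2real e\<rfloor>"]) measurable
    show "integrable M (\<lambda>\<omega>. w l ^ c l \<omega>)" if "l \<in> {1..L}" for l
      by (rule integrable_const_bound[of _ 1, OF _ cm[OF that]]) (use w in \<open>auto simp: norm_power intro!: power_le_one\<close>)
  qed simp
  also have "\<dots> = (\<Prod>l=1..L. exp (of_real (measure (tail_measure \<alpha>) {x. lab x = l}) * (w l - 1)))"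
    unfolding c_def A_def[symmetric] by (intro prod.cong refl poisson_count(2)[OF Em _ poi]) auto
  finally show "(\<lambda>n. expectation (\<lambda>\<omega>. \<Prod>i<n. w (lab (P i \<omega>)))) \<longlonglongrightarrow>
      (\<Prod>l=1..L. exp (of_real (measure (tail_measure \<alpha>) {x. lab x = l}) * (w l - 1)))" .
qed

text \<open>Only finitely many pairs contribute, so from some n on the first n rows exhaust the
  sum.\<close>

lemma point_sum_prod:
  fixes z :: "nat \<times> nat \<Rightarrow> 'w \<Rightarrow> real"
  assumes fin: "finite {p. g (z p \<omega>) \<noteq> 0}" and g: "\<And>x. 0 \<le> g x"
  shows "\<exists>n0. \<forall>n\<ge>n0. (\<Sum>i<n. enn2real (point_sum (\<lambda>j. z (i, j)) g \<omega>)) = enn2real (point_sum z g \<omega>)"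
proof -
  let ?S = "{p. g (z p \<omega>) \<noteq> 0}"
  obtain n0 where n0: "fst ` ?S \<subseteq> {..<n0}" using finite_nat_iff_bounded fin by (meson finite_imageI)
  have fini: "finite {j. g (z (i, j) \<omega>) \<noteq> 0}" for i
    by (rule finite_subset[OF _ finite_imageI[OF fin, of snd]]) force
  have row: "enn2real (point_sum (\<lambda>j. z (i, j)) g \<omega>) = (\<Sum>j\<in>{j. g (z (i, j) \<omega>) \<noteq> 0}. g (z (i, j) \<omega>))" for i
    using point_sum_finite[of g "\<lambda>j. z (i, j)" \<omega>] fini g by (simp add: sum_nonneg)
  have "(\<Sum>i<n. enn2real (point_sum (\<lambda>j. z (i, j)) g \<omega>)) = enn2real (point_sum z g \<omega>)" if "n \<ge> n0" for n
  proof -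
    have "(\<Sum>i<n. enn2real (point_sum (\<lambda>j. z (i, j)) g \<omega>)) = (\<Sum>(i, j)\<in>(SIGMA i:{..<n}. {j. g (z (i, j) \<omega>) \<noteq> 0}). g (z (i, j) \<omega>))"
      unfolding row by (rule sum.Sigma) (auto simp: fini)
    also have "(SIGMA i:{..<n}. {j. g (z (i, j) \<omega>) \<noteq> 0}) = ?S" using n0 that by force
    also have "(\<Sum>(i, j)\<in>?S. g (z (i, j) \<omega>)) = (\<Sum>p\<in>?S. g (z p \<omega>))" by (intro sum.cong) auto
    also have "\<dots> = enn2real (point_sum z g \<omega>)"
      using point_sum_finite[of g z \<omega>] fin g by (simp add: sum_nonneg)
    finally show ?thesis .
  qed
  then show ?thesis by blast
qed

text \<open>The limit in n of the identity for the first n clusters: one side becomes the whole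
  process, the other the Poisson product. With v 0 = 0 the discarded centres send all their points
  to the value 0, which encodes absence.\<close>

lemma expectation_labelled_process:
  fixes lab :: "real \<Rightarrow> nat"
  assumes g[measurable]: "g \<in> borel_measurable borel" and g0: "g 0 = 0" "\<And>x. 0 \<le> g x"
    and lab[measurable]: "lab \<in> measurable borel (count_space UNIV)"
    and L: "\<And>x. lab x \<le> L" and lab0: "lab 0 = 0"
    and fin: "\<And>l. l \<ge> 1 \<Longrightarrow> emeasure (tail_measure \<alpha>) {x. lab x = l} < \<infinity>"
    and v0: "v 0 = 0"
    and locfin: "AE \<omega> in M. finite {(i, j). g (v (lab (P i \<omega>)) * Q i j \<omega>) \<noteq> 0}"
  shows "expectation (\<lambda>\<omega>. iexp (u * enn2real (point_sum (\<lambda>(i, j) \<omega>. v (lab (P i \<omega>)) * Q i j \<omega>) g \<omega>)))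
    = (\<Prod>l=1..L. exp (of_real (measure (tail_measure \<alpha>) {x. lab x = l}) * (cluster_char g u (v l) - 1)))"
proof -
  let ?z = "\<lambda>(i, j) \<omega>. v (lab (P i \<omega>)) * Q i j \<omega>"
  have vlab: "(\<lambda>x. v (lab x)) \<in> borel_measurable borel" by (rule measurable_compose[OF lab]) simp
  have zm: "?z p \<in> borel_measurable M" for p
    by (cases p) (auto intro!: borel_measurable_times measurable_compose[OF random_P vlab])
  have ci: "cluster_iexp g u i (v (lab (P i \<omega>))) \<omega> = iexp (u * enn2real (point_sum (\<lambda>j. ?z (i, j)) g \<omega>))" for i \<omega>
    by (simp add: cluster_iexp_def point_sum_def)
  have pm: "point_sum (\<lambda>j. ?z (i, j)) g \<in> borel_measurable M" for i
    by (rule point_sum_measurable[OF zm g])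
  have pmz: "point_sum ?z g \<in> borel_measurable M" by (rule point_sum_measurable[OF zm g])
  have "(\<lambda>n. expectation (\<lambda>\<omega>. \<Prod>i<n. cluster_iexp g u i (v (lab (P i \<omega>))) \<omega>)) \<longlonglongrightarrow>
     expectation (\<lambda>\<omega>. iexp (u * enn2real (point_sum ?z g \<omega>)))"
  proof (rule integral_dominated_convergence[where w="\<lambda>_. 1"])
    show "AE \<omega> in M. (\<lambda>n. \<Prod>i<n. cluster_iexp g u i (v (lab (P i \<omega>))) \<omega>) \<longlonglongrightarrow> iexp (u * enn2real (point_sum ?z g \<omega>))"
      using locfin
    proof eventually_elim
      case (elim \<omega>)
      have "finite {p. g (?z p \<omega>) \<noteq> 0}" using elim by (simp add: case_prod_unfold)
      from point_sum_prod[where z="?z" and g=g and \<omega>=\<omega>, OF this g0(2)] obtain n0 where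
        n0: "\<And>n. n \<ge> n0 \<Longrightarrow> (\<Sum>i<n. enn2real (point_sum (\<lambda>j. ?z (i, j)) g \<omega>)) = enn2real (point_sum ?z g \<omega>)" by blast
      have "(\<Prod>i<n. cluster_iexp g u i (v (lab (P i \<omega>))) \<omega>) = iexp (u * enn2real (point_sum ?z g \<omega>))" if "n \<ge> n0" for n
        unfolding ci n0[OF that, symmetric] by (simp add: exp_sum sum_distrib_left)
      then show ?case by (intro tendsto_eventually) (auto simp: eventually_sequentially)
    qed
    show "AE \<omega> in M. cmod (\<Prod>i<n. cluster_iexp g u i (v (lab (P i \<omega>))) \<omega>) \<le> 1" for n
      by (simp add: prod_norm[symmetric])
    show "(\<lambda>\<omega>. iexp (u * enn2real (point_sum ?z g \<omega>))) \<in> borel_measurable M" using pmz by measurable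
    show "(\<lambda>\<omega>. \<Prod>i<n. cluster_iexp g u i (v (lab (P i \<omega>))) \<omega>) \<in> borel_measurable M" for n
      unfolding ci using pm by measurable
  qed simp
  moreover have "(\<lambda>n. expectation (\<lambda>\<omega>. \<Prod>i<n. cluster_char g u (v (lab (P i \<omega>))))) \<longlonglongrightarrow>
      (\<Prod>l=1..L. exp (of_real (measure (tail_measure \<alpha>) {x. lab x = l}) * (cluster_char g u (v l) - 1)))"
    by (rule poisson_labels(2)[OF lab L lab0 fin, of "\<lambda>l. cluster_char g u (v l)"])
      (use norm_cluster_char[OF g] g0 v0 in auto)
  ultimately show ?thesis unfolding expectation_prod_clusters[OF g g0(1) lab L]
    by (rule LIMSEQ_unique)
qed

end

text \<open>Divided by 2^k, the label rounds x down to a multiple of 2^(-k), capped at 2^k;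
  \<open>nat\<close> sends negative x to 0. The cap makes the set of labels finite, and label 0 is
  left for the accumulation of centres at 0.\<close>

definition dyadic_label :: "nat \<Rightarrow> real \<Rightarrow> nat" where
  "dyadic_label k x = nat \<lfloor>min (2 ^ k * x) (4 ^ k)\<rfloor>"

lemma dyadic_label_measurable [measurable]: "dyadic_label k \<in> measurable borel (count_space UNIV)"
  unfolding dyadic_label_def[abs_def] by measurable

lemma dyadic_label_le: "dyadic_label k x \<le> 4 ^ k"
proof -
  have "\<lfloor>min (2 ^ k * x) (4 ^ k)\<rfloor> \<le> \<lfloor>(4::real) ^ k\<rfloor>" by (intro floor_mono) simp
  also have "\<lfloor>(4::real) ^ k\<rfloor> = 4 ^ k" using floor_of_int[of "4 ^ k", where ?'a = real] by simp
  finally show ?thesis by (simp add: dyadic_label_def nat_le_iff)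
qed

lemma dyadic_label_pos:
  assumes "dyadic_label k x = l" "l \<ge> 1" shows "1 \<le> 2 ^ k * x"
proof -
  have "1 \<le> \<lfloor>min (2 ^ k * x) (4 ^ k)\<rfloor>" using assms unfolding dyadic_label_def by linarith
  then have "1 \<le> min (2 ^ k * x) (4 ^ k)" by (simp only: one_le_floor)
  then show ?thesis by simp
qed

lemma dyadic_label_floor: "0 \<le> x \<Longrightarrow> real (dyadic_label k x) / 2 ^ k \<le> x"
proof -
  assume x: "0 \<le> x"
  have "real (dyadic_label k x) = of_int \<lfloor>min (2 ^ k * x) (4 ^ k)\<rfloor>" using x by (simp add: dyadic_label_def)
  also have "\<dots> \<le> 2 ^ k * x" by (rule order_trans[OF of_int_floor_le]) simp
  finally show ?thesis by (simp add: pos_divide_le_eq mult.commute)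
qed

lemma dyadic_label_limit:
  assumes x: "0 \<le> x"
  shows "(\<lambda>k. real (dyadic_label k x) / 2 ^ k) \<longlonglongrightarrow> x"
proof (rule tendsto_sandwich)
  show "\<forall>\<^sub>F k in sequentially. real (dyadic_label k x) / 2 ^ k \<le> x" using dyadic_label_floor[OF x] by simp
  obtain k0 where k0: "x < 2 ^ k0" using real_arch_pow[of 2 x] by auto
  have "x - (1/2) ^ k \<le> real (dyadic_label k x) / 2 ^ k" if "k \<ge> k0" for k
  proof -
    have "(2::real) ^ k0 \<le> 2 ^ k" using that by (intro power_increasing) auto
    then have "x \<le> 2 ^ k" using k0 by linarith
    then have "2 ^ k * x \<le> 2 ^ k * (2 ^ k)" by (intro mult_left_mono) auto
    also have "\<dots> = (4::real) ^ k" by (simp add: power_mult_distrib[symmetric])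
    finally have "real (dyadic_label k x) = of_int \<lfloor>2 ^ k * x\<rfloor>" using x by (simp add: dyadic_label_def)
    moreover have "2 ^ k * x - 1 \<le> of_int \<lfloor>2 ^ k * x\<rfloor>" by linarith
    ultimately have "(2 ^ k * x - 1) / 2 ^ k \<le> real (dyadic_label k x) / 2 ^ k" by (intro divide_right_mono) auto
    then show ?thesis by (simp add: diff_divide_distrib power_one_over)
  qed
  then show "\<forall>\<^sub>F k in sequentially. x - (1/2) ^ k \<le> real (dyadic_label k x) / 2 ^ k" by (auto simp: eventually_sequentially)
  show "(\<lambda>k. x - (1/2) ^ k) \<longlonglongrightarrow> x" using tendsto_diff[OF tendsto_const LIMSEQ_realpow_zero[of "1/2"]] by simp
qed simp

section \<open>From rounded centres to the cluster process\<close>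

context poisson_cluster_points
begin

text \<open>The intensity has no mass on the negative axis, so the Poisson count there is 0 with
  probability 1.\<close>

lemma P_nonneg: "AE \<omega> in M. \<forall>i. 0 \<le> P i \<omega>"
proof -
  have A: "{..<0::real} \<in> sets punctured_borel" by (simp add: punctured_sets_iff)
  have z: "emeasure (tail_measure \<alpha>) {..<0} = 0"
    unfolding tail_measure_def by (subst emeasure_density) (auto intro!: nn_integral_zero' AE_I2 simp: indicator_def)
  then have m: "measure (tail_measure \<alpha>) {..<0} = 0" by (simp add: measure_def)
  let ?E = "\<lambda>\<omega>. emeasure (dirac_sum UNIV (\<lambda>i. P i \<omega>)) {..<0}"
  have "prob {\<omega>\<in>space M. ?E \<omega> = of_nat 0} = measure (tail_measure \<alpha>) {..<0} ^ 0 / fact 0 * exp (- measure (tail_measure \<alpha>) {..<0})"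
  proof -
    have "emeasure (tail_measure \<alpha>) {..<0} < \<infinity>" using z by simp
    with A show ?thesis using poisson_P unfolding poisson_process_def by blast
  qed
  then have p1: "prob {\<omega>\<in>space M. ?E \<omega> = 0} = 1" by (simp add: m)
  have "?E = point_sum P (indicator {..<0})" using A by (auto simp: emeasure_dirac_sum point_sum_def ennreal_indicator)
  then have [measurable]: "?E \<in> borel_measurable M" by simp
  have "AE \<omega> in M. ?E \<omega> = 0" using p1 by (subst (asm) prob_Collect_eq_1) auto
  then show ?thesis
  proof eventually_elim
    case (elim \<omega>)
    then have "AE i in count_space UNIV. indicator {..<0} (P i \<omega>) = (0::ennreal)"
      unfolding emeasure_dirac_sum[OF A] by (subst (asm) nn_integral_0_iff_AE) auto
    then show ?case by (auto simp: AE_count_space indicator_def not_less[symmetric])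
  qed
qed

text \<open>Rounding a centre down cannot lift a point above a positive threshold. The sign of Q has
  to be settled first, since for negative Q rounding down moves the point upwards.\<close>

lemma dyadic_process_bound:
  assumes "0 \<le> P i \<omega>" "0 < c" "0 < \<delta>" "\<delta> < (real (dyadic_label k (c * P i \<omega>)) / 2 ^ k) * Q i j \<omega>"
  shows "\<delta> / c < P i \<omega> * Q i j \<omega>"
proof -
  let ?d = "real (dyadic_label k (c * P i \<omega>)) / 2 ^ k"
  have d: "0 \<le> ?d" "?d \<le> c * P i \<omega>" using assms by (auto intro!: dyadic_label_floor)
  have "0 < Q i j \<omega>"
  proof (rule ccontr)
    assume "\<not> ?thesis"
    then have "?d * Q i j \<omega> \<le> 0" using d(1) by (intro mult_nonneg_nonpos) auto
    then show False using assms by linarith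
  qed
  then have "?d * Q i j \<omega> \<le> (c * P i \<omega>) * Q i j \<omega>" using d by (intro mult_right_mono) auto
  then have "\<delta> < c * (P i \<omega> * Q i j \<omega>)" using assms by (simp add: mult_ac)
  then show ?thesis using assms by (simp add: pos_divide_less_eq mult.commute)
qed

text \<open>As g vanishes below \<delta>, for every k the rounded sum runs over the same almost
  surely finite set of pairs, those whose point P Q exceeds \<delta> / c. On this set the points
  converge and g is continuous.\<close>

lemma dyadic_process_limit:
  assumes g: "continuous_on UNIV g" "\<And>x. 0 \<le> g x" "0 < \<delta>" "\<And>x. x \<le> \<delta> \<Longrightarrow> g x = 0"
    and locfin: "AE \<omega> in M. \<forall>\<delta>>0. finite {(i, j). \<delta> < P i \<omega> * Q i j \<omega>}"
    and c: "0 < c"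
  shows "(\<lambda>k. expectation (\<lambda>\<omega>. iexp (u * enn2real (point_sum (\<lambda>(i, j) \<omega>. real (dyadic_label k (c * P i \<omega>)) / 2 ^ k * Q i j \<omega>) g \<omega>))))
     \<longlonglongrightarrow> expectation (\<lambda>\<omega>. iexp (u * enn2real (point_sum (\<lambda>(i, j) \<omega>. P i \<omega> * Q i j \<omega>) (\<lambda>x. g (c * x)) \<omega>)))"
    and "AE \<omega> in M. finite {(i, j). g (real (dyadic_label k (c * P i \<omega>)) / 2 ^ k * Q i j \<omega>) \<noteq> 0}"
proof -
  have gm[measurable]: "g \<in> borel_measurable borel" using g by (auto intro: borel_measurable_continuous_onI)
  let ?d = "\<lambda>k i \<omega>. real (dyadic_label k (c * P i \<omega>)) / 2 ^ k"
  let ?z = "\<lambda>k. \<lambda>(i, j) \<omega>. ?d k i \<omega> * Q i j \<omega>"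
  let ?z' = "\<lambda>(i, j) \<omega>. P i \<omega> * Q i j \<omega>"
  have dm: "(\<lambda>\<omega>. ?d k i \<omega>) \<in> borel_measurable M" for k i
  proof -
    have "(\<lambda>x. real (dyadic_label k (c * x)) / 2 ^ k) \<in> borel_measurable borel" by measurable
    from measurable_compose[OF random_P this] show ?thesis .
  qed
  have zm: "?z k p \<in> borel_measurable M" for k p
    using dm by (cases p) (auto intro!: borel_measurable_times)
  have zm': "?z' p \<in> borel_measurable M" for p by (cases p) auto
  have pm: "point_sum (?z k) g \<in> borel_measurable M" for k by (rule point_sum_measurable[OF zm gm])
  have pm': "point_sum ?z' (\<lambda>x. g (c * x)) \<in> borel_measurable M" by (rule point_sum_measurable[OF zm']) measurable
  have sub: "{p. g (?z k p \<omega>) \<noteq> 0} \<subseteq> {p. \<delta> / c < ?z' p \<omega>}" if "\<forall>i. 0 \<le> P i \<omega>" for k \<omega>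
  proof
    fix p assume p: "p \<in> {p. g (?z k p \<omega>) \<noteq> 0}"
    obtain i j where ij: "p = (i, j)" by (cases p)
    have "\<delta> < ?d k i \<omega> * Q i j \<omega>" using p g(4) by (force simp: ij not_le[symmetric])
    from dyadic_process_bound[OF _ c g(3) this] that show "p \<in> {p. \<delta> / c < ?z' p \<omega>}" by (simp add: ij)
  qed
  have fin: "AE \<omega> in M. finite {p. \<delta> / c < ?z' p \<omega>}"
    using locfin by eventually_elim (use c g(3) in \<open>auto simp: case_prod_unfold\<close>)
  show "AE \<omega> in M. finite {(i, j). g (?d k i \<omega> * Q i j \<omega>) \<noteq> 0}"
    using fin P_nonneg
  proof eventually_elim
    case (elim \<omega>)
    have "finite {p. g (?z k p \<omega>) \<noteq> 0}" by (rule finite_subset[OF sub elim(1)]) (use elim in auto)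
    then show ?case by (simp add: case_prod_unfold)
  qed
  show "(\<lambda>k. expectation (\<lambda>\<omega>. iexp (u * enn2real (point_sum (?z k) g \<omega>))))
     \<longlonglongrightarrow> expectation (\<lambda>\<omega>. iexp (u * enn2real (point_sum ?z' (\<lambda>x. g (c * x)) \<omega>)))"
  proof (rule integral_dominated_convergence[where w="\<lambda>_. 1"])
    show "AE \<omega> in M. (\<lambda>k. iexp (u * enn2real (point_sum (?z k) g \<omega>))) \<longlonglongrightarrow> iexp (u * enn2real (point_sum ?z' (\<lambda>x. g (c * x)) \<omega>))"
      using fin P_nonneg
    proof eventually_elim
      case (elim \<omega>)
      let ?J = "{p. \<delta> / c < ?z' p \<omega>}"
      have 1: "enn2real (point_sum (?z k) g \<omega>) = (\<Sum>p\<in>?J. g (?z k p \<omega>))" for k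
      proof -
        have s: "{p. g (?z k p \<omega>) \<noteq> 0} \<subseteq> ?J" by (rule sub) (use elim in auto)
        have "enn2real (point_sum (?z k) g \<omega>) = (\<Sum>p\<in>{p. g (?z k p \<omega>) \<noteq> 0}. g (?z k p \<omega>))"
          using point_sum_finite[where g=g and z="?z k" and \<omega>=\<omega>, OF finite_subset[OF s elim(1)] g(2)] g(2) by (simp add: sum_nonneg)
        also have "\<dots> = (\<Sum>p\<in>?J. g (?z k p \<omega>))"
          by (rule sum.mono_neutral_left[OF elim(1) s]) auto
        finally show ?thesis .
      qed
      have 2: "enn2real (point_sum ?z' (\<lambda>x. g (c * x)) \<omega>) = (\<Sum>p\<in>?J. g (c * ?z' p \<omega>))"
      proof -
        have s: "{p. g (c * ?z' p \<omega>) \<noteq> 0} \<subseteq> ?J"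
        proof
          fix p assume "p \<in> {p. g (c * ?z' p \<omega>) \<noteq> 0}"
          then have "\<delta> < c * ?z' p \<omega>" using g(4) by (force simp: not_le[symmetric])
          then show "p \<in> ?J" using c by (simp add: pos_divide_less_eq mult.commute)
        qed
        have "enn2real (point_sum ?z' (\<lambda>x. g (c * x)) \<omega>) = (\<Sum>p\<in>{p. g (c * ?z' p \<omega>) \<noteq> 0}. g (c * ?z' p \<omega>))"
          using point_sum_finite[where g="\<lambda>x. g (c * x)" and z="?z'" and \<omega>=\<omega>, OF finite_subset[OF s elim(1)] g(2)] g(2) by (simp add: sum_nonneg)
        also have "\<dots> = (\<Sum>p\<in>?J. g (c * ?z' p \<omega>))"
          by (rule sum.mono_neutral_left[OF elim(1) s]) auto
        finally show ?thesis .
      qed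
      have "(\<lambda>k. ?z k p \<omega>) \<longlonglongrightarrow> c * ?z' p \<omega>" for p
      proof -
        obtain i j where ij: "p = (i, j)" by (cases p)
        have "(\<lambda>k. ?d k i \<omega> * Q i j \<omega>) \<longlonglongrightarrow> (c * P i \<omega>) * Q i j \<omega>"
          using elim c by (intro tendsto_mult dyadic_label_limit tendsto_const) auto
        then show ?thesis by (simp add: ij mult_ac)
      qed
      then have "(\<lambda>k. \<Sum>p\<in>?J. g (?z k p \<omega>)) \<longlonglongrightarrow> (\<Sum>p\<in>?J. g (c * ?z' p \<omega>))"
        by (intro tendsto_sum continuous_on_tendsto_compose[OF g(1)]) auto
      then have "(\<lambda>k. u * enn2real (point_sum (?z k) g \<omega>)) \<longlonglongrightarrow> u * enn2real (point_sum ?z' (\<lambda>x. g (c * x)) \<omega>)"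
        unfolding 1 2 by (rule tendsto_mult_left)
      from isCont_tendsto_compose[OF isCont_iexp this] show ?case .
    qed
    show "(\<lambda>\<omega>. iexp (u * enn2real (point_sum (?z k) g \<omega>))) \<in> borel_measurable M" for k using pm[of k] by measurable
    show "(\<lambda>\<omega>. iexp (u * enn2real (point_sum ?z' (\<lambda>x. g (c * x)) \<omega>))) \<in> borel_measurable M" using pm' by measurable
  qed auto
qed

text \<open>Dilating the process by \<open>m\<^sup>1\<^sup>/\<^sup>\<alpha>\<close> multiplies the intensity of the cluster centres by
  \<open>m\<close>, hence raises the characteristic functional to the power \<open>m\<close>. For the discretised centres
  this is an exact identity between finite products.\<close>

lemma cluster_process_scaling:
  assumes \<alpha>: "0 < \<alpha>" and m: "m \<ge> 1"
    and g: "continuous_on UNIV g" "\<And>x. 0 \<le> g x" "0 < \<delta>" "\<And>x. x \<le> \<delta> \<Longrightarrow> g x = 0"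
    and locfin: "AE \<omega> in M. \<forall>\<delta>>0. finite {(i, j). \<delta> < P i \<omega> * Q i j \<omega>}"
  shows "expectation (\<lambda>\<omega>. iexp (u * enn2real (point_sum (\<lambda>(i, j) \<omega>. P i \<omega> * Q i j \<omega>) (\<lambda>x. g (real m powr (1 / \<alpha>) * x)) \<omega>)))
     = (expectation (\<lambda>\<omega>. iexp (u * enn2real (point_sum (\<lambda>(i, j) \<omega>. P i \<omega> * Q i j \<omega>) g \<omega>)))) ^ m"
proof -
  define c where "c = real m powr (1 / \<alpha>)"
  have c: "0 < c" "c powr \<alpha> = real m" using m \<alpha> by (auto simp: c_def powr_powr)
  have gm: "g \<in> borel_measurable borel" using g by (auto intro: borel_measurable_continuous_onI)
  have g0: "g 0 = 0" using g by auto
  define \<Psi> where "\<Psi> k l = cluster_char g u (real l / 2 ^ k)" for k l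
  define r where "r k l = measure (tail_measure \<alpha>) {x. dyadic_label k x = l}" for k l
  have fin1: "emeasure (tail_measure \<alpha>) {x. dyadic_label k x = l} < \<infinity>" if "l \<ge> 1" for k l
  proof -
    have "{x. dyadic_label k x = l} \<subseteq> {1 / (2 * 2 ^ k)<..}"
    proof
      fix x assume "x \<in> {x. dyadic_label k x = l}"
      then have "1 \<le> 2 ^ k * x" using dyadic_label_pos[of k x l] that by simp
      then have "1 < 2 * (2 ^ k * x)" by linarith
      then show "x \<in> {1 / (2 * 2 ^ k)<..}" by (simp add: pos_divide_less_eq mult_ac)
    qed
    then have "emeasure (tail_measure \<alpha>) {x. dyadic_label k x = l} \<le> emeasure (tail_measure \<alpha>) {1 / (2 * 2 ^ k)<..}"
      by (rule emeasure_mono) (simp add: tail_measure_def)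
    also have "\<dots> < \<infinity>" using \<alpha> by (subst emeasure_tail_measure_Ioi) auto
    finally show ?thesis .
  qed
  \<comment> \<open>As c^\<alpha> = m, each label of the dilated centres has m times its former
    intensity.\<close>
  have sc: "emeasure (tail_measure \<alpha>) {x. dyadic_label k (c * x) = l} = ennreal (real m) * emeasure (tail_measure \<alpha>) {x. dyadic_label k x = l}" for k l
  proof -
    have "{x. dyadic_label k x = l} \<in> sets borel" by measurable
    from measure_tail_measure_scale[OF c(1) this, of \<alpha>] c(2) show ?thesis by simp
  qed
  have fin2: "emeasure (tail_measure \<alpha>) {x. dyadic_label k (c * x) = l} < \<infinity>" if "l \<ge> 1" for k l
    using fin1[OF that] by (simp add: sc ennreal_mult_less_top)
  have r2: "measure (tail_measure \<alpha>) {x. dyadic_label k (c * x) = l} = real m * r k l" for k l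
    by (simp add: measure_def sc r_def enn2real_mult)
  have lm: "(\<lambda>x. dyadic_label k (c * x)) \<in> measurable borel (count_space UNIV)" for k by measurable
  have lim: "(\<lambda>k. expectation (\<lambda>\<omega>. iexp (u * enn2real (point_sum (\<lambda>(i, j) \<omega>. real (dyadic_label k (c * P i \<omega>)) / 2 ^ k * Q i j \<omega>) g \<omega>))))
     \<longlonglongrightarrow> expectation (\<lambda>\<omega>. iexp (u * enn2real (point_sum (\<lambda>(i, j) \<omega>. P i \<omega> * Q i j \<omega>) (\<lambda>x. g (c * x)) \<omega>)))"
    if "0 < c" for c by (rule dyadic_process_limit(1)[OF g(1-3) _ locfin that]) (rule g(4))
  have lf: "AE \<omega> in M. finite {(i, j). g (real (dyadic_label k (c * P i \<omega>)) / 2 ^ k * Q i j \<omega>) \<noteq> 0}"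
    if "0 < c" for c k by (rule dyadic_process_limit(2)[OF g(1-3) _ locfin that]) (rule g(4))
  have A: "expectation (\<lambda>\<omega>. iexp (u * enn2real (point_sum (\<lambda>(i, j) \<omega>. real (dyadic_label k (c * P i \<omega>)) / 2 ^ k * Q i j \<omega>) g \<omega>)))
    = (\<Prod>l=1..4^k. exp (of_real (real m * r k l) * (\<Psi> k l - 1)))" for k
    unfolding r2[symmetric] \<Psi>_def
    by (rule expectation_labelled_process[OF gm g0 g(2) lm dyadic_label_le _ fin2 _ lf[OF c(1)]])
      (auto simp: dyadic_label_def)
  have B: "expectation (\<lambda>\<omega>. iexp (u * enn2real (point_sum (\<lambda>(i, j) \<omega>. real (dyadic_label k (1 * P i \<omega>)) / 2 ^ k * Q i j \<omega>) g \<omega>)))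
    = (\<Prod>l=1..4^k. exp (of_real (r k l) * (\<Psi> k l - 1)))" for k
    unfolding r_def \<Psi>_def mult_1
    by (rule expectation_labelled_process[OF gm g0 g(2) dyadic_label_measurable dyadic_label_le _ fin1 _ lf[OF zero_less_one, unfolded mult_1]])
      (auto simp: dyadic_label_def)
  have AB: "(\<Prod>l=1..4^k. exp (of_real (real m * r k l) * (\<Psi> k l - 1))) = (\<Prod>l=1..4^k. exp (of_real (r k l) * (\<Psi> k l - 1))) ^ m" for k
  proof -
    have "exp (of_real (real m * r k l) * (\<Psi> k l - 1)) = exp (of_real (r k l) * (\<Psi> k l - 1)) ^ m" for l
      by (subst exp_of_nat_mult[symmetric]) (simp add: mult.assoc)
    then show ?thesis by (simp only: prod_power_distrib)
  qed
  \<comment> \<open>Both sides of the claim are limits of this one sequence of finite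
    products.\<close>
  have "(\<lambda>k. (\<Prod>l=1..4^k. exp (of_real (r k l) * (\<Psi> k l - 1))) ^ m) \<longlonglongrightarrow>
     (expectation (\<lambda>\<omega>. iexp (u * enn2real (point_sum (\<lambda>(i, j) \<omega>. P i \<omega> * Q i j \<omega>) g \<omega>)))) ^ m"
    using lim[OF zero_less_one, unfolded B, unfolded mult_1] by (rule tendsto_power)
  moreover have "(\<lambda>k. (\<Prod>l=1..4^k. exp (of_real (r k l) * (\<Psi> k l - 1))) ^ m) \<longlonglongrightarrow>
     expectation (\<lambda>\<omega>. iexp (u * enn2real (point_sum (\<lambda>(i, j) \<omega>. P i \<omega> * Q i j \<omega>) (\<lambda>x. g (c * x)) \<omega>)))"
    using lim[OF c(1)] unfolding A AB .
  ultimately show ?thesis unfolding c_def by (rule LIMSEQ_unique[symmetric])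
qed

end

section \<open>Characteristic functions and stability\<close>

text \<open>Interchange of limits: the approximation error is uniform in n and vanishes with R.
  Every cut-off below, at 0 or at infinity, is removed in this way on the side of the array.\<close>

lemma tendsto_approx:
  fixes a' :: "nat \<Rightarrow> 'a::real_normed_vector"
  assumes conv: "\<And>R. (\<lambda>n. a R n) \<longlonglongrightarrow> b R" and close: "\<And>R n. norm (a R n - a' n) \<le> e R"
    and e: "e \<longlonglongrightarrow> (0::real)" and b: "b \<longlonglongrightarrow> b'"
  shows "a' \<longlonglongrightarrow> b'"
proof (rule LIMSEQ_I)
  fix r :: real assume r: "0 < r"
  have "\<forall>\<^sub>F R in sequentially. e R < r / 3 \<and> norm (b R - b') < r / 3"
    using order_tendstoD(2)[OF e, of "r/3"] b[unfolded tendsto_iff dist_norm, rule_format, of "r/3"] r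
    by (auto intro: eventually_conj)
  then obtain R where R: "e R < r / 3" "norm (b R - b') < r / 3" by (auto simp: eventually_sequentially)
  obtain n0 where n0: "\<And>n. n \<ge> n0 \<Longrightarrow> norm (a R n - b R) < r / 3"
    using LIMSEQ_D[OF conv, of "r/3" R] r by auto
  have "norm (a' n - b') < r" if "n \<ge> n0" for n
  proof -
    have "a' n - b' = (a R n - b R) + (b R - b') - (a R n - a' n)" by simp
    also have "norm \<dots> \<le> norm (a R n - b R) + norm (b R - b') + norm (a R n - a' n)"
      by (meson norm_triangle_ineq norm_triangle_ineq4 add_mono order_refl order_trans)
    also have "\<dots> < r" using n0[OF that] R close[of R n] by linarith
    finally show ?thesis .
  qed
  then show "\<exists>no. \<forall>n\<ge>no. norm (a' n - b') < r" by blast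
qed

lemma (in prob_space) char_distr:
  assumes [measurable]: "Y \<in> borel_measurable M"
  shows "char (distr M borel Y) u = expectation (\<lambda>\<omega>. iexp (u * Y \<omega>))"
  unfolding char_def by (subst integral_distr) auto

lemma (in prob_space) real_distribution_distr_borel:
  "Y \<in> borel_measurable M \<Longrightarrow> real_distribution (distr M borel Y)"
  by (rule real_distribution_distr) simp

text \<open>Convergence in law between different probability spaces, recorded by characteristic
  functions because the limits below are obtained in that form; Levy's continuity theorem converts
  it.\<close>

locale conv_law = A: prob_space A + B: prob_space B for A :: "'a measure" and B :: "'b measure" +
  fixes Yn :: "nat \<Rightarrow> 'a \<Rightarrow> real" and Y :: "'b \<Rightarrow> real"
  assumes Yn_meas [measurable]: "Yn n \<in> borel_measurable A" and Y_meas [measurable]: "Y \<in> borel_measurable B"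
    and char_conv: "(\<lambda>n. A.expectation (\<lambda>x. iexp (u * Yn n x))) \<longlonglongrightarrow> B.expectation (\<lambda>x. iexp (u * Y x))"
begin

lemma weak_conv: "weak_conv_m (\<lambda>n. distr A borel (Yn n)) (distr B borel Y)"
proof (rule levy_continuity)
  show "(\<lambda>n. char (distr A borel (Yn n)) u) \<longlonglongrightarrow> char (distr B borel Y) u" for u
    unfolding A.char_distr[OF Yn_meas] B.char_distr[OF Y_meas] by (rule char_conv)
qed (auto intro: A.real_distribution_distr_borel B.real_distribution_distr_borel)

lemma expectation_conv:
  fixes h :: "real \<Rightarrow> real"
  assumes h: "continuous_on UNIV h" "\<And>x. \<bar>h x\<bar> \<le> D"
  shows "(\<lambda>n. A.expectation (\<lambda>x. h (Yn n x))) \<longlonglongrightarrow> B.expectation (\<lambda>x. h (Y x))"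
proof -
  have [measurable]: "h \<in> borel_measurable borel" using h by (auto intro: borel_measurable_continuous_onI)
  have "(\<lambda>n. integral\<^sup>L (distr A borel (Yn n)) h) \<longlonglongrightarrow> integral\<^sup>L (distr B borel Y) h"
  proof (rule weak_conv_imp_integral_bdd_continuous_conv[OF _ _ weak_conv])
    show "isCont h x" for x using h(1) by (simp add: continuous_on_eq_continuous_at)
  qed (use h in \<open>auto intro: A.real_distribution_distr_borel B.real_distribution_distr_borel\<close>)
  then show ?thesis by (simp add: integral_distr)
qed

text \<open>Truncating the square at k gives bounded continuous functions, to which convergence in
  law applies; then k tends to infinity. Replacing c n by its limit costs the factor 2, and the
  additional term 2 (c n - c')^2 vanishes.\<close>

lemma second_moment_limit:
  assumes int: "\<And>n. integrable A (\<lambda>x. (Yn n x - c n)\<^sup>2)"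
    and bd: "\<And>n. A.expectation (\<lambda>x. (Yn n x - c n)\<^sup>2) \<le> C" and c: "c \<longlonglongrightarrow> c'"
  shows "integrable B (\<lambda>x. (Y x - c')\<^sup>2)" and "B.expectation (\<lambda>x. (Y x - c')\<^sup>2) \<le> 2 * C"
proof -
  have C: "0 \<le> C" using bd[of 0] by (rule order_trans[rotated]) simp
  have le: "(\<integral>\<^sup>+x. ennreal (min ((Y x - c')\<^sup>2) (real k)) \<partial>B) \<le> ennreal (2 * C)" for k :: nat
  proof -
    have cont: "continuous_on UNIV (\<lambda>y::real. min ((y - c')\<^sup>2) (real k))" by (intro continuous_intros)
    have "B.expectation (\<lambda>x. min ((Y x - c')\<^sup>2) (real k)) \<le> 2 * C"
    proof (rule LIMSEQ_le)
      show "(\<lambda>n. A.expectation (\<lambda>x. min ((Yn n x - c')\<^sup>2) (real k))) \<longlonglongrightarrow> B.expectation (\<lambda>x. min ((Y x - c')\<^sup>2) (real k))"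
        using expectation_conv[OF cont, of "real k"] by simp
      have "(\<lambda>n. 2 * C + 2 * (c n - c')\<^sup>2) \<longlonglongrightarrow> 2 * C + 2 * (c' - c')\<^sup>2"
        by (intro tendsto_intros c)
      then show "(\<lambda>n. 2 * C + 2 * (c n - c')\<^sup>2) \<longlonglongrightarrow> 2 * C" by simp
      have "A.expectation (\<lambda>x. min ((Yn n x - c')\<^sup>2) (real k)) \<le> 2 * C + 2 * (c n - c')\<^sup>2" for n
      proof -
        have "A.expectation (\<lambda>x. min ((Yn n x - c')\<^sup>2) (real k)) \<le> A.expectation (\<lambda>x. 2 * (Yn n x - c n)\<^sup>2 + 2 * (c n - c')\<^sup>2)"
        proof (rule integral_mono)
          show "integrable A (\<lambda>x. min ((Yn n x - c')\<^sup>2) (real k))"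
            by (rule A.integrable_const_bound[of _ "real k"]) auto
          show "integrable A (\<lambda>x. 2 * (Yn n x - c n)\<^sup>2 + 2 * (c n - c')\<^sup>2)" using int by simp
          have "(y - c')\<^sup>2 \<le> 2 * (y - c n)\<^sup>2 + 2 * (c n - c')\<^sup>2" for y :: real
          proof -
            have "0 \<le> ((y - c n) - (c n - c'))\<^sup>2" by simp
            then show ?thesis by (simp add: power2_eq_square algebra_simps)
          qed
          then show "min ((Yn n x - c')\<^sup>2) (real k) \<le> 2 * (Yn n x - c n)\<^sup>2 + 2 * (c n - c')\<^sup>2" for x
            by (rule min.coboundedI1)
        qed
        also have "\<dots> = 2 * A.expectation (\<lambda>x. (Yn n x - c n)\<^sup>2) + 2 * (c n - c')\<^sup>2"
          using int by (simp add: A.prob_space)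
        finally show ?thesis using bd[of n] by simp
      qed
      then show "\<exists>N. \<forall>n\<ge>N. A.expectation (\<lambda>x. min ((Yn n x - c')\<^sup>2) (real k)) \<le> 2 * C + 2 * (c n - c')\<^sup>2" by blast
    qed
    moreover have "integrable B (\<lambda>x. min ((Y x - c')\<^sup>2) (real k))"
      by (rule B.integrable_const_bound[of _ "real k"]) auto
    ultimately show ?thesis by (subst nn_integral_eq_integral) (auto intro: ennreal_leI)
  qed
  have "(\<integral>\<^sup>+x. ennreal ((Y x - c')\<^sup>2) \<partial>B) = (\<integral>\<^sup>+x. (SUP k. ennreal (min ((Y x - c')\<^sup>2) (real k))) \<partial>B)"
  proof (rule nn_integral_cong)
    fix x
    obtain k where k: "(Y x - c')\<^sup>2 \<le> real k" using real_arch_simple by blast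
    show "ennreal ((Y x - c')\<^sup>2) = (SUP k. ennreal (min ((Y x - c')\<^sup>2) (real k)))"
    proof (rule antisym)
      show "ennreal ((Y x - c')\<^sup>2) \<le> (SUP k. ennreal (min ((Y x - c')\<^sup>2) (real k)))"
        using k by (intro SUP_upper2[of k]) auto
    qed (auto intro!: SUP_least ennreal_leI)
  qed
  also have "\<dots> = (SUP k. \<integral>\<^sup>+x. ennreal (min ((Y x - c')\<^sup>2) (real k)) \<partial>B)"
    by (rule nn_integral_monotone_convergence_SUP) (auto simp: incseq_def le_fun_def intro!: ennreal_leI min.mono)
  also have "\<dots> \<le> ennreal (2 * C)" by (rule SUP_least) (rule le)
  finally have fin: "(\<integral>\<^sup>+x. ennreal ((Y x - c')\<^sup>2) \<partial>B) \<le> ennreal (2 * C)" .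
  then show "integrable B (\<lambda>x. (Y x - c')\<^sup>2)" by (intro integrableI_nonneg) (auto intro: le_less_trans)
  show "B.expectation (\<lambda>x. (Y x - c')\<^sup>2) \<le> 2 * C"
    using fin C by (subst integral_eq_nn_integral) (auto intro: enn2real_leI)
qed

text \<open>Bounded second moments give uniform integrability: clipping at k + 1 changes a mean by
  at most the second moment divided by k + 1.\<close>

lemma mean_limit:
  assumes int: "\<And>n. integrable A (\<lambda>x. (Yn n x)\<^sup>2)" and bd: "\<And>n. A.expectation (\<lambda>x. (Yn n x)\<^sup>2) \<le> C"
  shows "integrable B Y" and "(\<lambda>n. A.expectation (Yn n)) \<longlonglongrightarrow> B.expectation Y"
proof -
  have sq: "integrable B (\<lambda>x. (Y x)\<^sup>2)" "B.expectation (\<lambda>x. (Y x)\<^sup>2) \<le> 2 * C"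
    using second_moment_limit[of "\<lambda>_. 0" C 0] int bd by simp_all
  show iY: "integrable B Y" using B.square_integrable_imp_integrable[OF Y_meas sq(1)] .
  have iYn: "integrable A (Yn n)" for n using A.square_integrable_imp_integrable[OF Yn_meas int] .
  define h where "h k y = max (- real (Suc k)) (min y (real (Suc k)))" for k y
  have hb: "\<bar>h k y\<bar> \<le> real (Suc k)" for k y by (auto simp: h_def abs_le_iff)
  have [measurable]: "h k \<in> borel_measurable borel" for k unfolding h_def[abs_def] by measurable
  have hc: "continuous_on UNIV (h k)" for k unfolding h_def[abs_def] by (intro continuous_intros)
  have close: "\<bar>h k y - y\<bar> \<le> y\<^sup>2 / real (Suc k)" for k y
  proof (cases "\<bar>y\<bar> \<le> real (Suc k)")
    case True
    then have "h k y = y" by (auto simp: h_def)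
    then show ?thesis by simp
  next
    case False
    then have "\<bar>h k y - y\<bar> \<le> \<bar>y\<bar>" by (auto simp: h_def max_def min_def)
    also have "\<bar>y\<bar> * real (Suc k) \<le> \<bar>y\<bar> * \<bar>y\<bar>" using False by (intro mult_left_mono) auto
    then have "\<bar>y\<bar> \<le> y\<^sup>2 / real (Suc k)" by (simp add: pos_le_divide_eq power2_eq_square abs_mult_self_eq)
    finally show ?thesis .
  qed
  have approx: "\<bar>prob_space.expectation P (\<lambda>x. h k (V x)) - prob_space.expectation P V\<bar> \<le> D / real (Suc k)"
    if P: "prob_space P" and [measurable]: "V \<in> borel_measurable P" and i: "integrable P V" "integrable P (\<lambda>x. (V x)\<^sup>2)"
      and D: "integral\<^sup>L P (\<lambda>x. (V x)\<^sup>2) \<le> D" for P :: "'c measure" and V D k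
  proof -
    interpret P: prob_space P by (rule P)
    have ih: "integrable P (\<lambda>x. h k (V x))" by (rule P.integrable_const_bound[of _ "real (Suc k)"]) (use hb in auto)
    have "\<bar>P.expectation (\<lambda>x. h k (V x)) - P.expectation V\<bar> = \<bar>P.expectation (\<lambda>x. h k (V x) - V x)\<bar>" using ih i by simp
    also have "\<dots> \<le> P.expectation (\<lambda>x. \<bar>h k (V x) - V x\<bar>)" using integral_norm_bound[of P "\<lambda>x. h k (V x) - V x"] by simp
    also have "\<dots> \<le> P.expectation (\<lambda>x. (V x)\<^sup>2 / real (Suc k))" using ih i close by (intro integral_mono) auto
    also have "\<dots> \<le> D / real (Suc k)" using D by (simp add: divide_right_mono del: of_nat_Suc)
    finally show ?thesis .
  qed
  have e: "(\<lambda>k. D / real (Suc k)) \<longlonglongrightarrow> 0" for D using LIMSEQ_inverse_real_of_nat[THEN tendsto_mult_right_zero, of D] by (simp add: divide_inverse)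
  show "(\<lambda>n. A.expectation (Yn n)) \<longlonglongrightarrow> B.expectation Y"
  proof (rule tendsto_approx[where e="\<lambda>k. C / real (Suc k)"])
    show "(\<lambda>n. A.expectation (\<lambda>x. h k (Yn n x))) \<longlonglongrightarrow> B.expectation (\<lambda>x. h k (Y x))" for k
      by (rule expectation_conv[OF hc hb])
    show "norm (A.expectation (\<lambda>x. h k (Yn n x)) - A.expectation (Yn n)) \<le> C / real (Suc k)" for k n
      using approx[OF A.prob_space_axioms Yn_meas iYn int bd] by simp
    show "(\<lambda>k. B.expectation (\<lambda>x. h k (Y x))) \<longlonglongrightarrow> B.expectation Y"
    proof (rule LIM_zero_cancel, rule Lim_null_comparison)
      show "\<forall>\<^sub>F k in sequentially. norm (B.expectation (\<lambda>x. h k (Y x)) - B.expectation Y) \<le> 2 * C / real (Suc k)"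
        using approx[OF B.prob_space_axioms Y_meas iY sq] by (intro always_eventually allI) simp
    qed (rule e)
  qed (rule e)
qed

end

section \<open>Comparison of characteristic functions, independent sums, and stability\<close>

lemma (in prob_space) iexp_diff_le:
  assumes [measurable]: "V \<in> borel_measurable M" "W \<in> borel_measurable M" and int: "integrable M (\<lambda>x. V x - W x)"
  shows "cmod (expectation (\<lambda>x. iexp (u * V x)) - expectation (\<lambda>x. iexp (u * W x))) \<le> \<bar>u\<bar> * expectation (\<lambda>x. \<bar>V x - W x\<bar>)"
proof -
  have i: "integrable M (\<lambda>x. iexp (u * V x))" "integrable M (\<lambda>x. iexp (u * W x))"
    by (rule integrable_const_bound[of _ 1]; simp)+
  have p: "cmod (iexp a - iexp b) \<le> \<bar>a - b\<bar>" for a b :: real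
  proof -
    have "iexp a - iexp b = iexp b * (iexp (a - b) - 1)" by (simp add: algebra_simps exp_add[symmetric])
    then have "cmod (iexp a - iexp b) = cmod (iexp (a - b) - 1)" by (simp add: norm_mult)
    then show ?thesis using iexp_approx1[of "a - b" 0] by simp
  qed
  have "cmod (expectation (\<lambda>x. iexp (u * V x)) - expectation (\<lambda>x. iexp (u * W x))) = cmod (expectation (\<lambda>x. iexp (u * V x) - iexp (u * W x)))"
    using i by simp
  also have "\<dots> \<le> expectation (\<lambda>x. cmod (iexp (u * V x) - iexp (u * W x)))" by (rule integral_norm_bound)
  also have "\<dots> \<le> expectation (\<lambda>x. \<bar>u\<bar> * \<bar>V x - W x\<bar>)"
  proof (rule integral_mono)
    show "cmod (iexp (u * V x) - iexp (u * W x)) \<le> \<bar>u\<bar> * \<bar>V x - W x\<bar>" for x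
      using p[of "u * V x" "u * W x"] by (simp add: abs_mult[symmetric] right_diff_distrib)
  qed (use i int in auto)
  finally show ?thesis by simp
qed

lemma (in prob_space) iexp_diff_prob_le:
  assumes [measurable]: "V \<in> borel_measurable M" "W \<in> borel_measurable M" "E \<in> sets M"
    and eq: "\<And>x. x \<in> space M \<Longrightarrow> x \<notin> E \<Longrightarrow> V x = W x"
  shows "cmod (expectation (\<lambda>x. iexp (u * V x)) - expectation (\<lambda>x. iexp (u * W x))) \<le> 2 * prob E"
proof -
  have i: "integrable M (\<lambda>x. iexp (u * V x))" "integrable M (\<lambda>x. iexp (u * W x))"
    by (rule integrable_const_bound[of _ 1]; simp)+
  have "cmod (expectation (\<lambda>x. iexp (u * V x)) - expectation (\<lambda>x. iexp (u * W x))) = cmod (expectation (\<lambda>x. iexp (u * V x) - iexp (u * W x)))"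
    using i by simp
  also have "\<dots> \<le> expectation (\<lambda>x. cmod (iexp (u * V x) - iexp (u * W x)))" by (rule integral_norm_bound)
  also have "\<dots> \<le> expectation (\<lambda>x. 2 * indicator E x)"
  proof (rule integral_mono)
    show "cmod (iexp (u * V x) - iexp (u * W x)) \<le> 2 * indicator E x" if "x \<in> space M" for x
      using eq[OF that] norm_triangle_ineq4[of "iexp (u * V x)" "iexp (u * W x)"] by (cases "x \<in> E") auto
    show "integrable M (\<lambda>x. 2 * indicator E x :: real)" by (rule integrable_const_bound[of _ 2]) (auto simp: indicator_def)
  qed (use i in auto)
  finally show ?thesis by simp
qed

lemma char_iid_sum:
  assumes L: "real_distribution L"
  shows "real_distribution (distr (\<Pi>\<^sub>M i\<in>{..<m}. L) borel (\<lambda>x. \<Sum>i<m. x i))"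
    and "char (distr (\<Pi>\<^sub>M i\<in>{..<m}. L) borel (\<lambda>x. \<Sum>i<m. x i)) u = char L u ^ m"
    and "integrable L (\<lambda>x. x) \<Longrightarrow> (\<integral>x. x \<partial>distr (\<Pi>\<^sub>M i\<in>{..<m}. L) borel (\<lambda>x. \<Sum>i<m. x i)) = real m * (\<integral>x. x \<partial>L)"
proof -
  interpret L: real_distribution L by fact
  interpret P: product_prob_space "\<lambda>_. L" "{..<m}" by unfold_locales
  have comp: "(\<lambda>x. x i) \<in> borel_measurable (\<Pi>\<^sub>M i\<in>{..<m}. L)" if "i \<in> {..<m}" for i
    using measurable_component_singleton[OF that, of "\<lambda>_. L"] by (simp cong: measurable_cong_sets)
  have sm: "(\<lambda>x. \<Sum>i<m. x i) \<in> borel_measurable (\<Pi>\<^sub>M i\<in>{..<m}. L)" by (rule borel_measurable_sum) (rule comp)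
  then show "real_distribution (distr (\<Pi>\<^sub>M i\<in>{..<m}. L) borel (\<lambda>x. \<Sum>i<m. x i))"
    by (rule P.real_distribution_distr_borel)
  have dc: "distr (\<Pi>\<^sub>M i\<in>{..<m}. L) borel (\<lambda>x. x i) = L" if "i \<in> {..<m}" for i
  proof -
    have "distr (\<Pi>\<^sub>M i\<in>{..<m}. L) borel (\<lambda>x. x i) = distr (\<Pi>\<^sub>M i\<in>{..<m}. L) L (\<lambda>x. x i)"
      by (rule distr_cong) auto
    also have "\<dots> = L" using P.PiM_component[OF that] by simp
    finally show ?thesis .
  qed
  have ind: "P.indep_vars (\<lambda>_. borel) (\<lambda>i x. x i) {..<m}"
  \<comment> \<open>The criterion through the joint law is for nonempty index sets.\<close>
  proof (cases "m = 0")
    case False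
    have "distr (\<Pi>\<^sub>M i\<in>{..<m}. L) (\<Pi>\<^sub>M i\<in>{..<m}. borel) (\<lambda>x. \<lambda>i\<in>{..<m}. x i) = (\<Pi>\<^sub>M i\<in>{..<m}. L)"
    proof -
      have "distr (\<Pi>\<^sub>M i\<in>{..<m}. L) (\<Pi>\<^sub>M i\<in>{..<m}. borel) (\<lambda>x. \<lambda>i\<in>{..<m}. x i) = distr (\<Pi>\<^sub>M i\<in>{..<m}. L) (\<Pi>\<^sub>M i\<in>{..<m}. L) (\<lambda>x. x)"
        by (rule distr_cong) (auto simp: space_PiM intro!: sets_PiM_cong restrict_ext simp: PiE_def extensional_restrict)
      then show ?thesis by simp
    qed
    also have "\<dots> = (\<Pi>\<^sub>M i\<in>{..<m}. distr (\<Pi>\<^sub>M i\<in>{..<m}. L) borel (\<lambda>x. x i))" by (rule PiM_cong) (auto simp: dc)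
    finally show ?thesis using False comp by (subst P.indep_vars_iff_distr_eq_PiM') auto
  next
    case True
    then show ?thesis unfolding P.indep_vars_def P.indep_sets_def by auto
  qed
  show "char (distr (\<Pi>\<^sub>M i\<in>{..<m}. L) borel (\<lambda>x. \<Sum>i<m. x i)) u = char L u ^ m"
    unfolding P.char_distr_sum[OF ind] by (simp add: dc)
  show "(\<integral>x. x \<partial>distr (\<Pi>\<^sub>M i\<in>{..<m}. L) borel (\<lambda>x. \<Sum>i<m. x i)) = real m * (\<integral>x. x \<partial>L)" if int: "integrable L (\<lambda>x. x)"
  proof -
    have i: "integrable (\<Pi>\<^sub>M i\<in>{..<m}. L) (\<lambda>x. x i)" and e: "(\<integral>x. x i \<partial>(\<Pi>\<^sub>M i\<in>{..<m}. L)) = (\<integral>x. x \<partial>L)" if "i \<in> {..<m}" for i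
    proof -
      have "integrable (distr (\<Pi>\<^sub>M i\<in>{..<m}. L) borel (\<lambda>x. x i)) (\<lambda>x. x)" unfolding dc[OF that] by (rule int)
      then show "integrable (\<Pi>\<^sub>M i\<in>{..<m}. L) (\<lambda>x. x i)" by (rule integrable_distr[OF comp[OF that]])
      have "(\<integral>x. x \<partial>distr (\<Pi>\<^sub>M i\<in>{..<m}. L) borel (\<lambda>x. x i)) = (\<integral>x. x i \<partial>(\<Pi>\<^sub>M i\<in>{..<m}. L))"
        by (rule integral_distr[OF comp[OF that]]) simp
      then show "(\<integral>x. x i \<partial>(\<Pi>\<^sub>M i\<in>{..<m}. L)) = (\<integral>x. x \<partial>L)" unfolding dc[OF that] by simp
    qed
    have "(\<integral>x. x \<partial>distr (\<Pi>\<^sub>M i\<in>{..<m}. L) borel (\<lambda>x. \<Sum>i<m. x i)) = (\<integral>x. (\<Sum>i<m. x i) \<partial>(\<Pi>\<^sub>M i\<in>{..<m}. L))"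
      by (rule integral_distr[OF sm]) simp
    also have "\<dots> = (\<Sum>i<m. \<integral>x. x i \<partial>(\<Pi>\<^sub>M i\<in>{..<m}. L))" by (rule Bochner_Integration.integral_sum) (rule i)
    also have "\<dots> = (\<Sum>i<m. \<integral>x. x \<partial>L)" by (rule sum.cong) (auto simp: e)
    finally show ?thesis by simp
  qed
qed

text \<open>By uniqueness of characteristic functions V has the law of a sum of m independent copies
  of W. This yields the mean without differentiating at u = 0.\<close>

lemma (in prob_space) mean_of_char_power:
  assumes [measurable]: "V \<in> borel_measurable M" "W \<in> borel_measurable M" and int: "integrable M W"
    and eq: "\<And>u. expectation (\<lambda>x. iexp (u * V x)) = expectation (\<lambda>x. iexp (u * W x)) ^ m"
  shows "expectation V = real m * expectation W"
proof -
  let ?L = "distr M borel W"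
  have L: "real_distribution ?L" by (rule real_distribution_distr_borel) simp
  have "distr M borel V = distr (\<Pi>\<^sub>M i\<in>{..<m}. ?L) borel (\<lambda>x. \<Sum>i<m. x i)"
  proof (rule Levy_uniqueness[OF real_distribution_distr_borel char_iid_sum(1)[OF L]], measurable, rule ext)
    fix u
    show "char (distr M borel V) u = char (distr (\<Pi>\<^sub>M i\<in>{..<m}. ?L) borel (\<lambda>x. \<Sum>i<m. x i)) u"
      unfolding char_iid_sum(2)[OF L] char_distr[OF assms(1)] char_distr[OF assms(2)] by (rule eq)
  qed
  moreover have "integrable ?L (\<lambda>x. x)" using int by (subst integrable_distr_eq) auto
  ultimately have "(\<integral>x. x \<partial>distr M borel V) = real m * (\<integral>x. x \<partial>?L)" using char_iid_sum(3)[OF L] by metis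
  then show ?thesis by (simp add: integral_distr)
qed

text \<open>In terms of characteristic functions the sum of m independent copies becomes the m-th
  power.\<close>

lemma (in prob_space) stable_lawI:
  assumes [measurable]: "Y \<in> borel_measurable M" and nd: "\<And>c. \<not> (AE x in M. Y x = c)"
    and st: "\<And>m. m \<ge> 1 \<Longrightarrow> \<exists>d. \<forall>u. expectation (\<lambda>x. iexp (u * Y x)) ^ m = expectation (\<lambda>x. iexp (u * (real m powr (1 / \<alpha>) * Y x + d)))"
  shows "stable_law \<alpha> (distr M borel Y)"
  unfolding stable_law_def
proof (intro conjI allI impI)
  let ?L = "distr M borel Y"
  show L: "real_distribution ?L" by (rule real_distribution_distr_borel) simp
  show "\<not> (\<exists>c. AE x in ?L. x = c)" using nd by (auto simp: AE_distr_iff)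
  fix m :: nat assume "m \<ge> 1"
  then obtain d where d: "\<And>u. expectation (\<lambda>x. iexp (u * Y x)) ^ m = expectation (\<lambda>x. iexp (u * (real m powr (1 / \<alpha>) * Y x + d)))"
    using st by blast
  have dm: "(\<lambda>x. real m powr (1 / \<alpha>) * Y x + d) \<in> borel_measurable M" by measurable
  have dd: "distr ?L borel (\<lambda>x. real m powr (1 / \<alpha>) * x + d) = distr M borel (\<lambda>x. real m powr (1 / \<alpha>) * Y x + d)"
    by (subst distr_distr) (auto simp: comp_def)
  have "distr (\<Pi>\<^sub>M i\<in>{..<m}. ?L) borel (\<lambda>x. \<Sum>i<m. x i) = distr M borel (\<lambda>x. real m powr (1 / \<alpha>) * Y x + d)"
  proof (rule Levy_uniqueness[OF char_iid_sum(1)[OF L] real_distribution_distr_borel], measurable, rule ext)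
    fix u
    show "char (distr (\<Pi>\<^sub>M i\<in>{..<m}. ?L) borel (\<lambda>x. \<Sum>i<m. x i)) u = char (distr M borel (\<lambda>x. real m powr (1 / \<alpha>) * Y x + d)) u"
      unfolding char_iid_sum(2)[OF L] char_distr[OF assms(1)] char_distr[OF dm] by (rule d)
  qed
  then show "\<exists>d. distr (\<Pi>\<^sub>M i\<in>{..<m}. ?L) borel (\<lambda>x. \<Sum>i<m. x i) = distr ?L borel (\<lambda>x. real m powr (1 / \<alpha>) * x + d)"
    unfolding dd[symmetric] by blast
qed

lemma (in prob_space) second_moment_fatou:
  fixes V :: "'a \<Rightarrow> real" and Vk :: "nat \<Rightarrow> 'a \<Rightarrow> real"
  assumes [measurable]: "V \<in> borel_measurable M" "\<And>k. Vk k \<in> borel_measurable M"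
    and lim: "AE x in M. (\<lambda>k::nat. Vk k x) \<longlonglongrightarrow> V x"
    and int: "\<And>k. integrable M (\<lambda>x. (Vk k x)\<^sup>2)" "\<And>k. expectation (\<lambda>x. (Vk k x)\<^sup>2) \<le> C"
  shows "integrable M (\<lambda>x. (V x)\<^sup>2)" "expectation (\<lambda>x. (V x)\<^sup>2) \<le> C"
proof -
  have "0 \<le> expectation (\<lambda>x. (Vk 0 x)\<^sup>2)" by simp
  then have C: "0 \<le> C" using int(2)[of 0] by linarith
  have "(\<integral>\<^sup>+x. ennreal ((V x)\<^sup>2) \<partial>M) = (\<integral>\<^sup>+x. liminf (\<lambda>k. ennreal ((Vk k x)\<^sup>2)) \<partial>M)"
  proof (rule nn_integral_cong_AE)
    show "AE x in M. ennreal ((V x)\<^sup>2) = liminf (\<lambda>k. ennreal ((Vk k x)\<^sup>2))"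
      using lim
    proof eventually_elim
      case (elim x)
      have "(\<lambda>k. ennreal ((Vk k x)\<^sup>2)) \<longlonglongrightarrow> ennreal ((V x)\<^sup>2)" by (intro tendsto_ennrealI tendsto_power elim)
      then show ?case by (rule lim_imp_Liminf[symmetric, rotated]) simp
    qed
  qed
  also have "\<dots> \<le> liminf (\<lambda>k. \<integral>\<^sup>+x. ennreal ((Vk k x)\<^sup>2) \<partial>M)" by (rule nn_integral_liminf) simp
  also have "\<dots> \<le> ennreal C"
  proof (rule Liminf_le)
    have "(\<integral>\<^sup>+x. ennreal ((Vk k x)\<^sup>2) \<partial>M) \<le> ennreal C" for k
      using int by (subst nn_integral_eq_integral) (auto intro: ennreal_leI)
    then show "\<forall>\<^sub>F k in sequentially. (\<integral>\<^sup>+x. ennreal ((Vk k x)\<^sup>2) \<partial>M) \<le> ennreal C"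
      by simp
  qed simp
  finally have fin: "(\<integral>\<^sup>+x. ennreal ((V x)\<^sup>2) \<partial>M) \<le> ennreal C" .
  then show "integrable M (\<lambda>x. (V x)\<^sup>2)" by (intro integrableI_nonneg) (auto intro: le_less_trans)
  show "expectation (\<lambda>x. (V x)\<^sup>2) \<le> C"
    using fin C by (subst integral_eq_nn_integral) (auto intro: enn2real_leI)
qed

lemma (in prob_space) abs_mean_le_sqrt:
  fixes V :: "'a \<Rightarrow> real"
  assumes [measurable]: "V \<in> borel_measurable M" and int: "integrable M (\<lambda>x. (V x)\<^sup>2)" and C: "expectation (\<lambda>x. (V x)\<^sup>2) \<le> C"
  shows "integrable M V" "expectation (\<lambda>x. \<bar>V x\<bar>) \<le> sqrt C"
proof -
  show i: "integrable M V" by (rule square_integrable_imp_integrable[OF _ int]) simp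
  have "(expectation (\<lambda>x. \<bar>V x\<bar>))\<^sup>2 \<le> expectation (\<lambda>x. \<bar>V x\<bar>\<^sup>2)"
    using variance_eq[of "\<lambda>x. \<bar>V x\<bar>"] variance_positive[of "\<lambda>x. \<bar>V x\<bar>"] i int by simp
  then show "expectation (\<lambda>x. \<bar>V x\<bar>) \<le> sqrt C" using C by (intro real_le_rsqrt) simp
qed

section \<open>Convergence of sums over large points\<close>

definition test_fun :: "real \<Rightarrow> real \<Rightarrow> (real \<Rightarrow> real) \<Rightarrow> bool" where
  "test_fun \<delta> R f \<longleftrightarrow> continuous_on UNIV f \<and> (\<forall>x. 0 \<le> f x) \<and> 0 < \<delta> \<and>
     (\<forall>x. \<bar>x\<bar> \<le> \<delta> \<longrightarrow> f x = 0) \<and> (\<forall>x. R \<le> \<bar>x\<bar> \<longrightarrow> f x = 0)"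

definition tail_test_fun :: "real \<Rightarrow> (real \<Rightarrow> real) \<Rightarrow> bool" where
  "tail_test_fun \<delta> g \<longleftrightarrow> continuous_on UNIV g \<and> (\<forall>x. 0 \<le> g x) \<and> 0 < \<delta> \<and> (\<forall>x\<le>\<delta>. g x = 0)"

lemma tail_test_fun_measurable: "tail_test_fun \<delta> g \<Longrightarrow> g \<in> borel_measurable borel"
  by (auto simp: tail_test_fun_def intro: borel_measurable_continuous_onI)

lemma test_fun_measurable: "test_fun \<delta> R g \<Longrightarrow> g \<in> borel_measurable borel"
  by (auto simp: test_fun_def intro: borel_measurable_continuous_onI)

text \<open>Collects what is used of the cluster process. Local finiteness towards infinity stands
  as a premise of \<open>scaling\<close> because it is derived only inside the locale, from the tail
  bound of the array.\<close>

locale cluster_limit = tail_array \<mu> X \<alpha> K + L: prob_space M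
  for \<mu> :: "'a measure" and X \<alpha> K and M :: "'w measure" +
  fixes z :: "nat \<times> nat \<Rightarrow> 'w \<Rightarrow> real"
  assumes z_meas [measurable]: "z p \<in> borel_measurable M"
    and shell_finite: "AE \<omega> in M. \<forall>k. finite {p. z p \<omega> \<in> shell k}"
    and test_conv: "test_fun \<delta> R f \<Longrightarrow> continuous_on UNIV (h :: real \<Rightarrow> real) \<Longrightarrow> (\<And>x. \<bar>h x\<bar> \<le> D) \<Longrightarrow>
      (\<lambda>n. expectation (\<lambda>x. h (\<Sum>j=1..n. f (X n j x)))) \<longlonglongrightarrow> L.expectation (\<lambda>\<omega>. h (enn2real (point_sum z f \<omega>)))"
    and scaling: "m \<ge> 1 \<Longrightarrow> tail_test_fun \<delta> g \<Longrightarrow> (AE \<omega> in M. \<forall>\<delta>>0. finite {p. \<delta> < z p \<omega>}) \<Longrightarrow>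
      L.expectation (\<lambda>\<omega>. iexp (u * enn2real (point_sum z (\<lambda>x. g (real m powr (1 / \<alpha>) * x)) \<omega>))) =
      L.expectation (\<lambda>\<omega>. iexp (u * enn2real (point_sum z g \<omega>))) ^ m"
begin

abbreviation N :: "nat \<Rightarrow> (real \<Rightarrow> real) \<Rightarrow> 'a \<Rightarrow> real" where "N n g x \<equiv> (\<Sum>j=1..n. g (X n j x))"
abbreviation Z :: "(real \<Rightarrow> real) \<Rightarrow> 'w \<Rightarrow> real" where "Z g \<omega> \<equiv> enn2real (point_sum z g \<omega>)"
definition H where "H n t = (\<Sum>j=1..n. prob {x\<in>space \<mu>. t < X n j x})"

lemma H_le: "0 < t \<Longrightarrow> H n t \<le> K * t powr (- \<alpha>)"
  unfolding H_def by (rule tail_le)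

section \<open>Means of point sums under the limit\<close>

lemma N_mean_le:
  assumes [measurable]: "g \<in> borel_measurable borel" and g: "\<And>x. 0 \<le> g x" "\<And>x. g x \<le> D" "\<And>x. x \<le> \<delta> \<Longrightarrow> g x = 0"
  shows "integrable \<mu> (\<lambda>x. N n g x)" and "expectation (\<lambda>x. N n g x) \<le> D * H n \<delta>"
proof -
  have D: "0 \<le> D" using g(1,2)[of 0] by linarith
  have ij: "integrable \<mu> (\<lambda>x. g (X n j x))" for j
    by (rule integrable_const_bound[of _ D]) (use g in auto)
  then show "integrable \<mu> (\<lambda>x. N n g x)" by auto
  have "expectation (\<lambda>x. N n g x) = (\<Sum>j=1..n. expectation (\<lambda>x. g (X n j x)))"
    using ij by (intro Bochner_Integration.integral_sum) auto
  also have "\<dots> \<le> (\<Sum>j=1..n. D * prob {x\<in>space \<mu>. \<delta> < X n j x})"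
  proof (rule sum_mono)
    fix j
    have "expectation (\<lambda>x. g (X n j x)) \<le> expectation (\<lambda>x. D * indicator {x\<in>space \<mu>. \<delta> < X n j x} x)"
    proof (rule integral_mono[OF ij])
      show "integrable \<mu> (\<lambda>x. D * indicator {x\<in>space \<mu>. \<delta> < X n j x} x)"
        by (rule integrable_const_bound[of _ D]) (use D in \<open>auto simp: indicator_def\<close>)
      show "g (X n j x) \<le> D * indicator {x\<in>space \<mu>. \<delta> < X n j x} x" if "x \<in> space \<mu>" for x
        using g(2)[of "X n j x"] g(3)[of "X n j x"] that by (auto simp: indicator_def)
    qed
    then show "expectation (\<lambda>x. g (X n j x)) \<le> D * prob {x\<in>space \<mu>. \<delta> < X n j x}" by simp
  qed
  also have "\<dots> = D * H n \<delta>" by (simp add: H_def sum_distrib_left)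
  finally show "expectation (\<lambda>x. N n g x) \<le> D * H n \<delta>" .
qed

lemma point_sum_test_finite:
  assumes "test_fun \<delta> R f"
  shows "AE \<omega> in M. finite {p. f (z p \<omega>) \<noteq> 0}"
proof -
  note assms = assms[unfolded test_fun_def]
  have "0 < \<delta>" using assms by simp
  obtain k1 :: nat where k1: "1 / Suc k1 < \<delta>" using nat_approx_posE[OF \<open>0 < \<delta>\<close>] by blast
  obtain k2 :: nat where k2: "R \<le> k2" using real_arch_simple by blast
  define k where "k = max k1 k2"
  have "1 / Suc k \<le> 1 / Suc k1" by (simp add: k_def frac_le)
  then have k: "1 / Suc k < \<delta>" "R \<le> Suc k" using k1 k2 by (auto simp: k_def)
  have "x \<in> shell k" if "f x \<noteq> 0" for x
  proof -
    have "\<not> \<bar>x\<bar> \<le> \<delta>" "\<not> R \<le> \<bar>x\<bar>" using assms that by auto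
    then show ?thesis using k unfolding shell_def by auto
  qed
  then have "{p. f (z p \<omega>) \<noteq> 0} \<subseteq> {p. z p \<omega> \<in> shell k}" for \<omega> by auto
  then show ?thesis using shell_finite by (auto elim!: eventually_mono intro: finite_subset)
qed

text \<open>Upper bounds on means survive the limit: truncated sums have convergent means, and the
  truncation is removed by monotone convergence.\<close>

lemma nn_point_sum_test_le:
  assumes f: "test_fun \<delta> R f"
    and D: "0 \<le> D" "\<And>n. expectation (\<lambda>x. N n f x) \<le> D" "\<And>n. integrable \<mu> (\<lambda>x. N n f x)"
  shows "(\<integral>\<^sup>+\<omega>. point_sum z f \<omega> \<partial>M) \<le> ennreal D"
proof -
  have [measurable]: "f \<in> borel_measurable borel" by (rule test_fun_measurable[OF f])
  have fnn: "0 \<le> f x" for x using f by (simp add: test_fun_def)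
  have fin: "AE \<omega> in M. point_sum z f \<omega> = ennreal (Z f \<omega>)"
    using point_sum_test_finite[OF f]
    by eventually_elim (auto simp: point_sum_finite fnn sum_nonneg)
  have le: "(\<integral>\<^sup>+\<omega>. ennreal (min (Z f \<omega>) (real k)) \<partial>M) \<le> ennreal D" for k :: nat
  proof -
    \<comment> \<open>The outer maximum makes the truncation bounded on the whole line, as
      \<open>test_conv\<close> requires.\<close>
    have c: "continuous_on UNIV (\<lambda>y::real. max 0 (min y (real k)))" by (intro continuous_intros)
    have "L.expectation (\<lambda>\<omega>. max 0 (min (Z f \<omega>) (real k))) \<le> D"
    proof (rule LIMSEQ_le_const2[OF test_conv[OF f c, of "real k"]])
      have "expectation (\<lambda>x. max 0 (min (N n f x) (real k))) \<le> D" for n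
      proof -
        have "expectation (\<lambda>x. max 0 (min (N n f x) (real k))) \<le> expectation (\<lambda>x. N n f x)"
        proof (rule integral_mono[OF _ D(3)])
          show "integrable \<mu> (\<lambda>x. max 0 (min (N n f x) (real k)))"
            by (rule integrable_const_bound[of _ "real k"]) auto
          show "max 0 (min (N n f x) (real k)) \<le> N n f x" for x using fnn by (auto intro: sum_nonneg)
        qed
        then show ?thesis using D(2)[of n] by linarith
      qed
      then show "\<exists>N. \<forall>n\<ge>N. expectation (\<lambda>x. max 0 (min (\<Sum>j=1..n. f (X n j x)) (real k))) \<le> D" by blast
    qed auto
    moreover have "(\<lambda>\<omega>. max 0 (min (Z f \<omega>) (real k))) = (\<lambda>\<omega>. min (Z f \<omega>) (real k))" by (auto simp: max_def min_def)
    moreover have "integrable M (\<lambda>\<omega>. min (Z f \<omega>) (real k))" by (rule L.integrable_const_bound[of _ "real k"]) auto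
    ultimately show ?thesis by (subst nn_integral_eq_integral) (auto intro: ennreal_leI)
  qed
  have "(\<integral>\<^sup>+\<omega>. point_sum z f \<omega> \<partial>M) = (\<integral>\<^sup>+\<omega>. (SUP k. ennreal (min (Z f \<omega>) (real k))) \<partial>M)"
  proof (rule nn_integral_cong_AE)
    show "AE \<omega> in M. point_sum z f \<omega> = (SUP k. ennreal (min (Z f \<omega>) (real k)))"
      using fin
    proof eventually_elim
      case (elim \<omega>)
      obtain k where k: "Z f \<omega> \<le> real k" using real_arch_simple by blast
      have "ennreal (Z f \<omega>) = (SUP k. ennreal (min (Z f \<omega>) (real k)))"
      proof (rule antisym)
        show "ennreal (Z f \<omega>) \<le> (SUP k. ennreal (min (Z f \<omega>) (real k)))" using k by (intro SUP_upper2[of k]) auto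
      qed (auto intro!: SUP_least ennreal_leI)
      then show ?case using elim by simp
    qed
  qed
  also have "\<dots> = (SUP k. \<integral>\<^sup>+\<omega>. ennreal (min (Z f \<omega>) (real k)) \<partial>M)"
    by (rule nn_integral_monotone_convergence_SUP) (auto simp: incseq_def le_fun_def intro!: ennreal_leI min.mono)
  also have "\<dots> \<le> ennreal D" by (rule SUP_least) (rule le)
  finally show ?thesis .
qed

lemma point_sum_SUP:
  assumes "\<And>k x. 0 \<le> gk k x" "\<And>x. incseq (\<lambda>k. gk k x)" "\<And>x. \<exists>k. gk k x = g x" "\<And>k x. gk k x \<le> g x"
  shows "point_sum z g \<omega> = (SUP k. point_sum z (gk k) \<omega>)"
proof -
  have "point_sum z g \<omega> = (\<integral>\<^sup>+p. (SUP k. ennreal (gk k (z p \<omega>))) \<partial>count_space UNIV)"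
    unfolding point_sum_def
  proof (rule nn_integral_cong)
    fix p
    obtain k where k: "gk k (z p \<omega>) = g (z p \<omega>)" using assms by blast
    show "ennreal (g (z p \<omega>)) = (SUP k. ennreal (gk k (z p \<omega>)))"
    proof (rule antisym)
      show "ennreal (g (z p \<omega>)) \<le> (SUP k. ennreal (gk k (z p \<omega>)))" using k by (intro SUP_upper2[of k]) auto
    qed (auto intro!: SUP_least ennreal_leI assms)
  qed
  also have "\<dots> = (SUP k. \<integral>\<^sup>+p. ennreal (gk k (z p \<omega>)) \<partial>count_space UNIV)"
    using assms(2) by (intro nn_integral_monotone_convergence_SUP) (auto simp: incseq_def le_fun_def intro!: ennreal_leI)
  finally show ?thesis by (simp add: point_sum_def)
qed

lemma nn_point_sum_SUP:
  assumes "\<And>k x. 0 \<le> gk k x" "\<And>x. incseq (\<lambda>k. gk k x)" "\<And>x. \<exists>k. gk k x = g x" "\<And>k x. gk k x \<le> g x"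
    and [measurable]: "\<And>k. gk k \<in> borel_measurable borel"
  shows "(\<integral>\<^sup>+\<omega>. point_sum z g \<omega> \<partial>M) = (SUP k. \<integral>\<^sup>+\<omega>. point_sum z (gk k) \<omega> \<partial>M)"
proof -
  have "(\<integral>\<^sup>+\<omega>. point_sum z g \<omega> \<partial>M) = (\<integral>\<^sup>+\<omega>. (SUP k. point_sum z (gk k) \<omega>) \<partial>M)"
    by (simp add: point_sum_SUP[OF assms(1-4)])
  also have "\<dots> = (SUP k. \<integral>\<^sup>+\<omega>. point_sum z (gk k) \<omega> \<partial>M)"
  proof (rule nn_integral_monotone_convergence_SUP)
    show "incseq (\<lambda>k. point_sum z (gk k))"
      unfolding incseq_def le_fun_def point_sum_def using assms(2)
      by (auto simp: incseq_def intro!: nn_integral_mono ennreal_leI)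
  qed simp
  finally show ?thesis .
qed

definition cut :: "nat \<Rightarrow> real \<Rightarrow> real" where "cut R x = max 0 (min 1 (real R + 1 - x))"

lemma cut_props: "0 \<le> cut R x" "cut R x \<le> 1" "x \<le> real R \<Longrightarrow> cut R x = 1" "real R + 1 \<le> x \<Longrightarrow> cut R x = 0"
  "R \<le> R' \<Longrightarrow> cut R x \<le> cut R' x" "continuous_on UNIV (cut R)"
  unfolding cut_def[abs_def] by (auto intro!: continuous_intros)

lemma cut_tail_test_fun:
  assumes "tail_test_fun \<delta> g"
  shows "test_fun \<delta> (real R + 1) (\<lambda>x. g x * cut R x)" "0 \<le> g x * cut R x" "g x * cut R x \<le> g x"
proof -
  note a = assms[unfolded tail_test_fun_def]
  show "0 \<le> g x * cut R x" "g x * cut R x \<le> g x" for x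
    using a cut_props(1,2)[of R x] by (auto intro!: mult_left_le)
  have "g x * cut R x = 0" if "real R + 1 \<le> \<bar>x\<bar>" for x
    using that a cut_props(4)[of R x] by (cases "x < 0") auto
  moreover have "g x * cut R x = 0" if "\<bar>x\<bar> \<le> \<delta>" for x using that a by auto
  ultimately show "test_fun \<delta> (real R + 1) (\<lambda>x. g x * cut R x)"
    unfolding test_fun_def using a cut_props(1)[of R] cut_props(6)[of R] by (auto intro!: continuous_intros)
qed

text \<open>Extends the bound beyond compact support by letting a cut-off at infinity increase to
  1.\<close>

lemma nn_point_sum_le:
  assumes g: "tail_test_fun \<delta> g" and D: "0 \<le> D" "\<And>n. expectation (\<lambda>x. N n g x) \<le> D" "\<And>n. integrable \<mu> (\<lambda>x. N n g x)"
  shows "(\<integral>\<^sup>+\<omega>. point_sum z g \<omega> \<partial>M) \<le> ennreal D"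
proof -
  have gm[measurable]: "g \<in> borel_measurable borel" by (rule tail_test_fun_measurable[OF g])
  have cm[measurable]: "cut R \<in> borel_measurable borel" for R unfolding cut_def[abs_def] by measurable
  have "(\<integral>\<^sup>+\<omega>. point_sum z g \<omega> \<partial>M) = (SUP R. \<integral>\<^sup>+\<omega>. point_sum z (\<lambda>x. g x * cut R x) \<omega> \<partial>M)"
  proof (rule nn_point_sum_SUP)
    show "(\<lambda>x. g x * cut R x) \<in> borel_measurable borel" for R by measurable
    show "0 \<le> g x * cut R x" "g x * cut R x \<le> g x" for R x using cut_tail_test_fun[OF g] by auto
    show "incseq (\<lambda>R. g x * cut R x)" for x
      unfolding incseq_def using g cut_props(5) by (auto simp: tail_test_fun_def intro!: mult_left_mono)
    show "\<exists>R. g x * cut R x = g x" for x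
      using real_arch_simple[of x] cut_props(3) by (metis mult.right_neutral)
  qed
  moreover have "(\<integral>\<^sup>+\<omega>. point_sum z (\<lambda>x. g x * cut R x) \<omega> \<partial>M) \<le> ennreal D" for R
  proof (rule nn_point_sum_test_le[OF cut_tail_test_fun(1)[OF g]])
    show "0 \<le> D" by fact
    have le: "N n (\<lambda>x. g x * cut R x) x \<le> N n g x" for n x by (intro sum_mono cut_tail_test_fun(3)[OF g])
    have nn: "0 \<le> N n (\<lambda>x. g x * cut R x) x" for n x by (intro sum_nonneg cut_tail_test_fun(2)[OF g])
    show i: "integrable \<mu> (\<lambda>x. N n (\<lambda>x. g x * cut R x) x)" for n
    proof (rule Bochner_Integration.integrable_bound[OF D(3)[of n]])
      have "\<bar>N n (\<lambda>x. g x * cut R x) x\<bar> \<le> \<bar>N n g x\<bar>" for x using le[of n x] nn[of n x] by linarith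
      then show "AE x in \<mu>. norm (N n (\<lambda>x. g x * cut R x) x) \<le> norm (N n g x)" by (simp only: real_norm_def AE_I2)
    qed measurable
    show "expectation (\<lambda>x. N n (\<lambda>x. g x * cut R x) x) \<le> D" for n
      using integral_mono[OF i D(3) le] D(2)[of n] by (rule order_trans)
  qed
  ultimately show ?thesis by (simp add: SUP_least)
qed

text \<open>Counts of points above a level are not continuous functionals; a ramp lies between two
  such counts and is an admissible test function.\<close>

definition ramp :: "real \<Rightarrow> real \<Rightarrow> real \<Rightarrow> real" where "ramp s t x = (min x t - min x s) / (t - s)"

lemma ramp_props:
  assumes "0 < s" "s < t"
  shows "tail_test_fun s (ramp s t)" "0 \<le> ramp s t x" "ramp s t x \<le> 1" "x \<le> s \<Longrightarrow> ramp s t x = 0" "t \<le> x \<Longrightarrow> ramp s t x = 1"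
    "indicator {t<..} x \<le> ramp s t x" "ramp s t x \<le> indicator {s<..} x" "continuous_on UNIV (ramp s t)"
proof -
  show b: "0 \<le> ramp s t x" "ramp s t x \<le> 1" for x using assms by (auto simp: ramp_def divide_simps min_def)
  show 1: "x \<le> s \<Longrightarrow> ramp s t x = 0" "t \<le> x \<Longrightarrow> ramp s t x = 1" for x using assms by (auto simp: ramp_def)
  show c: "continuous_on UNIV (ramp s t)" unfolding ramp_def[abs_def] using assms by (auto intro!: continuous_intros)
  show "tail_test_fun s (ramp s t)" unfolding tail_test_fun_def using b 1 c assms by auto
  show "indicator {t<..} x \<le> ramp s t x" "ramp s t x \<le> indicator {s<..} x"
    using b[of x] 1[of x] by (auto simp: indicator_def)
qed

text \<open>The points of the array are nonnegative, so test functions supported in a bounded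
  negative interval away from 0 have sum 0, and by the bound on means so they have in the
  limit.\<close>

lemma z_nonneg: "AE \<omega> in M. \<forall>p. 0 \<le> z p \<omega>"
proof -
  have "AE \<omega> in M. \<forall>p. \<not> (- real (k + 2) < z p \<omega> \<and> z p \<omega> < - (1 / real (k + 1)))" for k :: nat
  proof -
    define f where "f x = max 0 (min (- x - 1 / real (k + 1)) (real (k + 2) + x))" for x
    have f: "continuous_on UNIV f" "0 \<le> f x" for x unfolding f_def[abs_def] by (auto intro!: continuous_intros)
    have fz: "f x = 0" if "\<bar>x\<bar> \<le> 1 / real (k + 1)" for x using that by (auto simp: f_def max_def min_def)
    have fR: "f x = 0" if "real (k + 2) \<le> \<bar>x\<bar>" for x
    proof (cases "x < 0")
      case False
      moreover have "0 \<le> 1 / real (k + 1)" by simp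
      ultimately have "- x - 1 / real (k + 1) \<le> 0" by linarith
      then show ?thesis by (simp add: f_def)
    qed (use that in \<open>auto simp: f_def\<close>)
    have fX: "f (X n j x) = 0" for n j x
    proof -
      have "0 \<le> 1 / real (k + 1)" by simp
      then have "- X n j x - 1 / real (k + 1) \<le> 0" using X_nonneg[of n j x] by linarith
      then show ?thesis by (simp add: f_def)
    qed
    have "(\<integral>\<^sup>+\<omega>. point_sum z f \<omega> \<partial>M) \<le> ennreal 0"
    proof (rule nn_point_sum_test_le)
      show "test_fun (1 / real (k + 1)) (real (k + 2)) f" unfolding test_fun_def using f fz fR by auto
    qed (auto simp: fX)
    moreover have [measurable]: "f \<in> borel_measurable borel" using f by (auto intro: borel_measurable_continuous_onI)
    ultimately have "AE \<omega> in M. point_sum z f \<omega> = 0" by (subst nn_integral_0_iff_AE[symmetric]) auto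
    then show ?thesis
    proof eventually_elim
      case (elim \<omega>)
      then have "\<forall>p. f (z p \<omega>) \<le> 0" unfolding point_sum_def by (subst (asm) nn_integral_0_iff_AE) (auto simp: AE_count_space ennreal_eq_0_iff)
      moreover have "0 < f y" if "- real (k + 2) < y" "y < - (1 / real (k + 1))" for y
        using that unfolding f_def less_max_iff_disj by (simp only: min_less_iff_conj) linarith
      ultimately show ?case by (auto simp: not_le[symmetric])
    qed
  qed
  then have "AE \<omega> in M. \<forall>k p. \<not> (- real (k + 2) < z p \<omega> \<and> z p \<omega> < - (1 / real (k + 1)))" by (simp add: AE_all_countable)
  then show ?thesis
  proof eventually_elim
    case (elim \<omega>)
    show ?case
    proof (rule allI, rule ccontr)
      fix p assume "\<not> 0 \<le> z p \<omega>"
      then have neg: "0 < - z p \<omega>" by simp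
      obtain k1 :: nat where k1: "1 / Suc k1 < - z p \<omega>" using nat_approx_posE[OF neg] by blast
      obtain k2 :: nat where k2: "- z p \<omega> \<le> k2" using real_arch_simple by blast
      define k where "k = max k1 k2"
      have "1 / real (k + 1) \<le> 1 / Suc k1" by (simp add: k_def frac_le)
      moreover have "- z p \<omega> < real (k + 2)" using k2 by (simp add: k_def)
      ultimately show False using elim[rule_format, of k p] k1 by linarith
    qed
  qed
qed

text \<open>Vague convergence alone would allow points to accumulate at infinity. The tail bound,
  uniform in n, excludes this by bounding the mean number of points above each positive
  level.\<close>

lemma locally_finite: "AE \<omega> in M. \<forall>\<delta>>0. finite {p. \<delta> < z p \<omega>}"
proof -
  have "AE \<omega> in M. finite {p. 1 / real (k + 1) < z p \<omega>}" for k :: nat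
  proof -
    define t where "t = 1 / real (k + 1)"
    have "0 < t" by (simp add: t_def)
    then have t: "0 < t / 2" "t / 2 < t" by simp_all
    let ?f = "ramp (t / 2) t"
    note f = ramp_props[OF t]
    have [measurable]: "?f \<in> borel_measurable borel" by (rule tail_test_fun_measurable[OF f(1)])
    have "expectation (\<lambda>x. N n ?f x) \<le> K * (t / 2) powr (- \<alpha>)" for n
      using N_mean_le(2)[of ?f 1 "t/2" n] H_le[OF t(1), of n] f by simp
    then have "(\<integral>\<^sup>+\<omega>. point_sum z ?f \<omega> \<partial>M) \<le> ennreal (K * (t / 2) powr (- \<alpha>))"
      by (intro nn_point_sum_le[OF f(1)] N_mean_le(1)[of ?f 1 "t/2"]) (use K_pos f in auto)
    then have "(\<integral>\<^sup>+\<omega>. point_sum z ?f \<omega> \<partial>M) < \<infinity>" by (rule le_less_trans) simp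
    then have "AE \<omega> in M. point_sum z ?f \<omega> \<noteq> \<infinity>" by (intro nn_integral_PInf_AE) auto
    then show ?thesis
    proof eventually_elim
      case (elim \<omega>)
      have "emeasure (count_space UNIV) {p. t < z p \<omega>} = (\<integral>\<^sup>+p. indicator {p. t < z p \<omega>} p \<partial>count_space UNIV)" by simp
      also have "\<dots> \<le> point_sum z ?f \<omega>" unfolding point_sum_def
        using f(5) f(2) by (intro nn_integral_mono) (auto simp: indicator_def)
      finally have "emeasure (count_space UNIV) {p. t < z p \<omega>} \<noteq> \<infinity>" using elim by (auto simp: top_unique)
      then show ?case by (auto simp: emeasure_count_space t_def split: if_splits)
    qed
  qed
  then have "AE \<omega> in M. \<forall>k::nat. finite {p. 1 / real (k + 1) < z p \<omega>}" by (simp add: AE_all_countable)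
  then show ?thesis
  proof eventually_elim
    case (elim \<omega>)
    show ?case
    proof (intro allI impI)
      fix \<delta> :: real assume "0 < \<delta>"
      then obtain k :: nat where k: "1 / Suc k < \<delta>" using nat_approx_posE by blast
      then have "{p. \<delta> < z p \<omega>} \<subseteq> {p. 1 / real (k + 1) < z p \<omega>}" by auto
      then show "finite {p. \<delta> < z p \<omega>}" by (rule finite_subset) (use elim in auto)
    qed
  qed
qed

lemma point_sum_tail_test_fun:
  assumes "\<And>x. 0 \<le> g x" "\<And>x. x \<le> \<delta> \<Longrightarrow> g x = 0" "finite {p. \<delta> < z p \<omega>}"
  shows "point_sum z g \<omega> = ennreal (\<Sum>p\<in>{p. \<delta> < z p \<omega>}. g (z p \<omega>))"
    and "Z g \<omega> = (\<Sum>p\<in>{p. \<delta> < z p \<omega>}. g (z p \<omega>))"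
proof -
  have s: "{p. g (z p \<omega>) \<noteq> 0} \<subseteq> {p. \<delta> < z p \<omega>}" using assms(2) by (force simp: not_le[symmetric])
  have "point_sum z g \<omega> = ennreal (\<Sum>p\<in>{p. g (z p \<omega>) \<noteq> 0}. g (z p \<omega>))"
    by (rule point_sum_finite[where g=g and z=z and \<omega>=\<omega>, OF finite_subset[OF s assms(3)] assms(1)])
  also have "(\<Sum>p\<in>{p. g (z p \<omega>) \<noteq> 0}. g (z p \<omega>)) = (\<Sum>p\<in>{p. \<delta> < z p \<omega>}. g (z p \<omega>))"
    by (rule sum.mono_neutral_left[OF assms(3) s]) auto
  finally show 1: "point_sum z g \<omega> = ennreal (\<Sum>p\<in>{p. \<delta> < z p \<omega>}. g (z p \<omega>))" .
  show "Z g \<omega> = (\<Sum>p\<in>{p. \<delta> < z p \<omega>}. g (z p \<omega>))" unfolding 1 using assms(1) by (simp add: sum_nonneg)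
qed

text \<open>A cut-off at R changes the prelimit sum only if some point exceeds R, which has
  probability at most K R^(-\<alpha>) for every n. In the limit the cut-off is eventually invisible,
  since only finitely many points lie above \<delta>.\<close>

lemma N_conv_law:
  assumes g: "tail_test_fun \<delta> g"
  shows "conv_law \<mu> M (\<lambda>n x. N n g x) (Z g)"
proof -
  have gm[measurable]: "g \<in> borel_measurable borel" by (rule tail_test_fun_measurable[OF g])
  have cm[measurable]: "cut R \<in> borel_measurable borel" for R unfolding cut_def[abs_def] by measurable
  note ga = g[unfolded tail_test_fun_def]
  have conv: "(\<lambda>n. expectation (\<lambda>x. iexp (u * N n g x))) \<longlonglongrightarrow> L.expectation (\<lambda>x. iexp (u * Z g x))" for u
  \<comment> \<open>The extra 2 at R = 0 is the trivial bound; there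
    \<open>0 powr (- \<alpha>) = 0\<close> makes the tail expression meaningless.\<close>
  proof (rule tendsto_approx[where e="\<lambda>R. 2 * (K * (real R) powr (- \<alpha>)) + (if R = 0 then 2 else 0)"])
    let ?g = "\<lambda>R x. g x * cut R x"
    show "(\<lambda>n. expectation (\<lambda>x. iexp (u * N n (?g R) x))) \<longlonglongrightarrow> L.expectation (\<lambda>x. iexp (u * Z (?g R) x))" for R
    proof -
      \<comment> \<open>\<open>test_conv\<close> concerns real-valued functions, so the exponential
        is treated through cosine and sine.\<close>
      have c: "continuous_on UNIV (\<lambda>y. cos (u * y))" and s: "continuous_on UNIV (\<lambda>y. sin (u * y))" by (intro continuous_intros)+
      have eq: "expectation (\<lambda>x. iexp (u * V x)) = Complex (expectation (\<lambda>x. cos (u * V x))) (expectation (\<lambda>x. sin (u * V x)))"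
        if [measurable]: "V \<in> borel_measurable \<mu>" for V
      proof -
        have "integrable \<mu> (\<lambda>x. iexp (u * V x))" by (rule integrable_const_bound[of _ 1]) auto
        then show ?thesis by (auto simp: complex_eq_iff Re_exp Im_exp simp flip: integral_Re integral_Im)
      qed
      have eqL: "L.expectation (\<lambda>x. iexp (u * V x)) = Complex (L.expectation (\<lambda>x. cos (u * V x))) (L.expectation (\<lambda>x. sin (u * V x)))"
        if [measurable]: "V \<in> borel_measurable M" for V
      proof -
        have "integrable M (\<lambda>x. iexp (u * V x))" by (rule L.integrable_const_bound[of _ 1]) auto
        then show ?thesis by (auto simp: complex_eq_iff Re_exp Im_exp simp flip: integral_Re integral_Im)
      qed
      show ?thesis
        by (subst eq, simp, subst eqL, simp)
          (intro tendsto_Complex test_conv[OF cut_tail_test_fun(1)[OF g] c, of 1] test_conv[OF cut_tail_test_fun(1)[OF g] s, of 1], auto)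
    qed
    show "cmod (expectation (\<lambda>x. iexp (u * N n (?g R) x)) - expectation (\<lambda>x. iexp (u * N n g x))) \<le>
      2 * (K * (real R) powr (- \<alpha>)) + (if R = 0 then 2 else 0)" for R n
    proof -
      define E where "E = (\<Union>j\<in>{1..n}. {x\<in>space \<mu>. real R < X n j x})"
      have [measurable]: "E \<in> events" unfolding E_def by measurable
      have le: "cmod (expectation (\<lambda>x. iexp (u * N n (?g R) x)) - expectation (\<lambda>x. iexp (u * N n g x))) \<le> 2 * prob E"
        by (rule iexp_diff_prob_le) (auto simp: E_def cut_props not_less intro!: sum.cong)
      have "prob E \<le> K * (real R) powr (- \<alpha>)" if "R \<noteq> 0"
      proof -
        have "prob E \<le> H n (real R)" unfolding E_def H_def by (rule measure_UNION_le) auto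
        also have "\<dots> \<le> K * (real R) powr (- \<alpha>)" by (rule H_le) (use that in simp)
        finally show ?thesis .
      qed
      moreover have "2 * prob E \<le> 2" by simp
      ultimately have "2 * prob E \<le> 2 * (K * (real R) powr (- \<alpha>)) + (if R = 0 then 2 else 0)"
        using K_pos by (cases "R = 0") auto
      with le show ?thesis by (rule order_trans)
    qed
    have "(\<lambda>R. 2 * (K * (real R) powr (- \<alpha>))) \<longlonglongrightarrow> 2 * (K * 0)"
      by (intro tendsto_mult_left tendsto_neg_powr) (use \<alpha>_range in \<open>auto simp: filterlim_real_sequentially\<close>)
    moreover have "(\<lambda>R::nat. if R = 0 then 2 else 0 :: real) \<longlonglongrightarrow> 0"
      by (rule tendsto_eventually) (auto simp: eventually_sequentially intro!: exI[of _ 1])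
    ultimately have "(\<lambda>R. 2 * (K * (real R) powr (- \<alpha>)) + (if R = 0 then 2 else 0)) \<longlonglongrightarrow> 2 * (K * 0) + 0" by (rule tendsto_add)
    then show "(\<lambda>R. 2 * (K * (real R) powr (- \<alpha>)) + (if R = 0 then 2 else 0)) \<longlonglongrightarrow> 0" by simp
    show "(\<lambda>R. L.expectation (\<lambda>x. iexp (u * Z (?g R) x))) \<longlonglongrightarrow> L.expectation (\<lambda>x. iexp (u * Z g x))"
    proof (rule integral_dominated_convergence[where w="\<lambda>_. 1"])
      show "AE x in M. (\<lambda>R. iexp (u * Z (?g R) x)) \<longlonglongrightarrow> iexp (u * Z g x)"
        using locally_finite
      proof eventually_elim
        case (elim \<omega>)
        let ?J = "{p. \<delta> < z p \<omega>}"
        have J: "finite ?J" using elim ga by blast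
        \<comment> \<open>Beyond the largest of the finitely many points above \<delta> the cut-off
          has no effect.\<close>
        obtain R0 :: nat where R0: "\<And>p. p \<in> ?J \<Longrightarrow> z p \<omega> \<le> real R0"
        proof -
          obtain b where b: "\<And>y. y \<in> (\<lambda>p. z p \<omega>) ` ?J \<Longrightarrow> y \<le> b" using J by (meson bdd_above_finite finite_imageI bdd_above.unfold)
          obtain R0 :: nat where "b \<le> real R0" using real_arch_simple by blast
          then show ?thesis using b that[of R0] by force
        qed
        have "Z (?g R) \<omega> = Z g \<omega>" if "R \<ge> R0" for R
        proof -
          have "Z (?g R) \<omega> = (\<Sum>p\<in>?J. ?g R (z p \<omega>))"
            by (rule point_sum_tail_test_fun(2)) (use ga cut_props J in auto)
          also have "\<dots> = (\<Sum>p\<in>?J. g (z p \<omega>))"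
          proof (rule sum.cong[OF refl])
            fix p assume "p \<in> ?J"
            then have "z p \<omega> \<le> real R" using R0[of p] that by simp
            then show "?g R (z p \<omega>) = g (z p \<omega>)" by (simp add: cut_props)
          qed
          also have "\<dots> = Z g \<omega>" by (rule point_sum_tail_test_fun(2)[symmetric]) (use ga J in auto)
          finally show ?thesis .
        qed
        then show ?case by (intro tendsto_eventually) (auto simp: eventually_sequentially intro!: exI[of _ R0])
      qed
    qed auto
  qed
  show ?thesis by unfold_locales (use conv in auto)
qed

end

section \<open>The mean measure\<close>

text \<open>Homogeneity under integers extends to rationals; monotonicity then squeezes f s between
  the values at a / n and (a + 1) / n, where a is the integer part of n s.\<close>

lemma monotone_homogeneous:
  fixes f :: "real \<Rightarrow> real"
  assumes mono: "\<And>s t. 0 < s \<Longrightarrow> s \<le> t \<Longrightarrow> f s \<le> f t" and nn: "\<And>s. 0 < s \<Longrightarrow> 0 \<le> f s"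
    and hom: "\<And>m s. m \<ge> 1 \<Longrightarrow> 0 < s \<Longrightarrow> f (real m * s) = real m * f s" and s: "0 < s"
  shows "f s = s * f 1"
proof -
  have "\<bar>f s - s * f 1\<bar> \<le> f 1 / real n" if n: "real n > 1 / s" for n
  proof -
    have n1: "n \<ge> 1" using n s by (cases n) (auto simp: not_less)
    define a where "a = nat \<lfloor>real n * s\<rfloor>"
    have ns: "1 < real n * s" using n s by (simp add: pos_divide_less_eq)
    have a: "real a \<le> real n * s" "real n * s \<le> real a + 1" unfolding a_def using ns by linarith+
    have a1: "a \<ge> 1" unfolding a_def using ns by linarith
    have f1: "f (1 / real n) = f 1 / real n" using hom[OF n1, of "1 / real n"] n1 by (simp add: field_simps)
    have frac: "f (real k / real n) = real k * f 1 / real n" if "k \<ge> 1" for k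
      using hom[OF that, of "1 / real n"] n1 f1 by simp
    have "real a / real n \<le> s" "s \<le> real (a + 1) / real n" using a n1 by (auto simp: field_simps)
    then have "real a * f 1 / real n \<le> f s" "f s \<le> real (a + 1) * f 1 / real n"
      using mono[of "real a / real n" s] mono[of s "real (a + 1) / real n"] frac[OF a1] frac[of "a + 1"] a1 n1 s by auto
    moreover have "real a * f 1 / real n \<le> s * f 1" "s * f 1 \<le> real (a + 1) * f 1 / real n"
      using mult_right_mono[OF a(1), of "f 1"] mult_right_mono[OF a(2), of "f 1"] nn[of 1] n1 by (auto simp: field_simps)
    moreover have "real (a + 1) * f 1 / real n = real a * f 1 / real n + f 1 / real n" using n1 by (simp add: field_simps)
    ultimately show ?thesis by linarith
  qed
  moreover have "\<forall>\<^sub>F n in sequentially. real n > 1 / s"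
    using filterlim_real_sequentially by (simp add: filterlim_at_top_dense)
  ultimately have ev: "\<forall>\<^sub>F n in sequentially. \<bar>f s - s * f 1\<bar> \<le> f 1 / real n" by (auto elim: eventually_mono)
  have "(\<lambda>n. f 1 / real n) \<longlonglongrightarrow> 0" by (rule lim_const_over_n)
  then have "\<bar>f s - s * f 1\<bar> \<le> 0" by (rule tendsto_lowerbound[OF _ ev]) simp
  then show ?thesis by simp
qed

section \<open>Mean measures of the array and of its limit\<close>

context cluster_limit
begin

text \<open>The mean measure of the n-th point process applied to g.\<close>

definition nu :: "nat \<Rightarrow> (real \<Rightarrow> real) \<Rightarrow> real" where "nu n g = (\<Sum>j=1..n. expectation (\<lambda>x. g (X n j x)))"

text \<open>The bound is asked for on the nonnegative axis, where the points lie; functions such as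
  \<open>min x e\<close> are unbounded below elsewhere.\<close>

lemma nu_eq:
  assumes [measurable]: "g \<in> borel_measurable borel" and "\<forall>x\<ge>0. \<bar>g x\<bar> \<le> D"
  shows "expectation (\<lambda>x. N n g x) = nu n g" "integrable \<mu> (\<lambda>x. g (X n j x))" "integrable \<mu> (\<lambda>x. N n g x)"
    "integrable \<mu> (\<lambda>x. (N n g x - c)\<^sup>2)"
proof -
  show i: "integrable \<mu> (\<lambda>x. g (X n j x))" for j
    by (rule integrable_const_bound[of _ D]) (use assms X_nonneg in auto)
  show "expectation (\<lambda>x. N n g x) = nu n g" unfolding nu_def by (rule Bochner_Integration.integral_sum) (rule i)
  show "integrable \<mu> (\<lambda>x. N n g x)" using i by auto
  have b: "\<bar>N n g x - c\<bar> \<le> real n * D + \<bar>c\<bar>" for x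
  proof -
    have "\<bar>N n g x\<bar> \<le> (\<Sum>j=1..n. \<bar>g (X n j x)\<bar>)" by (rule sum_abs)
    also have "\<dots> \<le> (\<Sum>j=1..n. D)" using assms X_nonneg by (intro sum_mono) auto
    finally have "\<bar>N n g x\<bar> \<le> real n * D" by simp
    then show ?thesis by linarith
  qed
  show "integrable \<mu> (\<lambda>x. (N n g x - c)\<^sup>2)"
  proof (rule integrable_const_bound[of _ "(real n * D + \<bar>c\<bar>)\<^sup>2"])
    show "AE x in \<mu>. norm ((N n g x - c)\<^sup>2) \<le> (real n * D + \<bar>c\<bar>)\<^sup>2"
      using power_mono[OF b abs_ge_zero, of _ 2] by (auto intro!: AE_I2)
  qed measurable
qed

lemma nu_mono:
  assumes "g \<in> borel_measurable borel" "\<forall>x\<ge>0. \<bar>g x\<bar> \<le> D" "h \<in> borel_measurable borel" "\<forall>x\<ge>0. \<bar>h x\<bar> \<le> D'"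
    and "\<And>x. 0 \<le> x \<Longrightarrow> g x \<le> h x"
  shows "nu n g \<le> nu n h"
  unfolding nu_def by (intro sum_mono integral_mono nu_eq(2)[OF assms(1,2)] nu_eq(2)[OF assms(3,4)] assms(5) X_nonneg)

lemma nu_indicator: "nu n (indicator {t<..}) = H n t"
  unfolding nu_def H_def
proof (rule sum.cong[OF refl])
  fix j
  have "expectation (\<lambda>x. indicator {t<..} (X n j x) :: real) = expectation (indicator {x\<in>space \<mu>. t < X n j x})"
    by (intro Bochner_Integration.integral_cong) (auto simp: indicator_def)
  then show "expectation (\<lambda>x. indicator {t<..} (X n j x)) = prob {x\<in>space \<mu>. t < X n j x}" by simp
qed

lemma ramp_measurable [measurable]: "ramp s t \<in> borel_measurable borel"
  unfolding ramp_def[abs_def] by measurable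

lemma ramp_abs: "0 < s \<Longrightarrow> s < t \<Longrightarrow> \<forall>x\<ge>0. \<bar>ramp s t x\<bar> \<le> 1"
  using ramp_props(2,3)[of s t] by simp

lemma ramp_variance:
  assumes "0 < s" "s < t"
  shows "expectation (\<lambda>x. (N n (ramp s t) x - nu n (ramp s t))\<^sup>2) \<le> K * s powr (- \<alpha>)"
  using var_ramp[OF assms, of n] unfolding nu_def ramp_def by (simp add: sum_subtractf)

lemma ramp_nu_bounds:
  assumes "0 < s" "s < t"
  shows "H n t \<le> nu n (ramp s t)" "nu n (ramp s t) \<le> H n s" "0 \<le> nu n (ramp s t)"
proof -
  have i: "\<forall>x\<ge>0. \<bar>indicator {r<..} x :: real\<bar> \<le> 1" for r :: real by simp
  show "H n t \<le> nu n (ramp s t)" unfolding nu_indicator[symmetric]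
    by (rule nu_mono[OF _ i ramp_measurable ramp_abs[OF assms] ramp_props(6)[OF assms]]) simp
  show "nu n (ramp s t) \<le> H n s" unfolding nu_indicator[symmetric]
    by (rule nu_mono[OF ramp_measurable ramp_abs[OF assms] _ i ramp_props(7)[OF assms]]) simp
  show "0 \<le> nu n (ramp s t)" using ramp_props(2)[OF assms] by (simp add: nu_def sum_nonneg)
qed

text \<open>Variance plus squared mean, both bounded independently of n, as the convergence of means
  demands.\<close>

lemma ramp_second_moment:
  assumes st: "0 < s" "s < t"
  shows "expectation (\<lambda>x. (N n (ramp s t) x)\<^sup>2) \<le> 2 * (K * s powr (- \<alpha>)) + 2 * (K * s powr (- \<alpha>))\<^sup>2"
proof -
  let ?v = "nu n (ramp s t)"
  note i = nu_eq(4)[OF ramp_measurable ramp_abs[OF st], of n]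
  have "expectation (\<lambda>x. (N n (ramp s t) x)\<^sup>2) \<le> expectation (\<lambda>x. 2 * (N n (ramp s t) x - ?v)\<^sup>2 + 2 * ?v\<^sup>2)"
  proof (rule integral_mono)
    show "integrable \<mu> (\<lambda>x. (N n (ramp s t) x)\<^sup>2)" using i[of 0] by simp
    show "integrable \<mu> (\<lambda>x. 2 * (N n (ramp s t) x - ?v)\<^sup>2 + 2 * ?v\<^sup>2)" using i[of ?v] by simp
    have sq: "y\<^sup>2 \<le> 2 * (y - v)\<^sup>2 + 2 * v\<^sup>2" for y v :: real
    proof -
      have "0 \<le> ((y - v) - v)\<^sup>2" by simp
      then show ?thesis by (simp add: power2_eq_square algebra_simps)
    qed
    show "(N n (ramp s t) x)\<^sup>2 \<le> 2 * (N n (ramp s t) x - ?v)\<^sup>2 + 2 * ?v\<^sup>2" for x by (rule sq)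
  qed
  also have "\<dots> = 2 * expectation (\<lambda>x. (N n (ramp s t) x - ?v)\<^sup>2) + 2 * ?v\<^sup>2"
    using i[of ?v] by (simp add: prob_space)
  also have "\<dots> \<le> 2 * (K * s powr (- \<alpha>)) + 2 * (K * s powr (- \<alpha>))\<^sup>2"
    using ramp_variance[OF st, of n] ramp_nu_bounds[OF st, of n] H_le[OF st(1), of n]
    by (intro add_mono mult_left_mono power_mono) auto
  finally show ?thesis .
qed

definition ramp_mean where "ramp_mean s t = L.expectation (Z (ramp s t))"

text \<open>Second moments bounded in n turn convergence in law into convergence of means. The last
  identity holds because the sum is almost surely finite, so \<open>enn2real\<close> loses
  nothing.\<close>

lemma ramp_mean_limit:
  assumes st: "0 < s" "s < t"
  shows "integrable M (Z (ramp s t))" "(\<lambda>n. nu n (ramp s t)) \<longlonglongrightarrow> ramp_mean s t"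
    "(\<integral>\<^sup>+\<omega>. point_sum z (ramp s t) \<omega> \<partial>M) = ennreal (ramp_mean s t)"
proof -
  interpret C: conv_law \<mu> M "\<lambda>n x. N n (ramp s t) x" "Z (ramp s t)"
    by (rule N_conv_law[OF ramp_props(1)[OF st]])
  have i: "integrable \<mu> (\<lambda>x. (N n (ramp s t) x)\<^sup>2)" for n
    using nu_eq(4)[OF ramp_measurable ramp_abs[OF st], of n 0] by simp
  note ml = C.mean_limit[OF i ramp_second_moment[OF st]]
  show iZ: "integrable M (Z (ramp s t))" by (rule ml(1))
  show "(\<lambda>n. nu n (ramp s t)) \<longlonglongrightarrow> ramp_mean s t"
    using ml(2) unfolding ramp_mean_def nu_eq(1)[OF ramp_measurable ramp_abs[OF st]] .
  have "AE \<omega> in M. point_sum z (ramp s t) \<omega> = ennreal (Z (ramp s t) \<omega>)"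
    using locally_finite
  proof eventually_elim
    case (elim \<omega>)
    have "point_sum z (ramp s t) \<omega> = ennreal (\<Sum>p\<in>{p. s < z p \<omega>}. ramp s t (z p \<omega>))"
      by (rule point_sum_tail_test_fun(1)) (use ramp_props[OF st] elim st in auto)
    then show ?case by (simp add: ramp_props[OF st] sum_nonneg)
  qed
  then have "(\<integral>\<^sup>+\<omega>. point_sum z (ramp s t) \<omega> \<partial>M) = (\<integral>\<^sup>+\<omega>. ennreal (Z (ramp s t) \<omega>) \<partial>M)" by (rule nn_integral_cong_AE)
  also have "\<dots> = ennreal (ramp_mean s t)" unfolding ramp_mean_def using iZ by (rule nn_integral_eq_integral) simp
  finally show "(\<integral>\<^sup>+\<omega>. point_sum z (ramp s t) \<omega> \<partial>M) = ennreal (ramp_mean s t)" .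
qed

lemma ramp_mean_nonneg: "0 \<le> ramp_mean s t"
  unfolding ramp_mean_def by simp

lemma ramp_scale:
  assumes "0 < c" shows "ramp s t (c * x) = ramp (s / c) (t / c) x"
  unfolding ramp_def using assms by (simp add: min_def field_simps)

text \<open>An m-th power of characteristic functions means an m-fold mean, so the mean measure
  inherits the scaling of the process.\<close>

lemma ramp_mean_scale:
  assumes st: "0 < s" "s < t" and m: "m \<ge> 1"
  defines "c \<equiv> real m powr (1 / \<alpha>)"
  shows "ramp_mean (s / c) (t / c) = real m * ramp_mean s t"
proof -
  have c: "0 < c" using m by (simp add: c_def)
  have eq: "ramp (s / c) (t / c) = (\<lambda>x. ramp s t (c * x))" using ramp_scale[OF c] by (auto simp: fun_eq_iff)
  show ?thesis unfolding ramp_mean_def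
  proof (rule L.mean_of_char_power)
    show "integrable M (Z (ramp s t))" by (rule ramp_mean_limit(1)[OF st])
    show "L.expectation (\<lambda>x. iexp (u * Z (ramp (s / c) (t / c)) x)) = L.expectation (\<lambda>x. iexp (u * Z (ramp s t) x)) ^ m" for u
      unfolding eq by (rule scaling[OF m ramp_props(1)[OF st] locally_finite, folded c_def])
  qed measurable
qed

definition tail where "tail t = (\<integral>\<^sup>+\<omega>. point_sum z (indicator {t<..}) \<omega> \<partial>M)"

text \<open>Ramps of shrinking width increase to the indicator, which carries the scaling of ramp
  means over to tails. The factor c covers the dilated process.\<close>

lemma tail_SUP:
  assumes t: "0 < t" and c: "0 < c"
  shows "(\<integral>\<^sup>+\<omega>. point_sum z (\<lambda>x. indicator {t<..} (c * x)) \<omega> \<partial>M) = (SUP k. ennreal (ramp_mean (t / c) ((t + 1 / Suc k) / c)))"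
proof -
  have st: "0 < t / c" "t / c < (t + 1 / Suc k) / c" for k using t c by (auto simp: divide_strict_right_mono)
  have rc: "ramp t (t + 1 / Suc k) (c * x) = ramp (t / c) ((t + 1 / Suc k) / c) x" for k x using ramp_scale[OF c] .
  have tt: "0 < t" "t < t + 1 / Suc k" for k :: nat using t by auto
  have "(\<integral>\<^sup>+\<omega>. point_sum z (\<lambda>x. indicator {t<..} (c * x)) \<omega> \<partial>M) = (SUP k. \<integral>\<^sup>+\<omega>. point_sum z (ramp (t / c) ((t + 1 / Suc k) / c)) \<omega> \<partial>M)"
  proof (rule nn_point_sum_SUP)
    show "0 \<le> ramp (t / c) ((t + 1 / Suc k) / c) x" for k x by (rule ramp_props(2)[OF st])
    show "ramp (t / c) ((t + 1 / Suc k) / c) x \<le> indicator {t<..} (c * x)" for k x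
      unfolding rc[symmetric] by (rule ramp_props(7)[OF tt])
    show "incseq (\<lambda>k. ramp (t / c) ((t + 1 / Suc k) / c) x)" for x
      unfolding rc[symmetric]
    proof (rule incseq_SucI)
      fix k
      let ?y = "c * x"
      show "ramp t (t + 1 / Suc k) ?y \<le> ramp t (t + 1 / Suc (Suc k)) ?y"
      \<comment> \<open>Above t the ramp is (y - t) (k + 1) capped at 1, hence increasing in
        k.\<close>
      proof (cases "?y \<le> t")
        case False
        show ?thesis
        proof (cases "t + 1 / Suc (Suc k) \<le> ?y")
          case True
          then have "ramp t (t + 1 / Suc (Suc k)) ?y = 1" by (rule ramp_props(5)[OF tt])
          then show ?thesis using ramp_props(3)[OF tt, of k ?y] by (simp only:)
        next
          case F: False
          have "1 / real (Suc (Suc k)) \<le> 1 / Suc k" by (simp add: frac_le)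
          then have "?y \<le> t + 1 / Suc k" using F by linarith
          then have "ramp t (t + 1 / Suc k) ?y = (?y - t) * Suc k" "ramp t (t + 1 / Suc (Suc k)) ?y = (?y - t) * Suc (Suc k)"
            using F False by (simp_all add: ramp_def)
          then show ?thesis using False by (simp add: mult_left_mono)
        qed
      next
        case True
        then show ?thesis using ramp_props(4)[OF tt True, of k] ramp_props(4)[OF tt True, of "Suc k"] by (simp only:)
      qed
    qed
    show "\<exists>k. ramp (t / c) ((t + 1 / Suc k) / c) x = indicator {t<..} (c * x)" for x
      unfolding rc[symmetric]
    proof (cases "c * x \<le> t")
      case True
      then show "\<exists>k. ramp t (t + 1 / Suc k) (c * x) = indicator {t<..} (c * x)" using ramp_props(4)[OF tt] by auto
    next
      case False
      then obtain k :: nat where "1 / Suc k < c * x - t" using nat_approx_posE[of "c * x - t"] by auto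
      then have "ramp t (t + 1 / Suc k) (c * x) = 1" by (intro ramp_props(5)[OF tt]) simp
      then show "\<exists>k. ramp t (t + 1 / Suc k) (c * x) = indicator {t<..} (c * x)" using False by (intro exI[of _ k]) auto
    qed
  qed simp
  then show ?thesis unfolding ramp_mean_limit(3)[OF st] .
qed

lemma tail_bounds:
  assumes st: "0 < s" "s < t"
  shows "tail t \<le> ennreal (ramp_mean s t)" "ennreal (ramp_mean s t) \<le> tail s"
proof -
  have "tail t \<le> (\<integral>\<^sup>+\<omega>. point_sum z (ramp s t) \<omega> \<partial>M)" unfolding tail_def point_sum_def
    using ramp_props(6)[OF st] by (intro nn_integral_mono ennreal_leI) auto
  then show "tail t \<le> ennreal (ramp_mean s t)" unfolding ramp_mean_limit(3)[OF st] .
  have "(\<integral>\<^sup>+\<omega>. point_sum z (ramp s t) \<omega> \<partial>M) \<le> tail s" unfolding tail_def point_sum_def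
    using ramp_props(7)[OF st] by (intro nn_integral_mono ennreal_leI) auto
  then show "ennreal (ramp_mean s t) \<le> tail s" unfolding ramp_mean_limit(3)[OF st] .
qed

lemma tail_finite: "0 < t \<Longrightarrow> tail t < \<infinity>"
  using tail_bounds(1)[of "t / 2" t] by (auto intro: le_less_trans)

lemma tail_scale:
  assumes t: "0 < t" and m: "m \<ge> 1"
  defines "c \<equiv> real m powr (1 / \<alpha>)"
  shows "tail (t / c) = ennreal (real m) * tail t"
proof -
  have c: "0 < c" using m by (simp add: c_def)
  have e: "indicator {t / c<..} = (\<lambda>x. indicator {t<..} (c * x) :: real)"
    using c by (auto simp: fun_eq_iff indicator_def pos_divide_less_eq mult.commute)
  have "tail (t / c) = (SUP k. ennreal (ramp_mean (t / c) ((t + 1 / Suc k) / c)))"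
    unfolding tail_def e by (rule tail_SUP[OF t c])
  also have "\<dots> = (SUP k. ennreal (real m) * ennreal (ramp_mean t (t + 1 / Suc k)))"
    unfolding c_def using t m by (subst ramp_mean_scale) (auto simp: ennreal_mult ramp_mean_nonneg)
  also have "\<dots> = ennreal (real m) * (SUP k. ennreal (ramp_mean t (t + 1 / Suc k)))"
    by (rule SUP_mult_left_ennreal[symmetric])
  also have "(SUP k. ennreal (ramp_mean t (t + 1 / Suc k))) = tail t"
    unfolding tail_def using tail_SUP[OF t zero_less_one] by simp
  finally show ?thesis .
qed

text \<open>In the variable s = t^(-\<alpha>) the scaling of the tail is homogeneity under integers,
  and monotonicity makes it linear.\<close>

lemma tail_power: "0 < t \<Longrightarrow> enn2real (tail t) = t powr (- \<alpha>) * enn2real (tail 1)"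
proof -
  assume t: "0 < t"
  define f where "f s = enn2real (tail (s powr (- 1 / \<alpha>)))" for s
  have "f (t powr (- \<alpha>)) = t powr (- \<alpha>) * f 1"
  proof (rule monotone_homogeneous)
    have mono: "tail b \<le> tail a" if "a \<le> b" for a b
      unfolding tail_def point_sum_def using that by (intro nn_integral_mono ennreal_leI) (auto simp: indicator_def)
    show "f s \<le> f t" if "0 < s" "s \<le> t" for s t
      unfolding f_def using that \<alpha>_range tail_finite[of "s powr (- 1 / \<alpha>)"] tail_finite[of "t powr (- 1 / \<alpha>)"]
      by (intro enn2real_mono mono powr_mono2') auto
    show "f (real m * s) = real m * f s" if "m \<ge> 1" "0 < s" for m s
    proof -
      have "(real m * s) powr (- 1 / \<alpha>) = s powr (- 1 / \<alpha>) / real m powr (1 / \<alpha>)"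
        using that by (simp add: powr_mult powr_minus divide_inverse mult.commute)
      then show ?thesis unfolding f_def using tail_scale[of "s powr (- 1 / \<alpha>)" m] that by (simp add: enn2real_mult)
    qed
  qed (use t in \<open>auto simp: f_def\<close>)
  then show ?thesis unfolding f_def using t \<alpha>_range by (simp add: powr_powr)
qed

text \<open>Ramps squeeze the prelimit tails between limiting means at neighbouring levels, so
  \<open>H n t\<close> converges to k t^(-\<alpha>) with one constant k for all t. The choice of
  b_n, encoded in \<open>tail_lim\<close>, forces k = 1.\<close>

lemma tail_eq:
  assumes t: "0 < t" shows "tail t = ennreal (t powr (- \<alpha>))" and "(\<lambda>n. H n t) \<longlonglongrightarrow> t powr (- \<alpha>)"
proof -
  define k where "k = enn2real (tail 1)"
  have k0: "0 \<le> k" by (simp add: k_def)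
  have tk: "tail t = ennreal (t powr (- \<alpha>) * k)" if "0 < t" for t
    unfolding k_def tail_power[OF that, symmetric] using tail_finite[OF that] by simp
  have rb: "t powr (- \<alpha>) * k \<le> ramp_mean s t" "ramp_mean s t \<le> s powr (- \<alpha>) * k" if "0 < s" "s < t" for s t
    using tail_bounds[OF that] tk[of s] tk[of t] that k0 by (auto simp: ennreal_le_iff ramp_mean_nonneg)
  have cont: "((\<lambda>s. s powr (- \<alpha>) * k) \<longlongrightarrow> t powr (- \<alpha>) * k) (at t)" if "0 < t" for t
    using that by (intro tendsto_intros) auto
  have Hlim: "(\<lambda>n. H n t) \<longlonglongrightarrow> t powr (- \<alpha>) * k" if t: "0 < t" for t
  proof (rule order_tendstoI)
    fix y assume "y < t powr (- \<alpha>) * k"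
    then have "\<forall>\<^sub>F s in at_right t. y < s powr (- \<alpha>) * k"
      using cont[OF t] by (intro order_tendstoD(1)[of _ "t powr (- \<alpha>) * k"]) (auto intro: filterlim_at_split[THEN iffD1, THEN conjunct2])
    from eventually_happens'[OF trivial_limit_at_right_real eventually_conj[OF this eventually_at_right_less]]
    obtain s where s: "t < s" "y < s powr (- \<alpha>) * k" by blast
    have "\<forall>\<^sub>F n in sequentially. y < nu n (ramp t s)"
      using order_tendstoD(1)[OF ramp_mean_limit(2)[OF t s(1)], of y] rb(1)[OF t s(1)] s(2) by simp
    then show "\<forall>\<^sub>F n in sequentially. y < H n t"
      by eventually_elim (use ramp_nu_bounds(2)[OF t s(1)] in \<open>auto intro: less_le_trans\<close>)
  next
    fix y assume "t powr (- \<alpha>) * k < y"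
    then have "\<forall>\<^sub>F s in at_left t. s powr (- \<alpha>) * k < y"
      using cont[OF t] by (intro order_tendstoD(2)[of _ "t powr (- \<alpha>) * k"]) (auto intro: filterlim_at_split[THEN iffD1, THEN conjunct1])
    moreover have "\<forall>\<^sub>F s in at_left t. 0 < s \<and> s < t"
      unfolding eventually_at_left[OF t] using t by (intro exI[of _ 0]) simp
    ultimately have "\<forall>\<^sub>F s in at_left t. s powr (- \<alpha>) * k < y \<and> 0 < s \<and> s < t" by (rule eventually_conj)
    from eventually_happens'[OF trivial_limit_at_left_real this]
    obtain s where s: "0 < s" "s < t" "s powr (- \<alpha>) * k < y" by blast
    have "\<forall>\<^sub>F n in sequentially. nu n (ramp s t) < y"
      using order_tendstoD(2)[OF ramp_mean_limit(2)[OF s(1,2)], of y] rb(2)[OF s(1,2)] s(3) by simp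
    then show "\<forall>\<^sub>F n in sequentially. H n t < y"
      by eventually_elim (use ramp_nu_bounds(1)[OF s(1,2)] in \<open>auto intro: le_less_trans\<close>)
  qed
  have "k = 1"
    using LIMSEQ_unique[OF Hlim[OF zero_less_one]] tail_lim unfolding H_def by simp
  then show "tail t = ennreal (t powr (- \<alpha>))" "(\<lambda>n. H n t) \<longlonglongrightarrow> t powr (- \<alpha>)" using tk[OF t] Hlim[OF t] by auto
qed

end

section \<open>Compensated sums\<close>

text \<open>\<open>tail_int \<alpha> x\<close> is \<open>\<integral> t powr (- \<alpha>) dt\<close> over \<open>x \<le> t \<le> 1\<close>.\<close>

definition tail_int :: "real \<Rightarrow> real \<Rightarrow> real" where
  "tail_int \<alpha> x = (if \<alpha> = 1 then - ln x else (1 - x powr (1 - \<alpha>)) / (1 - \<alpha>))"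

lemma tail_int_deriv: "0 < x \<Longrightarrow> ((\<lambda>x. - tail_int \<alpha> x) has_real_derivative x powr (- \<alpha>)) (at x)"
  unfolding tail_int_def by (cases "\<alpha> = 1") (auto intro!: derivative_eq_intros simp: powr_minus divide_inverse)

lemma integral_powr:
  assumes ab: "0 < a" "a < b"
  shows "(\<integral>t. t powr (- \<alpha>) * indicator {a..<b} t \<partial>lborel) = tail_int \<alpha> a - tail_int \<alpha> b"
proof -
  have "(\<integral>\<^sup>+t. ennreal (t powr (- \<alpha>) * indicator {a..<b} t) \<partial>lborel) = (\<integral>\<^sup>+t. ennreal (t powr (- \<alpha>)) * indicator {a..b} t \<partial>lborel)"
    using AE_lborel_singleton[of b] by (intro nn_integral_cong_AE) (auto elim!: eventually_mono simp: indicator_def)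
  also have "\<dots> = ennreal (- tail_int \<alpha> b - (- tail_int \<alpha> a))"
    by (rule nn_integral_FTC_Icc) (use ab in \<open>auto intro!: tail_int_deriv DERIV_subset\<close>)
  finally have e: "(\<integral>\<^sup>+t. ennreal (t powr (- \<alpha>) * indicator {a..<b} t) \<partial>lborel) = ennreal (tail_int \<alpha> a - tail_int \<alpha> b)" by simp
  have le: "- tail_int \<alpha> a \<le> - tail_int \<alpha> b"
    by (rule DERIV_nonneg_imp_nondecreasing) (use ab tail_int_deriv in \<open>auto intro!: exI[of _ "_ powr (- \<alpha>)"] less_le_trans[OF ab(1)]\<close>)
  have "(\<integral>t. t powr (- \<alpha>) * indicator {a..<b} t \<partial>lborel) = enn2real (\<integral>\<^sup>+t. ennreal (t powr (- \<alpha>) * indicator {a..<b} t) \<partial>lborel)"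
    by (intro integral_eq_nn_integral) auto
  then show ?thesis unfolding e using le by simp
qed

lemma tail_int_1 [simp]: "tail_int \<alpha> 1 = 0"
  by (simp add: tail_int_def)

text \<open>Integration by parts for t against \<alpha> t^(-\<alpha> - 1) on [x, 1]. It links the
  centring of the sharply truncated sum to that of the excesses.\<close>

lemma tail_int_ibp: "0 < x \<Longrightarrow> \<alpha> * tail_int \<alpha> x = x powr (1 - \<alpha>) + tail_int \<alpha> x - 1"
  by (auto simp: tail_int_def field_simps)

text \<open>The difference does not depend on x, which makes the drift in the stability relation
  independent of the truncation level.\<close>

lemma tail_int_scale:
  assumes "0 < x" "0 < c"
  shows "c * tail_int \<alpha> (x / c) - c powr \<alpha> * tail_int \<alpha> x = c * tail_int \<alpha> (1 / c)"
proof (cases "\<alpha> = 1")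
  case True
  then show ?thesis using assms by (simp add: tail_int_def ln_div algebra_simps)
next
  case False
  have "c * (x / c) powr (1 - \<alpha>) = c powr \<alpha> * x powr (1 - \<alpha>)" if "0 < x" for x
    using that assms(2) by (simp add: powr_divide powr_diff powr_minus)
  from this[OF assms(1)] this[OF zero_less_one]
  have e: "c * (x / c) powr (1 - \<alpha>) = c powr \<alpha> * x powr (1 - \<alpha>)" "c * (1 / c) powr (1 - \<alpha>) = c powr \<alpha>" by simp_all
  have "c * tail_int \<alpha> (x / c) = (c - c * (x / c) powr (1 - \<alpha>)) / (1 - \<alpha>)"
    "c powr \<alpha> * tail_int \<alpha> x = (c powr \<alpha> - c powr \<alpha> * x powr (1 - \<alpha>)) / (1 - \<alpha>)"
    "c * tail_int \<alpha> (1 / c) = (c - c * (1 / c) powr (1 - \<alpha>)) / (1 - \<alpha>)"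
    using False by (simp_all only: tail_int_def if_False times_divide_eq_right right_diff_distrib mult_1_right)
  then show ?thesis unfolding e by (simp add: diff_divide_distrib)
qed

lemma point_sum_add:
  assumes "\<And>x. 0 \<le> g x" "\<And>x. 0 \<le> h x"
  shows "point_sum z (\<lambda>x. g x + h x) \<omega> = point_sum z g \<omega> + point_sum z h \<omega>"
  unfolding point_sum_def using assms by (simp add: ennreal_plus nn_integral_add)

lemma point_sum_cmult: "0 \<le> c \<Longrightarrow> (\<And>x. 0 \<le> g x) \<Longrightarrow> point_sum z (\<lambda>x. c * g x) \<omega> = ennreal c * point_sum z g \<omega>"
  unfolding point_sum_def by (simp add: ennreal_mult nn_integral_cmult)

lemma point_sum_cong: "(\<And>p. g (z p \<omega>) = h (z p \<omega>)) \<Longrightarrow> point_sum z g \<omega> = point_sum z h \<omega>"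
  unfolding point_sum_def by simp

text \<open>Fubini, as the integrand on the left is the length of the part of [a, b) lying below
  V.\<close>

lemma (in prob_space) layer_cake:
  assumes [measurable]: "V \<in> borel_measurable M" and ab: "a < (b::real)"
  shows "(\<integral>\<^sup>+x. ennreal (min (V x) b - min (V x) a) \<partial>M) = (\<integral>\<^sup>+t. ennreal (prob {x\<in>space M. t < V x}) * indicator {a..<b} t \<partial>lborel)"
proof -
  interpret P: pair_sigma_finite M lborel ..
  have m: "(\<lambda>(x, t). indicator {a..<b} t * indicator {t<..} (V x) :: ennreal) \<in> borel_measurable (M \<Otimes>\<^sub>M lborel)"
  proof -
    have "(\<lambda>(x, t). if a \<le> t \<and> t < b \<and> t < V x then 1 else 0 :: ennreal) \<in> borel_measurable (M \<Otimes>\<^sub>M lborel)" by measurable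
    also have "(\<lambda>(x, t). if a \<le> t \<and> t < b \<and> t < V x then 1 else 0 :: ennreal) = (\<lambda>(x, t). indicator {a..<b} t * indicator {t<..} (V x))"
      by (auto simp: fun_eq_iff indicator_def)
    finally show ?thesis .
  qed
  have "(\<integral>\<^sup>+x. ennreal (min (V x) b - min (V x) a) \<partial>M) = (\<integral>\<^sup>+x. (\<integral>\<^sup>+t. indicator {a..<b} t * indicator {t<..} (V x) \<partial>lborel) \<partial>M)"
  proof (rule nn_integral_cong)
    fix x
    have "(\<integral>\<^sup>+t. indicator {a..<b} t * indicator {t<..} (V x) \<partial>lborel) = (\<integral>\<^sup>+t. indicator {a..<min b (V x)} t \<partial>lborel)"
      by (intro nn_integral_cong) (auto simp: indicator_def)
    also have "\<dots> = emeasure lborel {a..<min b (V x)}" by simp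
    also have "\<dots> = ennreal (min (V x) b - min (V x) a)"
      using ab by (cases "V x \<le> a"; cases "V x \<le> b") (auto simp: min_def)
    finally show "ennreal (min (V x) b - min (V x) a) = (\<integral>\<^sup>+t. indicator {a..<b} t * indicator {t<..} (V x) \<partial>lborel)" by simp
  qed
  also have "\<dots> = (\<integral>\<^sup>+t. (\<integral>\<^sup>+x. indicator {a..<b} t * indicator {t<..} (V x) \<partial>M) \<partial>lborel)"
    using P.Fubini'[OF m] by simp
  also have "\<dots> = (\<integral>\<^sup>+t. ennreal (prob {x\<in>space M. t < V x}) * indicator {a..<b} t \<partial>lborel)"
  proof (rule nn_integral_cong)
    fix t
    have "(\<integral>\<^sup>+x. indicator {a..<b} t * indicator {t<..} (V x) \<partial>M) = (\<integral>\<^sup>+x. indicator {a..<b} t * indicator {x\<in>space M. t < V x} x \<partial>M)"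
      by (intro nn_integral_cong) (auto simp: indicator_def)
    also have "\<dots> = indicator {a..<b} t * emeasure M {x\<in>space M. t < V x}" by (subst nn_integral_cmult_indicator) auto
    finally show "(\<integral>\<^sup>+x. indicator {a..<b} t * indicator {t<..} (V x) \<partial>M) = ennreal (prob {x\<in>space M. t < V x}) * indicator {a..<b} t"
      by (simp add: emeasure_eq_measure mult.commute)
  qed
  finally show ?thesis .
qed

section \<open>Compensated sums and their limit as the truncation level vanishes\<close>

context cluster_limit
begin

definition clip :: "real \<Rightarrow> real \<Rightarrow> real \<Rightarrow> real" where "clip a b x = min x b - min x a"

lemma clip_measurable [measurable]: "clip a b \<in> borel_measurable borel"
  unfolding clip_def[abs_def] by measurable

lemma clip_props:
  assumes "0 < a" "a < b"
  shows "tail_test_fun a (clip a b)" "0 \<le> clip a b x" "clip a b x \<le> b" "\<forall>x\<ge>0. \<bar>clip a b x\<bar> \<le> b"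
proof -
  have "continuous_on UNIV (clip a b)" unfolding clip_def[abs_def] by (intro continuous_intros)
  then show "tail_test_fun a (clip a b)" "0 \<le> clip a b x" "clip a b x \<le> b" "\<forall>x\<ge>0. \<bar>clip a b x\<bar> \<le> b"
    using assms unfolding tail_test_fun_def by (auto simp: min_def clip_def)
qed

text \<open>By the layer cake formula the mean is the integral of \<open>H n\<close> over [a, b),
  and \<open>H n t\<close> converges pointwise to t^(-\<alpha>) while bounded by K
  a^(-\<alpha>).\<close>

lemma nu_clip_limit:
  assumes ab: "0 < a" "a < b"
  shows "(\<lambda>n. nu n (clip a b)) \<longlonglongrightarrow> tail_int \<alpha> a - tail_int \<alpha> b"
proof -
  have Hmono: "H n t \<le> H n s" if "s \<le> t" for n s t
    unfolding H_def using that by (intro sum_mono finite_measure_mono) auto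
  have Hm[measurable]: "H n \<in> borel_measurable borel" for n
  proof -
    have "mono (\<lambda>t. - H n t)" using Hmono by (auto simp: mono_def)
    then have "(\<lambda>t. - (- H n t)) \<in> borel_measurable borel" by (intro borel_measurable_uminus borel_measurable_mono)
    then show ?thesis by simp
  qed
  have Hnn: "0 \<le> H n t" for n t by (simp add: H_def sum_nonneg)
  have nu_int: "nu n (clip a b) = (\<integral>t. H n t * indicator {a..<b} t \<partial>lborel)" for n
  proof -
    have e: "ennreal (expectation (\<lambda>x. clip a b (X n j x))) = (\<integral>\<^sup>+t. ennreal (prob {x\<in>space \<mu>. t < X n j x}) * indicator {a..<b} t \<partial>lborel)" for j
    proof -
      have "ennreal (expectation (\<lambda>x. clip a b (X n j x))) = (\<integral>\<^sup>+x. ennreal (clip a b (X n j x)) \<partial>\<mu>)"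
        using nu_eq(2)[OF clip_measurable clip_props(4)[OF ab]] clip_props(2)[OF ab] by (intro nn_integral_eq_integral[symmetric]) auto
      also have "\<dots> = (\<integral>\<^sup>+t. ennreal (prob {x\<in>space \<mu>. t < X n j x}) * indicator {a..<b} t \<partial>lborel)"
        unfolding clip_def by (rule layer_cake[OF X_meas ab(2)])
      finally show ?thesis .
    qed
    have pm[measurable]: "(\<lambda>t. prob {x\<in>space \<mu>. t < X n j x}) \<in> borel_measurable borel" for j
    proof -
      have "mono (\<lambda>t. - prob {x\<in>space \<mu>. t < X n j x})" by (auto simp: mono_def intro!: finite_measure_mono)
      then have "(\<lambda>t. - (- prob {x\<in>space \<mu>. t < X n j x})) \<in> borel_measurable borel" by (intro borel_measurable_uminus borel_measurable_mono)
      then show ?thesis by simp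
    qed
    have "ennreal (nu n (clip a b)) = (\<Sum>j=1..n. ennreal (expectation (\<lambda>x. clip a b (X n j x))))"
      unfolding nu_def using clip_props(2)[OF ab] by (intro sum_ennreal[symmetric]) simp
    also have "\<dots> = (\<integral>\<^sup>+t. (\<Sum>j=1..n. ennreal (prob {x\<in>space \<mu>. t < X n j x}) * indicator {a..<b} t) \<partial>lborel)"
      unfolding e by (intro nn_integral_sum[symmetric]) measurable
    also have "\<dots> = (\<integral>\<^sup>+t. ennreal (H n t * indicator {a..<b} t) \<partial>lborel)"
      by (intro nn_integral_cong) (auto simp: H_def indicator_def sum_ennreal)
    finally have eq: "ennreal (nu n (clip a b)) = (\<integral>\<^sup>+t. ennreal (H n t * indicator {a..<b} t) \<partial>lborel)" .
    have "(\<integral>t. H n t * indicator {a..<b} t \<partial>lborel) = enn2real (\<integral>\<^sup>+t. ennreal (H n t * indicator {a..<b} t) \<partial>lborel)"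
      using Hnn by (intro integral_eq_nn_integral) (auto simp: indicator_def)
    also have "\<dots> = nu n (clip a b)" unfolding eq[symmetric] using clip_props(2)[OF ab] by (simp add: nu_def sum_nonneg)
    finally show ?thesis by simp
  qed
  have "(\<lambda>n. \<integral>t. H n t * indicator {a..<b} t \<partial>lborel) \<longlonglongrightarrow> (\<integral>t. t powr (- \<alpha>) * indicator {a..<b} t \<partial>lborel)"
  proof (rule integral_dominated_convergence[where w="\<lambda>t. (K * a powr (- \<alpha>)) * indicator {a..<b} t"])
    show "integrable lborel (\<lambda>t. (K * a powr (- \<alpha>)) * indicator {a..<b} t)" using ab by simp
    show "AE t in lborel. (\<lambda>n. H n t * indicator {a..<b} t) \<longlonglongrightarrow> t powr (- \<alpha>) * indicator {a..<b} t"
    proof (rule AE_I2)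
      fix t show "(\<lambda>n. H n t * indicator {a..<b} t) \<longlonglongrightarrow> t powr (- \<alpha>) * indicator {a..<b} t"
        using tail_eq(2)[of t] ab by (cases "t \<in> {a..<b}") auto
    qed
    show "AE t in lborel. norm (H n t * indicator {a..<b} t) \<le> K * a powr (- \<alpha>) * indicator {a..<b} t" for n
      using Hnn order_trans[OF Hmono H_le[OF ab(1)]] by (intro AE_I2) (auto simp: indicator_def)
  qed measurable
  then show ?thesis unfolding nu_int integral_powr[OF ab] .
qed

lemma min_measurable: "(\<lambda>x::real. min x e) \<in> borel_measurable borel" by measurable

lemma small_variance:
  assumes e: "0 < e"
  shows "expectation (\<lambda>x. (N n (\<lambda>x. min x e) x - nu n (\<lambda>x. min x e))\<^sup>2) \<le> K * e powr (2 - \<alpha>)"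
  using var_small[OF e, of n] unfolding nu_def by (simp add: sum_subtractf)

lemma min_abs: "0 < e \<Longrightarrow> \<forall>x\<ge>0. \<bar>min x e\<bar> \<le> (e::real)" by auto

text \<open>Only the upper level enters, because a^(2 - \<alpha>) is at most b^(2 - \<alpha>); this
  uniformity in a is what lets a tend to 0. The 4 is 2 + 2 from (u - v)^2 <= 2 u^2 + 2 v^2.\<close>

lemma clip_variance:
  assumes ab: "0 < a" "a < b"
  shows "expectation (\<lambda>x. (N n (clip a b) x - nu n (clip a b))\<^sup>2) \<le> 4 * (K * b powr (2 - \<alpha>))"
proof -
  let ?A = "\<lambda>e x. N n (\<lambda>x. min x e) x - nu n (\<lambda>x. min x e)"
  have b: "0 < b" using ab by simp
  have i: "integrable \<mu> (\<lambda>x. (?A e x)\<^sup>2)" if "0 < e" for e by (rule nu_eq(4)[OF min_measurable min_abs[OF that]])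
  have ic: "integrable \<mu> (\<lambda>x. (N n (clip a b) x - nu n (clip a b))\<^sup>2)"
    by (rule nu_eq(4)[OF clip_measurable clip_props(4)[OF ab]])
  have nc: "nu n (clip a b) = nu n (\<lambda>x. min x b) - nu n (\<lambda>x. min x a)"
    unfolding nu_def clip_def sum_subtractf[symmetric]
    by (intro sum.cong refl Bochner_Integration.integral_diff nu_eq(2)[OF min_measurable min_abs] ab b)
  have eq: "N n (clip a b) x - nu n (clip a b) = ?A b x - ?A a x" for x
    unfolding nc by (simp add: clip_def sum_subtractf)
  have sq: "(u - v)\<^sup>2 \<le> 2 * u\<^sup>2 + 2 * v\<^sup>2" for u v :: real
  proof -
    have "0 \<le> (u + v)\<^sup>2" by simp
    then show ?thesis by (simp add: power2_eq_square algebra_simps)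
  qed
  have "expectation (\<lambda>x. (N n (clip a b) x - nu n (clip a b))\<^sup>2) \<le> expectation (\<lambda>x. 2 * (?A b x)\<^sup>2 + 2 * (?A a x)\<^sup>2)"
    using i[OF b] i[OF ab(1)] ic sq unfolding eq by (intro integral_mono) auto
  also have "\<dots> = 2 * expectation (\<lambda>x. (?A b x)\<^sup>2) + 2 * expectation (\<lambda>x. (?A a x)\<^sup>2)"
    using i[OF b] i[OF ab(1)] by simp
  also have "\<dots> \<le> 2 * (K * b powr (2 - \<alpha>)) + 2 * (K * a powr (2 - \<alpha>))"
    by (intro add_mono mult_left_mono small_variance ab b) auto
  also have "\<dots> \<le> 2 * (K * b powr (2 - \<alpha>)) + 2 * (K * b powr (2 - \<alpha>))"
    using ab K_pos \<alpha>_range by (intro add_mono mult_left_mono powr_mono2) auto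
  finally show ?thesis by simp
qed

text \<open>The variance bound of the array in the limit, where \<open>second_moment_limit\<close>
  doubles the constant.\<close>

lemma clip_moment:
  assumes ab: "0 < a" "a < b"
  shows "integrable M (\<lambda>\<omega>. (Z (clip a b) \<omega> - (tail_int \<alpha> a - tail_int \<alpha> b))\<^sup>2)"
    "L.expectation (\<lambda>\<omega>. (Z (clip a b) \<omega> - (tail_int \<alpha> a - tail_int \<alpha> b))\<^sup>2) \<le> 8 * K * b powr (2 - \<alpha>)"
proof -
  interpret C: conv_law \<mu> M "\<lambda>n x. N n (clip a b) x" "Z (clip a b)"
    by (rule N_conv_law[OF clip_props(1)[OF ab]])
  note m = C.second_moment_limit[OF nu_eq(4)[OF clip_measurable clip_props(4)[OF ab]] clip_variance[OF ab] nu_clip_limit[OF ab]]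
  show "integrable M (\<lambda>\<omega>. (Z (clip a b) \<omega> - (tail_int \<alpha> a - tail_int \<alpha> b))\<^sup>2)" by (rule m(1))
  show "L.expectation (\<lambda>\<omega>. (Z (clip a b) \<omega> - (tail_int \<alpha> a - tail_int \<alpha> b))\<^sup>2) \<le> 8 * K * b powr (2 - \<alpha>)"
    using m(2) by simp
qed

lemma good_point: "AE \<omega> in M. (\<forall>p. 0 \<le> z p \<omega>) \<and> (\<forall>\<delta>>0. finite {p. \<delta> < z p \<omega>})"
  using z_nonneg locally_finite by eventually_elim simp

lemma Z_indicator:
  assumes a: "0 < a" and fin: "finite {p. a < z p \<omega>}"
  shows "point_sum z (indicator {a<..}) \<omega> = ennreal (real (card {p. a < z p \<omega>}))"
    "Z (indicator {a<..}) \<omega> = real (card {p. a < z p \<omega>})"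
proof -
  have 0: "x \<le> a \<Longrightarrow> indicator {a<..} x = (0::real)" for x by simp
  note p = point_sum_tail_test_fun[of "indicator {a<..}" a \<omega>, OF _ 0 fin]
  have s: "(\<Sum>p\<in>{p. a < z p \<omega>}. indicator {a<..} (z p \<omega>) :: real) = real (card {p. a < z p \<omega>})"
    by (subst sum.cong[OF refl, of _ _ "\<lambda>_. 1"]) auto
  show "Z (indicator {a<..}) \<omega> = real (card {p. a < z p \<omega>})" using p(2) s by simp
  show "point_sum z (indicator {a<..}) \<omega> = ennreal (real (card {p. a < z p \<omega>}))" using p(1) s by simp
qed

text \<open>The indicator is a limit of ramps whose variance bound depends on their lower end a
  only, so Fatou's lemma applies.\<close>

lemma indicator_moment:
  assumes a: "0 < a"
  shows "integrable M (\<lambda>\<omega>. (Z (indicator {a<..}) \<omega> - a powr (- \<alpha>))\<^sup>2)"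
    "L.expectation (\<lambda>\<omega>. (Z (indicator {a<..}) \<omega> - a powr (- \<alpha>))\<^sup>2) \<le> 2 * (K * a powr (- \<alpha>))"
proof -
  define t where "t k = a + 1 / real (Suc k)" for k
  have at: "0 < a" "a < t k" for k using a by (auto simp: t_def)
  have t0: "t \<longlonglongrightarrow> a" unfolding t_def using tendsto_add[OF tendsto_const LIMSEQ_inverse_real_of_nat, of a] by (simp add: divide_inverse)
  have rm: "(\<lambda>k. ramp_mean a (t k)) \<longlonglongrightarrow> a powr (- \<alpha>)"
  proof (rule tendsto_sandwich)
    have b: "t k powr (- \<alpha>) \<le> ramp_mean a (t k)" "ramp_mean a (t k) \<le> a powr (- \<alpha>)" for k
      using tail_bounds[OF at(1) at(2)[of k]] tail_eq(1)[OF a] tail_eq(1)[of "t k"] at(1) at(2)[of k] by (auto simp: ennreal_le_iff ramp_mean_nonneg)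
    show "\<forall>\<^sub>F k in sequentially. t k powr (- \<alpha>) \<le> ramp_mean a (t k)" "\<forall>\<^sub>F k in sequentially. ramp_mean a (t k) \<le> a powr (- \<alpha>)"
      using b by simp_all
    show "(\<lambda>k. t k powr (- \<alpha>)) \<longlonglongrightarrow> a powr (- \<alpha>)" using t0 a by (intro tendsto_intros) auto
  qed simp
  have mom: "integrable M (\<lambda>\<omega>. (Z (ramp a (t k)) \<omega> - ramp_mean a (t k))\<^sup>2)"
    "L.expectation (\<lambda>\<omega>. (Z (ramp a (t k)) \<omega> - ramp_mean a (t k))\<^sup>2) \<le> 2 * (K * a powr (- \<alpha>))" for k
  proof -
    interpret C: conv_law \<mu> M "\<lambda>n x. N n (ramp a (t k)) x" "Z (ramp a (t k))"
      by (rule N_conv_law[OF ramp_props(1)[OF at]])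
    note m = C.second_moment_limit[OF nu_eq(4)[OF ramp_measurable ramp_abs[OF at]] ramp_variance[OF at] ramp_mean_limit(2)[OF at]]
    show "integrable M (\<lambda>\<omega>. (Z (ramp a (t k)) \<omega> - ramp_mean a (t k))\<^sup>2)"
      "L.expectation (\<lambda>\<omega>. (Z (ramp a (t k)) \<omega> - ramp_mean a (t k))\<^sup>2) \<le> 2 * (K * a powr (- \<alpha>))" by (rule m)+
  qed
  have lim: "AE \<omega> in M. (\<lambda>k. Z (ramp a (t k)) \<omega> - ramp_mean a (t k)) \<longlonglongrightarrow> Z (indicator {a<..}) \<omega> - a powr (- \<alpha>)"
    using good_point
  proof eventually_elim
    case (elim \<omega>)
    let ?J = "{p. a < z p \<omega>}"
    have J: "finite ?J" using elim a by blast
    have 1: "Z (ramp a (t k)) \<omega> = (\<Sum>p\<in>?J. ramp a (t k) (z p \<omega>))" for k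
      by (rule point_sum_tail_test_fun(2)) (use ramp_props[OF at] J in auto)
    have 2: "Z (indicator {a<..}) \<omega> = (\<Sum>p\<in>?J. 1)" using Z_indicator(2)[OF a J] by simp
    have "(\<lambda>k. ramp a (t k) (z p \<omega>)) \<longlonglongrightarrow> 1" if "p \<in> ?J" for p
    proof (rule tendsto_eventually)
      have "\<forall>\<^sub>F k in sequentially. t k < z p \<omega>" using order_tendstoD(2)[OF t0, of "z p \<omega>"] that by simp
      then show "\<forall>\<^sub>F k in sequentially. ramp a (t k) (z p \<omega>) = 1" by eventually_elim (simp add: ramp_props(5)[OF at])
    qed
    then show ?case unfolding 1 2 by (intro tendsto_diff tendsto_sum rm)
  qed
  show "integrable M (\<lambda>\<omega>. (Z (indicator {a<..}) \<omega> - a powr (- \<alpha>))\<^sup>2)"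
    "L.expectation (\<lambda>\<omega>. (Z (indicator {a<..}) \<omega> - a powr (- \<alpha>))\<^sup>2) \<le> 2 * (K * a powr (- \<alpha>))"
    by (rule L.second_moment_fatou[OF _ _ lim mom]; measurable)+
qed

text \<open>The continuous counterpart of truncating x to x > e, so that limit theorem and scaling
  apply to it; the two differ by e times a count.\<close>

definition excess :: "real \<Rightarrow> real \<Rightarrow> real" where "excess e x = max 0 (x - e)"

lemma excess_measurable [measurable]: "excess e \<in> borel_measurable borel"
  unfolding excess_def[abs_def] by measurable

lemma excess_props: "0 < e \<Longrightarrow> tail_test_fun e (excess e)" "0 \<le> excess e x" "x \<le> e \<Longrightarrow> excess e x = 0"
  unfolding tail_test_fun_def excess_def[abs_def] by (auto intro!: continuous_intros)

lemma excess_split: "a \<le> b \<Longrightarrow> excess a x = excess b x + clip a b x" "x = excess e x + min x e"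
  unfolding excess_def clip_def by (auto simp: max_def min_def)

text \<open>The centring is that of the sharply truncated sum,
  \<open>\<alpha> * tail_int \<alpha> e\<close>, less e times the mean count e^(-\<alpha>); by
  \<open>tail_int_ibp\<close> this is \<open>tail_int \<alpha> e - 1\<close>.\<close>

definition compensated :: "real \<Rightarrow> 'w \<Rightarrow> real" where "compensated e \<omega> = Z (excess e) \<omega> - (tail_int \<alpha> e - 1)"

lemma compensated_measurable [measurable]: "compensated e \<in> borel_measurable M"
  unfolding compensated_def[abs_def] by measurable

lemma compensated_diff:
  assumes ab: "0 < a" "a < b"
  shows "AE \<omega> in M. compensated a \<omega> - compensated b \<omega> = Z (clip a b) \<omega> - (tail_int \<alpha> a - tail_int \<alpha> b)"
  using good_point
proof eventually_elim
  case (elim \<omega>)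
  let ?J = "{p. a < z p \<omega>}"
  have J: "finite ?J" using elim ab by blast
  have "Z (excess a) \<omega> = (\<Sum>p\<in>?J. excess a (z p \<omega>))"
    by (rule point_sum_tail_test_fun(2)[OF _ _ J]) (auto simp: excess_def)
  moreover have "Z (excess b) \<omega> = (\<Sum>p\<in>?J. excess b (z p \<omega>))"
    by (rule point_sum_tail_test_fun(2)[OF _ _ J]) (use ab in \<open>auto simp: excess_def\<close>)
  moreover have "Z (clip a b) \<omega> = (\<Sum>p\<in>?J. clip a b (z p \<omega>))"
    by (rule point_sum_tail_test_fun(2)[OF _ _ J], rule clip_props(2)[OF ab]) (use ab in \<open>simp add: clip_def\<close>)
  moreover have "excess a x = excess b x + clip a b x" for x using ab by (intro excess_split(1)) simp
  ultimately have "Z (excess a) \<omega> = Z (excess b) \<omega> + Z (clip a b) \<omega>" by (simp only: sum.distrib)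
  then show ?case by (simp add: compensated_def)
qed

lemma compensated_moment:
  assumes ab: "0 < a" "a < b"
  shows "integrable M (\<lambda>\<omega>. (compensated a \<omega> - compensated b \<omega>)\<^sup>2)" "L.expectation (\<lambda>\<omega>. (compensated a \<omega> - compensated b \<omega>)\<^sup>2) \<le> 8 * K * b powr (2 - \<alpha>)"
proof -
  have e: "AE \<omega> in M. (compensated a \<omega> - compensated b \<omega>)\<^sup>2 = (Z (clip a b) \<omega> - (tail_int \<alpha> a - tail_int \<alpha> b))\<^sup>2"
    using compensated_diff[OF ab] by eventually_elim simp
  show "integrable M (\<lambda>\<omega>. (compensated a \<omega> - compensated b \<omega>)\<^sup>2)"
    by (rule integrable_cong_AE[THEN iffD2, OF _ _ e clip_moment(1)[OF ab]]) measurable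
  have "L.expectation (\<lambda>\<omega>. (compensated a \<omega> - compensated b \<omega>)\<^sup>2) = L.expectation (\<lambda>\<omega>. (Z (clip a b) \<omega> - (tail_int \<alpha> a - tail_int \<alpha> b))\<^sup>2)"
    by (rule integral_cong_AE[OF _ _ e]) measurable
  then show "L.expectation (\<lambda>\<omega>. (compensated a \<omega> - compensated b \<omega>)\<^sup>2) \<le> 8 * K * b powr (2 - \<alpha>)" using clip_moment(2)[OF ab] by simp
qed

text \<open>The levels 2^(-k) suffice for an almost sure limit; other levels are compared with it in
  mean square.\<close>

definition compensated_limit :: "'w \<Rightarrow> real" where "compensated_limit \<omega> = lim (\<lambda>k. compensated ((1/2) ^ k) \<omega>)"

lemma compensated_limit_measurable [measurable]: "compensated_limit \<in> borel_measurable M"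
  unfolding compensated_limit_def[abs_def] by measurable

text \<open>Increments between consecutive dyadic levels have L2 norm of order 2^(-k (1 -
  \<alpha>/2)). These are summable because \<alpha> < 2, so almost surely the increments are
  absolutely summable.\<close>

lemma compensated_limit_limit: "AE \<omega> in M. (\<lambda>k. compensated ((1/2) ^ k) \<omega>) \<longlonglongrightarrow> compensated_limit \<omega>"
proof -
  define D where "D k \<omega> = compensated ((1/2) ^ Suc k) \<omega> - compensated ((1/2) ^ k) \<omega>" for k \<omega>
  have [measurable]: "D k \<in> borel_measurable M" for k unfolding D_def[abs_def] by measurable
  \<comment> \<open>The square root of the ratio of successive variance bounds.\<close>
  define r where "r = sqrt ((1/2) powr (2 - \<alpha>))"
  have r: "0 < r" "r < 1" using \<alpha>_range by (auto simp: r_def powr01_less_one)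
  have rk: "((1/2) ^ k) powr (2 - \<alpha>) = (r ^ k)\<^sup>2" for k
  proof -
    have "((1/2::real) ^ k) powr (2 - \<alpha>) = ((1/2) powr (2 - \<alpha>)) ^ k"
      by (simp add: powr_realpow[symmetric] powr_powr mult.commute)
    also have "(1/2) powr (2 - \<alpha>) = r\<^sup>2" by (simp add: r_def)
    finally show ?thesis by (simp add: power_mult[symmetric] mult.commute)
  qed
  have ED: "L.expectation (\<lambda>\<omega>. \<bar>D k \<omega>\<bar>) \<le> sqrt (8 * K) * r ^ k" "integrable M (D k)" for k
  proof -
    have lt: "0 < (1/2::real) ^ Suc k" "(1/2::real) ^ Suc k < (1/2) ^ k" by auto
    have m: "L.expectation (\<lambda>\<omega>. (D k \<omega>)\<^sup>2) \<le> 8 * K * (r ^ k)\<^sup>2"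
      unfolding D_def using compensated_moment(2)[OF lt] unfolding rk .
    note a = L.abs_mean_le_sqrt[OF _ compensated_moment(1)[OF lt, folded D_def] m]
    show "integrable M (D k)" by (rule a(1)) measurable
    have "L.expectation (\<lambda>\<omega>. \<bar>D k \<omega>\<bar>) \<le> sqrt (8 * K * (r ^ k)\<^sup>2)" by (rule a(2)) measurable
    then show "L.expectation (\<lambda>\<omega>. \<bar>D k \<omega>\<bar>) \<le> sqrt (8 * K) * r ^ k" using r by (simp add: real_sqrt_mult)
  qed
  have "(\<integral>\<^sup>+\<omega>. (\<Sum>k. ennreal \<bar>D k \<omega>\<bar>) \<partial>M) = (\<Sum>k. \<integral>\<^sup>+\<omega>. ennreal \<bar>D k \<omega>\<bar> \<partial>M)"
    by (rule nn_integral_suminf) measurable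
  also have "\<dots> \<le> (\<Sum>k. ennreal (sqrt (8 * K) * r ^ k))"
  proof (intro suminf_le summableI)
    fix k
    have "(\<integral>\<^sup>+\<omega>. ennreal \<bar>D k \<omega>\<bar> \<partial>M) = ennreal (L.expectation (\<lambda>\<omega>. \<bar>D k \<omega>\<bar>))"
      using ED(2)[of k] by (intro nn_integral_eq_integral) auto
    also have "\<dots> \<le> ennreal (sqrt (8 * K) * r ^ k)" by (rule ennreal_leI) (rule ED(1))
    finally show "(\<integral>\<^sup>+\<omega>. ennreal \<bar>D k \<omega>\<bar> \<partial>M) \<le> ennreal (sqrt (8 * K) * r ^ k)" .
  qed
  also have "\<dots> = ennreal (sqrt (8 * K) * (1 / (1 - r)))"
    using r K_pos by (intro suminf_ennreal_eq sums_mult geometric_sums) auto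
  finally have "(\<integral>\<^sup>+\<omega>. (\<Sum>k. ennreal \<bar>D k \<omega>\<bar>) \<partial>M) \<noteq> \<infinity>" by (auto simp: top_unique)
  then have "AE \<omega> in M. (\<Sum>k. ennreal \<bar>D k \<omega>\<bar>) \<noteq> \<infinity>" by (intro nn_integral_PInf_AE) measurable
  then show ?thesis
  proof eventually_elim
    case (elim \<omega>)
    then have "summable (\<lambda>k. \<bar>D k \<omega>\<bar>)" by (intro summable_suminf_not_top) auto
    then have "summable (\<lambda>k. D k \<omega>)" by (rule summable_rabs_cancel)
    then have "(\<lambda>n. \<Sum>k<n. D k \<omega>) \<longlonglongrightarrow> (\<Sum>k. D k \<omega>)" by (rule summable_LIMSEQ)
    moreover have "(\<Sum>k<n. D k \<omega>) = compensated ((1/2) ^ n) \<omega> - compensated 1 \<omega>" for n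
      unfolding D_def using sum_lessThan_telescope[of "\<lambda>k. compensated ((1/2) ^ k) \<omega>" n] by simp
    ultimately have "(\<lambda>n. (compensated ((1/2) ^ n) \<omega> - compensated 1 \<omega>) + compensated 1 \<omega>) \<longlonglongrightarrow> (\<Sum>k. D k \<omega>) + compensated 1 \<omega>"
      by (intro tendsto_intros) simp
    then have "convergent (\<lambda>n. compensated ((1/2) ^ n) \<omega>)" unfolding convergent_def by auto
    then show ?case unfolding compensated_limit_def by (simp add: convergent_LIMSEQ_iff)
  qed
qed

text \<open>Fatou along the dyadic levels below e, for which the bound in terms of the larger level
  e is uniform.\<close>

lemma compensated_limit_moment:
  assumes e: "0 < e"
  shows "integrable M (\<lambda>\<omega>. (compensated_limit \<omega> - compensated e \<omega>)\<^sup>2)" "L.expectation (\<lambda>\<omega>. (compensated_limit \<omega> - compensated e \<omega>)\<^sup>2) \<le> 8 * K * e powr (2 - \<alpha>)"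
proof -
  obtain k0 where k0: "(1/2::real) ^ k0 < e" using real_arch_pow_inv[OF e, of "1/2"] by auto
  have lt: "0 < (1/2::real) ^ (k + k0)" "(1/2::real) ^ (k + k0) < e" for k
  proof -
    have "(1/2::real) ^ (k + k0) \<le> (1/2) ^ k0" by (rule power_decreasing) auto
    then show "(1/2::real) ^ (k + k0) < e" using k0 by linarith
  qed simp
  have lim: "AE \<omega> in M. (\<lambda>k. compensated ((1/2) ^ (k + k0)) \<omega> - compensated e \<omega>) \<longlonglongrightarrow> compensated_limit \<omega> - compensated e \<omega>"
    using compensated_limit_limit
  proof eventually_elim
    case (elim \<omega>)
    then show ?case by (intro tendsto_diff tendsto_const LIMSEQ_ignore_initial_segment)
  qed
  show "integrable M (\<lambda>\<omega>. (compensated_limit \<omega> - compensated e \<omega>)\<^sup>2)" "L.expectation (\<lambda>\<omega>. (compensated_limit \<omega> - compensated e \<omega>)\<^sup>2) \<le> 8 * K * e powr (2 - \<alpha>)"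
    by (rule L.second_moment_fatou[OF _ _ lim compensated_moment[OF lt]]; measurable)+
qed

lemma powr_eps_tendsto:
  assumes "\<And>k. 0 < e k" "e \<longlonglongrightarrow> (0::real)" "0 < p"
  shows "(\<lambda>k. e k powr p) \<longlonglongrightarrow> 0"
proof -
  have "(\<lambda>k. e k powr p) \<longlonglongrightarrow> 0 powr p"
    using assms by (intro tendsto_powr' tendsto_const) (auto intro: always_eventually less_imp_le)
  then show ?thesis by simp
qed

text \<open>Characteristic functions at u differ by at most |u| times the L1 distance.\<close>

lemma char_limit:
  assumes V: "\<And>k. V k \<in> borel_measurable M" and e: "\<And>k. 0 < e k" "e \<longlonglongrightarrow> 0"
    and int: "\<And>k. integrable M (\<lambda>\<omega>. V k \<omega> - W \<omega>)" and W: "W \<in> borel_measurable M"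
    and bd: "\<And>k. L.expectation (\<lambda>\<omega>. \<bar>V k \<omega> - W \<omega>\<bar>) \<le> C * e k powr p" and p: "0 < p"
  shows "(\<lambda>k. L.expectation (\<lambda>\<omega>. iexp (u * V k \<omega>))) \<longlonglongrightarrow> L.expectation (\<lambda>\<omega>. iexp (u * W \<omega>))"
proof (rule LIM_zero_cancel, rule Lim_null_comparison)
  show "\<forall>\<^sub>F k in sequentially. cmod (L.expectation (\<lambda>\<omega>. iexp (u * V k \<omega>)) - L.expectation (\<lambda>\<omega>. iexp (u * W \<omega>))) \<le> \<bar>u\<bar> * (C * e k powr p)"
    using order_trans[OF L.iexp_diff_le[OF V W int] mult_left_mono[OF bd abs_ge_zero]] by (intro always_eventually allI)
  show "(\<lambda>k. \<bar>u\<bar> * (C * e k powr p)) \<longlonglongrightarrow> 0"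
    using tendsto_mult_right_zero[OF tendsto_mult_right_zero[OF powr_eps_tendsto[OF e p]]] .
qed

lemma half_exponent: "0 < e \<Longrightarrow> 0 \<le> C \<Longrightarrow> sqrt (C * e powr (2 - \<alpha>)) = sqrt C * e powr (1 - \<alpha> / 2)"
proof -
  assume e: "0 < e" and C: "0 \<le> C"
  have "(e powr (1 - \<alpha> / 2))\<^sup>2 = e powr (2 - \<alpha>)" by (simp add: power2_eq_square powr_add[symmetric])
  then have "sqrt (e powr (2 - \<alpha>)) = e powr (1 - \<alpha> / 2)" by (metis powr_ge_zero real_sqrt_unique)
  then show ?thesis by (simp add: real_sqrt_mult)
qed

lemma compensated_mean:
  assumes e: "0 < e"
  shows "integrable M (\<lambda>\<omega>. compensated e \<omega> - compensated_limit \<omega>)" "L.expectation (\<lambda>\<omega>. \<bar>compensated e \<omega> - compensated_limit \<omega>\<bar>) \<le> sqrt (8 * K) * e powr (1 - \<alpha> / 2)"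
proof -
  note a = L.abs_mean_le_sqrt[OF _ compensated_limit_moment[OF e]]
  have i: "integrable M (\<lambda>\<omega>. compensated_limit \<omega> - compensated e \<omega>)" by (rule a(1)) measurable
  from Bochner_Integration.integrable_minus[OF i] show "integrable M (\<lambda>\<omega>. compensated e \<omega> - compensated_limit \<omega>)" by simp
  have "L.expectation (\<lambda>\<omega>. \<bar>compensated_limit \<omega> - compensated e \<omega>\<bar>) \<le> sqrt (8 * K * e powr (2 - \<alpha>))" by (rule a(2)) measurable
  then show "L.expectation (\<lambda>\<omega>. \<bar>compensated e \<omega> - compensated_limit \<omega>\<bar>) \<le> sqrt (8 * K) * e powr (1 - \<alpha> / 2)"
    using half_exponent[OF e, of "8 * K"] K_pos by (simp add: abs_minus_commute)
qed

lemma compensated_char_limit: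
  assumes "\<And>k. 0 < e k" "e \<longlonglongrightarrow> 0"
  shows "(\<lambda>k. L.expectation (\<lambda>\<omega>. iexp (u * compensated (e k) \<omega>))) \<longlonglongrightarrow> L.expectation (\<lambda>\<omega>. iexp (u * compensated_limit \<omega>))"
  by (rule char_limit[OF compensated_measurable assms compensated_mean(1)[OF assms(1)] compensated_limit_measurable compensated_mean(2)[OF assms(1)]])
    (use \<alpha>_range in auto)

text \<open>The truncated sum in the form of the claim: for e < 1 the subtracted term is the
  integral of x against the intensity over e < |x| <= 1.\<close>

definition sharp :: "real \<Rightarrow> 'w \<Rightarrow> real" where
  "sharp e \<omega> = Z (\<lambda>x. x * indicator {e<..} x) \<omega> - \<alpha> * tail_int \<alpha> e"

text \<open>The two truncations differ by e times a centred count. Its mean square is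
  O(e^(-\<alpha>)), so the difference is O(e^(1 - \<alpha>/2)) in mean and both truncations have the
  same limit.\<close>

lemma sharp_compensated:
  assumes e: "0 < e"
  shows "AE \<omega> in M. sharp e \<omega> - compensated e \<omega> = e * (Z (indicator {e<..}) \<omega> - e powr (- \<alpha>))"
  using good_point
proof eventually_elim
  case (elim \<omega>)
  let ?J = "{p. e < z p \<omega>}"
  have J: "finite ?J" using elim e by blast
  have "Z (\<lambda>x. x * indicator {e<..} x) \<omega> = (\<Sum>p\<in>?J. z p \<omega> * indicator {e<..} (z p \<omega>))"
    by (rule point_sum_tail_test_fun(2)[OF _ _ J]) (use e in \<open>auto simp: indicator_def\<close>)
  moreover have "Z (excess e) \<omega> = (\<Sum>p\<in>?J. excess e (z p \<omega>))"
    by (rule point_sum_tail_test_fun(2)[OF _ _ J]) (auto simp: excess_def)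
  moreover have "(\<Sum>p\<in>?J. z p \<omega> * indicator {e<..} (z p \<omega>)) = (\<Sum>p\<in>?J. excess e (z p \<omega>) + e)"
    by (intro sum.cong) (auto simp: excess_def)
  moreover have "e * e powr (- \<alpha>) = e powr (1 - \<alpha>)" using e by (simp add: powr_diff powr_minus field_simps)
  ultimately show ?case
    using tail_int_ibp[OF e, of \<alpha>] Z_indicator(2)[OF e J] by (simp add: sharp_def compensated_def sum.distrib algebra_simps)
qed

lemma sharp_measurable [measurable]: "sharp e \<in> borel_measurable M"
  unfolding sharp_def[abs_def] by measurable

lemma sharp_mean:
  assumes e: "0 < e"
  shows "integrable M (\<lambda>\<omega>. sharp e \<omega> - compensated_limit \<omega>)"
    "L.expectation (\<lambda>\<omega>. \<bar>sharp e \<omega> - compensated_limit \<omega>\<bar>) \<le> (sqrt (2 * K) + sqrt (8 * K)) * e powr (1 - \<alpha> / 2)"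
proof -
  let ?I = "\<lambda>\<omega>. Z (indicator {e<..}) \<omega> - e powr (- \<alpha>)"
  note a = L.abs_mean_le_sqrt[OF _ indicator_moment[OF e]]
  have i: "integrable M ?I" by (rule a(1)) measurable
  have m: "L.expectation (\<lambda>\<omega>. \<bar>?I \<omega>\<bar>) \<le> sqrt (2 * (K * e powr (- \<alpha>)))" by (rule a(2)) measurable
  have eq: "AE \<omega> in M. sharp e \<omega> - compensated_limit \<omega> = e * ?I \<omega> + (compensated e \<omega> - compensated_limit \<omega>)"
    using sharp_compensated[OF e] by eventually_elim simp
  have i2: "integrable M (\<lambda>\<omega>. e * ?I \<omega> + (compensated e \<omega> - compensated_limit \<omega>))" using i compensated_mean(1)[OF e] by auto
  show i3: "integrable M (\<lambda>\<omega>. sharp e \<omega> - compensated_limit \<omega>)"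
    by (rule integrable_cong_AE[THEN iffD2, OF _ _ eq i2]) measurable
  have "L.expectation (\<lambda>\<omega>. \<bar>sharp e \<omega> - compensated_limit \<omega>\<bar>) \<le> L.expectation (\<lambda>\<omega>. e * \<bar>?I \<omega>\<bar> + \<bar>compensated e \<omega> - compensated_limit \<omega>\<bar>)"
  proof (rule integral_mono_AE)
    show "AE \<omega> in M. \<bar>sharp e \<omega> - compensated_limit \<omega>\<bar> \<le> e * \<bar>?I \<omega>\<bar> + \<bar>compensated e \<omega> - compensated_limit \<omega>\<bar>"
      using eq
    proof eventually_elim
      case (elim \<omega>)
      have "\<bar>e * ?I \<omega> + (compensated e \<omega> - compensated_limit \<omega>)\<bar> \<le> \<bar>e * ?I \<omega>\<bar> + \<bar>compensated e \<omega> - compensated_limit \<omega>\<bar>" by (rule abs_triangle_ineq)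
      then show ?case unfolding elim using e by (simp add: abs_mult)
    qed
  qed (use i3 i compensated_mean(1)[OF e] in auto)
  also have "\<dots> = e * L.expectation (\<lambda>\<omega>. \<bar>?I \<omega>\<bar>) + L.expectation (\<lambda>\<omega>. \<bar>compensated e \<omega> - compensated_limit \<omega>\<bar>)"
    using i compensated_mean(1)[OF e] by simp
  also have "\<dots> \<le> e * sqrt (2 * (K * e powr (- \<alpha>))) + sqrt (8 * K) * e powr (1 - \<alpha> / 2)"
    using m e compensated_mean(2)[OF e] by (intro add_mono mult_left_mono) auto
  also have "e * sqrt (2 * (K * e powr (- \<alpha>))) = sqrt (2 * K) * e powr (1 - \<alpha> / 2)"
  proof -
    have "e * sqrt (2 * (K * e powr (- \<alpha>))) = sqrt (e\<^sup>2 * (2 * (K * e powr (- \<alpha>))))" using e by (simp add: real_sqrt_mult)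
    also have "e\<^sup>2 * (2 * (K * e powr (- \<alpha>))) = (2 * K) * e powr (2 - \<alpha>)"
      using e by (simp add: powr_diff powr_minus powr_numeral field_simps)
    finally show ?thesis using half_exponent[OF e, of "2 * K"] K_pos by simp
  qed
  finally show "L.expectation (\<lambda>\<omega>. \<bar>sharp e \<omega> - compensated_limit \<omega>\<bar>) \<le> (sqrt (2 * K) + sqrt (8 * K)) * e powr (1 - \<alpha> / 2)"
    by (simp add: algebra_simps)
qed

lemma sharp_weak_conv:
  assumes "\<And>k. 0 < e k" "e \<longlonglongrightarrow> 0"
  shows "weak_conv_m (\<lambda>k. distr M borel (sharp (e k))) (distr M borel compensated_limit)"
proof -
  have "(\<lambda>k. L.expectation (\<lambda>\<omega>. iexp (u * sharp (e k) \<omega>))) \<longlonglongrightarrow> L.expectation (\<lambda>\<omega>. iexp (u * compensated_limit \<omega>))" for u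
    by (rule char_limit[OF sharp_measurable assms sharp_mean(1)[OF assms(1)] compensated_limit_measurable sharp_mean(2)[OF assms(1)]])
      (use \<alpha>_range in auto)
  then interpret C: conv_law M M "\<lambda>k. sharp (e k)" compensated_limit by unfold_locales auto
  show ?thesis by (rule C.weak_conv)
qed

text \<open>\<open>excess e (c * x)\<close> is c times \<open>excess (e / c) x\<close>, so dilating
  the process amounts to shifting the truncation level.\<close>

lemma Z_excess_scaling:
  assumes e: "0 < e" and m: "m \<ge> 1"
  defines "c \<equiv> real m powr (1 / \<alpha>)"
  shows "L.expectation (\<lambda>\<omega>. iexp (u * (c * Z (excess (e / c)) \<omega>))) = L.expectation (\<lambda>\<omega>. iexp (u * Z (excess e) \<omega>)) ^ m"
proof -
  have c: "0 < c" using m by (simp add: c_def)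
  have "excess e (c * x) = c * excess (e / c) x" for x
    unfolding excess_def using c by (simp add: max_def field_simps)
  then have "point_sum z (\<lambda>x. excess e (c * x)) \<omega> = ennreal c * point_sum z (excess (e / c)) \<omega>" for \<omega>
    using point_sum_cmult[of c "excess (e / c)" z \<omega>] c excess_props(2) by simp
  then have "Z (\<lambda>x. excess e (c * x)) \<omega> = c * Z (excess (e / c)) \<omega>" for \<omega> using c by (simp add: enn2real_mult)
  then show ?thesis using scaling[OF m excess_props(1)[OF e] locally_finite, folded c_def] by simp
qed

text \<open>A point above R contributes at least R - 1, so the second moment is at least (R - 1)^2
  times the mean number R^(-\<alpha>) of such points, which is unbounded as \<alpha> < 2.\<close>

lemma excess_not_square_integrable: "\<not> integrable M (\<lambda>\<omega>. (Z (excess 1) \<omega>)\<^sup>2)"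
proof
  assume i: "integrable M (\<lambda>\<omega>. (Z (excess 1) \<omega>)\<^sup>2)"
  define F where "F = L.expectation (\<lambda>\<omega>. (Z (excess 1) \<omega>)\<^sup>2)"
  have F: "0 \<le> F" by (simp add: F_def)
  have bd: "(R - 1)\<^sup>2 * R powr (- \<alpha>) \<le> F" if R: "1 < R" for R
  proof -
    have R0: "0 < R" using R by simp
    have ae: "AE \<omega> in M. ennreal ((R - 1)\<^sup>2) * point_sum z (indicator {R<..}) \<omega> \<le> ennreal ((Z (excess 1) \<omega>)\<^sup>2)"
      using good_point
    proof eventually_elim
      case (elim \<omega>)
      let ?J = "{p. R < z p \<omega>}" and ?J1 = "{p. 1 < z p \<omega>}"
      have J: "finite ?J" "finite ?J1" using elim R0 by auto
      have "(R - 1) * real (card ?J) = (\<Sum>p\<in>?J. R - 1)" by simp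
      also have "\<dots> \<le> (\<Sum>p\<in>?J. excess 1 (z p \<omega>))" by (intro sum_mono) (auto simp: excess_def)
      also have "\<dots> \<le> (\<Sum>p\<in>?J1. excess 1 (z p \<omega>))" using J R by (intro sum_mono2) (auto simp: excess_props)
      also have "\<dots> = Z (excess 1) \<omega>" by (rule point_sum_tail_test_fun(2)[OF _ _ J(2), symmetric]) (auto simp: excess_def)
      finally have "((R - 1) * real (card ?J))\<^sup>2 \<le> (Z (excess 1) \<omega>)\<^sup>2" using R by (intro power_mono) auto
      \<comment> \<open>A natural number is at most its square, so only the mean of the count is
        required.\<close>
      moreover have "real (card ?J) \<le> (real (card ?J))\<^sup>2" by (cases "card ?J") (auto simp: power2_eq_square)
      then have "(R - 1)\<^sup>2 * real (card ?J) \<le> ((R - 1) * real (card ?J))\<^sup>2"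
        unfolding power_mult_distrib by (rule mult_left_mono) simp
      ultimately have "(R - 1)\<^sup>2 * real (card ?J) \<le> (Z (excess 1) \<omega>)\<^sup>2" by linarith
      then have "ennreal ((R - 1)\<^sup>2 * real (card ?J)) \<le> ennreal ((Z (excess 1) \<omega>)\<^sup>2)" by (rule ennreal_leI)
      then show ?case unfolding Z_indicator(1)[OF R0 J(1)] by (simp add: ennreal_mult)
    qed
    have "ennreal ((R - 1)\<^sup>2) * tail R = (\<integral>\<^sup>+\<omega>. ennreal ((R - 1)\<^sup>2) * point_sum z (indicator {R<..}) \<omega> \<partial>M)"
      unfolding tail_def by (rule nn_integral_cmult[symmetric]) measurable
    also have "\<dots> \<le> (\<integral>\<^sup>+\<omega>. ennreal ((Z (excess 1) \<omega>)\<^sup>2) \<partial>M)" by (rule nn_integral_mono_AE[OF ae])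
    also have "\<dots> = ennreal F" unfolding F_def using i by (intro nn_integral_eq_integral) auto
    finally have "ennreal ((R - 1)\<^sup>2 * R powr (- \<alpha>)) \<le> ennreal F" unfolding tail_eq(1)[OF R0] by (simp add: ennreal_mult)
    then show ?thesis using F by (simp add: ennreal_le_iff)
  qed
  \<comment> \<open>R >= 2 gives R^2 <= 4 (R - 1)^2, and then R^(2 - \<alpha>) >= 4 F + 1
    contradicts the bound by 4 F.\<close>
  define R where "R = max 2 ((4 * F + 1) powr (1 / (2 - \<alpha>)))"
  have R: "2 \<le> R" by (simp add: R_def)
  have "4 * F + 1 = ((4 * F + 1) powr (1 / (2 - \<alpha>))) powr (2 - \<alpha>)" using F \<alpha>_range by (simp add: powr_powr)
  also have "\<dots> \<le> R powr (2 - \<alpha>)" using \<alpha>_range by (intro powr_mono2) (auto simp: R_def)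
  also have "\<dots> = R\<^sup>2 * R powr (- \<alpha>)" using R by (simp add: powr_diff powr_minus powr_numeral divide_inverse)
  also have "\<dots> \<le> (4 * (R - 1)\<^sup>2) * R powr (- \<alpha>)"
  proof (rule mult_right_mono)
    have "R\<^sup>2 \<le> (2 * (R - 1))\<^sup>2" using R by (intro power_mono) auto
    also have "(2 * (R - 1))\<^sup>2 = 4 * (R - 1)\<^sup>2" by (simp only: power_mult_distrib) simp
    finally show "R\<^sup>2 \<le> 4 * (R - 1)\<^sup>2" .
  qed simp
  also have "\<dots> \<le> 4 * F" using bd[of R] R by simp
  finally show False by simp
qed

text \<open>The limit is at finite mean square distance from the sum of the excesses over 1; were it
  constant, that sum would be square integrable.\<close>

lemma compensated_limit_not_constant: "\<not> (AE \<omega> in M. compensated_limit \<omega> = y)"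
proof
  assume "AE \<omega> in M. compensated_limit \<omega> = y"
  then have e: "AE \<omega> in M. (compensated_limit \<omega> - compensated 1 \<omega>)\<^sup>2 = (y - compensated 1 \<omega>)\<^sup>2" by eventually_elim simp
  have i: "integrable M (\<lambda>\<omega>. (y - compensated 1 \<omega>)\<^sup>2)"
    by (rule integrable_cong_AE[THEN iffD1, OF _ _ e compensated_limit_moment(1)[OF zero_less_one]]) measurable
  have i1: "integrable M (\<lambda>\<omega>. y - compensated 1 \<omega>)"
    by (rule L.square_integrable_imp_integrable[OF _ i]) measurable
  \<comment> \<open>As \<open>tail_int \<alpha> 1 = 0\<close>, the sum of the excesses is
    \<open>compensated 1\<close> minus 1.\<close>
  have eq: "(Z (excess 1) \<omega>)\<^sup>2 = (y - compensated 1 \<omega>)\<^sup>2 - 2 * (y - 1) * (y - compensated 1 \<omega>) + (y - 1)\<^sup>2" for \<omega>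
    unfolding compensated_def by (simp add: power2_eq_square algebra_simps)
  have "integrable M (\<lambda>\<omega>. (Z (excess 1) \<omega>)\<^sup>2)" unfolding eq using i i1 by auto
  then show False using excess_not_square_integrable by simp
qed

section \<open>Stability of the compensated limit and convergence of centred sums\<close>

lemma halves: "0 < (1/2::real) ^ k" "(\<lambda>k. (1/2::real) ^ k) \<longlonglongrightarrow> 0"
  by (auto intro: LIMSEQ_realpow_zero)

text \<open>The m-th power of the characteristic function at level e is that of c times the sum at
  level e / c, plus a drift. The drift does not depend on e, so e may tend to 0 on both
  sides.\<close>

lemma compensated_limit_stable: "stable_law \<alpha> (distr M borel compensated_limit)"
proof (rule L.stable_lawI[OF compensated_limit_measurable compensated_limit_not_constant])
  fix m :: nat assume m: "m \<ge> 1"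
  define c where "c = real m powr (1 / \<alpha>)"
  have c: "0 < c" "c powr \<alpha> = real m" using m \<alpha>_range by (auto simp: c_def powr_powr)
  \<comment> \<open>The drift c (tail_int(e / c) - 1) - m (tail_int(e) - 1), evaluated by
    \<open>tail_int_scale\<close> with c^\<alpha> = m.\<close>
  define d where "d = c * (tail_int \<alpha> (1 / c) - 1) + real m"
  have "L.expectation (\<lambda>\<omega>. iexp (u * compensated_limit \<omega>)) ^ m = L.expectation (\<lambda>\<omega>. iexp (u * (c * compensated_limit \<omega> + d)))" for u
  proof (rule LIMSEQ_unique)
    let ?e = "\<lambda>k. (1/2::real) ^ k"
    show "(\<lambda>k. L.expectation (\<lambda>\<omega>. iexp (u * compensated (?e k) \<omega>)) ^ m) \<longlonglongrightarrow> L.expectation (\<lambda>\<omega>. iexp (u * compensated_limit \<omega>)) ^ m"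
      by (intro tendsto_power compensated_char_limit halves)
    have ec: "0 < ?e k / c" "(\<lambda>k. ?e k / c) \<longlonglongrightarrow> 0" for k
      using c halves tendsto_divide[OF halves(2) tendsto_const, of c] by auto
    have shift: "L.expectation (\<lambda>\<omega>. iexp (u * (a * V \<omega> + b))) = iexp (u * b) * L.expectation (\<lambda>\<omega>. iexp ((u * a) * V \<omega>))" for V a b
    proof -
      have "iexp (u * (a * V \<omega> + b)) = iexp (u * b) * iexp ((u * a) * V \<omega>)" for \<omega>
        by (simp add: exp_add[symmetric] algebra_simps)
      then show ?thesis by (simp only: integral_mult_right_zero)
    qed
    have eq: "L.expectation (\<lambda>\<omega>. iexp (u * compensated (?e k) \<omega>)) ^ m = L.expectation (\<lambda>\<omega>. iexp (u * (c * compensated (?e k / c) \<omega> + d)))" for k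
    proof -
      let ?t = "?e k"
      have dk: "d = c * (tail_int \<alpha> (?t / c) - 1) - real m * (tail_int \<alpha> ?t - 1)"
        using tail_int_scale[OF halves(1) c(1), of \<alpha> k] unfolding c(2) d_def by (simp add: algebra_simps)
      have Yt: "compensated ?t \<omega> = 1 * Z (excess ?t) \<omega> + - (tail_int \<alpha> ?t - 1)" for \<omega> by (simp add: compensated_def)
      have Yc: "c * compensated (?t / c) \<omega> + d = c * Z (excess (?t / c)) \<omega> + - (real m * (tail_int \<alpha> ?t - 1))" for \<omega>
        by (simp add: compensated_def dk algebra_simps)
      have "L.expectation (\<lambda>\<omega>. iexp (u * compensated ?t \<omega>)) ^ m = (iexp (u * (- (tail_int \<alpha> ?t - 1)))) ^ m * L.expectation (\<lambda>\<omega>. iexp (u * Z (excess ?t) \<omega>)) ^ m"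
        unfolding Yt shift by (simp add: power_mult_distrib)
      also have "(iexp (u * (- (tail_int \<alpha> ?t - 1)))) ^ m = iexp (u * (- (real m * (tail_int \<alpha> ?t - 1))))"
        by (subst exp_of_nat_mult[symmetric]) (simp add: algebra_simps)
      also have "L.expectation (\<lambda>\<omega>. iexp (u * Z (excess ?t) \<omega>)) ^ m = L.expectation (\<lambda>\<omega>. iexp ((u * c) * Z (excess (?t / c)) \<omega>))"
        using Z_excess_scaling[OF halves(1) m, of u k, folded c_def] by (simp add: mult.assoc)
      finally show ?thesis unfolding Yc shift .
    qed
    show "(\<lambda>k. L.expectation (\<lambda>\<omega>. iexp (u * compensated (?e k) \<omega>)) ^ m) \<longlonglongrightarrow> L.expectation (\<lambda>\<omega>. iexp (u * (c * compensated_limit \<omega> + d)))"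
      unfolding eq shift by (intro tendsto_mult tendsto_const compensated_char_limit ec)
  qed
  then show "\<exists>d. \<forall>u. L.expectation (\<lambda>\<omega>. iexp (u * compensated_limit \<omega>)) ^ m = L.expectation (\<lambda>\<omega>. iexp (u * (real m powr (1 / \<alpha>) * compensated_limit \<omega> + d)))"
    unfolding c_def by blast
qed

text \<open>The centring truncates strictly below b_n, so its complement is a closed half-line,
  squeezed between the open half-lines starting at 1 and at some s < 1.\<close>

lemma nu_atLeast_limit: "(\<lambda>n. nu n (indicator {1..})) \<longlonglongrightarrow> 1"
proof (rule order_tendstoI)
  have i: "\<forall>x\<ge>0. \<bar>indicator A x :: real\<bar> \<le> 1" for A :: "real set" by (simp add: indicator_def)
  have le: "nu n (indicator {1<..}) \<le> nu n (indicator {1..})" "s < 1 \<Longrightarrow> nu n (indicator {1..}) \<le> nu n (indicator {s<..})" for n s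
    by (rule nu_mono[OF _ i _ i]; simp add: indicator_def)+
  show "\<forall>\<^sub>F n in sequentially. y < nu n (indicator {1..})" if "y < 1" for y
    using order_tendstoD(1)[OF tail_eq(2)[OF zero_less_one], of y] that
    by (auto elim!: eventually_mono intro: less_le_trans[OF _ le(1)] simp: nu_indicator)
  show "\<forall>\<^sub>F n in sequentially. nu n (indicator {1..}) < y" if "1 < y" for y
  proof -
    \<comment> \<open>Makes s^(-\<alpha>) the midpoint of 1 and y.\<close>
    define s where "s = ((1 + y) / 2) powr (- 1 / \<alpha>)"
    have y: "1 < (1 + y) / 2" "(1 + y) / 2 < y" using that by auto
    have "s = 1 / ((1 + y) / 2) powr (1 / \<alpha>)" by (simp add: s_def powr_minus_divide)
    moreover have "1 < ((1 + y) / 2) powr (1 / \<alpha>)" using y \<alpha>_range by (intro gr_one_powr) auto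
    ultimately have s: "0 < s" "s < 1" using that by (simp_all add: divide_less_eq)
    have "s powr (- \<alpha>) = (1 + y) / 2" unfolding s_def using \<alpha>_range y by (simp add: powr_powr)
    then have "\<forall>\<^sub>F n in sequentially. H n s < y" using order_tendstoD(2)[OF tail_eq(2)[OF s(1)], of y] y by simp
    then show ?thesis by (auto elim!: eventually_mono intro: le_less_trans[OF le(2)[OF s(2)]] simp: nu_indicator)
  qed
qed

lemma nu_diff:
  assumes "g \<in> borel_measurable borel" "\<forall>x\<ge>0. \<bar>g x\<bar> \<le> D" "h \<in> borel_measurable borel" "\<forall>x\<ge>0. \<bar>h x\<bar> \<le> D'"
  shows "nu n (\<lambda>x. g x - h x) = nu n g - nu n h"
  unfolding nu_def sum_subtractf[symmetric]
  by (intro sum.cong refl Bochner_Integration.integral_diff nu_eq(2)[OF assms(1,2)] nu_eq(2)[OF assms(3,4)])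

text \<open>Each term is split at level e into an excess and a small part. The centred small part
  has mean square of order e^(2 - \<alpha>) for all n at once; the excesses converge in law, and
  what is left of the centring converges to \<open>tail_int \<alpha> e - 1\<close>, the one in
  \<open>compensated\<close>.\<close>

lemma centred_sum_limit:
  "weak_conv_m (\<lambda>n. distr \<mu> borel (\<lambda>x. (\<Sum>j=1..n. X n j x) - nu n (\<lambda>x. x * indicator {..<1} x))) (distr M borel compensated_limit)"
proof -
  let ?T = "\<lambda>n x. (\<Sum>j=1..n. X n j x) - nu n (\<lambda>x. x * indicator {..<1} x)"
  \<comment> \<open>The successor keeps the level below 1, as clipping between it and 1
    demands.\<close>
  define e where "e R = (1/2::real) ^ Suc R" for R
  have e: "0 < e R" "e R < 1" for R
    unfolding e_def by (rule zero_less_power, simp) (rule power_Suc_less_one; simp)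
  have e0: "e \<longlonglongrightarrow> 0" unfolding e_def by (rule LIMSEQ_Suc[OF halves(2)])
  define a where "a R n = nu n (clip (e R) 1) - nu n (indicator {1..})" for R n
  have ilt: "\<forall>x\<ge>0. \<bar>x * indicator {..<1} x :: real\<bar> \<le> 1" by (auto simp: indicator_def)
  have ind: "\<forall>x\<ge>0. \<bar>indicator {1..} x :: real\<bar> \<le> 1" by (simp add: indicator_def)
  \<comment> \<open>The truncation of x below 1 is min(x, 1) less the indicator of x >= 1, and
    min(x, 1) is min(x, e) plus a clip.\<close>
  have trunc: "nu n (\<lambda>x. x * indicator {..<1} x) = nu n (\<lambda>x. min x (e R)) + a R n" for n R
  proof -
    have fe: "(\<lambda>x. x * indicator {..<1} x) = (\<lambda>x. min x 1 - indicator {1..} x :: real)"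
      by (auto simp: fun_eq_iff indicator_def min_def)
    have fc: "clip (e R) 1 = (\<lambda>x. min x 1 - min x (e R))" by (auto simp: clip_def fun_eq_iff)
    have "nu n (\<lambda>x. min x 1 - indicator {1..} x) = nu n (\<lambda>x. min x 1) - nu n (indicator {1..})"
      by (rule nu_diff[OF min_measurable min_abs[OF zero_less_one] _ ind]) simp
    moreover have "nu n (\<lambda>x. min x 1 - min x (e R)) = nu n (\<lambda>x. min x 1) - nu n (\<lambda>x. min x (e R))"
      by (rule nu_diff[OF min_measurable min_abs[OF zero_less_one] min_measurable min_abs[OF e(1)]])
    ultimately show ?thesis unfolding a_def fe fc by simp
  qed
  have conv: "(\<lambda>n. expectation (\<lambda>x. iexp (u * ?T n x))) \<longlonglongrightarrow> L.expectation (\<lambda>\<omega>. iexp (u * compensated_limit \<omega>))" for u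
  proof (rule tendsto_approx)
    show "(\<lambda>n. expectation (\<lambda>x. iexp (u * (N n (excess (e R)) x - a R n)))) \<longlonglongrightarrow> L.expectation (\<lambda>\<omega>. iexp (u * compensated (e R) \<omega>))" for R
    proof -
      interpret C: conv_law \<mu> M "\<lambda>n x. N n (excess (e R)) x" "Z (excess (e R))" by (rule N_conv_law[OF excess_props(1)[OF e(1)]])
      have s1: "expectation (\<lambda>x. iexp (u * (V x - b))) = iexp (- (u * b)) * expectation (\<lambda>x. iexp (u * V x))" for V b
      proof -
        have "iexp (u * (V x - b)) = iexp (- (u * b)) * iexp (u * V x)" for x by (simp add: exp_add[symmetric] algebra_simps)
        then show ?thesis by (simp only: integral_mult_right_zero)
      qed
      have s2: "L.expectation (\<lambda>x. iexp (u * (V x - b))) = iexp (- (u * b)) * L.expectation (\<lambda>x. iexp (u * V x))" for V b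
      proof -
        have "iexp (u * (V x - b)) = iexp (- (u * b)) * iexp (u * V x)" for x by (simp add: exp_add[symmetric] algebra_simps)
        then show ?thesis by (simp only: integral_mult_right_zero)
      qed
      have "(\<lambda>n. a R n) \<longlonglongrightarrow> (tail_int \<alpha> (e R) - tail_int \<alpha> 1) - 1"
        unfolding a_def by (intro tendsto_diff nu_clip_limit nu_atLeast_limit e)
      then have "(\<lambda>n. - (u * a R n)) \<longlonglongrightarrow> - (u * (tail_int \<alpha> (e R) - 1))" by (intro tendsto_intros) simp
      from isCont_tendsto_compose[OF isCont_iexp this]
      have "(\<lambda>n. iexp (- (u * a R n))) \<longlonglongrightarrow> iexp (- (u * (tail_int \<alpha> (e R) - 1)))" .
      from tendsto_mult[OF this C.char_conv[of u]] show ?thesis unfolding compensated_def s1 s2 .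
    qed
    show "norm (expectation (\<lambda>x. iexp (u * (N n (excess (e R)) x - a R n))) - expectation (\<lambda>x. iexp (u * ?T n x))) \<le> \<bar>u\<bar> * (sqrt K * e R powr (1 - \<alpha> / 2))" for R n
    proof -
      let ?D = "\<lambda>x. N n (\<lambda>x. min x (e R)) x - nu n (\<lambda>x. min x (e R))"
      have eq: "(N n (excess (e R)) x - a R n) - ?T n x = - ?D x" for x
      proof -
        have "(\<Sum>j=1..n. X n j x) = (\<Sum>j=1..n. excess (e R) (X n j x) + min (X n j x) (e R))"
          by (intro sum.cong refl excess_split(2))
        then show ?thesis unfolding trunc[of n R] by (simp add: sum.distrib)
      qed
      have iD: "integrable \<mu> (\<lambda>x. (?D x)\<^sup>2)" by (rule nu_eq(4)[OF min_measurable min_abs[OF e(1)]])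
      have mD: "?D \<in> borel_measurable \<mu>" by measurable
      note a = abs_mean_le_sqrt[OF mD iD small_variance[OF e(1)]]
      have "cmod (expectation (\<lambda>x. iexp (u * (N n (excess (e R)) x - a R n))) - expectation (\<lambda>x. iexp (u * ?T n x)))
         \<le> \<bar>u\<bar> * expectation (\<lambda>x. \<bar>(N n (excess (e R)) x - a R n) - ?T n x\<bar>)"
        by (rule iexp_diff_le) (measurable, unfold eq, rule Bochner_Integration.integrable_minus[OF a(1)])
      also have "\<dots> \<le> \<bar>u\<bar> * sqrt (K * e R powr (2 - \<alpha>))" unfolding eq abs_minus_cancel by (rule mult_left_mono[OF a(2)]) simp
      finally show ?thesis using half_exponent[OF e(1), of K] K_pos by simp
    qed
    show "(\<lambda>R. \<bar>u\<bar> * (sqrt K * e R powr (1 - \<alpha> / 2))) \<longlonglongrightarrow> 0"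
      by (intro tendsto_mult_right_zero powr_eps_tendsto e e0) (use \<alpha>_range in auto)
    show "(\<lambda>R. L.expectation (\<lambda>\<omega>. iexp (u * compensated (e R) \<omega>))) \<longlonglongrightarrow> L.expectation (\<lambda>\<omega>. iexp (u * compensated_limit \<omega>))"
      by (rule compensated_char_limit[OF e(1) e0])
  qed
  interpret C: conv_law \<mu> M ?T compensated_limit by unfold_locales (use conv in auto)
  show ?thesis by (rule C.weak_conv)
qed

section \<open>The case \<alpha> < 1: sums without centring\<close>

lemma small_points_mean:
  assumes a1: "\<alpha> < 1" and e: "0 < e"
  shows "(\<integral>\<^sup>+\<omega>. point_sum z (\<lambda>x. max 0 (min x e)) \<omega> \<partial>M) \<le> ennreal (K * e powr (1 - \<alpha>))"
proof -
  define d where "d k = (1/2::real) ^ k" for k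
  have d: "0 < d k" "d k < 2 * d k" "2 * d (Suc k) = d k" for k by (auto simp: d_def)
  \<comment> \<open>The function min(x, e) does not vanish near 0, so it is multiplied by a ramp
    that switches on between \<open>d k\<close> and \<open>2 * d k\<close>. Since
    \<open>2 * d (Suc k)\<close> is \<open>d k\<close>, each ramp has reached 1 where the previous
    one starts, so they increase with k.\<close>
  define g where "g k x = ramp (d k) (2 * d k) x * max 0 (min x e)" for k x
  note r = ramp_props[OF d(1,2)]
  have g_le: "0 \<le> g k x" "g k x \<le> max 0 (min x e)" for k x
    unfolding g_def using r(2,3)[of k x] by (auto intro: mult_left_le_one_le)
  have g_cont: "continuous_on UNIV (g k)" for k unfolding g_def[abs_def] by (intro continuous_intros r(8))
  have g_zero: "g k x = 0" if "x \<le> d k" for k x unfolding g_def using r(4)[OF that] by simp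
  have g_tail_test_fun: "tail_test_fun (d k) (g k)" for k
    unfolding tail_test_fun_def by (intro conjI allI impI g_cont g_le(1) d(1) g_zero)
  have gm[measurable]: "g k \<in> borel_measurable borel" for k by (rule tail_test_fun_measurable[OF g_tail_test_fun])
  have gi: "integrable \<mu> (\<lambda>x. N n (g k) x)" for n k
  proof (rule N_mean_le(1)[OF gm g_le(1) _ g_zero])
    show "g k x \<le> e" for x by (rule order_trans[OF g_le(2)]) (use e in simp)
  qed
  have "(\<integral>\<^sup>+\<omega>. point_sum z (g k) \<omega> \<partial>M) \<le> ennreal (K * e powr (1 - \<alpha>))" for k
  proof (rule nn_point_sum_le[OF g_tail_test_fun])
    show "expectation (\<lambda>x. N n (g k) x) \<le> K * e powr (1 - \<alpha>)" for n
    proof -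
      have "expectation (\<lambda>x. N n (g k) x) \<le> expectation (\<lambda>x. N n (\<lambda>x. min x e) x)"
      proof (rule integral_mono[OF gi nu_eq(3)[OF min_measurable min_abs[OF e]]])
        show "N n (g k) x \<le> N n (\<lambda>x. min x e) x" for x
        proof (rule sum_mono)
          fix j
          have "max 0 (min (X n j x) e) = min (X n j x) e" using X_nonneg[of n j x] e by simp
          then show "g k (X n j x) \<le> min (X n j x) e" using g_le(2)[of k "X n j x"] by simp
        qed
      qed
      also have "\<dots> = nu n (\<lambda>x. min x e)" by (rule nu_eq(1)[OF min_measurable min_abs[OF e]])
      also have "\<dots> \<le> K * e powr (1 - \<alpha>)" unfolding nu_def by (rule mean_small[OF a1 e])
      finally show ?thesis .
    qed
  qed (use K_pos gi in auto)
  moreover have "(\<integral>\<^sup>+\<omega>. point_sum z (\<lambda>x. max 0 (min x e)) \<omega> \<partial>M) = (SUP k. \<integral>\<^sup>+\<omega>. point_sum z (g k) \<omega> \<partial>M)"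
  proof (rule nn_point_sum_SUP[OF g_le(1) _ _ g_le(2) gm])
    show "incseq (\<lambda>k. g k x)" for x
    proof (rule incseq_SucI)
      fix k
      have "ramp (d k) (2 * d k) x \<le> indicator {d k<..} x" by (rule r(7))
      also have "\<dots> \<le> ramp (d (Suc k)) (2 * d (Suc k)) x" using r(6)[of "Suc k" x] unfolding d(3) .
      finally show "g k x \<le> g (Suc k) x" unfolding g_def by (rule mult_right_mono) simp
    qed
    show "\<exists>k. g k x = max 0 (min x e)" for x
    proof (cases "0 < x")
      case True
      then obtain k where "(1/2::real) ^ k < x" using real_arch_pow_inv[of x "1/2"] by auto
      then have "2 * d (Suc k) \<le> x" unfolding d(3) by (simp add: d_def)
      then have "g (Suc k) x = max 0 (min x e)" unfolding g_def using r(5)[of "Suc k" x] by simp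
      then show ?thesis ..
    qed (auto simp: g_def)
  qed
  ultimately show ?thesis by (simp add: SUP_least)
qed

text \<open>The positive part keeps the sum in \<open>ennreal\<close>; almost surely it changes
  nothing, the points being nonnegative.\<close>

definition S :: "'w \<Rightarrow> real" where "S \<omega> = Z (\<lambda>x. max 0 x) \<omega>"

lemma S_measurable [measurable]: "S \<in> borel_measurable M"
  unfolding S_def[abs_def] by measurable

lemma S_split:
  assumes a1: "\<alpha> < 1" and e: "0 < e"
  shows "AE \<omega> in M. point_sum z (\<lambda>x. max 0 x) \<omega> < \<infinity> \<and> S \<omega> = Z (excess e) \<omega> + Z (\<lambda>x. max 0 (min x e)) \<omega> \<and>
    point_sum z (\<lambda>x. max 0 (min x e)) \<omega> < \<infinity>"
proof -
  have "(\<integral>\<^sup>+\<omega>. point_sum z (\<lambda>x. max 0 (min x e)) \<omega> \<partial>M) \<noteq> \<infinity>"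
    using small_points_mean[OF a1 e] by (auto simp: top_unique)
  then have "AE \<omega> in M. point_sum z (\<lambda>x. max 0 (min x e)) \<omega> \<noteq> \<infinity>" by (intro nn_integral_PInf_AE) measurable
  then show ?thesis using good_point
  proof eventually_elim
    case (elim \<omega>)
    have J: "finite {p. e < z p \<omega>}" using elim e by blast
    have p: "point_sum z (excess e) \<omega> < \<infinity>"
      by (subst point_sum_tail_test_fun(1)[OF _ _ J]) (auto simp: excess_def)
    have "point_sum z (\<lambda>x. max 0 x) \<omega> = point_sum z (\<lambda>x. excess e x + max 0 (min x e)) \<omega>"
      by (rule point_sum_cong) (use e in \<open>auto simp: excess_def max_def min_def\<close>)
    also have "\<dots> = point_sum z (excess e) \<omega> + point_sum z (\<lambda>x. max 0 (min x e)) \<omega>"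
      by (rule point_sum_add) (auto simp: excess_def)
    finally have a: "point_sum z (\<lambda>x. max 0 x) \<omega> = point_sum z (excess e) \<omega> + point_sum z (\<lambda>x. max 0 (min x e)) \<omega>" .
    have q: "point_sum z (\<lambda>x. max 0 (min x e)) \<omega> < \<infinity>" using elim(1) by (simp add: less_top)
    have "point_sum z (\<lambda>x. max 0 x) \<omega> < \<infinity>" unfolding a using p q by simp
    moreover have "S \<omega> = Z (excess e) \<omega> + Z (\<lambda>x. max 0 (min x e)) \<omega>"
      unfolding S_def a using p q by (simp add: enn2real_plus)
    ultimately show ?case using q by blast
  qed
qed

lemma S_mean:
  assumes a1: "\<alpha> < 1" and e: "0 < e"
  shows "integrable M (\<lambda>\<omega>. Z (excess e) \<omega> - S \<omega>)" "L.expectation (\<lambda>\<omega>. \<bar>Z (excess e) \<omega> - S \<omega>\<bar>) \<le> K * e powr (1 - \<alpha>)"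
proof -
  let ?R = "Z (\<lambda>x. max 0 (min x e))"
  have eq: "AE \<omega> in M. Z (excess e) \<omega> - S \<omega> = - ?R \<omega>" using S_split[OF a1 e] by eventually_elim simp
  have "(\<integral>\<^sup>+\<omega>. ennreal (?R \<omega>) \<partial>M) \<le> (\<integral>\<^sup>+\<omega>. point_sum z (\<lambda>x. max 0 (min x e)) \<omega> \<partial>M)"
    by (intro nn_integral_mono) (simp add: ennreal_enn2real_if)
  then have le: "(\<integral>\<^sup>+\<omega>. ennreal (?R \<omega>) \<partial>M) \<le> ennreal (K * e powr (1 - \<alpha>))"
    using small_points_mean[OF a1 e] by (rule order_trans)
  then have i: "integrable M ?R" by (intro integrableI_nonneg) (auto intro: le_less_trans)
  show "integrable M (\<lambda>\<omega>. Z (excess e) \<omega> - S \<omega>)"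
    by (rule integrable_cong_AE[THEN iffD2, OF _ _ eq Bochner_Integration.integrable_minus[OF i]]) measurable
  have "L.expectation (\<lambda>\<omega>. \<bar>Z (excess e) \<omega> - S \<omega>\<bar>) = L.expectation ?R"
    by (rule integral_cong_AE) (measurable, use eq in \<open>auto elim!: eventually_mono\<close>)
  also have "\<dots> = enn2real (\<integral>\<^sup>+\<omega>. ennreal (?R \<omega>) \<partial>M)" by (rule integral_eq_nn_integral) auto
  also have "\<dots> \<le> K * e powr (1 - \<alpha>)" using le K_pos by (intro enn2real_leI) auto
  finally show "L.expectation (\<lambda>\<omega>. \<bar>Z (excess e) \<omega> - S \<omega>\<bar>) \<le> K * e powr (1 - \<alpha>)" .
qed

lemma excess_char_limit:
  assumes "\<alpha> < 1" "\<And>k. 0 < e k" "e \<longlonglongrightarrow> 0"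
  shows "(\<lambda>k. L.expectation (\<lambda>\<omega>. iexp (u * Z (excess (e k)) \<omega>))) \<longlonglongrightarrow> L.expectation (\<lambda>\<omega>. iexp (u * S \<omega>))"
  by (rule char_limit[OF _ assms(2,3) S_mean(1)[OF assms(1,2)] S_measurable S_mean(2)[OF assms(1,2)]])
    (use assms in auto)

text \<open>For \<alpha> < 1 the mean of the small part itself is O(e^(1 - \<alpha>)) uniformly in
  n, so a first-moment bound replaces centring and variances.\<close>

lemma sum_limit:
  assumes a1: "\<alpha> < 1"
  shows "weak_conv_m (\<lambda>n. distr \<mu> borel (\<lambda>x. \<Sum>j=1..n. X n j x)) (distr M borel S)"
proof -
  let ?T = "\<lambda>n x. \<Sum>j=1..n. X n j x"
  let ?e = "\<lambda>R. (1/2::real) ^ R"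
  have conv: "(\<lambda>n. expectation (\<lambda>x. iexp (u * ?T n x))) \<longlonglongrightarrow> L.expectation (\<lambda>\<omega>. iexp (u * S \<omega>))" for u
  proof (rule tendsto_approx)
    show "(\<lambda>n. expectation (\<lambda>x. iexp (u * N n (excess (?e R)) x))) \<longlonglongrightarrow> L.expectation (\<lambda>\<omega>. iexp (u * Z (excess (?e R)) \<omega>))" for R
      by (rule conv_law.char_conv[OF N_conv_law[OF excess_props(1)[OF halves(1)]]])
    show "norm (expectation (\<lambda>x. iexp (u * N n (excess (?e R)) x)) - expectation (\<lambda>x. iexp (u * ?T n x))) \<le> \<bar>u\<bar> * (K * ?e R powr (1 - \<alpha>))" for R n
    proof -
      let ?D = "\<lambda>x. N n (\<lambda>x. min x (?e R)) x"
      have eq: "N n (excess (?e R)) x - ?T n x = - ?D x" for x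
      proof -
        have "(\<Sum>j=1..n. X n j x) = (\<Sum>j=1..n. excess (?e R) (X n j x) + min (X n j x) (?e R))"
          by (intro sum.cong refl excess_split(2))
        then show ?thesis by (simp add: sum.distrib)
      qed
      note i = nu_eq(1,3)[OF min_measurable min_abs[OF halves(1)[of R]], of n]
      have D0: "0 \<le> ?D x" for x using X_nonneg by (intro sum_nonneg) simp
      have "cmod (expectation (\<lambda>x. iexp (u * N n (excess (?e R)) x)) - expectation (\<lambda>x. iexp (u * ?T n x)))
         \<le> \<bar>u\<bar> * expectation (\<lambda>x. \<bar>N n (excess (?e R)) x - ?T n x\<bar>)"
        by (rule iexp_diff_le) (measurable, unfold eq, rule Bochner_Integration.integrable_minus[OF i(2)])
      also have "expectation (\<lambda>x. \<bar>N n (excess (?e R)) x - ?T n x\<bar>) = nu n (\<lambda>x. min x (?e R))"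
        unfolding eq abs_minus_cancel abs_of_nonneg[OF D0] by (rule i(1))
      also have "\<bar>u\<bar> * \<dots> \<le> \<bar>u\<bar> * (K * ?e R powr (1 - \<alpha>))"
        unfolding nu_def by (rule mult_left_mono[OF mean_small[OF a1 halves(1)]]) simp
      finally show ?thesis .
    qed
    show "(\<lambda>R. \<bar>u\<bar> * (K * ?e R powr (1 - \<alpha>))) \<longlonglongrightarrow> 0"
      by (intro tendsto_mult_right_zero powr_eps_tendsto halves) (use a1 in auto)
    show "(\<lambda>R. L.expectation (\<lambda>\<omega>. iexp (u * Z (excess (?e R)) \<omega>))) \<longlonglongrightarrow> L.expectation (\<lambda>\<omega>. iexp (u * S \<omega>))"
      by (rule excess_char_limit[OF a1 halves])
  qed
  interpret C: conv_law \<mu> M ?T S by unfold_locales (use conv in auto)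
  show ?thesis by (rule C.weak_conv)
qed

text \<open>Without centring there is no drift, so d = 0. A constant S would bound the sum of the
  excesses over 1, which is not even square integrable.\<close>

lemma S_stable:
  assumes a1: "\<alpha> < 1"
  shows "stable_law \<alpha> (distr M borel S)"
proof (rule L.stable_lawI[OF S_measurable])
  show "\<not> (AE \<omega> in M. S \<omega> = s)" for s
  proof
    assume "AE \<omega> in M. S \<omega> = s"
    then have b: "AE \<omega> in M. norm ((Z (excess 1) \<omega>)\<^sup>2) \<le> s\<^sup>2" using S_split[OF a1 zero_less_one]
    proof eventually_elim
      case (elim \<omega>)
      then have "Z (excess 1) \<omega> \<le> s" using enn2real_nonneg[of "point_sum z (\<lambda>x. max 0 (min x 1)) \<omega>"] by linarith
      then show ?case by (auto intro: power_mono)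
    qed
    have "integrable M (\<lambda>\<omega>. (Z (excess 1) \<omega>)\<^sup>2)" by (rule L.integrable_const_bound[OF b]) measurable
    then show False using excess_not_square_integrable by simp
  qed
  fix m :: nat assume m: "m \<ge> 1"
  define c where "c = real m powr (1 / \<alpha>)"
  have c: "0 < c" using m by (simp add: c_def)
  have "L.expectation (\<lambda>\<omega>. iexp (u * S \<omega>)) ^ m = L.expectation (\<lambda>\<omega>. iexp (u * (c * S \<omega> + 0)))" for u
  proof (rule LIMSEQ_unique)
    let ?e = "\<lambda>k. (1/2::real) ^ k"
    have ec: "0 < ?e k / c" "(\<lambda>k. ?e k / c) \<longlonglongrightarrow> 0" for k
      using c halves tendsto_divide[OF halves(2) tendsto_const, of c] by auto
    show "(\<lambda>k. L.expectation (\<lambda>\<omega>. iexp (u * Z (excess (?e k)) \<omega>)) ^ m) \<longlonglongrightarrow> L.expectation (\<lambda>\<omega>. iexp (u * S \<omega>)) ^ m"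
      by (intro tendsto_power excess_char_limit halves a1)
    have "(\<lambda>k. L.expectation (\<lambda>\<omega>. iexp ((u * c) * Z (excess (?e k / c)) \<omega>))) \<longlonglongrightarrow> L.expectation (\<lambda>\<omega>. iexp ((u * c) * S \<omega>))"
      by (rule excess_char_limit[OF a1 ec])
    moreover have "L.expectation (\<lambda>\<omega>. iexp ((u * c) * Z (excess (?e k / c)) \<omega>)) = L.expectation (\<lambda>\<omega>. iexp (u * Z (excess (?e k)) \<omega>)) ^ m" for k
      using Z_excess_scaling[OF halves(1) m, of u k, folded c_def] by (simp add: mult.assoc)
    ultimately show "(\<lambda>k. L.expectation (\<lambda>\<omega>. iexp (u * Z (excess (?e k)) \<omega>)) ^ m) \<longlonglongrightarrow> L.expectation (\<lambda>\<omega>. iexp (u * (c * S \<omega> + 0)))"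
      by (simp add: mult.assoc)
  qed
  then show "\<exists>d. \<forall>u. L.expectation (\<lambda>\<omega>. iexp (u * S \<omega>)) ^ m = L.expectation (\<lambda>\<omega>. iexp (u * (real m powr (1 / \<alpha>) * S \<omega> + d)))"
    unfolding c_def by blast
qed

end

section \<open>Iterated series and assembly of the result\<close>

lemma nested_suminf:
  fixes f :: "nat \<times> nat \<Rightarrow> real"
  assumes nn: "\<And>p. 0 \<le> f p" and fin: "(\<integral>\<^sup>+p. ennreal (f p) \<partial>count_space UNIV) < \<infinity>"
  shows "summable (\<lambda>j. f (i, j))" "summable (\<lambda>i. \<Sum>j. f (i, j))"
    "(\<Sum>i. \<Sum>j. f (i, j)) = enn2real (\<integral>\<^sup>+p. ennreal (f p) \<partial>count_space UNIV)"
proof -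
  have eq: "(\<integral>\<^sup>+p. ennreal (f p) \<partial>count_space UNIV) = (\<Sum>i. \<Sum>j. ennreal (f (i, j)))"
    by (subst nn_integral_fst_count_space[symmetric]) (simp add: nn_integral_count_space_nat)
  have "(\<Sum>j. ennreal (f (i, j))) \<noteq> \<infinity>" for i
  proof -
    have "(\<Sum>j. ennreal (f (i, j))) = sum (\<lambda>i. \<Sum>j. ennreal (f (i, j))) {i}" by simp
    also have "\<dots> \<le> (\<Sum>i. \<Sum>j. ennreal (f (i, j)))" by (rule sum_le_suminf) auto
    finally show ?thesis using fin unfolding eq by (auto simp: top_unique)
  qed
  then show s: "summable (\<lambda>j. f (i, j))" for i by (intro summable_suminf_not_top nn) auto
  have row: "(\<Sum>j. ennreal (f (i, j))) = ennreal (\<Sum>j. f (i, j))" for i by (rule suminf_ennreal2[OF nn s])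
  have r0: "0 \<le> (\<Sum>j. f (i, j))" for i by (rule suminf_nonneg[OF s nn])
  show s2: "summable (\<lambda>i. \<Sum>j. f (i, j))"
    using fin unfolding eq row by (intro summable_suminf_not_top r0) auto
  show "(\<Sum>i. \<Sum>j. f (i, j)) = enn2real (\<integral>\<^sup>+p. ennreal (f p) \<partial>count_space UNIV)"
    unfolding eq row suminf_ennreal2[OF r0 s2] using suminf_nonneg[OF s2 r0] by simp
qed

lemma dirac_sum_cong:
  assumes "\<And>i. i \<in> I \<Longrightarrow> x i = y i" shows "dirac_sum I x = dirac_sum I y"
proof (rule measure_eqI)
  fix A assume "A \<in> sets (dirac_sum I x)"
  then have A: "A \<in> sets punctured_borel" by simp
  show "emeasure (dirac_sum I x) A = emeasure (dirac_sum I y) A"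
    unfolding emeasure_dirac_sum[OF A] using assms by (intro nn_integral_cong) simp
qed simp

text \<open>On the positive axis x times the density is \<alpha> x^(-\<alpha>), and the two end
  points are null.\<close>

lemma set_integral_tail_measure:
  assumes e: "0 < e" "e < 1" and \<alpha>: "0 < \<alpha>"
  shows "(LINT x:{x. e < \<bar>x\<bar> \<and> \<bar>x\<bar> \<le> 1}|tail_measure \<alpha>. x) = \<alpha> * tail_int \<alpha> e"
proof -
  have [measurable]: "{x::real. e < \<bar>x\<bar> \<and> \<bar>x\<bar> \<le> 1} \<in> sets borel" by measurable
  have "(LINT x:{x. e < \<bar>x\<bar> \<and> \<bar>x\<bar> \<le> 1}|tail_measure \<alpha>. x)
     = (\<integral>x. (\<alpha> * x powr (- \<alpha> - 1) * indicator {0<..} x) *\<^sub>R (indicator {x. e < \<bar>x\<bar> \<and> \<bar>x\<bar> \<le> 1} x *\<^sub>R x) \<partial>lborel)"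
    unfolding set_lebesgue_integral_def tail_measure_def
    by (rule integral_density) (use \<alpha> in \<open>auto simp: indicator_def\<close>)
  also have "\<dots> = (\<integral>x. \<alpha> * (x powr (- \<alpha>) * indicator {e..<1} x) \<partial>lborel)"
  proof (rule integral_cong_AE)
    have *: "(\<alpha> * x powr (- \<alpha> - 1) * indicator {0<..} x) *\<^sub>R (indicator {x. e < \<bar>x\<bar> \<and> \<bar>x\<bar> \<le> 1} x *\<^sub>R x)
      = \<alpha> * (x powr (- \<alpha>) * indicator {e..<1} x)" if "x \<noteq> e" "x \<noteq> 1" for x
    proof (cases "0 < x")
      case True
      then have "x powr (- \<alpha> - 1) * x = x powr (- \<alpha>)" by (simp add: powr_diff)
      then show ?thesis using True that by (auto simp: indicator_def)
    qed (use e in \<open>auto simp: indicator_def\<close>)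
    show "AE x in lborel. (\<alpha> * x powr (- \<alpha> - 1) * indicator {0<..} x) *\<^sub>R (indicator {x. e < \<bar>x\<bar> \<and> \<bar>x\<bar> \<le> 1} x *\<^sub>R x)
      = \<alpha> * (x powr (- \<alpha>) * indicator {e..<1} x)"
      using AE_lborel_singleton[of e] AE_lborel_singleton[of "1::real"] by eventually_elim (rule *)
  qed measurable
  also have "\<dots> = \<alpha> * tail_int \<alpha> e" using integral_powr[OF e, of \<alpha>] by simp
  finally show ?thesis .
qed

text \<open>Joins the dynamics to the cluster process. The point processes for b_n and for |b_n|
  coincide, since a difference could arise only at n = 0, where there are no points.\<close>

lemma orbit_cluster_limit:
  assumes gm: "gibbs_markov_map \<mu> T \<P>" and decay: "exp_decay_BV \<mu> T"
    and \<alpha>: "0 < \<alpha>" "\<alpha> < 2" and x0: "0 < x\<^sub>0" "x\<^sub>0 < 1"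
    and \<phi>: "\<And>x. \<phi> x = dist x x\<^sub>0 powr (- 1 / \<alpha>)"
    and b: "\<And>n. n \<ge> 1 \<Longrightarrow> b n > 0"
    and lim: "(\<lambda>n. real n * measure \<mu> {x \<in> space \<mu>. \<bar>\<phi> x\<bar> > b n}) \<longlonglongrightarrow> 1"
    and pc: "poisson_cluster_points M \<alpha> P Q"
    and conv: "conv_in_distr_pp \<mu> (\<lambda>n x. dirac_sum {1..n} (\<lambda>j. \<phi> ((T ^^ j) x) / b n))
           M (\<lambda>\<omega>. dirac_sum UNIV (\<lambda>(i, j). P i \<omega> * Q i j \<omega>))"
  shows "\<exists>K. cluster_limit \<mu> (\<lambda>n j x. \<phi> ((T ^^ j) x) / \<bar>b n\<bar>) \<alpha> K M (\<lambda>p \<omega>. P (fst p) \<omega> * Q (fst p) (snd p) \<omega>)"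
proof -
  interpret G: gibbs_markov_map \<mu> T \<P> by fact
  interpret C: poisson_cluster_points M \<alpha> P Q by fact
  let ?X = "\<lambda>n j x. \<phi> ((T ^^ j) x) / \<bar>b n\<bar>"
  let ?z = "\<lambda>p \<omega>. P (fst p) \<omega> * Q (fst p) (snd p) \<omega>"
  obtain K where K: "tail_array \<mu> ?X \<alpha> K"
    using G.tail_array_orbit[OF decay \<phi> \<alpha> x0 b lim] by blast
  have zm: "?z p \<in> borel_measurable M" for p by measurable
  have "dirac_sum {1..n} (\<lambda>j. \<phi> ((T ^^ j) x) / b n) = dirac_sum {1..n} (\<lambda>j. ?X n j x)" for n x
    by (rule dirac_sum_cong) (use b[of n] in auto)
  then have conv': "conv_in_distr_pp \<mu> (\<lambda>n x. dirac_sum {1..n} (\<lambda>j. ?X n j x)) M (\<lambda>\<omega>. dirac_sum UNIV (\<lambda>p. ?z p \<omega>))"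
    using conv by (simp add: case_prod_unfold)
  have "cluster_limit_axioms \<mu> ?X \<alpha> M ?z"
  proof
    show "?z p \<in> borel_measurable M" for p by (rule zm)
    have "AE \<omega> in M. dirac_sum UNIV (\<lambda>p. ?z p \<omega>) \<in> counting_measures"
      using conv' by (simp add: conv_in_distr_pp_def)
    then show "AE \<omega> in M. \<forall>k. finite {p. ?z p \<omega> \<in> shell k}"
      by eventually_elim (simp add: dirac_sum_counting_iff)
    show "(\<lambda>n. \<integral>x. h (\<Sum>j=1..n. f (?X n j x)) \<partial>\<mu>) \<longlonglongrightarrow> (\<integral>\<omega>. h (enn2real (point_sum ?z f \<omega>)) \<partial>M)"
      if "test_fun \<delta> R f" "continuous_on UNIV h" "\<And>x. \<bar>h x\<bar> \<le> D" for \<delta> R f and h :: "real \<Rightarrow> real" and D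
      by (rule point_convergence[OF conv' zm, where \<delta>=\<delta> and R=R and B=D])
        (use that in \<open>auto simp: test_fun_def\<close>)
    show "(\<integral>\<omega>. iexp (u * enn2real (point_sum ?z (\<lambda>x. g (real m powr (1 / \<alpha>) * x)) \<omega>)) \<partial>M) =
      (\<integral>\<omega>. iexp (u * enn2real (point_sum ?z g \<omega>)) \<partial>M) ^ m"
      if "m \<ge> 1" "tail_test_fun \<delta> g" "AE \<omega> in M. \<forall>\<delta>>0. finite {p. \<delta> < ?z p \<omega>}" for m \<delta> g u
    proof -
      have z: "(\<lambda>(i, j) \<omega>. P i \<omega> * Q i j \<omega>) = ?z" by (auto simp: fun_eq_iff)
      have "AE \<omega> in M. \<forall>\<delta>>0. finite {(i, j). \<delta> < P i \<omega> * Q i j \<omega>}" using that(3) by (simp add: case_prod_unfold)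
      from C.cluster_process_scaling[OF \<alpha>(1) that(1) _ _ _ _ this, of g \<delta> u] that(2)
      show ?thesis unfolding z tail_test_fun_def by blast
    qed
  qed
  with K C.prob_space_axioms show ?thesis by (blast intro: cluster_limit.intro)
qed

text \<open>Tonelli over pairs of indices: nonnegative terms with finite total may be summed row by
  row, which is the form of the double series in the claim.\<close>

lemma (in cluster_limit) nested_sum:
  assumes g: "\<And>x. 0 \<le> x \<Longrightarrow> 0 \<le> g x"
    and nn: "\<forall>p. 0 \<le> z p \<omega>" and fin: "point_sum z (\<lambda>x. max 0 (g x)) \<omega> < \<infinity>"
  shows "summable (\<lambda>j. g (z (i, j) \<omega>))" "summable (\<lambda>i. \<Sum>j. g (z (i, j) \<omega>))"
    "(\<Sum>i. \<Sum>j. g (z (i, j) \<omega>)) = Z (\<lambda>x. max 0 (g x)) \<omega>"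
proof -
  have g0: "0 \<le> g (z p \<omega>)" for p using g nn by blast
  have eq: "max 0 (g (z p \<omega>)) = g (z p \<omega>)" for p by (rule max_absorb2[OF g0])
  have f: "(\<integral>\<^sup>+p. ennreal (g (z p \<omega>)) \<partial>count_space UNIV) < \<infinity>" using fin unfolding point_sum_def eq .
  show "summable (\<lambda>j. g (z (i, j) \<omega>))" by (rule nested_suminf(1)[where f="\<lambda>p. g (z p \<omega>)", OF g0 f])
  show "summable (\<lambda>i. \<Sum>j. g (z (i, j) \<omega>))" by (rule nested_suminf(2)[where f="\<lambda>p. g (z p \<omega>)", OF g0 f])
  show "(\<Sum>i. \<Sum>j. g (z (i, j) \<omega>)) = Z (\<lambda>x. max 0 (g x)) \<omega>"
    unfolding point_sum_def eq by (rule nested_suminf(3)[where f="\<lambda>p. g (z p \<omega>)", OF g0 f])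
qed

text \<open>Only finitely many points exceed e, and for nonnegative points truncation by |x| and by
  x agree.\<close>

lemma (in cluster_limit) sharp_nested_sum:
  assumes e: "0 < e"
  shows "AE \<omega> in M. (\<forall>i. summable (\<lambda>j. z (i, j) \<omega> * indicator {e<..} \<bar>z (i, j) \<omega>\<bar>)) \<and>
    summable (\<lambda>i. \<Sum>j. z (i, j) \<omega> * indicator {e<..} \<bar>z (i, j) \<omega>\<bar>) \<and>
    (\<Sum>i. \<Sum>j. z (i, j) \<omega> * indicator {e<..} \<bar>z (i, j) \<omega>\<bar>) = Z (\<lambda>x. x * indicator {e<..} x) \<omega>"
  using good_point
proof eventually_elim
  case (elim \<omega>)
  have J: "finite {p. e < z p \<omega>}" using elim e by blast
  let ?g = "\<lambda>x::real. x * indicator {e<..} \<bar>x\<bar>"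
  have g: "max 0 (?g x) = x * indicator {e<..} x" for x using e by (auto simp: indicator_def)
  have "point_sum z (\<lambda>x. max 0 (?g x)) \<omega> < \<infinity>" unfolding g
    by (subst point_sum_tail_test_fun(1)[OF _ _ J]) (use e in \<open>auto simp: indicator_def\<close>)
  from nested_sum[of ?g, OF _ _ this] elim show ?case unfolding g by simp
qed

text \<open>Serves to discard the finitely many \<epsilon> k >= 1, for which the centring integral
  is over an empty set and is not given by \<open>tail_int\<close>.\<close>

lemma weak_conv_m_offset:
  assumes "weak_conv_m (\<lambda>n. f (n + k)) L" shows "weak_conv_m f L"
  using assms unfolding weak_conv_m_def weak_conv_def by (auto intro: LIMSEQ_offset[where k=k])

theorem corollary8p3:
  fixes \<mu> :: "real measure" and T :: "real \<Rightarrow> real" and \<P> :: "real set set"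
    and \<alpha> x\<^sub>0 :: real and \<phi> :: "real \<Rightarrow> real" and b :: "nat \<Rightarrow> real"
    and M :: "'w measure" and P :: "nat \<Rightarrow> 'w \<Rightarrow> real" and Q :: "nat \<Rightarrow> nat \<Rightarrow> 'w \<Rightarrow> real"
  assumes "gibbs_markov_map \<mu> T \<P>"
    and "exp_decay_BV \<mu> T"
    and "0 < \<alpha>" and "\<alpha> \<le> 2" and "0 < x\<^sub>0" and "x\<^sub>0 < 1"
    and "\<And>x. \<phi> x = dist x x\<^sub>0 powr (- 1 / \<alpha>)"
    and "\<And>n. n \<ge> 1 \<Longrightarrow> b n > 0"
    and "(\<lambda>n. real n * measure \<mu> {x \<in> space \<mu>. \<bar>\<phi> x\<bar> > b n}) \<longlonglongrightarrow> 1"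
    and "poisson_cluster_points M \<alpha> P Q"
    and "conv_in_distr_pp
           \<mu> (\<lambda>n x. dirac_sum {1..n} (\<lambda>j. \<phi> ((T ^^ j) x) / b n))
           M (\<lambda>\<omega>. dirac_sum UNIV (\<lambda>(i, j). P i \<omega> * Q i j \<omega>))"
  shows
    "(\<alpha> < 1 \<longrightarrow>
        (AE \<omega> in M. (\<forall>i. summable (\<lambda>j. P i \<omega> * Q i j \<omega>)) \<and>
                    summable (\<lambda>i. \<Sum>j. P i \<omega> * Q i j \<omega>)) \<and>
        weak_conv_m
          (\<lambda>n. distr \<mu> borel (\<lambda>x. (\<Sum>j=1..n. \<phi> ((T ^^ j) x)) / b n))
          (distr M borel (\<lambda>\<omega>. \<Sum>i. \<Sum>j. P i \<omega> * Q i j \<omega>)) \<and>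
        stable_law \<alpha> (distr M borel (\<lambda>\<omega>. \<Sum>i. \<Sum>j. P i \<omega> * Q i j \<omega>)))
     \<and>
     (1 \<le> \<alpha> \<and> \<alpha> < 2 \<longrightarrow>
        (\<forall>\<epsilon>>0. AE \<omega> in M.
           (\<forall>i. summable (\<lambda>j. P i \<omega> * Q i j \<omega> * indicator {\<epsilon><..} \<bar>P i \<omega> * Q i j \<omega>\<bar>)) \<and>
           summable (\<lambda>i. \<Sum>j. P i \<omega> * Q i j \<omega> * indicator {\<epsilon><..} \<bar>P i \<omega> * Q i j \<omega>\<bar>)) \<and>
        (\<exists>L. real_distribution L \<and>
           weak_conv_m
             (\<lambda>n. distr \<mu> borel (\<lambda>x.
                ((\<Sum>j=1..n. \<phi> ((T ^^ j) x)) -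
                 (\<integral>y. (\<Sum>j=1..n. \<phi> ((T ^^ j) y) *
                        indicator {z. \<bar>\<phi> ((T ^^ j) z)\<bar> < b n} y) \<partial>\<mu>)) / b n))
             L \<and>
           (\<forall>\<epsilon>. (\<forall>k. \<epsilon> k > 0) \<and> \<epsilon> \<longlonglongrightarrow> 0 \<longrightarrow>
              weak_conv_m
                (\<lambda>k. distr M borel (\<lambda>\<omega>.
                   (\<Sum>i. \<Sum>j. P i \<omega> * Q i j \<omega> * indicator {\<epsilon> k<..} \<bar>P i \<omega> * Q i j \<omega>\<bar>) -
                   (LINT x:{x. \<epsilon> k < \<bar>x\<bar> \<and> \<bar>x\<bar> \<le> 1}|tail_measure \<alpha>. x)))
                L) \<and>
           stable_law \<alpha> L))"
\<comment> \<open>At \<alpha> = 2 both implications have a false premise.\<close>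
proof (cases "\<alpha> < 2")
  case True
  let ?X = "\<lambda>n j x. \<phi> ((T ^^ j) x) / \<bar>b n\<bar>"
  let ?z = "\<lambda>p \<omega>. P (fst p) \<omega> * Q (fst p) (snd p) \<omega>"
  obtain K where "cluster_limit \<mu> ?X \<alpha> K M ?z"
    using orbit_cluster_limit[OF assms(1,2,3) True assms(5-11)] by blast
  then interpret cluster_limit \<mu> ?X \<alpha> K M ?z .
  have absb: "\<phi> ((T ^^ j) x) / \<bar>b n\<bar> = \<phi> ((T ^^ j) x) / b n" if "j \<in> {1..n}" for n j x
    using assms(8)[of n] that by auto
  have sumX: "(\<Sum>j=1..n. ?X n j x) = (\<Sum>j=1..n. \<phi> ((T ^^ j) x)) / b n" for n x
    unfolding sum_divide_distrib by (intro sum.cong absb refl)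
  have phi_nn: "\<bar>\<phi> x\<bar> = \<phi> x" for x by (simp add: assms(7))
  show ?thesis
  proof (intro conjI impI)
    assume a1: "\<alpha> < 1"
    \<comment> \<open>The double series agrees with \<open>S\<close> almost surely, so both have the
      same law.\<close>
    have nested: "AE \<omega> in M. (\<forall>i. summable (\<lambda>j. P i \<omega> * Q i j \<omega>)) \<and> summable (\<lambda>i. \<Sum>j. P i \<omega> * Q i j \<omega>) \<and>
        (\<Sum>i. \<Sum>j. P i \<omega> * Q i j \<omega>) = S \<omega>"
      using S_split[OF a1 zero_less_one] z_nonneg
    proof eventually_elim
      case (elim \<omega>)
      then show ?case using nested_sum[of "\<lambda>x. x" \<omega>] by (simp add: S_def)
    qed
    then show "AE \<omega> in M. (\<forall>i. summable (\<lambda>j. P i \<omega> * Q i j \<omega>)) \<and> summable (\<lambda>i. \<Sum>j. P i \<omega> * Q i j \<omega>)"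
      by eventually_elim blast
    have meas: "(\<lambda>\<omega>. \<Sum>i. \<Sum>j. P i \<omega> * Q i j \<omega>) \<in> borel_measurable M"
      using z_meas[of "(_, _)"] by (intro borel_measurable_suminf) simp
    have dS: "distr M borel (\<lambda>\<omega>. \<Sum>i. \<Sum>j. P i \<omega> * Q i j \<omega>) = distr M borel S"
      by (rule distr_cong_AE[OF refl refl _ meas S_measurable]) (use nested in \<open>auto elim: eventually_mono\<close>)
    show "weak_conv_m (\<lambda>n. distr \<mu> borel (\<lambda>x. (\<Sum>j=1..n. \<phi> ((T ^^ j) x)) / b n)) (distr M borel (\<lambda>\<omega>. \<Sum>i. \<Sum>j. P i \<omega> * Q i j \<omega>))"
      using sum_limit[OF a1] unfolding sumX dS .
    show "stable_law \<alpha> (distr M borel (\<lambda>\<omega>. \<Sum>i. \<Sum>j. P i \<omega> * Q i j \<omega>))"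
      unfolding dS by (rule S_stable[OF a1])
  next
    assume "1 \<le> \<alpha> \<and> \<alpha> < 2"
    show "\<forall>\<epsilon>>0. AE \<omega> in M.
           (\<forall>i. summable (\<lambda>j. P i \<omega> * Q i j \<omega> * indicator {\<epsilon><..} \<bar>P i \<omega> * Q i j \<omega>\<bar>)) \<and>
           summable (\<lambda>i. \<Sum>j. P i \<omega> * Q i j \<omega> * indicator {\<epsilon><..} \<bar>P i \<omega> * Q i j \<omega>\<bar>)"
    proof (intro allI impI)
      fix \<epsilon> :: real assume "0 < \<epsilon>"
      from sharp_nested_sum[OF this] show "AE \<omega> in M.
           (\<forall>i. summable (\<lambda>j. P i \<omega> * Q i j \<omega> * indicator {\<epsilon><..} \<bar>P i \<omega> * Q i j \<omega>\<bar>)) \<and>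
           summable (\<lambda>i. \<Sum>j. P i \<omega> * Q i j \<omega> * indicator {\<epsilon><..} \<bar>P i \<omega> * Q i j \<omega>\<bar>)"
        by eventually_elim simp
    qed
    have dist: "real_distribution (distr M borel compensated_limit)" by (rule L.real_distribution_distr_borel) simp
    \<comment> \<open>Dividing by b_n turns the truncation of \<phi> at b_n into truncation of the
      array at 1.\<close>
    have centre: "((\<Sum>j=1..n. \<phi> ((T ^^ j) x)) - (\<integral>y. (\<Sum>j=1..n. \<phi> ((T ^^ j) y) * indicator {z. \<bar>\<phi> ((T ^^ j) z)\<bar> < b n} y) \<partial>\<mu>)) / b n
      = (\<Sum>j=1..n. ?X n j x) - nu n (\<lambda>x. x * indicator {..<1} x)" for n x
    proof -
      have ilt: "\<forall>x\<ge>0. \<bar>x * indicator {..<1} x :: real\<bar> \<le> 1" by (auto simp: indicator_def)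
      have lm: "(\<lambda>x::real. x * indicator {..<1} x) \<in> borel_measurable borel" by measurable
      have "(\<Sum>j=1..n. \<phi> ((T ^^ j) y) * indicator {z. \<bar>\<phi> ((T ^^ j) z)\<bar> < b n} y) / b n
          = (\<Sum>j=1..n. ?X n j y * indicator {..<1} (?X n j y))" for y
        unfolding sum_divide_distrib
      proof (intro sum.cong refl)
        fix j assume j: "j \<in> {1..n}"
        then have "0 < b n" using assms(8)[of n] by simp
        then show "\<phi> ((T ^^ j) y) * indicator {z. \<bar>\<phi> ((T ^^ j) z)\<bar> < b n} y / b n = ?X n j y * indicator {..<1} (?X n j y)"
          by (simp add: phi_nn indicator_def)
      qed
      then have "(\<integral>y. (\<Sum>j=1..n. \<phi> ((T ^^ j) y) * indicator {z. \<bar>\<phi> ((T ^^ j) z)\<bar> < b n} y) \<partial>\<mu>) / b n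
          = (\<integral>y. (\<Sum>j=1..n. ?X n j y * indicator {..<1} (?X n j y)) \<partial>\<mu>)"
        by (simp flip: Bochner_Integration.integral_divide_zero)
      also have "\<dots> = nu n (\<lambda>x. x * indicator {..<1} x)" by (rule nu_eq(1)[OF lm ilt])
      finally show ?thesis unfolding sumX diff_divide_distrib by simp
    qed
    show "\<exists>L. real_distribution L \<and>
           weak_conv_m
             (\<lambda>n. distr \<mu> borel (\<lambda>x.
                ((\<Sum>j=1..n. \<phi> ((T ^^ j) x)) -
                 (\<integral>y. (\<Sum>j=1..n. \<phi> ((T ^^ j) y) *
                        indicator {z. \<bar>\<phi> ((T ^^ j) z)\<bar> < b n} y) \<partial>\<mu>)) / b n))
             L \<and>
           (\<forall>\<epsilon>. (\<forall>k. \<epsilon> k > 0) \<and> \<epsilon> \<longlonglongrightarrow> 0 \<longrightarrow>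
              weak_conv_m
                (\<lambda>k. distr M borel (\<lambda>\<omega>.
                   (\<Sum>i. \<Sum>j. P i \<omega> * Q i j \<omega> * indicator {\<epsilon> k<..} \<bar>P i \<omega> * Q i j \<omega>\<bar>) -
                   (LINT x:{x. \<epsilon> k < \<bar>x\<bar> \<and> \<bar>x\<bar> \<le> 1}|tail_measure \<alpha>. x)))
                L) \<and>
           stable_law \<alpha> L"
    proof (intro exI[of _ "distr M borel compensated_limit"] conjI dist compensated_limit_stable allI impI)
      show "weak_conv_m
             (\<lambda>n. distr \<mu> borel (\<lambda>x.
                ((\<Sum>j=1..n. \<phi> ((T ^^ j) x)) -
                 (\<integral>y. (\<Sum>j=1..n. \<phi> ((T ^^ j) y) *
                        indicator {z. \<bar>\<phi> ((T ^^ j) z)\<bar> < b n} y) \<partial>\<mu>)) / b n))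
             (distr M borel compensated_limit)"
        unfolding centre by (rule centred_sum_limit)
    next
      fix \<epsilon> :: "nat \<Rightarrow> real" assume "(\<forall>k. \<epsilon> k > 0) \<and> \<epsilon> \<longlonglongrightarrow> 0"
      then have pos: "\<And>k. 0 < \<epsilon> k" and lim0: "\<epsilon> \<longlonglongrightarrow> 0" by auto
      let ?F = "\<lambda>k. distr M borel (\<lambda>\<omega>.
                   (\<Sum>i. \<Sum>j. P i \<omega> * Q i j \<omega> * indicator {\<epsilon> k<..} \<bar>P i \<omega> * Q i j \<omega>\<bar>) -
                   (LINT x:{x. \<epsilon> k < \<bar>x\<bar> \<and> \<bar>x\<bar> \<le> 1}|tail_measure \<alpha>. x))"
      \<comment> \<open>The closed form of the centring integral is available for \<epsilon> k <
        1.\<close>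
      obtain k0 where k0: "\<And>k. k \<ge> k0 \<Longrightarrow> \<epsilon> k < 1"
        using order_tendstoD(2)[OF lim0 zero_less_one] by (auto simp: eventually_sequentially)
      have F: "?F k = distr M borel (sharp (\<epsilon> k))" if "k \<ge> k0" for k
      proof (rule distr_cong_AE[OF refl refl _ _ sharp_measurable])
        have zi: "(\<lambda>\<omega>. P i \<omega> * Q i j \<omega>) \<in> borel_measurable M" for i j using z_meas[of "(i, j)"] by simp
        show "(\<lambda>\<omega>. (\<Sum>i. \<Sum>j. P i \<omega> * Q i j \<omega> * indicator {\<epsilon> k<..} \<bar>P i \<omega> * Q i j \<omega>\<bar>) -
                   (LINT x:{x. \<epsilon> k < \<bar>x\<bar> \<and> \<bar>x\<bar> \<le> 1}|tail_measure \<alpha>. x)) \<in> borel_measurable M"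
        proof (intro borel_measurable_diff borel_measurable_suminf borel_measurable_const)
          have "(\<lambda>x::real. x * indicator {\<epsilon> k<..} \<bar>x\<bar>) \<in> borel_measurable borel" by measurable
          from measurable_compose[OF zi this]
          show "(\<lambda>\<omega>. P i \<omega> * Q i j \<omega> * indicator {\<epsilon> k<..} \<bar>P i \<omega> * Q i j \<omega>\<bar>) \<in> borel_measurable M" for i j .
        qed
        show "AE \<omega> in M. (\<Sum>i. \<Sum>j. P i \<omega> * Q i j \<omega> * indicator {\<epsilon> k<..} \<bar>P i \<omega> * Q i j \<omega>\<bar>) -
                   (LINT x:{x. \<epsilon> k < \<bar>x\<bar> \<and> \<bar>x\<bar> \<le> 1}|tail_measure \<alpha>. x) = sharp (\<epsilon> k) \<omega>"
          using sharp_nested_sum[OF pos[of k]]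
        proof eventually_elim
          case (elim \<omega>)
          then show ?case unfolding set_integral_tail_measure[OF pos k0[OF that] assms(3)] sharp_def by simp
        qed
      qed
      have "weak_conv_m (\<lambda>k. distr M borel (sharp (\<epsilon> (k + k0)))) (distr M borel compensated_limit)"
        by (rule sharp_weak_conv[OF pos LIMSEQ_ignore_initial_segment[OF lim0]])
      then have "weak_conv_m (\<lambda>k. ?F (k + k0)) (distr M borel compensated_limit)" by (simp only: F le_add2)
      then show "weak_conv_m ?F (distr M borel compensated_limit)" by (rule weak_conv_m_offset)
    qed
  qed
next
  case False
  then show ?thesis by simp
qed

end
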